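(* Let $X$ be an anisotropic quasilinear $p$-hypersurface over $F$, and let $X' \subset X$ be a plane section of codimension $\mathfrak{i}_1(X) - 1$. Then $X$ is birational to $X' \times \mathbb{P}_F^{\mathfrak{i}_1(X) - 1}$ over $F$.
   Context: $p$ is a prime and $F$ is a non-perfect field of characteristic $p$. A quasilinear $p$-form over a field $E$ of characteristic $p$ is a map $\varphi\colon V_\varphi \to E$ on a finite-dimensional $E$-vector space $V_\varphi$ with $\varphi(\lambda v)=\lambda^p\varphi(v)$ and $\varphi(v+w)=\varphi(v)+\varphi(w)$ for all $\lambda\in E$, $v,w\in V_\varphi$ (in coordinates, $a_1x_1^p+\dots+a_nx_n^p$). Its dimension is $\dim V_\varphi$, and $\varphi_L$ denotes its scalar extension to a field $L\supset E$. It is isotropic if $\varphi(v)=0$ for some $v\ne 0$, and anisotropic otherwise. The isotropic vectors form a subspace of $V_\varphi$, whose dimension is the defect index $\mathfrak{i}_0(\varphi)$. A subform of $\varphi$ is the restriction of $\varphi$ to a subspace of $V_\varphi$. For a quasilinear $p$-form $\varphi$ over $F$ of dimension $d+2\ge 2$, $X_\varphi=\{\varphi=0\}\subset\mathbb{P}(V_\varphi)$ is the associated projective hypersurface, of dimension $d$; schemes of this type are called quasilinear $p$-hypersurfaces. $X_\varphi$ is called anisotropic if $\varphi$ is; in that case it is integral and $F(\varphi)$ denotes its function field. For anisotropic $\varphi$, put $\mathfrak{i}_1(X_\varphi)=\mathfrak{i}_1(\varphi):=\mathfrak{i}_0(\varphi_{F(\varphi)})$. A plane section of $X_\varphi$ of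 codimension $c$ is a closed subscheme $X_\psi=X_\varphi\cap\mathbb{P}(V_\psi)$, where $\psi\subset\varphi$ is a subform of codimension $c$, i.e. the restriction of $\varphi$ to a codimension $c$ subspace $V_\psi\subset V_\varphi$. *)

theory Defs
  imports
    "HOL-Analysis.Abstract_Topology"
    "HOL-Algebra.QuotRing"
    "HOL-Library.Poly_Mapping"
    "Jordan_Normal_Form.Missing_VectorSpace"
    "HOL-Computational_Algebra.Primes"
begin

section \<open>Ringed spaces over a field\<close>

text \<open>
  A space with a sheaf of \<^typ>\<open>'f\<close>-algebras: \<open>sec X U\<close> is the ring of sections over the open set
  \<open>U\<close>, \<open>res X U V\<close> the restriction map for \<open>V \<subseteq> U\<close>, and \<open>scal X U\<close> the structure map from the
  base field to \<open>sec X U\<close>.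
\<close>

record ('a, 's, 'f) fspace =
  zar :: "'a topology"
  sec :: "'a set \<Rightarrow> 's ring"
  res :: "'a set \<Rightarrow> 'a set \<Rightarrow> 's \<Rightarrow> 's"
  scal :: "'a set \<Rightarrow> 'f \<Rightarrow> 's"

definition open_sub :: "('a, 's, 'f) fspace \<Rightarrow> 'a set \<Rightarrow> ('a, 's, 'f) fspace" where
  "open_sub X U = X\<lparr>zar := subtopology (zar X) U\<rparr>"

text \<open>
  An isomorphism over the base field is a homeomorphism \<open>g\<close> together with isomorphisms
  \<open>h V\<close> from the sections over \<open>V\<close> to those over the preimage of \<open>V\<close>, compatible with
  restriction.  Locality need not be demanded: an isomorphism of ringed spaces induces isomorphisms
  of stalks, which are automatically local.
\<close>

definition iso_over ::
    "('a, 's, 'f) fspace \<Rightarrow> ('b, 't, 'f) fspace \<Rightarrow> bool" where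
  "iso_over X Y \<longleftrightarrow>
     (\<exists>g h. homeomorphic_map (zar X) (zar Y) g \<and>
       (let pre = (\<lambda>V. {x \<in> topspace (zar X). g x \<in> V}) in
        \<forall>V. openin (zar Y) V \<longrightarrow>
          h V \<in> ring_iso (sec Y V) (sec X (pre V)) \<and>
          (\<forall>c. h V (scal Y V c) = scal X (pre V) c) \<and>
          (\<forall>W. openin (zar Y) W \<and> W \<subseteq> V \<longrightarrow>
             (\<forall>s \<in> carrier (sec Y V).
                h W (res Y V W s) = res X (pre V) (pre W) (h V s)))))"

definition birational_over ::
    "('a, 's, 'f) fspace \<Rightarrow> ('b, 't, 'f) fspace \<Rightarrow> bool" where
  "birational_over X Y \<longleftrightarrow>
     (\<exists>U V. openin (zar X) U \<and> (zar X) closure_of U = topspace (zar X) \<and>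
            openin (zar Y) V \<and> (zar Y) closure_of V = topspace (zar Y) \<and>
            iso_over (open_sub X U) (open_sub Y V))"


section \<open>Hypersurfaces in products of projective spaces\<close>

type_synonym ('x, 'f) mpoly = "('x \<Rightarrow>\<^sub>0 nat) \<Rightarrow>\<^sub>0 'f"

definition mconst :: "'f::field \<Rightarrow> ('x, 'f) mpoly" where
  "mconst c = Poly_Mapping.single 0 c"

definition mvar :: "'x \<Rightarrow> ('x, 'f::field) mpoly" where
  "mvar x = Poly_Mapping.single (Poly_Mapping.single x 1) 1"

definition mpoly_ring :: "'x set \<Rightarrow> ('x, 'f::field) mpoly ring" where
  "mpoly_ring A =
     \<lparr>carrier = {q. \<forall>m \<in> Poly_Mapping.keys q. Poly_Mapping.keys m \<subseteq> A},
      monoid.mult = (*), one = 1, zero = 0, add = (+)\<rparr>"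

text \<open>
  A product of projective spaces is described by a set \<open>Bs\<close> of pairwise disjoint, finite, nonempty
  blocks of variables, one block of homogeneous coordinates for each factor; a multidegree assigns
  a degree to each block.  For a single block this is the usual Proj of the polynomial ring; for
  several blocks it is the multigraded Proj, which is the fibre product of the projective spaces of
  the individual blocks.  For a multihomogeneous \<open>f\<close>, all notions below refer to the closed
  subscheme \<open>{f = 0}\<close>: its points are the multihomogeneous primes that contain \<open>f\<close> and
  do not contain all variables of any block, and its local ring at \<open>P\<close> consists of the fractions of
  multidegree \<open>0\<close> with denominator outside \<open>P\<close>, taken modulo \<open>f\<close>.
\<close>

definition mhomog :: "'x set set \<Rightarrow> ('x set \<Rightarrow> nat) \<Rightarrow> ('x, 'f::field) mpoly set" where
  "mhomog Bs e =
     {q \<in> carrier (mpoly_ring (\<Union>Bs)).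
        \<forall>m \<in> Poly_Mapping.keys q. \<forall>A \<in> Bs. (\<Sum>x\<in>A. Poly_Mapping.lookup m x) = e A}"

definition mproj_points ::
    "'x set set \<Rightarrow> ('x, 'f::field) mpoly \<Rightarrow> ('x, 'f) mpoly set set" where
  "mproj_points Bs f =
     {P. primeideal P (mpoly_ring (\<Union>Bs)) \<and>
         P = genideal (mpoly_ring (\<Union>Bs)) (P \<inter> (\<Union>e. mhomog Bs e)) \<and>
         (\<forall>A \<in> Bs. \<exists>x \<in> A. mvar x \<notin> P) \<and> f \<in> P}"

definition mproj_zariski ::
    "'x set set \<Rightarrow> ('x, 'f::field) mpoly \<Rightarrow> ('x, 'f) mpoly set topology" where
  "mproj_zariski Bs f =
     topology_generated_by
       {{P \<in> mproj_points Bs f. q \<notin> P} | q. q \<in> (\<Union>e. mhomog Bs e)}"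

text \<open>The fraction \<open>a / b\<close> in the local ring at \<open>P\<close>, as an equivalence class of pairs.\<close>

definition mfrac ::
    "'x set set \<Rightarrow> ('x, 'f::field) mpoly \<Rightarrow> ('x, 'f) mpoly set \<Rightarrow>
     ('x, 'f) mpoly \<Rightarrow> ('x, 'f) mpoly \<Rightarrow> (('x, 'f) mpoly \<times> ('x, 'f) mpoly) set" where
  "mfrac Bs f P a b =
     {(c, d). (\<exists>e. c \<in> mhomog Bs e \<and> d \<in> mhomog Bs e) \<and> d \<notin> P \<and>
        (\<exists>t \<in> (\<Union>e. mhomog Bs e) - P.
           t * (a * d - c * b) \<in> cgenideal (mpoly_ring (\<Union>Bs)) f)}"

definition mproj_stalk ::
    "'x set set \<Rightarrow> ('x, 'f::field) mpoly \<Rightarrow> ('x, 'f) mpoly set \<Rightarrow>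
     (('x, 'f) mpoly \<times> ('x, 'f) mpoly) set ring" where
  "mproj_stalk Bs f P =
     \<lparr>carrier = {mfrac Bs f P a b | a b e. a \<in> mhomog Bs e \<and> b \<in> mhomog Bs e \<and> b \<notin> P},
      monoid.mult = (\<lambda>x y. \<Union>(a, b)\<in>x. \<Union>(c, d)\<in>y. mfrac Bs f P (a * c) (b * d)),
      one = mfrac Bs f P 1 1,
      zero = mfrac Bs f P 0 1,
      add = (\<lambda>x y. \<Union>(a, b)\<in>x. \<Union>(c, d)\<in>y. mfrac Bs f P (a * d + c * b) (b * d))\<rparr>"

definition mproj_sections ::
    "'x set set \<Rightarrow> ('x, 'f::field) mpoly \<Rightarrow> ('x, 'f) mpoly set set \<Rightarrow>
     (('x, 'f) mpoly set \<Rightarrow> (('x, 'f) mpoly \<times> ('x, 'f) mpoly) set) ring" where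
  "mproj_sections Bs f U =
     \<lparr>carrier = {s \<in> (\<Pi>\<^sub>E P\<in>U. carrier (mproj_stalk Bs f P)).
        \<forall>P \<in> U. \<exists>V a b e. openin (mproj_zariski Bs f) V \<and> P \<in> V \<and> V \<subseteq> U \<and>
          a \<in> mhomog Bs e \<and> b \<in> mhomog Bs e \<and>
          (\<forall>Q \<in> V. b \<notin> Q \<and> s Q = mfrac Bs f Q a b)},
      monoid.mult = (\<lambda>s t. \<lambda>P\<in>U. s P \<otimes>\<^bsub>mproj_stalk Bs f P\<^esub> t P),
      one = (\<lambda>P\<in>U. \<one>\<^bsub>mproj_stalk Bs f P\<^esub>),
      zero = (\<lambda>P\<in>U. \<zero>\<^bsub>mproj_stalk Bs f P\<^esub>),
      add = (\<lambda>s t. \<lambda>P\<in>U. s P \<oplus>\<^bsub>mproj_stalk Bs f P\<^esub> t P)\<rparr>"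

definition mproj_hypersurface ::
    "'x set set \<Rightarrow> ('x, 'f::field) mpoly \<Rightarrow>
     (('x, 'f) mpoly set, ('x, 'f) mpoly set \<Rightarrow> (('x, 'f) mpoly \<times> ('x, 'f) mpoly) set, 'f) fspace"
  where
  "mproj_hypersurface Bs f =
     \<lparr>zar = mproj_zariski Bs f,
      sec = mproj_sections Bs f,
      res = (\<lambda>U V s. restrict s V),
      scal = (\<lambda>U c. \<lambda>P\<in>U. mfrac Bs f P (mconst c) 1)\<rparr>"

text \<open>
  If \<open>f\<close> generates a prime ideal, that ideal is the generic point of \<open>{f = 0}\<close>, and the local ring
  there is the function field.
\<close>

definition function_field ::
    "'x set set \<Rightarrow> ('x, 'f::field) mpoly \<Rightarrow> (('x, 'f) mpoly \<times> ('x, 'f) mpoly) set ring" where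
  "function_field Bs f = mproj_stalk Bs f (cgenideal (mpoly_ring (\<Union>Bs)) f)"

definition function_field_scal ::
    "'x set set \<Rightarrow> ('x, 'f::field) mpoly \<Rightarrow> 'f \<Rightarrow> (('x, 'f) mpoly \<times> ('x, 'f) mpoly) set" where
  "function_field_scal Bs f c = mfrac Bs f (cgenideal (mpoly_ring (\<Union>Bs)) f) (mconst c) 1"


section \<open>Quasilinear forms\<close>

definition quasilinear_form ::
    "nat \<Rightarrow> ('f::field \<Rightarrow> 'v::ab_group_add \<Rightarrow> 'v) \<Rightarrow> ('v \<Rightarrow> 'f) \<Rightarrow> bool" where
  "quasilinear_form p smul \<phi> \<longleftrightarrow>
     (\<forall>c v. \<phi> (smul c v) = c ^ p * \<phi> v) \<and> (\<forall>v w. \<phi> (v + w) = \<phi> v + \<phi> w)"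

definition anisotropic :: "('v::ab_group_add \<Rightarrow> 'f::field) \<Rightarrow> bool" where
  "anisotropic \<phi> \<longleftrightarrow> (\<forall>v. \<phi> v = 0 \<longrightarrow> v = 0)"

text \<open>
  Scalar extension along \<open>\<iota>\<close> into the field \<open>L\<close>, in terms of a basis \<open>B\<close> of the underlying space:
  the extended space is identified with the \<open>B\<close>-indexed families in \<open>L\<close>, the family \<open>u\<close> standing for
  the sum of the \<open>b \<otimes> u b\<close>.
\<close>

definition ext_space :: "('l, 'm) ring_scheme \<Rightarrow> 'v set \<Rightarrow> ('l, 'v \<Rightarrow> 'l) module" where
  "ext_space L B =
     \<lparr>carrier = B \<rightarrow>\<^sub>E carrier L, monoid.mult = undefined, one = undefined,
      zero = (\<lambda>b\<in>B. \<zero>\<^bsub>L\<^esub>), add = (\<lambda>u w. \<lambda>b\<in>B. u b \<oplus>\<^bsub>L\<^esub> w b),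
      smult = (\<lambda>c u. \<lambda>b\<in>B. c \<otimes>\<^bsub>L\<^esub> u b)\<rparr>"

definition ext_form ::
    "nat \<Rightarrow> ('l, 'm) ring_scheme \<Rightarrow> ('f \<Rightarrow> 'l) \<Rightarrow> 'v set \<Rightarrow> ('v \<Rightarrow> 'f) \<Rightarrow> ('v \<Rightarrow> 'l) \<Rightarrow> 'l" where
  "ext_form p L \<iota> B \<phi> u = (\<Oplus>\<^bsub>L\<^esub>b\<in>B. \<iota> (\<phi> b) \<otimes>\<^bsub>L\<^esub> (u b [^]\<^bsub>L\<^esub> p))"

definition defect_index ::
    "('l, 'm) ring_scheme \<Rightarrow> ('l, 'w) module \<Rightarrow> ('w \<Rightarrow> 'l) \<Rightarrow> nat" where
  "defect_index L M q =
     vectorspace.dim L (M\<lparr>carrier := {u \<in> carrier M. q u = \<zero>\<^bsub>L\<^esub>}\<rparr>)"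

text \<open>
  The equation \<open>\<Sum>b\<in>B. \<phi>(b) x\<^sub>b\<^sup>p\<close> of a quasilinear form on the span of the linearly independent
  set \<open>B\<close>; the coordinate with respect to \<open>b\<close> is the variable named \<open>\<nu> b\<close>.
\<close>

definition ql_poly ::
    "nat \<Rightarrow> ('v \<Rightarrow> 'f::field) \<Rightarrow> 'v set \<Rightarrow> ('v \<Rightarrow> 'x) \<Rightarrow> ('x, 'f) mpoly" where
  "ql_poly p \<phi> B \<nu> = (\<Sum>b\<in>B. mconst (\<phi> b) * mvar (\<nu> b) ^ p)"

abbreviation ql_hypersurface where
  "ql_hypersurface p \<phi> B \<equiv> mproj_hypersurface {B} (ql_poly p \<phi> B (\<lambda>b. b))"

text \<open>The product of the quasilinear hypersurface with the projective space of dimension \<open>n\<close>.\<close>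

abbreviation ql_hypersurface_times_proj where
  "ql_hypersurface_times_proj p \<phi> B n \<equiv>
     mproj_hypersurface {Inl ` B, Inr ` {..n::nat}} (ql_poly p \<phi> B Inl)"

text \<open>
  The defect index over the function field.  For an anisotropic form of dimension at least \<open>2\<close> it is
  positive, since the classes of the coordinates give an isotropic vector; so \<open>i1 - 1\<close> on the
  natural numbers is a genuine difference.
\<close>

definition i1 :: "nat \<Rightarrow> ('v \<Rightarrow> 'f::field) \<Rightarrow> 'v set \<Rightarrow> nat" where
  "i1 p \<phi> B =
     (let f = ql_poly p \<phi> B (\<lambda>b. b); L = function_field {B} f
      in defect_index L (ext_space L B) (ext_form p L (function_field_scal {B} f) B \<phi>))"

end

theory Submission
  imports Defs "HOL-Algebra.Algebraic_Closure_Type"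
begin

hide_const (open) Divisibility.prime

text \<open>
  Over the algebraic closure, the form \<open>\<phi>\<close> is the \<open>p\<close>-th power of a linear form \<open>\<Sum>i. \<alpha> i * y i\<close>, and a
  polynomial is divisible by the equation of the hypersurface exactly when it vanishes on the
  hyperplane \<open>H\<close> where this linear form is zero. So linear dependence over the function field becomes
  the existence of polynomial relations \<open>\<Sum>i. \<alpha> i * c i = 0\<close> on \<open>H\<close>, and \<open>i1\<close> is the number of coefficients \<open>\<alpha> i\<close>
  minus their rank over the function field. A subform of codimension \<open>i1 - 1\<close> therefore has one
  coefficient more than the rank, so its coefficients satisfy a relation \<open>u\<close> over the function field of
  the whole form. Differentiating relations shows that \<open>u\<close> can be chosen homogeneous of a degree prime to
  \<open>p\<close> and that the coefficients have the same rank over the function field of the section. The relation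
  \<open>u\<close> is then the required rational map to the section; it is inverted by the remaining relations
  together with the \<open>i1 - 1\<close> free coordinates.
\<close>

section \<open>Evaluation and substitution of polynomials\<close>

text \<open>The obstacle is that \<open>u\<close> must be a generic point of the section: a
  substitution that kills a non-zero function can neither be inverted nor applied to denominators.
  Derivatives alone do not decide this, since in characteristic p a non-constant polynomial may have
  zero derivatives. The way out is descent. If G vanishes at \<open>u\<close>, then so do its
  partial derivatives; by induction on the degree they are zero, so G is a p-th power over the
  perfect field, and its p-th root has smaller degree. That the derivatives vanish at
  \<open>u\<close> rests on two facts. The gradient of a relation along \<open>H\<close> is the
  vector \<alpha> times one common factor \<lambda>, which is non-zero for a minimal relation by
  anisotropy; and Euler's identity returns \<open>u\<close> from its derivatives, which is why its
  degree must be prime to p. The ideal of the equation is prime because two of the roots have an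
  irrational ratio; anisotropy in dimension at least two provides them. Non-perfectness enters
  through the infinitude of the base field, by which polynomials are determined by their
  values.\<close>

abbreviation "mkeys \<equiv> Poly_Mapping.keys"
abbreviation "look \<equiv> Poly_Mapping.lookup"
abbreviation "sg \<equiv> Poly_Mapping.single"

definition Pol :: "'x set \<Rightarrow> ('x, 'f::field) mpoly set" where
  "Pol A = {q. \<forall>m\<in>mkeys q. mkeys m \<subseteq> A}"

definition mev :: "('x \<Rightarrow> 'k::comm_ring_1) \<Rightarrow> ('x \<Rightarrow>\<^sub>0 nat) \<Rightarrow> 'k" where
  "mev y m = (\<Prod>x\<in>mkeys m. y x ^ look m x)"

text \<open>One definition serves three purposes, according to the coefficient map: values at points
  over \<open>'k\<close>, substitution of polynomials (with \<open>mconst\<close>), and restriction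
  to lines with values in univariate polynomials.\<close>

definition meval :: "('f::field \<Rightarrow> 'k::comm_ring_1) \<Rightarrow> ('x \<Rightarrow> 'k) \<Rightarrow> ('x, 'f) mpoly \<Rightarrow> 'k" where
  "meval \<iota> y q = (\<Sum>m\<in>mkeys q. \<iota> (look q m) * mev y m)"

locale rhom =
  fixes \<iota> :: "'f::field \<Rightarrow> 'k::comm_ring_1"
  assumes hom0 [simp]: "\<iota> 0 = 0" and hom1 [simp]: "\<iota> 1 = 1"
    and hom_add: "\<iota> (a + b) = \<iota> a + \<iota> b"
    and hom_mult: "\<iota> (a * b) = \<iota> a * \<iota> b"
begin

lemma hom_sum: "\<iota> (sum f S) = (\<Sum>x\<in>S. \<iota> (f x))"
  by (induction S rule: infinite_finite_induct) (auto simp: hom_add)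

lemma hom_power: "\<iota> (x ^ n) = \<iota> x ^ n"
  by (induction n) (auto simp: hom_mult)

lemma hom_uminus: "\<iota> (- x) = - \<iota> x"
  using hom_add[of x "- x"] by (simp add: eq_neg_iff_add_eq_0 add.commute)

lemma hom_diff: "\<iota> (x - y) = \<iota> x - \<iota> y"
  using hom_add[of x "- y"] by (simp add: hom_uminus)

lemma hom_of_nat: "\<iota> (of_nat n) = of_nat n"
  by (induction n) (auto simp: hom_add)

lemma hom_inj: "\<iota> x = 0 \<longleftrightarrow> x = 0"
proof
  assume *: "\<iota> x = 0"
  show "x = 0"
  proof (rule ccontr)
    assume "x \<noteq> 0"
    then have "\<iota> (x * inverse x) = 1" by simp
    with * show False by (simp add: hom_mult)
  qed
qed simp

end

lemma rhom_mconst: "rhom (mconst :: 'f::field \<Rightarrow> ('x, 'f) mpoly)"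
  by standard (auto simp: mconst_def single_add mult_single)

text \<open>A named identity, so that the rewrite rules of the interpretation of \<open>rhom\<close>
  at it have a constant to match.\<close>

definition ident :: "'a \<Rightarrow> 'a" where "ident x = x"

lemma rhom_ident: "rhom (ident :: 'f::field \<Rightarrow> 'f)"
  by standard (auto simp: ident_def)

lemma mev_superset:
  assumes "finite S" "mkeys m \<subseteq> S"
  shows "mev y m = (\<Prod>x\<in>S. y x ^ look m x)"
  unfolding mev_def using assms
  by (intro prod.mono_neutral_left) (auto simp: in_keys_iff)

lemma mev_add: "mev y (m + n) = mev y m * mev y n"
proof -
  let ?S = "mkeys m \<union> mkeys n"
  have "mev y (m + n) = (\<Prod>x\<in>?S. y x ^ look (m + n) x)"
    using Poly_Mapping.keys_add[of m n] by (intro mev_superset) auto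
  also have "\<dots> = (\<Prod>x\<in>?S. y x ^ look m x) * (\<Prod>x\<in>?S. y x ^ look n x)"
    by (simp add: lookup_add power_add prod.distrib)
  also have "\<dots> = mev y m * mev y n"
    by (simp add: mev_superset[of ?S m] mev_superset[of ?S n])
  finally show ?thesis .
qed

lemma mev_zero [simp]: "mev y 0 = 1"
  by (simp add: mev_def)

lemma mev_single [simp]: "mev y (sg x k) = y x ^ k"
  by (cases "k = 0") (auto simp: mev_def)

lemma sum_singles: "(\<Sum>m\<in>mkeys q. sg m (look q m)) = (q :: 'x \<Rightarrow>\<^sub>0 'a::comm_monoid_add)"
proof (rule poly_mapping_eqI)
  fix k
  have "look (\<Sum>m\<in>mkeys q. sg m (look q m)) k = (\<Sum>m\<in>mkeys q. if m = k then look q m else 0)"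
    by (auto simp: lookup_sum lookup_single when_def intro: sum.cong)
  also have "\<dots> = look q k" by (auto simp: in_keys_iff)
  finally show "look (\<Sum>m\<in>mkeys q. sg m (look q m)) k = look q k" .
qed

lemma mvar_power: "mvar x ^ k = sg (sg x k) 1"
  by (induction k) (auto simp: mvar_def mult_single single_add[symmetric])

lemma sg_prod_aux: "sg (sum f S) (1::'f::field) = (\<Prod>x\<in>S. sg (f x) 1)"
proof (induction S rule: infinite_finite_induct)
  case (insert x F)
  have "sg (f x + sum f F) (1::'f) = sg (f x) 1 * sg (sum f F) 1" by (simp add: mult_single)
  then show ?case using insert by simp
qed auto

lemma sg_mev: "sg m 1 = (mev mvar m :: ('x, 'f::field) mpoly)"
proof -
  have "sg m (1::'f) = sg (\<Sum>x\<in>mkeys m. sg x (look m x)) 1" by (simp add: sum_singles)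
  also have "\<dots> = (\<Prod>x\<in>mkeys m. sg (sg x (look m x)) 1)" by (rule sg_prod_aux)
  also have "\<dots> = mev mvar m" by (simp add: mev_def mvar_power)
  finally show ?thesis .
qed

lemma sg_eq: "sg m c = mconst c * (mev mvar m :: ('x, 'f::field) mpoly)"
  by (simp add: sg_mev[symmetric] mconst_def mult_single)

lemma Pol_single: "mkeys m \<subseteq> A \<Longrightarrow> sg m c \<in> Pol A"
  by (auto simp: Pol_def)
lemma Pol_0 [simp]: "0 \<in> Pol A" by (simp add: Pol_def)
lemma Pol_1 [simp]: "1 \<in> Pol A" by (simp add: Pol_def)
lemma Pol_const [simp]: "mconst c \<in> Pol A" by (auto simp: Pol_def mconst_def)
lemma Pol_var [simp]: "x \<in> A \<Longrightarrow> mvar x \<in> Pol A" by (auto simp: Pol_def mvar_def)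
lemma Pol_add: "a \<in> Pol A \<Longrightarrow> b \<in> Pol A \<Longrightarrow> a + b \<in> Pol A"
  unfolding Pol_def using Poly_Mapping.keys_add[of a b] by blast
lemma Pol_uminus: "a \<in> Pol A \<Longrightarrow> - a \<in> Pol A"
  by (auto simp: Pol_def in_keys_iff)
lemma Pol_diff: "a \<in> Pol A \<Longrightarrow> b \<in> Pol A \<Longrightarrow> a - b \<in> Pol A"
  using Pol_add[of a A "- b"] Pol_uminus[of b A] by simp
lemma Pol_mult: "a \<in> Pol A \<Longrightarrow> b \<in> Pol A \<Longrightarrow> a * b \<in> Pol A"
  unfolding Pol_def
proof safe
  fix m x assume a: "\<forall>m\<in>mkeys a. mkeys m \<subseteq> A" "\<forall>m\<in>mkeys b. mkeys m \<subseteq> A"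
    and m: "m \<in> mkeys (a * b)" "x \<in> mkeys m"
  obtain s t where st: "s \<in> mkeys a" "t \<in> mkeys b" "m = s + t"
    using m(1) Poly_Mapping.keys_mult[of a b] by blast
  then have "x \<in> mkeys s \<union> mkeys t" using m(2) Poly_Mapping.keys_add[of s t] by blast
  then show "x \<in> A" using a st by blast
qed
lemma Pol_sum: "(\<And>x. x \<in> S \<Longrightarrow> f x \<in> Pol A) \<Longrightarrow> sum f S \<in> Pol A"
  by (induction S rule: infinite_finite_induct) (auto intro: Pol_add)
lemma Pol_prod: "(\<And>x. x \<in> S \<Longrightarrow> f x \<in> Pol A) \<Longrightarrow> prod f S \<in> Pol A"
  by (induction S rule: infinite_finite_induct) (auto intro: Pol_mult)
lemma Pol_power: "a \<in> Pol A \<Longrightarrow> a ^ n \<in> Pol A"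
  by (induction n) (auto intro: Pol_mult)
lemma Pol_mono: "A \<subseteq> B \<Longrightarrow> q \<in> Pol A \<Longrightarrow> q \<in> Pol B"
  by (auto simp: Pol_def)
lemma Pol_UNIV [simp]: "q \<in> Pol UNIV" by (simp add: Pol_def)

lemmas Pol_intros = Pol_add Pol_uminus Pol_diff Pol_mult Pol_sum Pol_prod Pol_power

text \<open>Constants and variables generate the polynomial ring; evaluations are compared on them
  alone, without looking at monomials.\<close>

lemma Pol_induct [consumes 1, case_names const var add mult]:
  assumes "q \<in> Pol A"
    and const: "\<And>c. P (mconst c)"
    and var: "\<And>x. x \<in> A \<Longrightarrow> P (mvar x)"
    and add: "\<And>a b. a \<in> Pol A \<Longrightarrow> b \<in> Pol A \<Longrightarrow> P a \<Longrightarrow> P b \<Longrightarrow> P (a + b)"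
    and mult: "\<And>a b. a \<in> Pol A \<Longrightarrow> b \<in> Pol A \<Longrightarrow> P a \<Longrightarrow> P b \<Longrightarrow> P (a * b)"
  shows "P q"
proof -
  let ?Q = "\<lambda>q. q \<in> Pol A \<and> P q"
  have Q1: "?Q 1" using const[of 1] by (simp add: mconst_def)
  have Q0: "?Q 0" using const[of 0] by (simp add: mconst_def)
  have pw: "?Q (a ^ n)" if "?Q a" for a n
    using that by (induction n) (auto intro: mult Pol_mult simp: Q1)
  have pr: "?Q (prod f S)" if "\<And>x. x \<in> S \<Longrightarrow> ?Q (f x)" for f :: "'a \<Rightarrow> ('a, 'b) mpoly" and S
    using that by (induction S rule: infinite_finite_induct) (auto intro: mult Pol_mult simp: Q1)
  have sm: "?Q (sum f S)" if "\<And>x. x \<in> S \<Longrightarrow> ?Q (f x)" for f :: "('a \<Rightarrow>\<^sub>0 nat) \<Rightarrow> ('a, 'b) mpoly" and S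
    using that by (induction S rule: infinite_finite_induct) (auto intro: add Pol_add simp: Q0)
  have "?Q (sg m (look q m))" if "m \<in> mkeys q" for m
  proof -
    have "mkeys m \<subseteq> A" using that assms(1) by (auto simp: Pol_def)
    then have "?Q (mev mvar m)" unfolding mev_def by (intro pr pw) (auto intro: var)
    then show ?thesis unfolding sg_eq using const[of "look q m"] by (auto intro: mult Pol_mult)
  qed
  then have "?Q (\<Sum>m\<in>mkeys q. sg m (look q m))" by (intro sm) auto
  then show ?thesis by (simp add: sum_singles)
qed

lemma meval_superset:
  assumes "finite S" "mkeys q \<subseteq> S" "\<iota> 0 = 0"
  shows "meval \<iota> y q = (\<Sum>m\<in>S. \<iota> (look q m) * mev y m)"
  unfolding meval_def using assms
  by (intro sum.mono_neutral_left) (auto simp: in_keys_iff)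

context rhom
begin

lemma meval_add: "meval \<iota> y (a + b) = meval \<iota> y a + meval \<iota> y b"
proof -
  let ?S = "mkeys a \<union> mkeys b"
  have "meval \<iota> y (a + b) = (\<Sum>m\<in>?S. \<iota> (look (a + b) m) * mev y m)"
    using Poly_Mapping.keys_add[of a b] by (intro meval_superset) auto
  also have "\<dots> = (\<Sum>m\<in>?S. \<iota> (look a m) * mev y m) + (\<Sum>m\<in>?S. \<iota> (look b m) * mev y m)"
    by (simp add: lookup_add hom_add distrib_right sum.distrib)
  also have "\<dots> = meval \<iota> y a + meval \<iota> y b"
    by (simp add: meval_superset[of ?S a] meval_superset[of ?S b])
  finally show ?thesis .
qed

lemma meval_0 [simp]: "meval \<iota> y 0 = 0" by (simp add: meval_def)

lemma meval_single: "meval \<iota> y (sg m c) = \<iota> c * mev y m"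
  by (cases "c = 0") (auto simp: meval_def)

lemma meval_1 [simp]: "meval \<iota> y 1 = 1"
  using meval_single[of y 0 1] by simp
lemma meval_const [simp]: "meval \<iota> y (mconst c) = \<iota> c"
  by (simp add: mconst_def meval_single)
lemma meval_var [simp]: "meval \<iota> y (mvar x) = y x"
  by (simp add: mvar_def meval_single)

lemma meval_sum: "meval \<iota> y (sum f S) = (\<Sum>x\<in>S. meval \<iota> y (f x))"
  by (induction S rule: infinite_finite_induct) (auto simp: meval_add)

lemma meval_mult: "meval \<iota> y (a * b) = meval \<iota> y a * meval \<iota> y b"
proof -
  have "a * b = (\<Sum>m\<in>mkeys a. sg m (look a m)) * (\<Sum>n\<in>mkeys b. sg n (look b n))"
    by (simp add: sum_singles)
  also have "\<dots> = (\<Sum>m\<in>mkeys a. \<Sum>n\<in>mkeys b. sg (m + n) (look a m * look b n))"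
    by (simp add: sum_product mult_single)
  finally have "meval \<iota> y (a * b) =
      (\<Sum>m\<in>mkeys a. \<Sum>n\<in>mkeys b. \<iota> (look a m * look b n) * mev y (m + n))"
    by (simp add: meval_sum meval_single)
  also have "\<dots> = meval \<iota> y a * meval \<iota> y b"
    unfolding meval_def sum_product
    by (intro sum.cong refl) (simp add: hom_mult mev_add mult_ac)
  finally show ?thesis .
qed

lemma meval_power: "meval \<iota> y (a ^ n) = meval \<iota> y a ^ n"
  by (induction n) (auto simp: meval_mult)
lemma meval_prod: "meval \<iota> y (prod f S) = (\<Prod>x\<in>S. meval \<iota> y (f x))"
  by (induction S rule: infinite_finite_induct) (auto simp: meval_mult)
lemma meval_uminus: "meval \<iota> y (- a) = - meval \<iota> y a"
  using meval_add[of y a "- a"] by (simp add: eq_neg_iff_add_eq_0 add.commute)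
lemma meval_diff: "meval \<iota> y (a - b) = meval \<iota> y a - meval \<iota> y b"
  using meval_add[of y a "- b"] by (simp add: meval_uminus)

lemmas meval_simps = meval_add meval_mult meval_power meval_sum meval_prod meval_diff meval_uminus

lemma meval_cong: "q \<in> Pol A \<Longrightarrow> (\<And>x. x \<in> A \<Longrightarrow> y x = z x) \<Longrightarrow> meval \<iota> y q = meval \<iota> z q"
  by (induction q rule: Pol_induct) (auto simp: meval_simps)

lemma meval_subst:
  "meval \<iota> y (meval mconst \<sigma> q) = meval \<iota> (\<lambda>x. meval \<iota> y (\<sigma> x)) q"
proof -
  interpret c: rhom "mconst :: 'f \<Rightarrow> ('c, 'f) mpoly" by (rule rhom_mconst)
  have "q \<in> Pol UNIV" by simp
  then show ?thesis by (induction rule: Pol_induct) (auto simp: meval_simps c.meval_simps)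
qed

end

abbreviation "msubst \<equiv> meval mconst"

interpretation mc: rhom "mconst :: 'f::field \<Rightarrow> ('x, 'f) mpoly" by (rule rhom_mconst)

lemma msubst_Pol: "q \<in> Pol A \<Longrightarrow> (\<And>x. x \<in> A \<Longrightarrow> \<sigma> x \<in> Pol B) \<Longrightarrow> msubst \<sigma> q \<in> Pol B"
  by (induction q rule: Pol_induct) (auto simp: mc.meval_simps intro: Pol_intros)

lemma msubst_mvar: "msubst mvar q = q"
proof -
  have "q \<in> Pol UNIV" by simp
  then show ?thesis by (induction rule: Pol_induct) (auto simp: mc.meval_simps)
qed

section \<open>Partial derivatives, slices and weighted components\<close>

lemma inj_add_single: "inj (\<lambda>n. n + (k :: 'x \<Rightarrow>\<^sub>0 nat))"
  by (rule injI) simp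

text \<open>The formal partial derivative, encoded by a shift of exponents so that its coefficients
  are explicit.\<close>

definition pd :: "'x \<Rightarrow> ('x, 'f::field) mpoly \<Rightarrow> ('x, 'f) mpoly" where
  "pd j q = Poly_Mapping.mapp (\<lambda>n c. of_nat (look n j + 1) * c)
              (Poly_Mapping.map_key (\<lambda>n. n + sg j 1) q)"

lemma lookup_pd: "look (pd j q) n = of_nat (look n j + 1) * look q (n + sg j 1)"
  by (simp add: pd_def lookup_mapp map_key.rep_eq[OF inj_add_single] when_def in_keys_iff)

text \<open>The coefficient of the l-th power of x, as a polynomial in the other variables.\<close>

definition slice :: "'x \<Rightarrow> nat \<Rightarrow> ('x, 'f::field) mpoly \<Rightarrow> ('x, 'f) mpoly" where
  "slice x l q = Poly_Mapping.mapp (\<lambda>n c. if look n x = 0 then c else 0)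
              (Poly_Mapping.map_key (\<lambda>n. n + sg x l) q)"

lemma lookup_slice: "look (slice x l q) n = (if look n x = 0 then look q (n + sg x l) else 0)"
  by (simp add: slice_def lookup_mapp map_key.rep_eq[OF inj_add_single] when_def in_keys_iff)

definition wt :: "'x set \<Rightarrow> ('x \<Rightarrow>\<^sub>0 nat) \<Rightarrow> nat" where
  "wt A m = (\<Sum>x\<in>A. look m x)"

lemma wt_add: "wt A (m + n) = wt A m + wt A n"
  by (simp add: wt_def lookup_add sum.distrib)

text \<open>The homogeneous component of degree k when the variables in \<open>A\<close> have degree
  1 and all others degree 0.\<close>

definition wcomp :: "'x set \<Rightarrow> nat \<Rightarrow> ('x, 'f::field) mpoly \<Rightarrow> ('x, 'f) mpoly" where
  "wcomp A k q = Poly_Mapping.mapp (\<lambda>n c. if wt A n = k then c else 0) q"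

lemma lookup_wcomp: "look (wcomp A k q) n = (if wt A n = k then look q n else 0)"
  by (simp add: wcomp_def lookup_mapp when_def in_keys_iff)

lemma pd_add: "pd j (a + b) = pd j a + pd j b"
  by (rule poly_mapping_eqI) (simp add: lookup_pd lookup_add distrib_left)
lemma pd_0 [simp]: "pd j 0 = 0"
  by (rule poly_mapping_eqI) (simp add: lookup_pd)
lemma pd_sum: "pd j (sum f S) = (\<Sum>x\<in>S. pd j (f x))"
  by (induction S rule: infinite_finite_induct) (auto simp: pd_add)
lemma single_add_minus:
  fixes m :: "'x \<Rightarrow>\<^sub>0 nat"
  assumes "look m j \<noteq> 0" shows "m - sg j 1 + sg j 1 = m"
  using assms by (intro poly_mapping_eqI) (auto simp: lookup_add lookup_minus lookup_single when_def)

lemma pd_single: "pd j (sg m c) = sg (m - sg j 1) (of_nat (look m j) * c)"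
proof (rule poly_mapping_eqI)
  fix n
  show "look (pd j (sg m c)) n = look (sg (m - sg j 1) (of_nat (look m j) * c)) n"
  proof (cases "m = n + sg j 1")
    case True
    then show ?thesis by (simp add: lookup_pd lookup_single lookup_add)
  next
    case False
    then have "look m j = 0 \<or> m - sg j 1 \<noteq> n" using single_add_minus[of m j] by auto
    then show ?thesis using False by (auto simp: lookup_pd lookup_single when_def)
  qed
qed

lemma pd_mult_single:
  "pd j (sg m c * sg n d) = pd j (sg m c) * sg n d + sg m c * pd j (sg n d :: ('x, 'f::field) mpoly)"
proof -
  have 1: "sg (m + n - sg j 1) (of_nat (look m j) * c * d) =
      sg (m - sg j 1 + n) (of_nat (look m j) * c * (d::'f))"
  proof (cases "look m j = 0")
    case False
    then have "m + n - sg j 1 = m - sg j 1 + n"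
      by (intro poly_mapping_eqI) (auto simp: lookup_add lookup_minus lookup_single when_def)
    then show ?thesis by simp
  qed simp
  have 2: "sg (m + n - sg j 1) (of_nat (look n j) * c * d) =
      sg (m + (n - sg j 1)) (c * (of_nat (look n j) * (d::'f)))"
  proof (cases "look n j = 0")
    case False
    then have "m + n - sg j 1 = m + (n - sg j 1)"
      by (intro poly_mapping_eqI) (auto simp: lookup_add lookup_minus lookup_single when_def)
    then show ?thesis by (simp add: mult_ac)
  qed simp
  have "pd j (sg m c * sg n d) = sg (m + n - sg j 1) (of_nat (look m j) * c * d) +
      sg (m + n - sg j 1) (of_nat (look n j) * c * d)"
    by (simp add: mult_single pd_single lookup_add single_add[symmetric] distrib_left distrib_right mult_ac)
  then show ?thesis unfolding 1 2 by (simp add: pd_single mult_single)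
qed

lemma pd_mult: "pd j (a * b) = pd j a * b + a * pd j b"
proof -
  let ?A = "\<Sum>m\<in>mkeys a. sg m (look a m)" and ?B = "\<Sum>n\<in>mkeys b. sg n (look b n)"
  have "pd j (?A * ?B) = pd j ?A * ?B + ?A * pd j ?B"
    by (simp add: sum_product pd_sum pd_mult_single sum.distrib)
  then show ?thesis by (simp add: sum_singles)
qed

lemma pd_const [simp]: "pd j (mconst c) = 0"
  by (simp add: mconst_def pd_single)
lemma pd_1 [simp]: "pd j 1 = 0"
  using pd_const[of j 1] by (simp add: mconst_def)
lemma pd_var: "pd j (mvar x) = (if x = j then 1 else 0)"
  by (auto simp: mvar_def pd_single lookup_single when_def)
lemma pd_power: "pd j (a ^ n) = of_nat n * a ^ (n - 1) * pd j a"
proof (induction n)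
  case (Suc n)
  then show ?case
    by (cases n) (auto simp: pd_mult algebra_simps)
qed simp

lemma keys_pd: "m \<in> mkeys (pd j q) \<Longrightarrow> m + sg j 1 \<in> mkeys q"
  by (auto simp: in_keys_iff lookup_pd)
lemma keys_slice: "m \<in> mkeys (slice x l q) \<Longrightarrow> m + sg x l \<in> mkeys q \<and> look m x = 0"
  by (auto simp: in_keys_iff lookup_slice split: if_splits)
lemma keys_add_nat: "mkeys (m + n :: 'x \<Rightarrow>\<^sub>0 nat) = mkeys m \<union> mkeys n"
  by (auto simp: in_keys_iff lookup_add)

lemma pd_Pol: "q \<in> Pol A \<Longrightarrow> pd j q \<in> Pol A"
  unfolding Pol_def using keys_pd keys_add_nat by fast
lemma slice_Pol: "q \<in> Pol A \<Longrightarrow> slice x l q \<in> Pol (A - {x})"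
proof -
  assume q: "q \<in> Pol A"
  have "mkeys m \<subseteq> A - {x}" if "m \<in> mkeys (slice x l q)" for m
  proof -
    have "mkeys (m + sg x l) \<subseteq> A" "look m x = 0" using keys_slice[OF that] q by (auto simp: Pol_def)
    then show ?thesis unfolding keys_add_nat by (auto simp: in_keys_iff)
  qed
  then show ?thesis by (auto simp: Pol_def)
qed
lemma wcomp_Pol: "q \<in> Pol A \<Longrightarrow> wcomp B k q \<in> Pol A"
  by (auto simp: Pol_def in_keys_iff lookup_wcomp split: if_splits)

lemma slice_add: "slice x l (a + b) = slice x l a + slice x l b"
  by (rule poly_mapping_eqI) (simp add: lookup_slice lookup_add)
lemma slice_0 [simp]: "slice x l 0 = 0"
  by (rule poly_mapping_eqI) (simp add: lookup_slice)
lemma slice_sum: "slice x l (sum f S) = (\<Sum>y\<in>S. slice x l (f y))"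
  by (induction S rule: infinite_finite_induct) (auto simp: slice_add)
lemma slice_single: "slice x l (sg m c) = (if look m x = l then sg (m - sg x l) c else 0)"
proof (rule poly_mapping_eqI)
  fix n
  show "look (slice x l (sg m c)) n = look (if look m x = l then sg (m - sg x l) c else 0) n"
  proof (cases "m = n + sg x l")
    case True
    then show ?thesis by (auto simp: lookup_slice lookup_single when_def lookup_add)
  next
    case False
    have "m = n + sg x l" if "m - sg x l = n" "look m x = l"
      using that(2) unfolding that(1)[symmetric]
      by (intro poly_mapping_eqI) (auto simp: lookup_add lookup_minus lookup_single when_def)
    then show ?thesis using False by (auto simp: lookup_slice lookup_single when_def)
  qed
qed

lemma slice_expand:
  assumes "\<And>m. m \<in> mkeys q \<Longrightarrow> look m x < N"
  shows "q = (\<Sum>l<N. mvar x ^ l * slice x l q)"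
proof -
  have "(\<Sum>l<N. mvar x ^ l * slice x l (sg m c)) = sg m c" if "look m x < N" for m and c :: 'b
  proof -
    have "(\<Sum>l<N. mvar x ^ l * slice x l (sg m c)) =
        (\<Sum>l<N. if l = look m x then mvar x ^ l * sg (m - sg x l) c else 0)"
      by (intro sum.cong) (auto simp: slice_single)
    also have "\<dots> = mvar x ^ look m x * sg (m - sg x (look m x)) c" using that by simp
    also have "\<dots> = sg (sg x (look m x) + (m - sg x (look m x))) c"
      by (simp add: mvar_power mult_single)
    also have "sg x (look m x) + (m - sg x (look m x)) = m"
      by (intro poly_mapping_eqI) (auto simp: lookup_add lookup_minus lookup_single when_def)
    finally show ?thesis .
  qed
  then have "(\<Sum>m\<in>mkeys q. \<Sum>l<N. mvar x ^ l * slice x l (sg m (look q m))) =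
      (\<Sum>m\<in>mkeys q. sg m (look q m))"
    using assms by (intro sum.cong) auto
  then have "(\<Sum>l<N. mvar x ^ l * slice x l (\<Sum>m\<in>mkeys q. sg m (look q m))) =
      (\<Sum>m\<in>mkeys q. sg m (look q m))"
    by (subst (asm) sum.swap) (simp add: slice_sum sum_distrib_left)
  then show ?thesis by (simp add: sum_singles)
qed

lemma nat_image_bound: "finite S \<Longrightarrow> \<exists>N::nat. \<forall>m\<in>S. f m < N"
  using finite_nat_set_iff_bounded[of "f ` S"] by auto

lemma slice_bound: "\<exists>N. \<forall>m\<in>mkeys (q :: ('x, 'f::field) mpoly). look m x < N"
  by (rule nat_image_bound) simp

lemma wcomp_add: "wcomp A k (a + b) = wcomp A k a + wcomp A k b"
  by (rule poly_mapping_eqI) (simp add: lookup_wcomp lookup_add)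
lemma wcomp_0 [simp]: "wcomp A k 0 = 0"
  by (rule poly_mapping_eqI) (simp add: lookup_wcomp)
lemma wcomp_sum: "wcomp A k (sum f S) = (\<Sum>y\<in>S. wcomp A k (f y))"
  by (induction S rule: infinite_finite_induct) (auto simp: wcomp_add)
lemma wcomp_single: "wcomp A k (sg m c) = (if wt A m = k then sg m c else 0)"
  by (rule poly_mapping_eqI) (auto simp: lookup_wcomp lookup_single when_def)
lemma wcomp_expand:
  assumes "\<And>m. m \<in> mkeys q \<Longrightarrow> wt A m < N"
  shows "q = (\<Sum>k<N. wcomp A k q)"
proof (rule poly_mapping_eqI)
  fix n
  show "look q n = look (\<Sum>k<N. wcomp A k q) n"
    using assms[of n] by (cases "n \<in> mkeys q") (auto simp: lookup_sum lookup_wcomp in_keys_iff)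
qed

lemma wcomp_bound: "\<exists>N. \<forall>m\<in>mkeys q. wt A m < N"
  by (rule nat_image_bound) simp

lemma wcomp_mult: "wcomp A k (a * b) = (\<Sum>i\<le>k. wcomp A i a * wcomp A (k - i) b)"
proof -
  have *: "wcomp A k (sg m c * sg n d) = (\<Sum>i\<le>k. wcomp A i (sg m c) * wcomp A (k - i) (sg n d :: ('a, 'b) mpoly))"
    for m n c d
  proof -
    have "(\<Sum>i\<le>k. wcomp A i (sg m c) * wcomp A (k - i) (sg n d)) =
       (\<Sum>i\<le>k. if i = wt A m then wcomp A i (sg m c) * wcomp A (k - i) (sg n d) else 0)"
      by (intro sum.cong) (auto simp: wcomp_single)
    also have "\<dots> = (if wt A m \<le> k then sg m c * wcomp A (k - wt A m) (sg n d) else 0)"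
      by (auto simp: wcomp_single)
    also have "\<dots> = wcomp A k (sg m c * sg n d)"
      by (auto simp: mult_single wcomp_single wt_add)
    finally show ?thesis by simp
  qed
  let ?A = "\<Sum>m\<in>mkeys a. sg m (look a m)" and ?B = "\<Sum>n\<in>mkeys b. sg n (look b n)"
  have "wcomp A k (?A * ?B) = (\<Sum>m\<in>mkeys a. \<Sum>n\<in>mkeys b. \<Sum>i\<le>k. wcomp A i (sg m (look a m)) * wcomp A (k - i) (sg n (look b n)))"
    by (simp add: sum_product wcomp_sum *)
  also have "\<dots> = (\<Sum>m\<in>mkeys a. \<Sum>i\<le>k. \<Sum>n\<in>mkeys b. wcomp A i (sg m (look a m)) * wcomp A (k - i) (sg n (look b n)))"
    by (intro sum.cong refl) (rule sum.swap)
  also have "\<dots> = (\<Sum>i\<le>k. \<Sum>m\<in>mkeys a. \<Sum>n\<in>mkeys b. wcomp A i (sg m (look a m)) * wcomp A (k - i) (sg n (look b n)))"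
    by (rule sum.swap)
  also have "\<dots> = (\<Sum>i\<le>k. wcomp A i ?A * wcomp A (k - i) ?B)"
    by (simp add: sum_product wcomp_sum)
  finally show ?thesis by (simp add: sum_singles)
qed

lemma mev_scale:
  assumes "finite A"
  shows "mev (\<lambda>x. if x \<in> A then t * y x else y x) m = t ^ wt A m * mev y m"
proof -
  let ?S = "mkeys m \<union> A"
  have "mev (\<lambda>x. if x \<in> A then t * y x else y x) m =
      (\<Prod>x\<in>?S. (if x \<in> A then t * y x else y x) ^ look m x)"
    by (rule mev_superset) (use assms in auto)
  also have "\<dots> = (\<Prod>x\<in>?S. (if x \<in> A then t ^ look m x else 1) * y x ^ look m x)"
    by (intro prod.cong) (auto simp: power_mult_distrib)
  also have "\<dots> = (\<Prod>x\<in>?S. if x \<in> A then t ^ look m x else 1) * mev y m"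
    using assms by (simp add: prod.distrib mev_superset[of ?S m])
  also have "(\<Prod>x\<in>?S. if x \<in> A then t ^ look m x else 1) = (\<Prod>x\<in>A. t ^ look m x)"
    using assms by (intro prod.mono_neutral_cong_right) auto
  also have "\<dots> = t ^ wt A m" by (simp add: wt_def power_sum)
  finally show ?thesis .
qed

context rhom
begin

lemma meval_scale_wcomp:
  assumes "finite A"
  shows "meval \<iota> (\<lambda>x. if x \<in> A then t * y x else y x) (wcomp A k q) = t ^ k * meval \<iota> y (wcomp A k q)"
proof -
  have "wt A m = k" if "m \<in> mkeys (wcomp A k q)" for m
    using that by (auto simp: in_keys_iff lookup_wcomp split: if_splits)
  then show ?thesis
    unfolding meval_def by (auto simp: mev_scale[OF assms] sum_distrib_left mult_ac intro!: sum.cong)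
qed

end

section \<open>Functions that are polynomial along lines\<close>

text \<open>Polynomials over the base field are not enough: their values get multiplied by roots
  \<alpha> in \<open>'k\<close> and by functions such as \<open>lam\<close>. Being polynomial on
  every line survives these operations and suffices for cancelling factors.\<close>

definition linpoly :: "(('x \<Rightarrow> 'k::field) \<Rightarrow> 'k) \<Rightarrow> bool" where
  "linpoly f \<longleftrightarrow> (\<forall>y h. \<exists>P. \<forall>t. poly P t = f (\<lambda>x. y x + t * h x))"

lemma linpolyE:
  assumes "linpoly f" obtains P where "\<And>t. poly P t = f (\<lambda>x. y x + t * h x)"
  using assms unfolding linpoly_def by blast

lemma linpoly_const [intro, simp]: "linpoly (\<lambda>_. c)"
  unfolding linpoly_def by (intro allI exI[of _ "[:c:]"]) simp
lemma linpoly_coord [intro, simp]: "linpoly (\<lambda>y. y x)"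
  unfolding linpoly_def
proof (intro allI)
  fix y h :: "'a \<Rightarrow> 'b"
  show "\<exists>P. \<forall>t. poly P t = y x + t * h x" by (rule exI[of _ "[:y x, h x:]"]) simp
qed
lemma linpoly_add [intro]: assumes "linpoly f" "linpoly g" shows "linpoly (\<lambda>y. f y + g y)"
  unfolding linpoly_def
proof (intro allI)
  fix y h
  from assms obtain P Q where "\<And>t. poly P t = f (\<lambda>x. y x + t * h x)" "\<And>t. poly Q t = g (\<lambda>x. y x + t * h x)"
    by (metis linpolyE)
  then show "\<exists>P. \<forall>t. poly P t = f (\<lambda>x. y x + t * h x) + g (\<lambda>x. y x + t * h x)"
    by (intro exI[of _ "P + Q"]) simp
qed
lemma linpoly_mult [intro]: assumes "linpoly f" "linpoly g" shows "linpoly (\<lambda>y. f y * g y)"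
  unfolding linpoly_def
proof (intro allI)
  fix y h
  from assms obtain P Q where "\<And>t. poly P t = f (\<lambda>x. y x + t * h x)" "\<And>t. poly Q t = g (\<lambda>x. y x + t * h x)"
    by (metis linpolyE)
  then show "\<exists>P. \<forall>t. poly P t = f (\<lambda>x. y x + t * h x) * g (\<lambda>x. y x + t * h x)"
    by (intro exI[of _ "P * Q"]) simp
qed
lemma linpoly_sum [intro]: "(\<And>i. i \<in> S \<Longrightarrow> linpoly (f i)) \<Longrightarrow> linpoly (\<lambda>y. \<Sum>i\<in>S. f i y)"
  by (induction S rule: infinite_finite_induct) auto

lemma linpoly_meval:
  assumes "rhom \<iota>" "\<And>i. linpoly (g i)"
  shows "linpoly (\<lambda>y. meval \<iota> (\<lambda>i. g i y) q)"
proof -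
  interpret rhom \<iota> by fact
  have "q \<in> Pol UNIV" by simp
  then show ?thesis by (induction rule: Pol_induct) (auto simp: meval_simps assms(2))
qed

lemma infinite_diff_nonroot:
  assumes "infinite (UNIV :: 'k::field set)" "(P :: 'k poly) \<noteq> 0"
  shows "\<exists>t. poly P t \<noteq> 0"
  using assms poly_roots_finite[of P] by (metis (mono_tags, lifting) Collect_cong UNIV_def)

lemma poly_eq_0_infinite:
  assumes "infinite {t. poly P t = (0 :: 'k::field)}" shows "P = 0"
  using assms poly_roots_finite by blast

text \<open>Join a point where f is non-zero to one where g is non-zero. On this line both are
  non-zero univariate polynomials, so their product is non-zero at some parameter of the infinite
  field.\<close>

lemma linpoly_domain:
  fixes f g :: "('x \<Rightarrow> 'k::field) \<Rightarrow> 'k"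
  assumes inf: "infinite (UNIV :: 'k set)" and fg: "linpoly f" "linpoly g"
    and H: "\<And>y z t. y \<in> H \<Longrightarrow> z \<in> H \<Longrightarrow> (\<lambda>x. y x + t * (z x - y x)) \<in> H"
    and 0: "\<And>y. y \<in> H \<Longrightarrow> f y * g y = 0"
  shows "(\<forall>y\<in>H. f y = 0) \<or> (\<forall>y\<in>H. g y = 0)"
proof (rule ccontr)
  assume "\<not> ?thesis"
  then obtain y z where yz: "y \<in> H" "z \<in> H" "f y \<noteq> 0" "g z \<noteq> 0" by blast
  obtain P where P: "\<And>t. poly P t = f (\<lambda>x. y x + t * (z x - y x))"
    using fg(1) unfolding linpoly_def by (elim allE[of _ y] allE[of _ "\<lambda>x. z x - y x"]) blast
  obtain Q where Q: "\<And>t. poly Q t = g (\<lambda>x. y x + t * (z x - y x))"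
    using fg(2) unfolding linpoly_def by (elim allE[of _ y] allE[of _ "\<lambda>x. z x - y x"]) blast
  have "P \<noteq> 0" using P[of 0] yz by auto
  moreover have "Q \<noteq> 0" using Q[of 1] yz by auto
  ultimately have "P * Q \<noteq> 0" by simp
  then obtain t where "poly (P * Q) t \<noteq> 0" using infinite_diff_nonroot[OF inf] by blast
  with P[of t] Q[of t] 0[OF H[OF yz(1,2), of t]] show False by simp
qed

lemma meval_id_of_nat_point:
  assumes "rhom \<iota>" shows "meval \<iota> (\<lambda>x. \<iota> (f x)) q = \<iota> (meval ident f q)"
proof -
  interpret rhom \<iota> by fact
  interpret i: rhom ident by (rule rhom_ident)
  have "q \<in> Pol UNIV" by simp
  then show ?thesis proof (induction rule: Pol_induct)
    case (const c)
    show ?case unfolding meval_const i.meval_const by (simp only: ident_def)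
  next
    case (var x)
    show ?case unfolding meval_var i.meval_var ..
  next
    case (add a b)
    then show ?case unfolding meval_add i.meval_add hom_add by (simp only:)
  next
    case (mult a b)
    then show ?case unfolding meval_mult i.meval_mult hom_mult by (simp only:)
  qed
qed

text \<open>Induction on the variables: when the other variables are fixed, the values of the slices
  in x are the coefficients of a univariate polynomial that vanishes everywhere on an infinite
  field.\<close>

lemma mpoly_eq_0I:
  fixes q :: "('x, 'f::field) mpoly"
  assumes inf: "infinite (UNIV :: 'f set)" and "finite A" and "q \<in> Pol A"
    and "\<And>y. meval ident y q = 0"
  shows "q = 0"
  using assms(2-)
proof (induction A arbitrary: q rule: finite_induct)
  case (empty q)
  interpret i: rhom "ident :: 'f \<Rightarrow> 'f" by (rule rhom_ident)
  have m0: "m = 0" if "m \<in> mkeys q" for m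
  proof -
    have "mkeys m = {}" using that empty(1) by (auto simp: Pol_def)
    then show ?thesis by (intro poly_mapping_eqI) (auto simp: in_keys_iff)
  qed
  have q: "q = mconst (look q 0)"
  proof (intro poly_mapping_eqI)
    fix m show "look q m = look (mconst (look q 0)) m"
    proof (cases "m = 0")
      case False
      then have "m \<notin> mkeys q" using m0 by blast
      then have "look q m = 0" by (simp only: not_in_keys_iff_lookup_eq_zero)
      moreover have "look (mconst (look q 0)) m = 0"
        unfolding mconst_def using False by (intro lookup_single_not_eq) auto
      ultimately show ?thesis by (simp only:)
    qed (simp add: mconst_def)
  qed
  have "look q 0 = meval ident (\<lambda>_. 0) q"
    using arg_cong[OF q, of "meval ident (\<lambda>_. 0)"] by (simp add: ident_def)
  then have "look q 0 = 0" using empty(2)[of "\<lambda>_. 0"] by simp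
  then have "mconst (look q 0) = (0 :: ('x, 'f) mpoly)" by (simp add: mconst_def)
  with q show ?case by metis
next
  case (insert x A q)
  interpret i: rhom "ident :: 'f \<Rightarrow> 'f" by (rule rhom_ident)
  obtain N where N: "\<forall>m\<in>mkeys q. look m x < N" using slice_bound[of q x] by blast
  then have q: "q = (\<Sum>l<N. mvar x ^ l * slice x l q)" by (intro slice_expand) auto
  have sP: "slice x l q \<in> Pol (insert x A - {x})" for l using insert.prems(1) by (rule slice_Pol)
  have "slice x l q = 0" if "l < N" for l
  proof (rule insert.IH)
    show "slice x l q \<in> Pol A" using sP[of l] insert.hyps by simp
    fix y
    define P where "P = (\<Sum>l<N. monom (meval ident y (slice x l q)) l)"
    have "poly P t = 0" for t
    proof -
      have e: "meval ident (y(x := t)) (slice x l q) = meval ident y (slice x l q)" for l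
        using sP[of l] by (rule i.meval_cong) auto
      have "0 = meval ident (y(x := t)) q" using insert.prems by simp
      also have "\<dots> = (\<Sum>l<N. t ^ l * meval ident y (slice x l q))"
        by (subst q) (simp add: i.meval_simps e)
      also have "\<dots> = poly P t" by (simp add: P_def poly_sum poly_monom mult.commute)
      finally show ?thesis by simp
    qed
    then have "P = 0" using infinite_diff_nonroot[OF inf] by metis
    then have "coeff P l = 0" by simp
    then show "meval ident y (slice x l q) = 0" using that by (simp add: P_def coeff_sum)
  qed
  then have "(\<Sum>l<N. mvar x ^ l * slice x l q) = 0" by (intro sum.neutral) auto
  then show ?case using q by metis
qed

section \<open>Perfect extensions in characteristic p\<close>

text \<open>The perfect field holds the p-th roots of the coefficients of the form; on it the p-th
  power map is a field automorphism.\<close>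

locale frob = rhom \<iota> for \<iota> :: "'f::field \<Rightarrow> 'k::field" +
  fixes p :: nat
  assumes p: "prime p" and char_p: "CHAR('f) = p"
    and perfect: "\<And>x::'k. \<exists>y. y ^ p = x"
    and inf: "infinite (UNIV :: 'f set)"
begin

lemma p_gt_0: "p > 0" and p_gt_1: "p > 1"
  using p prime_gt_0_nat prime_gt_1_nat by auto

lemma inj_hom: "inj \<iota>"
  by (rule injI) (metis hom_diff hom_inj right_minus_eq)

lemma infK: "infinite (UNIV :: 'k set)"
  using inf inj_hom by (meson finite_imageD finite_subset subset_UNIV)

lemma char_K: "CHAR('k) = p"
proof -
  have "(of_nat p :: 'k) = \<iota> (of_nat p)" by (simp add: hom_of_nat)
  also have "(of_nat p :: 'f) = 0" using char_p by (metis of_nat_CHAR)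
  finally have "CHAR('k) dvd p" by (simp add: of_nat_eq_0_iff_char_dvd)
  moreover have "CHAR('k) \<noteq> 1" by simp
  ultimately show ?thesis using p prime_nat_iff by blast
qed

lemma frob_add: "(x + y :: 'k) ^ p = x ^ p + y ^ p"
  by (rule freshmans_dream) (use p char_K in auto)
lemma frob_sum: "(sum f S :: 'k) ^ p = (\<Sum>i\<in>S. f i ^ p)"
  by (rule freshmans_dream_sum) (use p char_K in auto)
lemma frob_uminus: "(- x :: 'k) ^ p = - (x ^ p)"
  using frob_add[of "- x" x] p_gt_0 by (simp add: eq_neg_iff_add_eq_0 power_0_left)
lemma frob_diff: "(x - y :: 'k) ^ p = x ^ p - y ^ p"
  using frob_add[of x "- y"] by (simp add: frob_uminus)
lemma frob_inj: "x ^ p = y ^ p \<Longrightarrow> x = (y :: 'k)"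
  using frob_diff[of x y] p_gt_0 by simp

lemma of_nat_K_0: "(of_nat n :: 'k) = 0 \<longleftrightarrow> p dvd n"
  using char_K of_nat_eq_0_iff_char_dvd by blast
lemma of_nat_F_0: "(of_nat n :: 'f) = 0 \<longleftrightarrow> p dvd n"
  using char_p of_nat_eq_0_iff_char_dvd by blast

abbreviation "mp \<equiv> map_poly \<iota>"

lemma coeff_mp: "coeff (mp P) n = \<iota> (coeff P n)"
  by (simp add: coeff_map_poly)
lemma mp_mult: "mp (P * Q) = mp P * mp Q"
  by (rule poly_eqI) (simp add: coeff_mp coeff_mult hom_sum hom_mult)
lemma mp_add: "mp (P + Q) = mp P + mp Q"
  by (rule poly_eqI) (simp add: coeff_mp hom_add)
lemma degree_mp: "degree (mp P) = degree P"
  by (rule degree_map_poly) (simp add: hom_inj)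

text \<open>The minimal polynomial of \<open>\<beta>\<close> divides \<open>X ^ p - \<beta> ^ p = (X - \<beta>) ^ p\<close>; if it has degree \<open>d < p\<close>,
  its coefficient \<open>- d \<beta>\<close> puts \<open>\<beta>\<close> into the base field.\<close>
lemma p_independent:
  assumes \<beta>: "\<beta> ^ p = \<iota> b" "\<beta> \<notin> range \<iota>" and rel: "(\<Sum>k<p. \<iota> (c k) * \<beta> ^ k) = 0" and k: "k < p"
  shows "c k = 0"
proof (rule ccontr)
  assume ck: "c k \<noteq> 0"
  \<comment> \<open>The relation as a polynomial of degree less than p with root \<beta>; it bounds
    the degree of the minimal polynomial \<open>g\<close>.\<close>
  define g0 where "g0 = (\<Sum>k<p. monom (c k) k)"
  have cg0: "coeff g0 i = (if i < p then c i else 0)" for i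
    by (simp add: g0_def coeff_sum)
  have "g0 \<noteq> 0" using cg0[of k] ck k by auto
  have "degree g0 < p"
  proof (rule ccontr)
    assume "\<not> degree g0 < p"
    then have "coeff g0 (degree g0) = 0" by (subst cg0) simp
    with \<open>g0 \<noteq> 0\<close> show False by (simp only: leading_coeff_0_iff)
  qed
  have e0: "poly (mp g0) \<beta> = 0"
  proof -
    have "poly (mp g0) \<beta> = (\<Sum>i\<le>degree (mp g0). coeff (mp g0) i * \<beta> ^ i)" by (rule poly_altdef)
    also have "\<dots> = (\<Sum>i<p. coeff (mp g0) i * \<beta> ^ i)"
      using \<open>degree g0 < p\<close> by (intro sum.mono_neutral_left) (auto simp: degree_mp coeff_mp coeff_eq_0)
    also have "\<dots> = 0" using rel by (simp add: coeff_mp cg0)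
    finally show ?thesis .
  qed
  let ?Q = "\<lambda>g. g \<noteq> 0 \<and> poly (mp g) \<beta> = 0"
  define g where "g = arg_min degree ?Q"
  have g: "?Q g" "\<And>g'. ?Q g' \<Longrightarrow> degree g \<le> degree g'"
    unfolding g_def using arg_min_nat_lemma[of ?Q g0 degree] \<open>g0 \<noteq> 0\<close> e0 by auto
  have dg: "degree g < p" using g(2)[of g0] \<open>degree g0 < p\<close> \<open>g0 \<noteq> 0\<close> e0 by simp
  have dg0: "degree g > 0"
  proof (rule ccontr)
    assume "\<not> degree g > 0"
    then have "degree g = 0" by simp
    then obtain c where c: "g = [:c:]" by (rule degree_eq_zeroE)
    have "mp [:c:] = [:\<iota> c:]" by (rule poly_eqI) (simp add: coeff_mp coeff_pCons split: nat.splits)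
    then have "\<iota> c = 0" using g(1) unfolding c by simp
    then show False using g(1) c by (simp add: hom_inj)
  qed
  define m where "m = monom 1 p - [:b:]"
  have mm: "mp m = [:- \<beta>, 1:] ^ p"
  proof -
    have "mp m = monom 1 p - [:\<iota> b:]"
      by (rule poly_eqI) (auto simp: m_def coeff_mp hom_diff coeff_pCons split: nat.splits)
    also have "\<dots> = (monom 1 1 + [:- \<beta>:]) ^ p"
    proof -
      have "(monom 1 1 + [:- \<beta>:]) ^ p = monom 1 1 ^ p + [:- \<beta>:] ^ p"
        by (rule freshmans_dream) (use p char_K in auto)
      also have "\<dots> = monom 1 p - [:\<iota> b:]"
        by (simp add: monom_power poly_const_pow frob_uminus \<beta>)
      finally show ?thesis by simp
    qed
    also have "monom 1 1 + [:- \<beta>:] = [:- \<beta>, 1:]" by (simp add: monom_altdef)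
    finally show ?thesis .
  qed
  have "m mod g = 0"
  proof (rule ccontr)
    assume r: "m mod g \<noteq> 0"
    have "mp m = mp (m div g) * mp g + mp (m mod g)"
      by (subst mp_mult[symmetric], subst mp_add[symmetric]) simp
    then have "poly (mp m) \<beta> = poly (mp (m div g)) \<beta> * poly (mp g) \<beta> + poly (mp (m mod g)) \<beta>"
      by simp
    then have "poly (mp (m mod g)) \<beta> = 0" using g(1) p_gt_0 unfolding mm by (simp add: power_0_left)
    then have "degree g \<le> degree (m mod g)" using g(2) r by auto
    then show False using degree_mod_less[of g m] g(1) r by auto
  qed
  then obtain Q where Q: "m = g * Q" by (metis dvd_def mod_0_imp_dvd)
  have GQ: "mp g * mp Q = [:- \<beta>, 1:] ^ p" using mm Q by (simp add: mp_mult)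
  have nz: "mp g * mp Q \<noteq> 0" unfolding GQ by simp
  then have nz': "mp g \<noteq> 0" "mp Q \<noteq> 0" by auto
  \<comment> \<open>The orders at \<beta> and the degrees of the two factors both add up to p, and
    no order exceeds its degree. Hence \<open>mp g\<close> is a constant times a power of X -
    \<beta>.\<close>
  have "Polynomial.order \<beta> (mp g) + Polynomial.order \<beta> (mp Q) = p"
    using order_mult[OF nz] GQ order_power_n_n[of \<beta> p] by simp
  moreover have "degree (mp g) + degree (mp Q) = p"
    using degree_mult_eq[OF nz'] GQ by (simp add: degree_power_eq)
  ultimately have "degree (mp g) = Polynomial.order \<beta> (mp g)"
    using order_degree[OF nz'(1), of \<beta>] order_degree[OF nz'(2), of \<beta>] by linarith
  moreover obtain s where s: "mp g = [:- \<beta>, 1:] ^ Polynomial.order \<beta> (mp g) * s" using order_1[of \<beta> "mp g"] by (auto elim: dvdE)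
  ultimately have s': "mp g = [:- \<beta>, 1:] ^ degree g * s" by (simp add: degree_mp)
  have "s \<noteq> 0" using s nz' by auto
  then have "degree (mp g) = degree g + degree s"
    unfolding s' by (simp add: degree_mult_eq degree_power_eq)
  then have "degree s = 0" by (simp add: degree_mp)
  then obtain c where c: "s = [:c:]" by (rule degree_eq_zeroE)
  have co: "\<iota> (coeff g i) = of_nat (degree g choose i) * (- \<beta>) ^ (degree g - i) * c" if "i \<le> degree g" for i
    using arg_cong[OF s', of "\<lambda>P. coeff P i"] coeff_linear_poly_power[OF that, of "- \<beta>" 1]
    by (simp add: coeff_mp c mult_ac)
  have 1: "\<iota> (coeff g (degree g)) = c" using co[OF order_refl] by simp
  have 2: "\<iota> (coeff g (degree g - 1)) = of_nat (degree g) * (- \<beta>) * c"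
  proof -
    have "degree g choose (degree g - 1) = degree g" using dg0 by (metis One_nat_def Suc_pred binomial_Suc_n)
    moreover have "degree g - (degree g - 1) = 1" using dg0 by simp
    ultimately show ?thesis using co[of "degree g - 1"] by simp
  qed
  have "c \<noteq> 0" using \<open>s \<noteq> 0\<close> c by auto
  moreover have d: "(of_nat (degree g) :: 'k) \<noteq> 0"
    unfolding of_nat_K_0 using dg dg0 by (meson dvd_imp_le not_less)
  ultimately have "\<beta> = - \<iota> (coeff g (degree g - 1)) / (of_nat (degree g) * c)"
    unfolding 2 by simp
  also have "\<dots> = \<iota> (- coeff g (degree g - 1) / (of_nat (degree g) * coeff g (degree g)))"
  proof -
    have "\<iota> (x / y) = \<iota> x / \<iota> y" if "\<iota> y \<noteq> 0" for x y
      using that hom_mult[of "x / y" y] by (simp add: hom_inj field_simps)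
    then show ?thesis using d \<open>c \<noteq> 0\<close> 1 by (simp add: hom_uminus hom_mult hom_of_nat)
  qed
  finally show False using \<beta>(2) by blast
qed

end

lemma keys_multE:
  assumes "m \<in> mkeys (f * g)"
  obtains s t where "s \<in> mkeys f" "t \<in> mkeys g" "m = s + t"
  using assms Poly_Mapping.keys_mult[of f g] by blast

section \<open>The ideal of a quasilinear form\<close>

text \<open>\<open>b0\<close> is the coordinate that is solved for. The irrational ratio of \<alpha>
  b1 and \<alpha> b0 makes the equation generate a prime ideal. The other roots may vanish, which
  admits the zero coefficients that describe a product with a projective space.\<close>

locale qform = frob \<iota> p for \<iota> :: "'f::field \<Rightarrow> 'k::field" and p :: nat +
  fixes A :: "'x set" and \<alpha> :: "'x \<Rightarrow> 'k" and a :: "'x \<Rightarrow> 'f" and b0 b1 :: 'x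
  assumes finA: "finite A" and \<alpha>_p: "\<And>i. i \<in> A \<Longrightarrow> \<alpha> i ^ p = \<iota> (a i)"
    and b0: "b0 \<in> A" "\<alpha> b0 \<noteq> 0" and b1: "b1 \<in> A" "\<And>c. \<alpha> b1 \<noteq> \<iota> c * \<alpha> b0"
begin

definition "H = {y. (\<Sum>i\<in>A. \<alpha> i * y i) = 0}"
definition "Z q \<longleftrightarrow> (\<forall>y\<in>H. meval \<iota> y q = 0)"
definition "fm = (\<Sum>i\<in>A. mconst (a i) * mvar i ^ p)"
text \<open>The normal form modulo \<open>fm\<close>, regarded as a polynomial of degree p in the
  variable \<open>b0\<close>.\<close>

definition red :: "('x, 'f) mpoly \<Rightarrow> bool" where
  "red q \<longleftrightarrow> q \<in> Pol A \<and> (\<forall>m\<in>mkeys q. look m b0 < p)"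

abbreviation "ev \<equiv> meval \<iota>"

lemma b1_ne: "b1 \<noteq> b0"
  using b1(2)[of 1] by auto

lemma linpoly_ev: "linpoly (\<lambda>y. ev y q)"
  using linpoly_meval[OF rhom_axioms, of "\<lambda>i y. y i"] by simp

lemma H_line: "y \<in> H \<Longrightarrow> h \<in> H \<Longrightarrow> (\<lambda>x. y x + t * h x) \<in> H"
proof -
  assume "y \<in> H" "h \<in> H"
  moreover have "(\<Sum>i\<in>A. \<alpha> i * (y i + t * h i)) = (\<Sum>i\<in>A. \<alpha> i * y i) + t * (\<Sum>i\<in>A. \<alpha> i * h i)"
    by (simp add: distrib_left sum.distrib sum_distrib_left mult_ac)
  ultimately show ?thesis by (simp add: H_def)
qed

lemma H_scale: "y \<in> H \<Longrightarrow> (\<lambda>x. t * y x) \<in> H"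
  using H_line[of "\<lambda>_. 0" y t] by (simp add: H_def)

lemma H_diff: "y \<in> H \<Longrightarrow> z \<in> H \<Longrightarrow> (\<lambda>x. z x - y x) \<in> H"
  using H_line[of z y "-1"] by simp

lemma H_cong: "(\<And>i. i \<in> A \<Longrightarrow> y i = z i) \<Longrightarrow> y \<in> H \<longleftrightarrow> z \<in> H"
  unfolding H_def by (simp cong: sum.cong)

lemma dom:
  assumes "linpoly f" "linpoly g" "\<And>y. y \<in> H \<Longrightarrow> f y * g y = 0"
  shows "(\<forall>y\<in>H. f y = 0) \<or> (\<forall>y\<in>H. g y = 0)"
  by (rule linpoly_domain[OF infK assms(1,2) _ assms(3)]) (auto intro: H_line H_diff)

lemma dom_cancel:
  assumes "linpoly g" "\<not> Z c" "\<And>y. y \<in> H \<Longrightarrow> ev y c * g y = 0" "y \<in> H"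
  shows "g y = 0"
  using dom[OF linpoly_ev assms(1), of c] assms(2-) unfolding Z_def by blast

lemma Z_prime: "Z (u * v) \<Longrightarrow> Z u \<or> Z v"
  using dom[OF linpoly_ev linpoly_ev, of u v] by (simp add: Z_def meval_mult)
lemma Z_0 [simp]: "Z 0" by (simp add: Z_def)
lemma zero_H: "(\<lambda>_. 0) \<in> H" by (simp add: H_def)
lemma not_Z_1 [simp]: "\<not> Z 1" unfolding Z_def using zero_H by auto
lemma Z_add: "Z u \<Longrightarrow> Z v \<Longrightarrow> Z (u + v)" by (simp add: Z_def meval_add)
lemma Z_diff: "Z u \<Longrightarrow> Z v \<Longrightarrow> Z (u - v)" by (simp add: Z_def meval_diff)
lemma Z_uminus: "Z u \<Longrightarrow> Z (- u)" by (simp add: Z_def meval_uminus)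
lemma Z_mult: "Z u \<Longrightarrow> Z (v * u)" by (simp add: Z_def meval_mult)
lemma Z_mult': "Z u \<Longrightarrow> Z (u * v)" by (simp add: Z_def meval_mult)
lemma Z_sum: "(\<And>i. i \<in> S \<Longrightarrow> Z (f i)) \<Longrightarrow> Z (sum f S)" by (simp add: Z_def meval_sum)
lemma not_Z_mult: "\<not> Z u \<Longrightarrow> \<not> Z v \<Longrightarrow> \<not> Z (u * v)" using Z_prime by blast
lemma not_Z_power: "\<not> Z u \<Longrightarrow> \<not> Z (u ^ n)"
  by (induction n) (auto dest: Z_prime)
lemma not_Z_prod: "(\<And>i. i \<in> S \<Longrightarrow> \<not> Z (f i)) \<Longrightarrow> \<not> Z (prod f S)"
  by (induction S rule: infinite_finite_induct) (auto dest: Z_prime)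

lemma ev_fm: "ev y fm = (\<Sum>i\<in>A. \<alpha> i * y i) ^ p"
  by (simp add: fm_def meval_simps frob_sum power_mult_distrib \<alpha>_p)

lemma Z_fm: "Z fm"
  using p_gt_0 by (simp add: Z_def ev_fm H_def)

lemma red_0 [simp]: "red 0" by (simp add: red_def)
lemma red_add: "red q \<Longrightarrow> red r \<Longrightarrow> red (q + r)"
  unfolding red_def using Pol_add[of q A r] Poly_Mapping.keys_add[of q r] by blast
lemma red_sum: "(\<And>i. i \<in> S \<Longrightarrow> red (f i)) \<Longrightarrow> red (sum f S)"
  by (induction S rule: infinite_finite_induct) (auto intro: red_add)

lemma red_mvar: assumes "k < p" "q \<in> Pol (A - {b0})" shows "red (mvar b0 ^ k * q)"
  unfolding red_def
proof (intro conjI ballI)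
  show "mvar b0 ^ k * q \<in> Pol A"
    using assms(2) b0(1) Pol_mono[of "A - {b0}" A q] by (auto intro!: Pol_mult Pol_power)
  fix m assume m: "m \<in> mkeys (mvar b0 ^ k * q)"
  obtain s t where st: "s \<in> mkeys (mvar b0 ^ k :: ('x, 'f) mpoly)" "t \<in> mkeys q" "m = s + t"
    by (rule keys_multE[OF m])
  have "s = sg b0 k" using st(1) by (simp add: mvar_power)
  moreover have "b0 \<notin> mkeys t" using st(2) assms(2) by (auto simp: Pol_def)
  ultimately show "look m b0 < p"
    using st(3) assms(1) by (simp add: lookup_add in_keys_iff)
qed

lemma a_b0: "a b0 \<noteq> 0"
  using \<alpha>_p[OF b0(1)] b0(2) p_gt_0 by auto

text \<open>The leading coefficient \<open>a b0\<close> of \<open>fm\<close> in the variable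
  \<open>b0\<close> is a unit, so the p-th power of this variable can be replaced repeatedly; each
  replacement lowers the exponent by p.\<close>

lemma division_mvar:
  assumes "q \<in> Pol (A - {b0})"
  shows "\<exists>g\<in>Pol A. \<exists>r. red r \<and> mvar b0 ^ k * q = g * fm + r"
  using assms
proof (induction k arbitrary: q rule: less_induct)
  case (less k q)
  have qA: "q \<in> Pol A" using less.prems Pol_mono[of "A - {b0}" A] by blast
  show ?case
  proof (cases "k < p")
    case True
    then show ?thesis using red_mvar[OF True less.prems] by (intro bexI[of _ 0] exI[of _ "mvar b0 ^ k * q"]) auto
  next
    case False
    define rest where "rest = (\<Sum>i\<in>A - {b0}. mconst (a i) * mvar i ^ p)"
    have rest: "rest \<in> Pol (A - {b0})" unfolding rest_def by (intro Pol_intros) auto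
    define c where "c = (mconst (inverse (a b0)) :: ('x, 'f) mpoly)"
    have fm: "fm = mconst (a b0) * mvar b0 ^ p + rest"
      unfolding fm_def rest_def using finA b0(1) by (simp add: sum.remove)
    have cc: "c * mconst (a b0) = 1"
      unfolding c_def mc.hom_mult[symmetric] using a_b0 by simp
    have X: "mvar b0 ^ p = c * (fm - rest)"
    proof -
      have "c * (fm - rest) = (c * mconst (a b0)) * mvar b0 ^ p" by (simp add: fm mult.assoc)
      then show ?thesis by (simp add: cc)
    qed
    define q' where "q' = - (c * rest * q)"
    have q': "q' \<in> Pol (A - {b0})"
      unfolding q'_def c_def using rest less.prems by (intro Pol_intros) auto
    have "k - p < k" using False p_gt_0 by simp
    from less.IH[OF this q'] obtain g r where gr: "g \<in> Pol A" "red r" "mvar b0 ^ (k - p) * q' = g * fm + r"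
      by blast
    have "mvar b0 ^ k * q = mvar b0 ^ (k - p) * (mvar b0 ^ p * q)"
      using False by (simp add: power_add[symmetric] mult.assoc[symmetric])
    also have "\<dots> = (mvar b0 ^ (k - p) * c * q) * fm + mvar b0 ^ (k - p) * q'"
      unfolding X q'_def by (simp add: algebra_simps)
    also have "\<dots> = (mvar b0 ^ (k - p) * c * q + g) * fm + r"
      unfolding gr(3) by (simp add: algebra_simps)
    finally have "mvar b0 ^ k * q = (mvar b0 ^ (k - p) * c * q + g) * fm + r" .
    moreover have "mvar b0 ^ (k - p) * c * q + g \<in> Pol A"
      unfolding c_def using gr(1) qA b0(1) by (intro Pol_intros) auto
    ultimately show ?thesis using gr(2) by blast
  qed
qed

lemma division:
  assumes "q \<in> Pol A"
  obtains g r where "g \<in> Pol A" "red r" "q = g * fm + r"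
proof -
  obtain N where "\<forall>m\<in>mkeys q. look m b0 < N" using slice_bound[of q b0] by blast
  then have q: "q = (\<Sum>l<N. mvar b0 ^ l * slice b0 l q)" by (intro slice_expand) auto
  have "\<exists>g\<in>Pol A. \<exists>r. red r \<and> mvar b0 ^ l * slice b0 l q = g * fm + r" for l
    by (rule division_mvar) (rule slice_Pol[OF assms])
  then obtain g r where gr: "\<And>l. g l \<in> Pol A" "\<And>l. red (r l)"
      "\<And>l. mvar b0 ^ l * slice b0 l q = g l * fm + r l" by metis
  have "q = (\<Sum>l<N. g l) * fm + (\<Sum>l<N. r l)"
    by (subst q) (simp add: gr(3) sum.distrib sum_distrib_right)
  then show ?thesis using that[of "\<Sum>l<N. g l" "\<Sum>l<N. r l"] gr by (auto intro: Pol_sum red_sum)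
qed

text \<open>Parametrises \<open>H\<close> by the coordinates other than \<open>b0\<close>, for which
  the equation of \<open>H\<close> is solved.\<close>

definition lift_pt :: "('x \<Rightarrow> 'k) \<Rightarrow> 'x \<Rightarrow> 'k" where
  "lift_pt f = f(b0 := - (\<Sum>i\<in>A - {b0}. \<alpha> i * f i) / \<alpha> b0)"

lemma lift_pt_H: "lift_pt f \<in> H"
proof -
  have "(\<Sum>i\<in>A. \<alpha> i * lift_pt f i) = \<alpha> b0 * lift_pt f b0 + (\<Sum>i\<in>A - {b0}. \<alpha> i * lift_pt f i)"
    using finA b0(1) by (simp add: sum.remove)
  also have "(\<Sum>i\<in>A - {b0}. \<alpha> i * lift_pt f i) = (\<Sum>i\<in>A - {b0}. \<alpha> i * f i)"
    by (intro sum.cong) (auto simp: lift_pt_def)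
  also have "\<alpha> b0 * lift_pt f b0 = - (\<Sum>i\<in>A - {b0}. \<alpha> i * f i)"
    using b0 by (simp add: lift_pt_def)
  finally show ?thesis by (simp add: H_def)
qed

lemma ev_lift_free: "q \<in> Pol (A - {b0}) \<Longrightarrow> ev (lift_pt f) q = ev f q"
  by (rule meval_cong) (auto simp: lift_pt_def)

lemma \<iota>_divide: "\<iota> (x / y) = \<iota> x / \<iota> y"
proof (cases "y = 0")
  case False
  then show ?thesis using hom_mult[of "x / y" y] by (simp add: hom_inj field_simps)
qed simp

text \<open>At a point with coordinates in the base field, except that \<open>b0\<close> is solved for, a reduced
  polynomial is a combination of \<open>1, \<beta>, \<dots>, \<beta> ^ (p - 1)\<close>, where \<open>\<beta>\<close> is a \<open>p\<close>-th root which
  is irrational for almost all values of the coordinate \<open>b1\<close>.\<close>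
lemma red_Z_0:
  assumes "red r" "Z r" shows "r = 0"
proof -
  have rP: "r \<in> Pol A" and rk: "\<forall>m\<in>mkeys r. look m b0 < p" using assms(1) by (auto simp: red_def)
  have r: "r = (\<Sum>k<p. mvar b0 ^ k * slice b0 k r)" using rk by (intro slice_expand) auto
  have sP: "slice b0 k r \<in> Pol (A - {b0})" for k using rP by (rule slice_Pol)
  define \<beta> where "\<beta> f = lift_pt (\<lambda>x. \<iota> (f x)) b0" for f :: "'x \<Rightarrow> 'f"
  interpret i: rhom "ident :: 'f \<Rightarrow> 'f" by (rule rhom_ident)
  have irr: "meval ident f (slice b0 k r) = 0" if f: "\<beta> f \<notin> range \<iota>" and k: "k < p" for f k
  proof (rule p_independent[where c = "\<lambda>k. meval ident f (slice b0 k r)", OF _ f _ k])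
    have "\<beta> f ^ p = - ((\<Sum>i\<in>A - {b0}. \<alpha> i * \<iota> (f i)) ^ p) / \<alpha> b0 ^ p"
      by (simp add: \<beta>_def lift_pt_def power_divide frob_uminus)
    also have "\<dots> = - (\<Sum>i\<in>A - {b0}. \<iota> (a i * f i ^ p)) / \<iota> (a b0)"
      using b0(1) by (simp add: frob_sum power_mult_distrib \<alpha>_p hom_mult hom_power)
    also have "\<dots> = \<iota> (- (\<Sum>i\<in>A - {b0}. a i * f i ^ p) / a b0)"
      by (simp only: \<iota>_divide hom_uminus hom_sum)
    finally show "\<beta> f ^ p = \<iota> (- (\<Sum>i\<in>A - {b0}. a i * f i ^ p) / a b0)" .
    let ?y = "lift_pt (\<lambda>x. \<iota> (f x))"
    have "0 = ev ?y r" using assms(2) lift_pt_H by (simp add: Z_def)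
    also have "\<dots> = (\<Sum>k<p. \<beta> f ^ k * \<iota> (meval ident f (slice b0 k r)))"
      by (subst r) (simp add: meval_simps ev_lift_free[OF sP] meval_id_of_nat_point[OF rhom_axioms] \<beta>_def)
    finally show "(\<Sum>k<p. \<iota> (meval ident f (slice b0 k r)) * \<beta> f ^ k) = 0"
      by (simp add: mult.commute)
  qed
  have "slice b0 k r = 0" if k: "k < p" for k
  proof (rule mpoly_eq_0I[OF inf _ sP])
    fix f :: "'x \<Rightarrow> 'f"
    define h :: "'x \<Rightarrow> 'f" where "h = (\<lambda>x. if x = b1 then 1 else 0)"
    have "linpoly (\<lambda>y. meval ident y (slice b0 k r))"
      using linpoly_meval[OF i.rhom_axioms, of "\<lambda>i y. y i"] by simp
    then obtain P where P: "\<And>t. poly P t = meval ident (\<lambda>x. f x + t * h x) (slice b0 k r)"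
      unfolding linpoly_def by blast
    have \<beta>h: "\<beta> (\<lambda>x. f x + t * h x) = \<beta> f - \<iota> t * \<alpha> b1 / \<alpha> b0" for t
    proof -
      have "(\<Sum>i\<in>A - {b0}. \<alpha> i * \<iota> (f i + t * h i)) =
          (\<Sum>i\<in>A - {b0}. \<alpha> i * \<iota> (f i)) + (\<Sum>i\<in>A - {b0}. if i = b1 then \<alpha> b1 * \<iota> t else 0)"
        unfolding sum.distrib[symmetric] by (intro sum.cong) (auto simp: h_def hom_add hom_mult distrib_left)
      also have "(\<Sum>i\<in>A - {b0}. if i = b1 then \<alpha> b1 * \<iota> t else 0) = \<alpha> b1 * \<iota> t"
        using finA b1 b1_ne by simp
      finally show ?thesis by (simp add: \<beta>_def lift_pt_def field_simps b0(2))
    qed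
    let ?R = "{t. \<beta> (\<lambda>x. f x + t * h x) \<in> range \<iota>}"
    \<comment> \<open>Two parameters with rational \<beta> would make the ratio of \<alpha> b1 and
      \<alpha> b0 rational.\<close>
    have one: "s = t" if "s \<in> ?R" "t \<in> ?R" for s t
    proof (rule ccontr)
      assume "s \<noteq> t"
      from that obtain u v where uv: "\<beta> f - \<iota> s * \<alpha> b1 / \<alpha> b0 = \<iota> u" "\<beta> f - \<iota> t * \<alpha> b1 / \<alpha> b0 = \<iota> v"
        unfolding mem_Collect_eq \<beta>h by blast
      then have "(\<iota> s - \<iota> t) * \<alpha> b1 / \<alpha> b0 = \<iota> v - \<iota> u" by (simp add: algebra_simps diff_divide_distrib) 
      then have "\<iota> (s - t) * \<alpha> b1 = \<iota> (v - u) * \<alpha> b0" using b0(2) by (simp add: hom_diff field_simps)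
      moreover have "\<iota> (s - t) \<noteq> 0" using \<open>s \<noteq> t\<close> by (simp add: hom_inj)
      ultimately have "\<alpha> b1 = \<iota> ((v - u) / (s - t)) * \<alpha> b0"
        unfolding \<iota>_divide by (simp add: field_simps)
      with b1(2) show False by blast
    qed
    have "finite ?R"
    proof (cases "?R = {}")
      case True then show ?thesis by (simp only: finite.emptyI)
    next
      case False
      then obtain s where "s \<in> ?R" by blast
      then have "?R \<subseteq> {s}" using one by blast
      then show ?thesis by (rule finite_subset) simp
    qed
    have "P = 0"
    proof (rule poly_eq_0_infinite)
      have "UNIV - ?R \<subseteq> {t. poly P t = 0}" unfolding P using irr[OF _ k] by blast
      moreover have "infinite (UNIV - ?R)" using \<open>finite ?R\<close> inf by (simp add: Diff_infinite_finite)
      ultimately show "infinite {t. poly P t = 0}" using infinite_super by blast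
    qed
    then show "meval ident f (slice b0 k r) = 0" using P[of 0] by simp
  qed (use finA in auto)
  then have "(\<Sum>k<p. mvar b0 ^ k * slice b0 k r) = 0" by (intro sum.neutral) auto
  then show ?thesis using r by metis
qed

text \<open>Division leaves a reduced remainder that vanishes on \<open>H\<close>, and
  \<open>red_Z_0\<close> makes it zero. So the ideal of the equation is the full vanishing ideal of
  \<open>H\<close>, which is prime by \<open>Z_prime\<close>.\<close>

lemma Z_iff:
  assumes "q \<in> Pol A" shows "Z q \<longleftrightarrow> (\<exists>g\<in>Pol A. q = g * fm)"
proof
  assume Zq: "Z q"
  obtain g r where gr: "g \<in> Pol A" "red r" "q = g * fm + r" using division[OF assms] .
  have "Z (q - g * fm)" by (intro Z_diff Zq Z_mult Z_fm)
  then have "Z r" using gr(3) by simp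
  then have "r = 0" by (rule red_Z_0[OF gr(2)])
  then show "\<exists>g\<in>Pol A. q = g * fm" using gr by auto
qed (auto intro: Z_mult Z_fm)

text \<open>All exponents in \<open>fm\<close> are multiples of the characteristic. Hence partial
  differentiation preserves the ideal and acts on the coordinate ring.\<close>

lemma pd_fm: "pd j fm = 0"
proof -
  have "(of_nat p :: ('x, 'f) mpoly) = mconst (of_nat p)" by (simp add: mc.hom_of_nat)
  also have "(of_nat p :: 'f) = 0" by (simp add: of_nat_F_0)
  finally have "(of_nat p :: ('x, 'f) mpoly) = 0" by simp
  then show ?thesis by (simp add: fm_def pd_sum pd_mult pd_power)
qed

end

section \<open>Derivatives along lines\<close>

context rhom begin

lemma rhom_pC: "rhom (\<lambda>c. [:\<iota> c:])"
  by standard (auto simp: hom_add hom_mult)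

lemma coeff_meval_0: "coeff (meval (\<lambda>c. [:\<iota> c:]) g q) 0 = meval \<iota> (\<lambda>i. coeff (g i) 0) q"
proof -
  interpret c: rhom "\<lambda>c. [:\<iota> c:]" by (rule rhom_pC)
  have "q \<in> Pol UNIV" by simp
  then show ?thesis
    by (induction rule: Pol_induct) (auto simp: c.meval_simps meval_simps coeff_mult_0)
qed

text \<open>Both sides obey the product rule, so it is enough to compare them on generators. This is
  the chain rule to first order along the curve \<open>g\<close>.\<close>

lemma coeff_meval_1:
  assumes "finite A" "q \<in> Pol A"
  shows "coeff (meval (\<lambda>c. [:\<iota> c:]) g q) 1 =
    (\<Sum>j\<in>A. coeff (g j) 1 * meval \<iota> (\<lambda>i. coeff (g i) 0) (pd j q))"
  using assms(2)
proof (induction rule: Pol_induct)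
  interpret c: rhom "\<lambda>c. [:\<iota> c:]" by (rule rhom_pC)
  {
    case (const c) then show ?case by simp
  next
    case (var x)
    have "(\<Sum>j\<in>A. coeff (g j) 1 * meval \<iota> (\<lambda>i. coeff (g i) 0) (pd j (mvar x))) =
        (\<Sum>j\<in>A. if j = x then coeff (g j) 1 else 0)"
      by (intro sum.cong) (auto simp: pd_var)
    then show ?case using var assms(1) by simp
  next
    case (add a b)
    then show ?case by (simp add: c.meval_add meval_add pd_add distrib_left sum.distrib)
  next
    case (mult a b)
    have "coeff (P * Q) 1 = coeff P 1 * coeff Q 0 + coeff P 0 * coeff Q 1" for P Q :: "'k poly"
      by (simp add: coeff_mult)
    then show ?case
      using mult by (simp add: c.meval_mult meval_mult meval_add pd_mult distrib_left sum.distrib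
          coeff_meval_0 sum_distrib_left sum_distrib_right mult_ac)
  }
qed

lemma poly_meval: "poly (meval (\<lambda>c. [:\<iota> c:]) g q) t = meval \<iota> (\<lambda>i. poly (g i) t) q"
proof -
  interpret c: rhom "\<lambda>c. [:\<iota> c:]" by (rule rhom_pC)
  have "q \<in> Pol UNIV" by simp
  then show ?thesis by (induction rule: Pol_induct) (auto simp: c.meval_simps meval_simps)
qed

end

section \<open>Linear dependence over the function field\<close>

definition homog :: "'x set \<Rightarrow> nat \<Rightarrow> ('x, 'f::field) mpoly \<Rightarrow> bool" where
  "homog A k q \<longleftrightarrow> q \<in> Pol A \<and> (\<forall>m\<in>mkeys q. wt A m = k)"

lemma homog_Pol: "homog A k q \<Longrightarrow> q \<in> Pol A" by (simp add: homog_def)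
lemma homog_0 [simp]: "homog A k 0" by (simp add: homog_def)
lemma homog_mult: assumes "homog A k q" "homog A l r" shows "homog A (k + l) (q * r)"
  unfolding homog_def
proof (intro conjI ballI)
  show "q * r \<in> Pol A" using assms by (auto simp: homog_def intro: Pol_mult)
  fix m assume "m \<in> mkeys (q * r)"
  then obtain s t where "s \<in> mkeys q" "t \<in> mkeys r" "m = s + t" by (rule keys_multE)
  then show "wt A m = k + l" using assms by (simp add: homog_def wt_add)
qed
lemma homog_const [simp]: "homog A 0 (mconst c)"
  by (auto simp: homog_def mconst_def wt_def Pol_single)
lemma homog_1 [simp]: "homog A 0 1"
  by (auto simp: homog_def wt_def)
lemma homog_var [simp]: "finite A \<Longrightarrow> x \<in> A \<Longrightarrow> homog A 1 (mvar x)"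
  by (auto simp: homog_def mvar_def wt_def lookup_single when_def Pol_single)
lemma homog_prod: "(\<And>i. i \<in> S \<Longrightarrow> homog A (d i) (f i)) \<Longrightarrow> homog A (sum d S) (prod f S)"
  by (induction S rule: infinite_finite_induct) (auto intro: homog_mult)
lemma homog_wcomp: "q \<in> Pol A \<Longrightarrow> homog A k (wcomp A k q)"
  unfolding homog_def by (auto simp: wcomp_Pol in_keys_iff lookup_wcomp split: if_splits)

lemma mvar_pd_single: "mvar j * pd j (sg m c) = sg m (of_nat (look m j) * c)"
proof (cases "look m j = 0")
  case False
  then have "sg j 1 + (m - sg j 1) = m" using single_add_minus[of m j] by (simp add: add.commute)
  then show ?thesis by (simp add: pd_single mvar_def mult_single)
qed (simp add: pd_single)

text \<open>In a degree prime to p this recovers a polynomial from its partial derivatives; the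
  relation \<open>u\<close> is chosen with such a degree for this purpose.\<close>

lemma euler:
  assumes "homog A k q" shows "(\<Sum>j\<in>A. mvar j * pd j q) = mconst (of_nat k) * q"
proof -
  have 1: "(\<Sum>j\<in>A. mvar j * pd j (sg m c)) = mconst (of_nat (wt A m)) * sg m c" for m and c :: 'b
  proof -
    have "(\<Sum>j\<in>A. sg m (f j)) = sg m (\<Sum>j\<in>A. f j)" for f :: "'a \<Rightarrow> 'b"
      by (induction A rule: infinite_finite_induct) (auto simp: single_add)
    then show ?thesis
      by (simp add: mvar_pd_single wt_def mconst_def mult_single flip: sum_distrib_right)
  qed
  have "(\<Sum>j\<in>A. mvar j * pd j q) = (\<Sum>j\<in>A. mvar j * pd j (\<Sum>m\<in>mkeys q. sg m (look q m)))"
    by (simp only: sum_singles)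
  also have "\<dots> = (\<Sum>j\<in>A. \<Sum>m\<in>mkeys q. mvar j * pd j (sg m (look q m)))"
    by (simp only: pd_sum sum_distrib_left)
  also have "\<dots> = (\<Sum>m\<in>mkeys q. \<Sum>j\<in>A. mvar j * pd j (sg m (look q m)))" by (rule sum.swap)
  also have "\<dots> = (\<Sum>m\<in>mkeys q. mconst (of_nat k) * sg m (look q m))"
    using assms by (intro sum.cong refl) (simp only: 1 homog_def)
  also have "\<dots> = mconst (of_nat k) * q" by (simp only: sum_singles flip: sum_distrib_left)
  finally show ?thesis .
qed

lemma (in rhom) meval_of_nat: "meval \<iota> y (of_nat n) = of_nat n"
  by (induction n) (auto simp: meval_add)

context qform
begin

definition rel :: "('i \<Rightarrow> 'k) \<Rightarrow> 'i set \<Rightarrow> ('i \<Rightarrow> ('x, 'f) mpoly) \<Rightarrow> bool" where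
  "rel \<gamma> S c \<longleftrightarrow> (\<forall>i\<in>S. c i \<in> Pol A) \<and> (\<forall>y\<in>H. (\<Sum>i\<in>S. \<gamma> i * ev y (c i)) = 0)"

text \<open>Inside the rational functions on \<open>H\<close> over \<open>'k\<close>, fractions of
  polynomials over the base field form the function field of the affine cone over the hypersurface.
  This is linear dependence of the constants \<gamma> over that subfield, with denominators
  cleared.\<close>

definition dep :: "('i \<Rightarrow> 'k) \<Rightarrow> 'i set \<Rightarrow> bool" where
  "dep \<gamma> S \<longleftrightarrow> (\<exists>c. rel \<gamma> S c \<and> (\<exists>i\<in>S. \<not> Z (c i)))"

definition spans :: "('i \<Rightarrow> 'k) \<Rightarrow> 'i set \<Rightarrow> 'k \<Rightarrow> bool" where
  "spans \<gamma> S v \<longleftrightarrow> (\<exists>d e. d \<in> Pol A \<and> \<not> Z d \<and> (\<forall>s\<in>S. e s \<in> Pol A) \<and>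
     (\<forall>y\<in>H. ev y d * v = (\<Sum>s\<in>S. \<gamma> s * ev y (e s))))"

text \<open>A relation is constant along \<open>H\<close>, so its gradient is a multiple of the
  vector \<alpha>. This is the factor, read off at the coordinate \<open>b0\<close>.\<close>

definition lam :: "'x set \<Rightarrow> ('x \<Rightarrow> ('x, 'f) mpoly) \<Rightarrow> ('x \<Rightarrow> 'k) \<Rightarrow> 'k" where
  "lam S c y = (\<Sum>i\<in>S. \<alpha> i * ev y (pd b0 (c i))) / \<alpha> b0"

lemma relD: "rel \<gamma> S c \<Longrightarrow> y \<in> H \<Longrightarrow> (\<Sum>i\<in>S. \<gamma> i * ev y (c i)) = 0"
  by (simp add: rel_def)

lemma rel_remove:
  assumes "rel \<gamma> S c" "finite S" "i \<in> S" "Z (c i)" shows "rel \<gamma> (S - {i}) c"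
  using assms by (auto simp: rel_def Z_def sum.remove)

lemma rel_indep: "rel \<gamma> S c \<Longrightarrow> \<not> dep \<gamma> S \<Longrightarrow> i \<in> S \<Longrightarrow> Z (c i)"
  unfolding dep_def by blast

lemma rel_mult: "rel \<gamma> S c \<Longrightarrow> d \<in> Pol A \<Longrightarrow> rel \<gamma> S (\<lambda>i. d * c i)"
  unfolding rel_def by (auto intro: Pol_mult simp: meval_mult mult.left_commute[of _ "ev _ d"] simp flip: sum_distrib_left)

lemma rel_diff: "rel \<gamma> S c \<Longrightarrow> rel \<gamma> S c' \<Longrightarrow> rel \<gamma> S (\<lambda>i. c i - c' i)"
  unfolding rel_def by (auto intro: Pol_diff simp: meval_diff right_diff_distrib sum_subtractf)

lemma dep_insert_spans:
  assumes "finite S" "\<not> dep \<gamma> S" "dep \<gamma> (insert i S)"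
  shows "spans \<gamma> S (\<gamma> i)"
proof -
  have iS: "i \<notin> S" using assms by (auto simp: insert_absorb)
  obtain c j where c: "rel \<gamma> (insert i S) c" "j \<in> insert i S" "\<not> Z (c j)" using assms(3) by (auto simp: dep_def)
  have "\<not> Z (c i)"
  proof
    assume "Z (c i)"
    then have "rel \<gamma> (insert i S - {i}) c" using c(1) assms(1) by (intro rel_remove) auto
    then have "rel \<gamma> S c" using iS by simp
    moreover have "j \<in> S" using c(2,3) \<open>Z (c i)\<close> by auto
    ultimately have "Z (c j)" using rel_indep[OF _ assms(2)] by auto
    then show False using c(3) by auto
  qed
  moreover have "ev y (c i) * \<gamma> i = (\<Sum>s\<in>S. \<gamma> s * ev y (- c s))" if "y \<in> H" for y
    using relD[OF c(1) that] assms(1) iS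
    by (simp add: meval_uminus sum_negf add_eq_0_iff mult.commute)
  ultimately show ?thesis
    using c(1) unfolding spans_def rel_def
    by (intro exI[of _ "c i"] exI[of _ "\<lambda>s. - c s"]) (auto intro: Pol_uminus)
qed

lemma spans_self: assumes "finite S" "i \<in> S" shows "spans \<gamma> S (\<gamma> i)"
  unfolding spans_def
proof (intro exI conjI ballI)
  show "\<not> Z 1" "1 \<in> Pol A" by auto
  show "(if s = i then 1 else 0) \<in> Pol A" for s by auto
  show "ev y 1 * \<gamma> i = (\<Sum>s\<in>S. \<gamma> s * ev y (if s = i then 1 else 0))" for y
    using assms by (subst sum.mono_neutral_right[of S "{i}"]) auto
qed

lemma max_indep:
  assumes "finite C" "S0 \<subseteq> C" "\<not> dep \<gamma> S0"
  obtains S where "S0 \<subseteq> S" "S \<subseteq> C" "\<not> dep \<gamma> S" "\<And>i. i \<in> C \<Longrightarrow> spans \<gamma> S (\<gamma> i)"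
proof -
  let ?F = "{S. S0 \<subseteq> S \<and> S \<subseteq> C \<and> \<not> dep \<gamma> S}"
  have "finite ?F" using assms(1) by (rule_tac finite_subset[of _ "Pow C"]) auto
  moreover have "S0 \<in> ?F" using assms by auto
  ultimately obtain S where S: "S \<in> ?F" "\<And>T. T \<in> ?F \<Longrightarrow> S \<subseteq> T \<Longrightarrow> S = T"
    using finite_has_maximal2[of ?F S0] by auto
  have fS: "finite S" using S(1) assms(1) by (auto intro: finite_subset)
  have "spans \<gamma> S (\<gamma> i)" if "i \<in> C" for i
  proof (cases "i \<in> S")
    case False
    then have "insert i S \<notin> ?F" using S(2)[of "insert i S"] by blast
    then have "dep \<gamma> (insert i S)" using S(1) that by auto
    then show ?thesis using S(1) by (intro dep_insert_spans fS) auto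
  qed (rule spans_self[OF fS])
  then show ?thesis using that S(1) by blast
qed

text \<open>Gaussian elimination modulo the prime ideal.\<close>
lemma linear_system:
  assumes "finite T" "finite S" "card S < card T" "\<And>t s. t \<in> T \<Longrightarrow> s \<in> S \<Longrightarrow> g t s \<in> Pol A"
  shows "\<exists>x. (\<forall>t\<in>T. x t \<in> Pol A) \<and> (\<exists>t\<in>T. \<not> Z (x t)) \<and> (\<forall>s\<in>S. Z (\<Sum>t\<in>T. x t * g t s))"
  using assms(2,1,3,4)
proof (induction S arbitrary: T g rule: finite_induct)
  case (empty T g)
  then have "T \<noteq> {}" by auto
  then show ?case by (intro exI[of _ "\<lambda>_. 1"]) auto
next
  case (insert s0 S T g)
  show ?case
  proof (cases "\<forall>t\<in>T. Z (g t s0)")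
    case True
    have "card S < card T" using insert by simp
    then obtain x where x: "\<forall>t\<in>T. x t \<in> Pol A" "\<exists>t\<in>T. \<not> Z (x t)" "\<forall>s\<in>S. Z (\<Sum>t\<in>T. x t * g t s)"
      using insert.IH[OF insert.prems(1), of g] insert.prems(3) by auto
    moreover have "Z (\<Sum>t\<in>T. x t * g t s0)" using True by (intro Z_sum Z_mult) auto
    ultimately show ?thesis by blast
  next
    case False
    then obtain t0 where t0: "t0 \<in> T" "\<not> Z (g t0 s0)" by auto
    define T' where "T' = T - {t0}"
    define g' where "g' t s = g t0 s0 * g t s - g t s0 * g t0 s" for t s
    have T': "finite T'" "T = insert t0 T'" "t0 \<notin> T'" using insert.prems(1) t0 by (auto simp: T'_def)
    have "card S < card T'" using insert.prems(2) insert.hyps T' by simp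
    moreover have "g' t s \<in> Pol A" if "t \<in> T'" "s \<in> S" for t s
      unfolding g'_def using that insert.prems(3) T' t0 by (intro Pol_intros) auto
    ultimately obtain x where x: "\<forall>t\<in>T'. x t \<in> Pol A" "\<exists>t\<in>T'. \<not> Z (x t)" "\<forall>s\<in>S. Z (\<Sum>t\<in>T'. x t * g' t s)"
      using insert.IH[OF T'(1)] by blast
    \<comment> \<open>Back substitution without division: the solution is multiplied by the pivot
      \<open>g t0 s0\<close>, and \<open>t0\<close> absorbs the equation \<open>s0\<close>.\<close>
    define x' where "x' t = (if t = t0 then - (\<Sum>t\<in>T'. x t * g t s0) else g t0 s0 * x t)" for t
    have "(\<Sum>t\<in>T. x' t * g t s) = (\<Sum>t\<in>T'. x t * g' t s)" for s
    proof -
      have "(\<Sum>t\<in>T. x' t * g t s) = x' t0 * g t0 s + (\<Sum>t\<in>T'. x' t * g t s)"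
        unfolding T'(2) using T' by simp
      also have "(\<Sum>t\<in>T'. x' t * g t s) = (\<Sum>t\<in>T'. g t0 s0 * x t * g t s)"
        using T' by (intro sum.cong) (auto simp: x'_def)
      also have "x' t0 * g t0 s = - (\<Sum>t\<in>T'. x t * g t s0 * g t0 s)"
        by (simp add: x'_def sum_distrib_right)
      also have "- (\<Sum>t\<in>T'. x t * g t s0 * g t0 s) + (\<Sum>t\<in>T'. g t0 s0 * x t * g t s) = (\<Sum>t\<in>T'. x t * g' t s)"
        unfolding sum_negf[symmetric] sum.distrib[symmetric] by (intro sum.cong) (auto simp: g'_def algebra_simps)
      finally show ?thesis .
    qed
    moreover have "g' t s0 = 0" for t by (simp add: g'_def)
    ultimately have "\<forall>s\<in>insert s0 S. Z (\<Sum>t\<in>T. x' t * g t s)" using x(3) by simp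
    moreover have "\<forall>t\<in>T. x' t \<in> Pol A"
      unfolding x'_def using x(1) insert.prems(3) t0 T' by (auto intro!: Pol_intros)
    moreover have "\<exists>t\<in>T. \<not> Z (x' t)"
    proof -
      obtain t where "t \<in> T'" "\<not> Z (x t)" using x(2) by blast
      then have "\<not> Z (x' t)" using t0 T' by (auto simp: x'_def dest: Z_prime)
      then show ?thesis using \<open>t \<in> T'\<close> T' by blast
    qed
    ultimately show ?thesis by blast
  qed
qed

text \<open>\<open>H\<close> is stable under scaling. Along the ray through a point the relation
  becomes a polynomial in the scaling factor that vanishes identically, and its coefficients are the
  relations between components.\<close>

lemma rel_wcomp:
  assumes "rel \<gamma> S c" "finite S" shows "rel \<gamma> S (\<lambda>i. wcomp A k (c i))"
  unfolding rel_def
proof (intro conjI ballI)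
  show "wcomp A k (c i) \<in> Pol A" if "i \<in> S" for i using assms(1) that by (auto simp: rel_def intro: wcomp_Pol)
  fix y assume y: "y \<in> H"
  have "finite (\<Union>i\<in>S. mkeys (c i))" using assms(2) by auto
  then obtain N where N: "\<forall>m\<in>(\<Union>i\<in>S. mkeys (c i)). wt A m < N" using nat_image_bound[of _ "wt A"] by blast
  define Q where "Q = (\<Sum>l<N. monom (\<Sum>i\<in>S. \<gamma> i * ev y (wcomp A l (c i))) l)"
  have "poly Q t = 0" for t
  proof -
    let ?y = "\<lambda>x. if x \<in> A then t * y x else y x"
    have "?y \<in> H" using H_scale[OF y, of t] H_cong[of ?y "\<lambda>x. t * y x"] by simp
    then have "0 = (\<Sum>i\<in>S. \<gamma> i * ev ?y (c i))" using relD[OF assms(1)] by simp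
    also have "\<dots> = (\<Sum>i\<in>S. \<gamma> i * (\<Sum>l<N. t ^ l * ev y (wcomp A l (c i))))"
    proof (intro sum.cong refl)
      fix i assume "i \<in> S"
      then have "c i = (\<Sum>l<N. wcomp A l (c i))" using N by (intro wcomp_expand) auto
      then have "ev ?y (c i) = ev ?y (\<Sum>l<N. wcomp A l (c i))" by (rule arg_cong)
      then show "\<gamma> i * ev ?y (c i) = \<gamma> i * (\<Sum>l<N. t ^ l * ev y (wcomp A l (c i)))"
        by (simp add: meval_sum meval_scale_wcomp[OF finA])
    qed
    also have "\<dots> = (\<Sum>i\<in>S. \<Sum>l<N. \<gamma> i * (t ^ l * ev y (wcomp A l (c i))))"
      by (simp add: sum_distrib_left)
    also have "\<dots> = (\<Sum>l<N. \<Sum>i\<in>S. \<gamma> i * (t ^ l * ev y (wcomp A l (c i))))" by (rule sum.swap)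
    also have "\<dots> = poly Q t"
      by (simp add: Q_def poly_sum poly_monom sum_distrib_left sum_distrib_right mult_ac)
    finally show ?thesis by simp
  qed
  then have "Q = 0" using infinite_diff_nonroot[OF infK] by metis
  then have "coeff Q k = 0" by simp
  then have *: "k < N \<Longrightarrow> (\<Sum>i\<in>S. \<gamma> i * ev y (wcomp A k (c i))) = 0" by (simp add: Q_def coeff_sum)
  show "(\<Sum>i\<in>S. \<gamma> i * ev y (wcomp A k (c i))) = 0"
  proof (cases "k < N")
    case False
    have "wcomp A k (c i) = 0" if "i \<in> S" for i
      using N False that by (intro poly_mapping_eqI) (metis UN_I in_keys_iff lookup_wcomp lookup_zero)
    then show ?thesis by simp
  qed (rule *)
qed

lemma not_Z_wcomp: assumes "\<not> Z q" obtains k where "\<not> Z (wcomp A k q)"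
proof -
  obtain N where "\<forall>m\<in>mkeys q. wt A m < N" using wcomp_bound[of q A] by blast
  then have "q = (\<Sum>k<N. wcomp A k q)" by (intro wcomp_expand) auto
  then show ?thesis using assms that Z_sum[of "{..<N}" "\<lambda>k. wcomp A k q"] by metis
qed

lemma dep_homog:
  assumes "dep \<gamma> S" "finite S"
  obtains c k where "rel \<gamma> S c" "\<And>i. i \<in> S \<Longrightarrow> homog A k (c i)" "\<exists>i\<in>S. \<not> Z (c i)"
proof -
  obtain c i where c: "rel \<gamma> S c" "i \<in> S" "\<not> Z (c i)" using assms(1) by (auto simp: dep_def)
  obtain k where "\<not> Z (wcomp A k (c i))" using not_Z_wcomp[OF c(3)] .
  then show ?thesis
    using that[OF rel_wcomp[OF c(1) assms(2)]] c(1,2) homog_wcomp unfolding rel_def by blast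
qed

text \<open>Vectors of \<open>H\<close> supported on \<open>j\<close> and \<open>b0\<close> suffice
  as tests: a functional that kills the hyperplane is a multiple of the one defining it.\<close>

lemma annihilator:
  assumes "\<And>h. h \<in> H \<Longrightarrow> (\<Sum>j\<in>A. h j * D j) = 0" "j \<in> A"
  shows "D j = (D b0 / \<alpha> b0) * \<alpha> j"
proof (cases "j = b0")
  case False
  let ?h = "\<lambda>i. if i = j then \<alpha> b0 else if i = b0 then - \<alpha> j else 0"
  have s: "(\<Sum>i\<in>A. f i) = f j + f b0" if "\<And>i. i \<noteq> j \<Longrightarrow> i \<noteq> b0 \<Longrightarrow> f i = 0" for f :: "'x \<Rightarrow> 'k"
  proof -
    have "(\<Sum>i\<in>A. f i) = (\<Sum>i\<in>{j, b0}. f i)"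
      using that finA assms(2) b0(1) by (intro sum.mono_neutral_right) auto
    then show ?thesis using False by simp
  qed
  have "(\<Sum>i\<in>A. \<alpha> i * ?h i) = 0" using False by (subst s) auto
  then have "?h \<in> H" by (simp add: H_def)
  then have "(\<Sum>i\<in>A. ?h i * D i) = 0" by (rule assms(1))
  then have "\<alpha> b0 * D j - \<alpha> j * D b0 = 0" using False by (subst (asm) s) auto
  then show ?thesis using b0(2) by (simp add: field_simps)
qed (use b0 in simp)

lemma coeff_line: "q \<in> Pol A \<Longrightarrow> coeff (meval (\<lambda>c. [:\<iota> c:]) (\<lambda>x. [:y x, h x:]) q) 1 = (\<Sum>j\<in>A. h j * ev y (pd j q))"
  using coeff_meval_1[OF finA, of q "\<lambda>x. [:y x, h x:]"] by simp

text \<open>The relation holds identically on the line through y in a direction h of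
  \<open>H\<close>, so its linear coefficient in the parameter vanishes. Then
  \<open>annihilator\<close> applies to the gradient.\<close>

lemma rel_derivative:
  assumes "rel \<gamma> S c" "y \<in> H" "j \<in> A"
  shows "(\<Sum>i\<in>S. \<gamma> i * ev y (pd j (c i))) = (\<Sum>i\<in>S. \<gamma> i * ev y (pd b0 (c i))) / \<alpha> b0 * \<alpha> j"
proof (rule annihilator[OF _ assms(3)])
  fix h assume h: "h \<in> H"
  define P where "P = (\<Sum>i\<in>S. smult (\<gamma> i) (meval (\<lambda>c. [:\<iota> c:]) (\<lambda>x. [:y x, h x:]) (c i)))"
  have "poly P t = 0" for t
    using relD[OF assms(1) H_line[OF assms(2) h, of t]] by (simp add: P_def poly_sum poly_meval)
  then have "P = 0" using infinite_diff_nonroot[OF infK] by metis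
  then have "coeff P 1 = 0" by simp
  moreover have "coeff P 1 = (\<Sum>i\<in>S. \<gamma> i * (\<Sum>j\<in>A. h j * ev y (pd j (c i))))"
    unfolding P_def coeff_sum coeff_smult
    using assms(1) by (intro sum.cong refl) (simp only: rel_def coeff_line)
  moreover have "(\<Sum>i\<in>S. \<gamma> i * (\<Sum>j\<in>A. h j * ev y (pd j (c i)))) = (\<Sum>i\<in>S. \<Sum>j\<in>A. h j * (\<gamma> i * ev y (pd j (c i))))"
    by (simp add: sum_distrib_left mult_ac)
  moreover have "\<dots> = (\<Sum>j\<in>A. \<Sum>i\<in>S. h j * (\<gamma> i * ev y (pd j (c i))))" by (rule sum.swap)
  ultimately show "(\<Sum>j\<in>A. h j * (\<Sum>i\<in>S. \<gamma> i * ev y (pd j (c i)))) = 0"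
    by (simp add: sum_distrib_left)
qed

lemma lam_eq: "rel \<alpha> S c \<Longrightarrow> y \<in> H \<Longrightarrow> j \<in> A \<Longrightarrow> (\<Sum>i\<in>S. \<alpha> i * ev y (pd j (c i))) = lam S c y * \<alpha> j"
  using rel_derivative[of \<alpha> S c y j] by (simp add: lam_def)

lemma linpoly_lam: "linpoly (lam S c)"
proof -
  have "linpoly (\<lambda>y. inverse (\<alpha> b0) * (\<Sum>i\<in>S. \<alpha> i * ev y (pd b0 (c i))))"
    by (intro linpoly_mult linpoly_sum linpoly_const linpoly_ev)
  then show ?thesis by (simp add: lam_def[abs_def] field_simps)
qed

lemma not_Z_b0: "\<not> Z (mvar b0)"
proof -
  have *: "\<alpha> b1 \<noteq> 0" using b1(2)[of 0] by auto
  have "(\<Sum>i\<in>A - {b0}. \<alpha> i * (if i = b1 then 1 else 0)) = (\<Sum>i\<in>A - {b0}. if i = b1 then \<alpha> b1 else 0)"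
    by (intro sum.cong) auto
  also have "\<dots> = \<alpha> b1" using finA b1(1) b1_ne by simp
  finally have "lift_pt (\<lambda>i. if i = b1 then 1 else 0) b0 = - \<alpha> b1 / \<alpha> b0" by (simp add: lift_pt_def)
  then show ?thesis using * b0(2) lift_pt_H unfolding Z_def by (metis divide_eq_0_iff meval_var neg_equal_0_iff_equal)
qed

end

text \<open>The \<open>p\<close>-th roots of the coefficients are linearly independent over the base field: this is
  the anisotropy of the form.\<close>
locale aform = qform \<iota> p A \<alpha> a b0 b1
  for \<iota> :: "'f::field \<Rightarrow> 'k::field" and p :: nat and A :: "'x set" and \<alpha> :: "'x \<Rightarrow> 'k"
    and a :: "'x \<Rightarrow> 'f" and b0 b1 :: 'x +
  assumes F_indep: "(\<Sum>i\<in>A. \<iota> (f i) * \<alpha> i) = 0 \<Longrightarrow> i \<in> A \<Longrightarrow> f i = 0"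
begin

section \<open>Consequences of anisotropy: non-vanishing of \<lambda> and the rank of the
  coefficients\<close>

lemma F_indep_sub: assumes "S \<subseteq> A" "(\<Sum>i\<in>S. \<iota> (f i) * \<alpha> i) = 0" "i \<in> S" shows "f i = 0"
proof -
  let ?f = "\<lambda>i. if i \<in> S then f i else 0"
  have "(\<Sum>i\<in>A. \<iota> (?f i) * \<alpha> i) = (\<Sum>i\<in>S. \<iota> (f i) * \<alpha> i)"
    using assms(1) finA by (intro sum.mono_neutral_cong_right) auto
  then have "?f i = 0" using assms by (intro F_indep[of ?f]) auto
  then show ?thesis using assms(3) by simp
qed

text \<open>All coordinates other than \<open>b0\<close> can be chosen freely in the base field. At
  such points the relation has coefficients in the base field, so \<open>F_indep_sub\<close>
  applies; a polynomial that vanishes at all of them is zero.\<close>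

lemma free_rel_0:
  assumes "S \<subseteq> A" "\<And>i. i \<in> S \<Longrightarrow> r i \<in> Pol (A - {b0})" "rel \<alpha> S r" "i \<in> S"
  shows "r i = 0"
proof (rule mpoly_eq_0I[OF inf _ assms(2)[OF assms(4)]])
  fix f :: "'x \<Rightarrow> 'f"
  let ?y = "lift_pt (\<lambda>x. \<iota> (f x))"
  have "0 = (\<Sum>i\<in>S. \<alpha> i * ev ?y (r i))" using relD[OF assms(3) lift_pt_H] by simp
  also have "\<dots> = (\<Sum>i\<in>S. \<iota> (meval ident f (r i)) * \<alpha> i)"
    by (intro sum.cong refl) (simp add: ev_lift_free[OF assms(2)] meval_id_of_nat_point[OF rhom_axioms])
  finally show "meval ident f (r i) = 0" using assms(1,4) by (intro F_indep_sub[of S]) auto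
qed (use finA in auto)

lemma red_pd: "red r \<Longrightarrow> red (pd j r)"
  unfolding red_def using keys_pd[of _ j r] by (fastforce intro: pd_Pol simp: lookup_add)

text \<open>In a reduced polynomial the exponents of \<open>b0\<close> are below p, so every
  non-zero one survives as a factor of the derivative.\<close>

lemma red_pd_0_free:
  assumes "red r" "pd b0 r = 0" shows "r \<in> Pol (A - {b0})"
proof -
  have "look m b0 = 0" if m: "m \<in> mkeys r" for m
  proof (rule ccontr)
    assume "look m b0 \<noteq> 0"
    then have e: "m - sg b0 1 + sg b0 1 = m" by (rule single_add_minus)
    have l: "look (m - sg b0 1) b0 + 1 = look m b0" using \<open>look m b0 \<noteq> 0\<close> by (simp add: lookup_minus)
    have "look (pd b0 r) (m - sg b0 1) = of_nat (look m b0) * look r m"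
      unfolding lookup_pd e l ..
    then have "(of_nat (look m b0) :: 'f) = 0 \<or> look r m = 0" using assms(2) by simp
    then have "p dvd look m b0" using m by (simp only: of_nat_F_0 in_keys_iff) auto
    moreover have "look m b0 < p" using assms(1) m by (simp add: red_def)
    ultimately show False using \<open>look m b0 \<noteq> 0\<close> by (meson dvd_imp_le not_less neq0_conv)
  qed
  then show ?thesis using assms(1) unfolding red_def Pol_def by (fastforce simp: in_keys_iff)
qed

text \<open>If \<open>\<lambda>\<close> vanished, the ratios of the coefficients of a minimal relation would be constants of
  the derivation; clearing denominators by \<open>p\<close>-th powers turns them into polynomials free of the
  variable \<open>b0\<close>, contradicting the independence over the base field.\<close>
lemma lam_nonzero:
  assumes S: "S \<subseteq> A" "\<And>T. T \<subset> S \<Longrightarrow> \<not> dep \<alpha> T" and c: "rel \<alpha> S c" "\<exists>i\<in>S. \<not> Z (c i)"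
  shows "\<exists>y\<in>H. lam S c y \<noteq> 0"
proof (rule ccontr)
  assume "\<not> ?thesis"
  then have l0: "\<And>y. y \<in> H \<Longrightarrow> (\<Sum>i\<in>S. \<alpha> i * ev y (pd b0 (c i))) = 0" using b0(2) by (auto simp: lam_def)
  have fS: "finite S" using S(1) finA finite_subset by blast
  obtain i0 where i0: "i0 \<in> S" "\<not> Z (c i0)" using c(2) by blast
  have cP: "c i \<in> Pol A" if "i \<in> S" for i using c(1) that by (simp add: rel_def)
  have relp: "rel \<alpha> S (\<lambda>i. pd b0 (c i))" unfolding rel_def using cP l0 by (auto intro: pd_Pol)
  \<comment> \<open>The numerator of the derivative of \<open>c i / c i0\<close>. It is a relation
    that vanishes at \<open>i0\<close>, so minimality of \<open>S\<close> forces it to vanish on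
    \<open>H\<close>.\<close>
  define d where "d i = c i0 * pd b0 (c i) - pd b0 (c i0) * c i" for i
  have "rel \<alpha> S d" unfolding d_def
    by (intro rel_diff rel_mult relp c(1) cP pd_Pol i0(1))
  moreover have "d i0 = 0" by (simp add: d_def mult.commute)
  ultimately have "rel \<alpha> (S - {i0}) d" using fS i0(1) by (intro rel_remove) auto
  moreover have "\<not> dep \<alpha> (S - {i0})" using S(2) i0(1) by blast
  ultimately have Zd: "Z (d i)" if "i \<in> S" for i
    using that rel_indep[of \<alpha> "S - {i0}" d i] \<open>d i0 = 0\<close> by (cases "i = i0") auto
  \<comment> \<open>The ratio \<open>c i / c i0\<close> multiplied by the p-th power of
    \<open>c i0\<close>, which is a constant of the derivation.\<close>
  define c' where "c' i = c i0 ^ (p - 1) * c i" for i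
  have relc': "rel \<alpha> S c'" unfolding c'_def by (intro rel_mult c(1) Pol_power cP i0(1))
  have Zp: "Z (pd b0 (c' i))" if "i \<in> S" for i
  proof -
    have "p = Suc (Suc (p - 2))" using p_gt_1 by simp
    then obtain q where q: "p = Suc (Suc q)" by (rule that)
    have "ev y (pd b0 (c' i)) = ev y (c i0) ^ q * ev y (d i) + of_nat p * (ev y (c i0) ^ q * ev y (pd b0 (c i0)) * ev y (c i))" for y
    proof -
      have gen: "of_nat (Suc q) * v ^ q * w * z + v ^ Suc q * x =
          v ^ q * (v * x - w * z) + of_nat (Suc (Suc q)) * (v ^ q * w * z)"
        for v w x z :: 'k by (simp add: algebra_simps)
      have "pd b0 (c' i) = of_nat (Suc q) * c i0 ^ q * pd b0 (c i0) * c i + c i0 ^ Suc q * pd b0 (c i)"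
        unfolding c'_def pd_mult pd_power q by simp
      then show ?thesis
        unfolding d_def q using gen[of "ev y (c i0)"] by (simp only: meval_simps meval_of_nat)
    qed
    then show ?thesis using Zd[OF that] by (simp add: Z_def of_nat_K_0)
  qed
  have "\<exists>g r. g \<in> Pol A \<and> red r \<and> c' i = g * fm + r" if "i \<in> S" for i
    using division[of "c' i"] relc' that by (metis rel_def)
  then obtain g r where gr: "\<And>i. i \<in> S \<Longrightarrow> g i \<in> Pol A" "\<And>i. i \<in> S \<Longrightarrow> red (r i)" "\<And>i. i \<in> S \<Longrightarrow> c' i = g i * fm + r i"
    by metis
  \<comment> \<open>Modulo the ideal the remainder has the same derivative as \<open>c' i\<close>.
    As this derivative is reduced, it is zero as a polynomial and not only on
    \<open>H\<close>.\<close>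
  have rfree: "r i \<in> Pol (A - {b0})" if "i \<in> S" for i
  proof (rule red_pd_0_free[OF gr(2)[OF that]])
    have "Z (pd b0 (c' i) - pd b0 (g i) * fm)" using Zp[OF that] by (intro Z_diff Z_mult Z_fm)
    moreover have "pd b0 (c' i) - pd b0 (g i) * fm = pd b0 (r i)" by (simp add: gr(3)[OF that] pd_add pd_mult pd_fm)
    ultimately show "pd b0 (r i) = 0" using red_pd[OF gr(2)[OF that]] by (intro red_Z_0) auto
  qed
  have "rel \<alpha> S r"
  proof -
    have "ev y (r i) = ev y (c' i)" if "i \<in> S" "y \<in> H" for i y
      using gr(3)[OF that(1)] Z_fm that(2) by (simp add: meval_simps Z_def)
    then show ?thesis using relc' gr(2) by (simp add: rel_def red_def)
  qed
  then have "r i0 = 0" using free_rel_0[of S r i0] S(1) rfree i0(1) by blast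
  then have "Z (c' i0)" using gr(3)[OF i0(1)] Z_mult[OF Z_fm] by simp
  then show False unfolding c'_def using i0(2) not_Z_mult not_Z_power by blast
qed

text \<open>Differentiating a relation with support in \<open>C\<close> multiplies the span of \<open>C\<close> by \<open>\<lambda>\<close>; so the
  span of \<open>C\<close> is everything.\<close>
lemma lam_span:
  assumes C: "C \<subseteq> A" and u: "rel \<alpha> C u"
    and S: "finite S" "\<And>i. i \<in> C \<Longrightarrow> spans \<alpha> S (\<alpha> i)"
  shows "\<exists>D g. \<not> Z D \<and> D \<in> Pol A \<and> (\<forall>t. \<forall>s\<in>S. g t s \<in> Pol A) \<and>
    (\<forall>y\<in>H. \<forall>t\<in>A. ev y D * lam C u y * \<alpha> t = (\<Sum>s\<in>S. \<alpha> s * ev y (g t s)))"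
proof -
  have fin: "finite C" using C finA finite_subset by blast
  define Q where "Q i d e \<longleftrightarrow> d \<in> Pol A \<and> \<not> Z d \<and> (\<forall>s\<in>S. e s \<in> Pol A) \<and>
     (\<forall>y\<in>H. ev y d * \<alpha> i = (\<Sum>s\<in>S. \<alpha> s * ev y (e s)))" for i d e
  have "\<exists>d e. Q i d e" if "i \<in> C" for i using S(2)[OF that] unfolding spans_def Q_def .
  then obtain d where "\<And>i. i \<in> C \<Longrightarrow> \<exists>e. Q i (d i) e" by metis
  then obtain e where Q: "\<And>i. i \<in> C \<Longrightarrow> Q i (d i) (e i)" by metis
  then have de: "\<And>i. i \<in> C \<Longrightarrow> d i \<in> Pol A \<and> \<not> Z (d i)" "\<And>i s. i \<in> C \<Longrightarrow> s \<in> S \<Longrightarrow> e i s \<in> Pol A"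
      "\<And>i y. i \<in> C \<Longrightarrow> y \<in> H \<Longrightarrow> ev y (d i) * \<alpha> i = (\<Sum>s\<in>S. \<alpha> s * ev y (e i s))"
    unfolding Q_def by blast+
  define D where "D = (\<Prod>i\<in>C. d i)"
  define E where "E i = (\<Prod>j\<in>C - {i}. d j)" for i
  have DE: "D = d i * E i" if "i \<in> C" for i unfolding D_def E_def using that fin by (simp add: prod.remove)
  have D: "\<not> Z D" unfolding D_def using de(1) by (intro not_Z_prod) auto
  \<comment> \<open>Differentiating the relation with respect to \<open>t\<close> gives \<lambda>
    \<alpha> t as a combination of the \<alpha> i in \<open>C\<close>; each of these is rewritten
    through \<open>S\<close> over the common denominator \<open>D\<close>.\<close>
  define g where "g t s = (\<Sum>i\<in>C. E i * e i s * pd t (u i))" for t s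
  have gP: "g t s \<in> Pol A" if "s \<in> S" for t s
    unfolding g_def E_def using de that u by (intro Pol_intros pd_Pol) (auto simp: rel_def)
  have key: "ev y D * lam C u y * \<alpha> t = (\<Sum>s\<in>S. \<alpha> s * ev y (g t s))" if "y \<in> H" "t \<in> A" for y t
  proof -
    have "ev y D * lam C u y * \<alpha> t = (\<Sum>i\<in>C. ev y (E i) * (ev y (d i) * \<alpha> i) * ev y (pd t (u i)))"
      unfolding mult.assoc lam_eq[OF u that, symmetric] sum_distrib_left
      by (intro sum.cong refl) (simp add: DE meval_mult mult_ac)
    also have "\<dots> = (\<Sum>i\<in>C. \<Sum>s\<in>S. \<alpha> s * (ev y (E i) * ev y (e i s) * ev y (pd t (u i))))"
    proof (intro sum.cong refl)
      fix i assume i: "i \<in> C"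
      show "ev y (E i) * (ev y (d i) * \<alpha> i) * ev y (pd t (u i)) =
          (\<Sum>s\<in>S. \<alpha> s * (ev y (E i) * ev y (e i s) * ev y (pd t (u i))))"
        unfolding de(3)[OF i that(1)] by (simp add: sum_distrib_left sum_distrib_right mult_ac)
    qed
    also have "\<dots> = (\<Sum>s\<in>S. \<Sum>i\<in>C. \<alpha> s * (ev y (E i) * ev y (e i s) * ev y (pd t (u i))))" by (rule sum.swap)
    also have "\<dots> = (\<Sum>s\<in>S. \<alpha> s * ev y (g t s))" by (simp add: g_def meval_simps sum_distrib_left)
    finally show ?thesis .
  qed
  have "D \<in> Pol A" unfolding D_def using de(1) by (intro Pol_prod) auto
  then show ?thesis using D gP key by (intro exI[of _ D] exI[of _ g]) auto
qed

text \<open>By \<open>lam_span\<close> every \<lambda> \<alpha> t lies in the span of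
  \<open>S\<close>, so more than \<open>card S\<close> of them satisfy a relation. The factor
  \<lambda> may lie outside the function field, but it is the same for all t and can be
  cancelled.\<close>

lemma rank_bound:
  assumes C: "C \<subseteq> A" and u: "rel \<alpha> C u" "\<exists>y\<in>H. lam C u y \<noteq> 0"
    and S: "finite S" "\<And>i. i \<in> C \<Longrightarrow> spans \<alpha> S (\<alpha> i)"
    and T: "T \<subseteq> A" "\<not> dep \<alpha> T"
  shows "card T \<le> card S"
proof (rule ccontr)
  assume "\<not> ?thesis"
  then have lt: "card S < card T" by simp
  have fin: "finite T" using T(1) finA finite_subset by blast
  obtain D g where D: "\<not> Z D" and gP: "\<forall>t. \<forall>s\<in>S. g t s \<in> Pol A"
    and key0: "\<forall>y\<in>H. \<forall>t\<in>A. ev y D * lam C u y * \<alpha> t = (\<Sum>s\<in>S. \<alpha> s * ev y (g t s))"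
    using lam_span[OF C u(1) S] by auto
  have key: "ev y D * lam C u y * \<alpha> t = (\<Sum>s\<in>S. \<alpha> s * ev y (g t s))" if "y \<in> H" "t \<in> A" for y t
    using key0 that by blast
  obtain x where x: "\<forall>t\<in>T. x t \<in> Pol A" "\<exists>t\<in>T. \<not> Z (x t)" "\<forall>s\<in>S. Z (\<Sum>t\<in>T. x t * g t s)"
    using linear_system[OF fin S(1) lt, of g] gP by blast
  let ?f = "\<lambda>y. \<Sum>t\<in>T. \<alpha> t * ev y (x t)"
  have z: "ev y D * lam C u y * ?f y = 0" if "y \<in> H" for y
  proof -
    have "ev y D * lam C u y * ?f y = (\<Sum>t\<in>T. (ev y D * lam C u y * \<alpha> t) * ev y (x t))"
      by (simp add: sum_distrib_left mult_ac)
    also have "\<dots> = (\<Sum>t\<in>T. \<Sum>s\<in>S. \<alpha> s * (ev y (x t) * ev y (g t s)))"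
    proof (intro sum.cong refl)
      fix t assume "t \<in> T"
      then have "t \<in> A" using T(1) by blast
      show "ev y D * lam C u y * \<alpha> t * ev y (x t) = (\<Sum>s\<in>S. \<alpha> s * (ev y (x t) * ev y (g t s)))"
        unfolding key[OF that \<open>t \<in> A\<close>] by (simp add: sum_distrib_left sum_distrib_right mult_ac)
    qed
    also have "\<dots> = (\<Sum>s\<in>S. \<Sum>t\<in>T. \<alpha> s * (ev y (x t) * ev y (g t s)))" by (rule sum.swap)
    also have "\<dots> = (\<Sum>s\<in>S. \<alpha> s * ev y (\<Sum>t\<in>T. x t * g t s))" by (simp add: meval_simps sum_distrib_left)
    also have "\<dots> = 0" using x(3) that by (simp add: Z_def)
    finally show ?thesis .
  qed
  have lf: "linpoly ?f" by (intro linpoly_sum linpoly_mult linpoly_const linpoly_ev)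
  have ll: "linpoly (\<lambda>y. lam C u y * ?f y)" by (intro linpoly_mult linpoly_lam lf)
  have "lam C u y * ?f y = 0" if "y \<in> H" for y
    using dom_cancel[OF ll D _ that] z by (simp add: mult.assoc)
  then have "\<forall>y\<in>H. ?f y = 0" using dom[OF linpoly_lam lf, of C u] u(2) by blast
  then have "dep \<alpha> T" unfolding dep_def rel_def using x by blast
  then show False using T(2) by blast
qed

text \<open>A minimal dependent subset of \<open>C\<close> has a relation with non-zero \<lambda>,
  which is extended by zero to all of \<open>C\<close>. If its degree is divisible by p, a further
  factor \<open>b0\<close> corrects the degree.\<close>

lemma good_relation:
  assumes "C \<subseteq> A" "dep \<alpha> C"
  obtains u k where "rel \<alpha> C u" "\<And>i. i \<in> C \<Longrightarrow> homog A k (u i)" "\<exists>y\<in>H. lam C u y \<noteq> 0" "\<not> p dvd k"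
proof -
  have fC: "finite C" using assms(1) finA finite_subset by blast
  let ?F = "{S. S \<subseteq> C \<and> dep \<alpha> S}"
  have "finite ?F" using fC by (rule_tac finite_subset[of _ "Pow C"]) auto
  moreover have "C \<in> ?F" using assms by auto
  ultimately obtain S where S: "S \<in> ?F" "\<And>T. T \<in> ?F \<Longrightarrow> T \<subseteq> S \<Longrightarrow> S = T"
    using finite_has_minimal2[of ?F C] by auto
  have SC: "S \<subseteq> C" and fS: "finite S" using S(1) fC finite_subset by auto
  obtain c k where c: "rel \<alpha> S c" "\<And>i. i \<in> S \<Longrightarrow> homog A k (c i)" "\<exists>i\<in>S. \<not> Z (c i)"
    using dep_homog[of \<alpha> S] S(1) fS by auto
  have "\<not> dep \<alpha> T" if "T \<subset> S" for T using S(2)[of T] that SC by blast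
  then have l: "\<exists>y\<in>H. lam S c y \<noteq> 0" using lam_nonzero[of S c] SC assms(1) c by auto
  define c' where "c' i = (if i \<in> S then c i else 0)" for i
  have sum_c': "(\<Sum>i\<in>C. \<alpha> i * ev y (F (c' i))) = (\<Sum>i\<in>S. \<alpha> i * ev y (F (c i)))" if "F 0 = 0" for y F
    unfolding c'_def using fC SC that by (intro sum.mono_neutral_cong_right) auto
  have relc': "rel \<alpha> C c'"
    using c(1) sum_c'[of "\<lambda>x. x"] by (auto simp: rel_def c'_def)
  have lamc': "lam C c' = lam S c"
    using sum_c'[of "pd b0"] by (auto simp: lam_def fun_eq_iff)
  have homc': "homog A k (c' i)" for i by (auto simp: c'_def c(2))
  show ?thesis
  proof (cases "p dvd k")
    case False
    then show ?thesis using that[OF relc' homc'] l lamc' by auto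
  next
    case True
    \<comment> \<open>The extra term of the product rule is the relation itself, so \<lambda> is
      merely multiplied by the value of the variable.\<close>
    define u where "u i = mvar b0 * c' i" for i
    have relu: "rel \<alpha> C u" unfolding u_def by (intro rel_mult relc') (use b0 in auto)
    have "homog A (k + 1) (u i)" for i
      unfolding u_def using homog_mult[OF homog_var[OF finA b0(1)] homc'[of i]] by (simp add: add.commute)
    moreover have "lam C u y = ev y (mvar b0) * lam C c' y" if "y \<in> H" for y
    proof -
      have "(\<Sum>i\<in>C. \<alpha> i * ev y (pd b0 (u i))) = y b0 * (\<Sum>i\<in>C. \<alpha> i * ev y (pd b0 (c' i))) + (\<Sum>i\<in>C. \<alpha> i * ev y (c' i))"
        by (simp add: u_def pd_mult pd_var meval_simps distrib_left sum.distrib sum_distrib_left mult_ac)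
      then show ?thesis using relD[OF relc' that] by (simp add: lam_def)
    qed
    then have "\<exists>y\<in>H. lam C u y \<noteq> 0"
      using dom_cancel[OF linpoly_lam[of C c'] not_Z_b0] l lamc' by metis
    moreover have "\<not> p dvd k + 1" using True p_gt_1 by (metis dvd_add_right_iff nat_dvd_1_iff_1 less_irrefl)
    ultimately show ?thesis using that[OF relu] by auto
  qed
qed

end

section \<open>Multihomogeneous polynomials\<close>

lemma carrier_mpoly_ring [simp]: "carrier (mpoly_ring A) = Pol A"
  by (simp add: mpoly_ring_def Pol_def)

lemma mhomog_iff: "q \<in> mhomog Bs e \<longleftrightarrow> q \<in> Pol (\<Union>Bs) \<and> (\<forall>m\<in>mkeys q. \<forall>A\<in>Bs. wt A m = e A)"
  by (simp add: mhomog_def wt_def)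

lemma mhomog_Pol: "q \<in> mhomog Bs e \<Longrightarrow> q \<in> Pol (\<Union>Bs)" by (simp add: mhomog_iff)
lemma homog_mhomog: "homog A k q \<longleftrightarrow> q \<in> mhomog {A} (\<lambda>_. k)"
  by (simp add: mhomog_iff homog_def)
lemma mhomog_cong: "(\<And>A. A \<in> Bs \<Longrightarrow> e A = e' A) \<Longrightarrow> mhomog Bs e = mhomog Bs e'"
  by (auto simp: mhomog_iff)
lemma mhomog_0 [simp]: "0 \<in> mhomog Bs e" by (simp add: mhomog_iff)
lemma mhomog_add: "q \<in> mhomog Bs e \<Longrightarrow> r \<in> mhomog Bs e \<Longrightarrow> q + r \<in> mhomog Bs e"
  unfolding mhomog_iff using Pol_add[of q "\<Union>Bs" r] Poly_Mapping.keys_add[of q r] by blast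
lemma mhomog_uminus: "q \<in> mhomog Bs e \<Longrightarrow> - q \<in> mhomog Bs e"
  unfolding mhomog_iff using Pol_uminus[of q "\<Union>Bs"] by (auto simp: in_keys_iff)
lemma mhomog_sum: "(\<And>i. i \<in> S \<Longrightarrow> f i \<in> mhomog Bs e) \<Longrightarrow> sum f S \<in> mhomog Bs e"
  by (induction S rule: infinite_finite_induct) (auto intro: mhomog_add)
lemma mhomog_mult:
  assumes "q \<in> mhomog Bs e" "r \<in> mhomog Bs e'" shows "q * r \<in> mhomog Bs (\<lambda>A. e A + e' A)"
  unfolding mhomog_iff
proof (intro conjI ballI)
  show "q * r \<in> Pol (\<Union>Bs)" using assms by (auto simp: mhomog_iff intro: Pol_mult)
  fix m A assume "m \<in> mkeys (q * r)" and A: "A \<in> Bs"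
  then obtain s t where "s \<in> mkeys q" "t \<in> mkeys r" "m = s + t" by (auto elim: keys_multE)
  then show "wt A m = e A + e' A" using assms A by (simp add: mhomog_iff wt_add)
qed
lemma mhomog_const [simp]: "mconst c \<in> mhomog Bs (\<lambda>_. 0)"
  by (auto simp: mhomog_iff mconst_def wt_def Pol_single)
lemma mhomog_1 [simp]: "1 \<in> mhomog Bs (\<lambda>_. 0)"
  by (auto simp: mhomog_iff wt_def)
lemma mhomog_power: "q \<in> mhomog Bs e \<Longrightarrow> q ^ n \<in> mhomog Bs (\<lambda>A. n * e A)"
  by (induction n) (auto dest: mhomog_mult)
lemma mhomog_prod: "(\<And>i. i \<in> S \<Longrightarrow> f i \<in> mhomog Bs (d i)) \<Longrightarrow> prod f S \<in> mhomog Bs (\<lambda>A. \<Sum>i\<in>S. d i A)"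
  by (induction S rule: infinite_finite_induct) (auto intro: mhomog_mult)

lemma mvar_mhomog:
  assumes "finite B" "x \<in> B" "B \<in> Bs" "disjoint Bs"
  shows "mvar x \<in> mhomog Bs (\<lambda>A. if A = B then 1 else 0)"
proof -
  have "wt A (sg x (Suc 0)) = (if A = B then 1 else 0)" if "A \<in> Bs" for A
  proof (cases "A = B")
    case True
    then show ?thesis using assms by (simp add: wt_def lookup_single when_def)
  next
    case False
    then have "x \<notin> A" using assms(2-) that by (auto simp: disjoint_def)
    then have "look (sg x (Suc 0)) z = 0" if "z \<in> A" for z
      using that by (intro lookup_single_not_eq) auto
    then show ?thesis using False by (simp add: wt_def)
  qed
  then show ?thesis using assms(2,3) by (auto simp: mhomog_iff mvar_def intro!: Pol_single)
qed

lemma msubst_mhomog: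
  assumes q: "q \<in> mhomog Bs' e'" and Bs': "finite Bs'" "\<And>A. A \<in> Bs' \<Longrightarrow> finite A" "disjoint Bs'"
    and \<sigma>: "\<And>A x. A \<in> Bs' \<Longrightarrow> x \<in> A \<Longrightarrow> \<sigma> x \<in> mhomog Bs (d A)"
  shows "msubst \<sigma> q \<in> mhomog Bs (\<lambda>B. \<Sum>A\<in>Bs'. e' A * d A B)"
  unfolding meval_def
proof (rule mhomog_sum)
  fix m assume m: "m \<in> mkeys q"
  have km: "mkeys m \<subseteq> \<Union>Bs'" using q m by (auto simp: mhomog_iff Pol_def)
  have "mev \<sigma> m = (\<Prod>x\<in>\<Union>Bs'. \<sigma> x ^ look m x)"
    using km Bs' by (intro mev_superset) auto
  also have "\<dots> = (\<Prod>A\<in>Bs'. \<Prod>x\<in>A. \<sigma> x ^ look m x)"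
    using Bs' by (subst prod.Union_disjoint) (auto simp: disjoint_def)
  also have "\<dots> \<in> mhomog Bs (\<lambda>B. \<Sum>A\<in>Bs'. \<Sum>x\<in>A. look m x * d A B)"
    by (intro mhomog_prod mhomog_power \<sigma>)
  also have "(\<lambda>B. \<Sum>A\<in>Bs'. \<Sum>x\<in>A. look m x * d A B) = (\<lambda>B. \<Sum>A\<in>Bs'. e' A * d A B)"
  proof (intro ext sum.cong refl)
    fix B A assume "A \<in> Bs'"
    then have "wt A m = e' A" using q m by (simp add: mhomog_iff)
    then show "(\<Sum>x\<in>A. look m x * d A B) = e' A * d A B"
      by (simp add: wt_def flip: sum_distrib_right)
  qed
  finally show "mconst (look q m) * mev \<sigma> m \<in> mhomog Bs (\<lambda>B. \<Sum>A\<in>Bs'. e' A * d A B)"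
    using mhomog_mult[OF mhomog_const[of "look q m" Bs]] by force
qed

section \<open>Restriction of coordinates\<close>

lemma (in qform) qform_sub: "A' \<subseteq> A \<Longrightarrow> b0 \<in> A' \<Longrightarrow> b1 \<in> A' \<Longrightarrow> qform \<iota> p A' \<alpha> a b0 b1"
  using finA \<alpha>_p b0 b1 by unfold_locales (auto intro: finite_subset)

text \<open>Dividing a relation by the largest power of the variable \<open>x\<close> and then putting \<open>x = 0\<close>.\<close>
lemma (in qform) dep_restrict1:
  assumes x: "x \<in> A" "x \<noteq> b0" "x \<noteq> b1" and S: "finite S" "dep \<gamma> S"
  shows "qform.dep \<iota> (A - {x}) \<alpha> \<gamma> S"
proof -
  interpret A': qform \<iota> p "A - {x}" \<alpha> a b0 b1
    by (rule qform_sub) (use x b0 b1 in auto)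
  obtain c i1 where c: "rel \<gamma> S c" "i1 \<in> S" "\<not> Z (c i1)" using S(2) by (auto simp: dep_def)
  \<comment> \<open>Reduced representatives are needed for the last step: slices of a reduced
    polynomial are reduced, so a non-zero one cannot vanish on the smaller hyperplane.\<close>
  have "\<exists>g r. g \<in> Pol A \<and> red r \<and> c i = g * fm + r" if "i \<in> S" for i
  proof -
    have "c i \<in> Pol A" using c(1) that by (simp add: rel_def)
    then obtain g r where "g \<in> Pol A" "red r" "c i = g * fm + r" by (rule division)
    then show ?thesis by blast
  qed
  then obtain g r where gr: "\<And>i. i \<in> S \<Longrightarrow> g i \<in> Pol A" "\<And>i. i \<in> S \<Longrightarrow> red (r i)" "\<And>i. i \<in> S \<Longrightarrow> c i = g i * fm + r i"
    by metis
  have evr: "ev y (r i) = ev y (c i)" if "i \<in> S" "y \<in> H" for i y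
    using gr(3)[OF that(1)] Z_fm that(2) by (simp add: meval_simps Z_def)
  have rP: "r i \<in> Pol A" if "i \<in> S" for i using gr(2)[OF that] by (simp add: red_def)
  have "finite (\<Union>i\<in>S. mkeys (r i))" using S(1) by auto
  then obtain N where N: "\<forall>m\<in>(\<Union>i\<in>S. mkeys (r i)). look m x < N" using nat_image_bound[of _ "\<lambda>m. look m x"] by blast
  have rexp: "r i = (\<Sum>l<N. mvar x ^ l * slice x l (r i))" if "i \<in> S" for i
    using N that by (intro slice_expand) auto
  let ?P = "\<lambda>l. \<exists>i\<in>S. slice x l (r i) \<noteq> 0"
  have exP: "\<exists>l. ?P l"
  proof (rule ccontr)
    assume "\<not> ?thesis"
    then have "r i1 = 0" using rexp[OF c(2)] c(2) by simp
    then have "Z (c i1)" using gr(3)[OF c(2)] Z_mult[OF Z_fm] by simp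
    then show False using c(3) by simp
  qed
  define l0 where "l0 = (LEAST l. ?P l)"
  have l0: "?P l0" unfolding l0_def using exP by (rule LeastI_ex)
  have less: "slice x l (r i) = 0" if "l < l0" "i \<in> S" for l i
    using not_less_Least[of l ?P] that unfolding l0_def by blast
  define r' where "r' i = (\<Sum>l\<in>{l0..<N}. mvar x ^ (l - l0) * slice x l (r i))" for i
  have rr': "r i = mvar x ^ l0 * r' i" if "i \<in> S" for i
  proof -
    have "r i = (\<Sum>l\<in>{l0..<N}. mvar x ^ l * slice x l (r i))"
      using less[OF _ that] by (subst rexp[OF that], intro sum.mono_neutral_right) auto
    also have "\<dots> = (\<Sum>l\<in>{l0..<N}. mvar x ^ l0 * (mvar x ^ (l - l0) * slice x l (r i)))"
      by (intro sum.cong refl) (simp add: mult.assoc[symmetric] power_add[symmetric])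
    finally show ?thesis by (simp add: r'_def sum_distrib_left)
  qed
  have l0N: "l0 < N"
  proof (rule ccontr)
    assume "\<not> l0 < N"
    then have "r i = 0" if "i \<in> S" for i using less[OF _ that] by (subst rexp[OF that]) (auto intro!: sum.neutral)
    then show False using l0 by auto
  qed
  have sP: "slice x l0 (r i) \<in> Pol (A - {x})" if "i \<in> S" for i using rP[OF that] by (rule slice_Pol)
  have Zx: "\<not> Z (mvar x)"
  proof -
    have "lift_pt (\<lambda>_. 1) x = 1" using x by (simp add: lift_pt_def)
    then show ?thesis using lift_pt_H unfolding Z_def by (metis meval_var zero_neq_one)
  qed
  have lf: "linpoly (\<lambda>y. \<Sum>i\<in>S. \<gamma> i * ev y (r' i))" by (intro linpoly_sum linpoly_mult linpoly_const linpoly_ev)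
  have rel': "(\<Sum>i\<in>S. \<gamma> i * ev y (r' i)) = 0" if "y \<in> H" for y
  proof (rule dom_cancel[OF lf not_Z_power[OF Zx, of l0] _ that])
    fix y assume y: "y \<in> H"
    have "ev y (mvar x ^ l0) * (\<Sum>i\<in>S. \<gamma> i * ev y (r' i)) = (\<Sum>i\<in>S. \<gamma> i * ev y (r i))"
      unfolding sum_distrib_left by (intro sum.cong refl) (simp add: rr' meval_mult mult_ac)
    also have "\<dots> = (\<Sum>i\<in>S. \<gamma> i * ev y (c i))" using y by (intro sum.cong refl) (simp add: evr)
    also have "\<dots> = 0" using relD[OF c(1) y] .
    finally show "ev y (mvar x ^ l0) * (\<Sum>i\<in>S. \<gamma> i * ev y (r' i)) = 0" .
  qed
  have "A'.rel \<gamma> S (\<lambda>i. slice x l0 (r i))"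
    unfolding A'.rel_def
  proof (intro conjI ballI)
    fix y assume y: "y \<in> A'.H"
    \<comment> \<open>Giving x the value 0 turns a point of the smaller hyperplane into one of
      \<open>H\<close>, and there only the lowest slice of \<open>r' i\<close> survives.\<close>
    let ?y = "y(x := 0)"
    have "(\<Sum>i\<in>A. \<alpha> i * ?y i) = (\<Sum>i\<in>A - {x}. \<alpha> i * y i)"
      using finA by (intro sum.mono_neutral_cong_right) auto
    then have "?y \<in> H" using y by (simp add: H_def A'.H_def)
    moreover have "ev ?y (r' i) = ev y (slice x l0 (r i))" if "i \<in> S" for i
    proof -
      have "ev ?y (r' i) = (\<Sum>l\<in>{l0..<N}. 0 ^ (l - l0) * ev ?y (slice x l (r i)))"
        unfolding r'_def by (simp add: meval_simps)
      also have "\<dots> = (\<Sum>l\<in>{l0..<N}. if l = l0 then ev ?y (slice x l0 (r i)) else 0)"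
        by (intro sum.cong refl) (auto simp: power_0_left)
      also have "\<dots> = ev ?y (slice x l0 (r i))" using l0N by simp
      also have "\<dots> = ev y (slice x l0 (r i))" by (rule meval_cong[OF sP[OF that]]) auto
      finally show ?thesis .
    qed
    ultimately show "(\<Sum>i\<in>S. \<gamma> i * ev y (slice x l0 (r i))) = 0" using rel'[of ?y] by simp
  qed (use sP in auto)
  moreover have "A'.red (slice x l0 (r i))" if "i \<in> S" for i
    unfolding A'.red_def
  proof (intro conjI ballI sP[OF that])
    fix m assume "m \<in> mkeys (slice x l0 (r i))"
    then have "m + sg x l0 \<in> mkeys (r i)" by (auto dest: keys_slice)
    then have "look (m + sg x l0) b0 < p" using gr(2)[OF that] by (simp add: red_def)
    then show "look m b0 < p" by (simp add: lookup_add)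
  qed
  then have "\<exists>i\<in>S. \<not> A'.Z (slice x l0 (r i))" using l0 A'.red_Z_0 by blast
  ultimately show ?thesis unfolding A'.dep_def by blast
qed

text \<open>Coordinates are removed one at a time. This is specialisation to a coordinate section:
  over its function field the rank is at most the rank over the function field of the whole
  form.\<close>

lemma (in qform) dep_restrict:
  assumes "finite S" "dep \<gamma> S" "A' \<subseteq> A" "b0 \<in> A'" "b1 \<in> A'"
  shows "qform.dep \<iota> A' \<alpha> \<gamma> S"
proof -
  have "finite D \<Longrightarrow> D \<subseteq> A - {b0, b1} \<Longrightarrow> qform.dep \<iota> (A - D) \<alpha> \<gamma> S" for D
  proof (induction D rule: finite_induct)
    case empty
    then show ?case using assms(2) by simp
  next
    case (insert x D)
    interpret D: qform \<iota> p "A - D" \<alpha> a b0 b1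
      by (rule qform_sub) (use insert.prems b0 b1 in auto)
    have "qform.dep \<iota> (A - D - {x}) \<alpha> \<gamma> S"
      using insert by (intro D.dep_restrict1 assms(1)) auto
    moreover have "A - D - {x} = A - insert x D" by auto
    ultimately show ?case by simp
  qed
  from this[of "A - A'"] have "qform.dep \<iota> (A - (A - A')) \<alpha> \<gamma> S" using assms finA by auto
  moreover have "A - (A - A') = A'" using assms by auto
  ultimately show ?thesis by simp
qed

lemma (in qform) Z_pd: assumes "q \<in> Pol A" "Z q" shows "Z (pd j q)"
proof -
  obtain g where "q = g * fm" using assms Z_iff by blast
  then show ?thesis by (auto simp: pd_mult pd_fm intro: Z_mult Z_fm)
qed

interpretation ik: rhom "ident :: 'k::field \<Rightarrow> 'k" by (rule rhom_ident)

lemma (in qform) lift_pt_id: assumes "w \<in> H" shows "lift_pt w = w"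
proof -
  have "\<alpha> b0 * w b0 + (\<Sum>i\<in>A - {b0}. \<alpha> i * w i) = 0"
    using assms finA b0(1) by (simp add: H_def sum.remove)
  then have "\<alpha> b0 * w b0 = - (\<Sum>i\<in>A - {b0}. \<alpha> i * w i)" by (simp only: eq_neg_iff_add_eq_0)
  then have "w b0 = - (\<Sum>i\<in>A - {b0}. \<alpha> i * w i) / \<alpha> b0" using b0(2) by (simp add: field_simps)
  then show ?thesis by (auto simp: lift_pt_def)
qed

lemma (in frob) rhom_mconst_hom: "rhom (\<lambda>f. mconst (\<iota> f) :: ('x, 'k) mpoly)"
  by standard (auto simp: hom_add hom_mult mc.hom_add mc.hom_mult)

text \<open>Substitute the solution of the linear equation for the variable \<open>b0\<close>. The
  result has coefficients in the perfect field, where p-th roots of polynomials can be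
  extracted.\<close>

lemma (in qform) eliminate_b0:
  assumes c: "c \<in> Pol A"
  shows "\<exists>G\<in>Pol (A - {b0}). \<forall>w. meval ident w G = ev (lift_pt w) c"
proof -
  define \<kappa> where "\<kappa> = (\<lambda>f. mconst (\<iota> f) :: ('x, 'k) mpoly)"
  interpret m: rhom \<kappa> unfolding \<kappa>_def by (rule rhom_mconst_hom)
  define L :: "'x \<Rightarrow> ('x, 'k) mpoly" where
    "L j = (if j = b0 then - (\<Sum>i\<in>A - {b0}. mconst (\<alpha> i / \<alpha> b0) * mvar i) else mvar j)" for j
  define G where "G = meval \<kappa> L c"
  have GP: "G \<in> Pol (A - {b0})" unfolding G_def using c
  proof (induction rule: Pol_induct)
    case (const c) then show ?case unfolding m.meval_const by (simp only: \<kappa>_def Pol_const)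
  next
    case (var x) then show ?case by (auto simp: L_def intro!: Pol_intros)
  qed (auto simp: m.meval_simps intro: Pol_intros)
  have LP: "meval ident w (L j) = lift_pt w j" for w j
  proof (cases "j = b0")
    case True
    have "meval ident w (L b0) = - (\<Sum>i\<in>A - {b0}. \<alpha> i / \<alpha> b0 * w i)"
      unfolding L_def by (simp only: if_True refl ik.meval_simps ik.meval_const ik.meval_var) (simp only: ident_def)
    also have "\<dots> = - (\<Sum>i\<in>A - {b0}. \<alpha> i * w i) / \<alpha> b0" by (simp add: sum_divide_distrib)
    finally show ?thesis using True by (simp add: lift_pt_def)
  next
    case False
    then show ?thesis by (simp add: L_def lift_pt_def)
  qed
  have evG: "meval ident w G = ev (lift_pt w) c" for w
    unfolding G_def using c
  proof (induction rule: Pol_induct)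
    case (const c)
    show ?case unfolding m.meval_const meval_const unfolding \<kappa>_def ik.meval_const by (simp only: ident_def)
  next
    case (var x)
    show ?case unfolding m.meval_var meval_var by (rule LP)
  next
    case (add q r)
    then show ?case by (simp only: m.meval_add ik.meval_add meval_add)
  next
    case (mult q r)
    then show ?case by (simp only: m.meval_mult ik.meval_mult meval_mult)
  qed
  show ?thesis using GP evG by blast
qed

section \<open>Genericity of a point of a linear section\<close>

text \<open>\<open>C\<close> indexes the coordinates of the section. By \<open>rank\<close>, the
  independent set \<open>S\<close> already has the rank of all coefficients, so \<open>C\<close>,
  with just one more element, has only the relation \<open>u\<close> up to a factor.\<close>

locale gsect = aform \<iota> p A \<alpha> a b0 b1
  for \<iota> :: "'f::field \<Rightarrow> 'k::field" and p :: nat and A :: "'x set" and \<alpha> :: "'x \<Rightarrow> 'k"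
    and a :: "'x \<Rightarrow> 'f" and b0 b1 :: 'x +
  fixes C S :: "'x set" and i0 :: 'x and u :: "'x \<Rightarrow> ('x, 'f) mpoly" and k :: nat
  assumes CA: "C \<subseteq> A" and bC: "b0 \<in> C" "b1 \<in> C" and CS: "C = insert i0 S" "i0 \<notin> S"
    and ind: "\<not> dep \<alpha> S" and rel_u: "rel \<alpha> C u" and hom_u: "\<And>i. i \<in> C \<Longrightarrow> homog A k (u i)"
    and lam_u: "\<exists>y\<in>H. lam C u y \<noteq> 0" and k: "\<not> p dvd k"
    and rank: "\<And>T. T \<subseteq> A \<Longrightarrow> \<not> dep \<alpha> T \<Longrightarrow> card T \<le> card S"
begin

lemma finC: "finite C" by (rule finite_subset[OF CA finA])
lemma finS: "finite S" using finC CS(1) by simp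
lemma SA: "S \<subseteq> A" and i0A: "i0 \<in> A" using CA unfolding CS(1) by simp_all

sublocale Cq: aform \<iota> p C \<alpha> a b0 b1
proof -
  interpret q: qform \<iota> p C \<alpha> a b0 b1 by (rule qform_sub[OF CA bC])
  show "aform \<iota> p C \<alpha> a b0 b1"
    by unfold_locales (use F_indep_sub[OF CA] in blast)
qed

lemma uP: "i \<in> C \<Longrightarrow> u i \<in> Pol A"
  using hom_u homog_Pol by blast

text \<open>Otherwise independence of \<open>S\<close> makes every component of \<open>u\<close>
  vanish on \<open>H\<close>, and with them their derivatives, so \<lambda> would be zero.\<close>

lemma u_i0: "\<not> Z (u i0)"
proof
  assume "Z (u i0)"
  then have "rel \<alpha> (C - {i0}) u" using rel_u finC CS by (intro rel_remove) auto
  then have "rel \<alpha> S u" using CS by simp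
  then have "Z (u i)" if "i \<in> C" for i using rel_indep[OF _ ind] that CS \<open>Z (u i0)\<close> by blast
  then have "Z (pd b0 (u i))" if "i \<in> C" for i using that uP Z_pd by blast
  then have "lam C u y = 0" if "y \<in> H" for y using that by (simp add: lam_def Z_def)
  then show False using lam_u by blast
qed

text \<open>Eliminating the component at \<open>i0\<close> leaves a relation on the independent set
  \<open>S\<close>. So the relations on \<open>C\<close> form a space of rank one.\<close>

lemma proportional:
  assumes "rel \<alpha> C v" "i \<in> C" shows "Z (u i0 * v i - v i0 * u i)"
proof -
  let ?w = "\<lambda>i. u i0 * v i - v i0 * u i"
  have "rel \<alpha> C ?w"
  proof (rule rel_diff[OF rel_mult[OF assms(1)] rel_mult[OF rel_u]])
    have "i0 \<in> C" using CS(1) by simp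
    then show "u i0 \<in> Pol A" "v i0 \<in> Pol A" using assms(1) uP by (simp_all add: rel_def)
  qed
  moreover have w0: "?w i0 = 0" by (simp add: mult.commute)
  ultimately have "rel \<alpha> (C - {i0}) ?w" using finC CS by (intro rel_remove) auto
  then have "rel \<alpha> S ?w" using CS by simp
  then show ?thesis using rel_indep[OF _ ind, of ?w i] assms(2) CS w0 by auto
qed

lemma spansC: assumes "i \<in> C" shows "spans \<alpha> S (\<alpha> i)"
proof (cases "i = i0")
  case True
  have "i0 \<in> C" using CS(1) by simp
  then have "dep \<alpha> C" unfolding dep_def using rel_u u_i0 by blast
  then show ?thesis using CS True by (intro dep_insert_spans finS ind) auto
next
  case False
  then show ?thesis using assms CS by (intro spans_self finS) auto
qed

text \<open>Multiplication by \<lambda> maps the span of \<open>S\<close> into itself by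
  \<open>lam_span\<close>, and injectively since \<lambda> is not zero. Counting dimensions makes it
  surjective, so \<alpha> c is reached.\<close>

lemma lam_surj:
  assumes c: "c \<in> C"
  shows "\<exists>x z. z \<in> Pol A \<and> \<not> Z z \<and> (\<forall>t\<in>S. x t \<in> Pol A) \<and>
    (\<forall>y\<in>H. (\<Sum>t\<in>S. ev y (x t) * (lam C u y * \<alpha> t)) + ev y z * \<alpha> c = 0)"
proof -
  obtain D g where D: "\<not> Z D" "D \<in> Pol A" and gP: "\<forall>t. \<forall>s\<in>S. g t s \<in> Pol A"
    and key: "\<forall>y\<in>H. \<forall>t\<in>A. ev y D * lam C u y * \<alpha> t = (\<Sum>s\<in>S. \<alpha> s * ev y (g t s))"
    using lam_span[OF CA rel_u finS spansC] by auto
  obtain d e where de: "d \<in> Pol A" "\<not> Z d" "\<forall>s\<in>S. e s \<in> Pol A"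
    "\<forall>y\<in>H. ev y d * \<alpha> c = (\<Sum>s\<in>S. \<alpha> s * ev y (e s))"
    using spansC[OF c] unfolding spans_def by blast
  \<comment> \<open>\<open>None\<close> stands for \<alpha> c and \<open>Some t\<close> for
    \<lambda> \<alpha> t. All of them are expressed through \<open>S\<close> over the common
    denominator \<open>d * D\<close>; they are one more than \<open>card S\<close> in
    number.\<close>
  define G where "G t s = (case t of Some t' \<Rightarrow> d * g t' s | None \<Rightarrow> D * e s)" for t s
  let ?T = "insert None (Some ` S)"
  have cT: "card S < card ?T" using finS by (simp add: card_image)
  have GP: "G t s \<in> Pol A" if "s \<in> S" for t s
    unfolding G_def using that D(2) de gP by (auto split: option.split intro: Pol_mult)
  obtain xx where xx: "\<forall>t\<in>?T. xx t \<in> Pol A" "\<exists>t\<in>?T. \<not> Z (xx t)" "\<forall>s\<in>S. Z (\<Sum>t\<in>?T. xx t * G t s)"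
    using linear_system[OF _ finS cT, of G] GP finS by auto
  have sumT: "(\<Sum>t\<in>?T. F t) = F None + (\<Sum>t\<in>S. F (Some t))" for F :: "_ \<Rightarrow> 'z::comm_monoid_add"
    using finS by (simp add: sum.reindex image_iff)
  let ?f = "\<lambda>y. (\<Sum>t\<in>S. ev y (xx (Some t)) * (lam C u y * \<alpha> t)) + ev y (xx None) * \<alpha> c"
  have lin: "linpoly ?f"
    by (intro linpoly_sum linpoly_add linpoly_mult linpoly_const linpoly_ev linpoly_lam)
  have f0: "?f y = 0" if y: "y \<in> H" for y
  proof (rule dom_cancel[OF lin _ _ y])
    show "\<not> Z (d * D)" by (rule not_Z_mult[OF de(2) D(1)])
    fix y assume y: "y \<in> H"
    have "ev y (d * D) * ?f y = (\<Sum>t\<in>S. ev y d * ev y (xx (Some t)) * (ev y D * lam C u y * \<alpha> t))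
        + ev y D * ev y (xx None) * (ev y d * \<alpha> c)"
      by (simp add: meval_mult distrib_left sum_distrib_left mult_ac)
    also have "\<dots> = (\<Sum>t\<in>S. \<Sum>s\<in>S. \<alpha> s * (ev y d * ev y (xx (Some t)) * ev y (g t s)))
        + (\<Sum>s\<in>S. \<alpha> s * (ev y D * ev y (xx None) * ev y (e s)))"
    proof -
      have "ev y d * ev y (xx (Some t)) * (ev y D * lam C u y * \<alpha> t) =
          (\<Sum>s\<in>S. \<alpha> s * (ev y d * ev y (xx (Some t)) * ev y (g t s)))" if "t \<in> S" for t
      proof -
        have "ev y D * lam C u y * \<alpha> t = (\<Sum>s\<in>S. \<alpha> s * ev y (g t s))" using key y that SA by blast
        then show ?thesis by (simp only: sum_distrib_left mult_ac)
      qed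
      moreover have "ev y d * \<alpha> c = (\<Sum>s\<in>S. \<alpha> s * ev y (e s))" using de(4) y by blast
      ultimately show ?thesis by (simp add: sum_distrib_left mult_ac)
    qed
    also have "(\<Sum>t\<in>S. \<Sum>s\<in>S. \<alpha> s * (ev y d * ev y (xx (Some t)) * ev y (g t s))) =
        (\<Sum>s\<in>S. \<Sum>t\<in>S. \<alpha> s * (ev y d * ev y (xx (Some t)) * ev y (g t s)))" by (rule sum.swap)
    also have "\<dots> + (\<Sum>s\<in>S. \<alpha> s * (ev y D * ev y (xx None) * ev y (e s))) =
        (\<Sum>s\<in>S. \<alpha> s * ev y (\<Sum>t\<in>?T. xx t * G t s))"
    proof -
      have "(\<Sum>t\<in>?T. xx t * G t s) = (\<Sum>t\<in>S. xx (Some t) * (d * g t s)) + xx None * (D * e s)" for s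
        by (simp add: sumT G_def add.commute)
      then show ?thesis
        unfolding sum.distrib[symmetric]
        by (intro sum.cong refl) (simp add: meval_simps distrib_left sum_distrib_left mult_ac)
    qed
    also have "\<dots> = 0" using xx(3) y by (simp add: Z_def)
    finally show "ev y (d * D) * ?f y = 0" .
  qed
  \<comment> \<open>Otherwise the vectors \<lambda> \<alpha> t alone would be dependent, and
    cancelling \<lambda> would give a relation on \<open>S\<close>.\<close>
  have "\<not> Z (xx None)"
  proof
    assume z: "Z (xx None)"
    let ?g = "\<lambda>y. \<Sum>t\<in>S. \<alpha> t * ev y (xx (Some t))"
    have "linpoly ?g" by (intro linpoly_sum linpoly_mult linpoly_const linpoly_ev)
    moreover have "lam C u y * ?g y = 0" if "y \<in> H" for y
      using f0[OF that] z that by (simp add: Z_def sum_distrib_left mult_ac)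
    ultimately have "\<forall>y\<in>H. ?g y = 0" using dom[OF linpoly_lam, of ?g C u] lam_u by blast
    then have "rel \<alpha> S (\<lambda>t. xx (Some t))" using xx(1) by (auto simp: rel_def)
    then have "\<forall>t\<in>S. Z (xx (Some t))" using rel_indep[OF _ ind] by blast
    then show False using xx(2) z by auto
  qed
  then show ?thesis using xx(1) f0
    by (intro exI[of _ "\<lambda>t. xx (Some t)"] exI[of _ "xx None"]) auto
qed

section \<open>Partial derivatives at the point \<open>u\<close> and descent by p-th roots\<close>

abbreviation "pt y \<equiv> (\<lambda>i. ev y (u i))"

lemma pt_H: "y \<in> H \<Longrightarrow> pt y \<in> Cq.H"
  using relD[OF rel_u] by (simp add: Cq.H_def)

text \<open>Let G_i be the value of \<open>pd i G\<close> at the point. Differentiating G(u(y)) = 0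
  along \<open>H\<close> yields a factor \<mu>, just as differentiating the relation yields
  \<lambda>. The vector \<rho> with entries \<lambda> G_i - \<mu> \<alpha> i is orthogonal to all
  derivatives of \<open>u\<close>, hence to \<open>u\<close> itself. Pairing it with suitable
  relations gives \<rho> = 0. As G is free of \<open>b0\<close>, the entry at \<open>b0\<close>
  shows \<mu> = 0; finally \<lambda> is cancelled.\<close>

lemma deriv_zero:
  assumes G: "G \<in> Pol (C - {b0})" and G0: "\<And>y. y \<in> H \<Longrightarrow> meval ident (pt y) G = 0"
    and c: "c \<in> C" and y: "y \<in> H"
  shows "meval ident (pt y) (pd c G) = 0"
proof -
  have GC: "G \<in> Pol C" by (rule Pol_mono[OF _ G]) blast
  let ?g = "\<lambda>i y. meval ident (pt y) (pd i G)"
  define \<mu> where "\<mu> y = (\<Sum>i\<in>C. ev y (pd b0 (u i)) * ?g i y) / \<alpha> b0" for y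
  have D: "(\<Sum>i\<in>C. ev y (pd j (u i)) * ?g i y) = \<mu> y * \<alpha> j" if y: "y \<in> H" and j: "j \<in> A" for y j
    unfolding \<mu>_def
  proof (rule annihilator[OF _ j])
    fix h assume h: "h \<in> H"
    let ?E = "\<lambda>i. meval (\<lambda>c. [:\<iota> c:]) (\<lambda>x. [:y x, h x:]) (u i)"
    define P where "P = meval (\<lambda>c. [:ident c:]) ?E G"
    have "poly P t = 0" for t
      using G0[OF H_line[OF y h, of t]] unfolding P_def ik.poly_meval poly_meval by simp
    then have "P = 0" using infinite_diff_nonroot[OF infK] by metis
    then have "coeff P 1 = 0" by simp
    moreover have "coeff P 1 = (\<Sum>i\<in>C. coeff (?E i) 1 * ?g i y)"
      unfolding P_def ik.coeff_meval_1[OF finC GC] coeff_meval_0 by (simp only: coeff_pCons_0)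
    moreover have "\<dots> = (\<Sum>i\<in>C. (\<Sum>j\<in>A. h j * ev y (pd j (u i))) * ?g i y)"
      by (intro sum.cong refl) (simp only: coeff_line[OF uP])
    moreover have "\<dots> = (\<Sum>i\<in>C. \<Sum>j\<in>A. h j * (ev y (pd j (u i)) * ?g i y))"
      by (simp add: sum_distrib_left sum_distrib_right mult_ac)
    moreover have "\<dots> = (\<Sum>j\<in>A. \<Sum>i\<in>C. h j * (ev y (pd j (u i)) * ?g i y))" by (rule sum.swap)
    ultimately show "(\<Sum>j\<in>A. h j * (\<Sum>i\<in>C. ev y (pd j (u i)) * ?g i y)) = 0"
      by (simp add: sum_distrib_left)
  qed
  define \<rho> where "\<rho> i y = lam C u y * ?g i y - \<mu> y * \<alpha> i" for i y
  have \<rho>M: "(\<Sum>i\<in>C. \<rho> i y * ev y (pd j (u i))) = 0" if "y \<in> H" "j \<in> A" for y j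
  proof -
    have "(\<Sum>i\<in>C. \<rho> i y * ev y (pd j (u i))) =
        lam C u y * (\<Sum>i\<in>C. ev y (pd j (u i)) * ?g i y) - \<mu> y * (\<Sum>i\<in>C. \<alpha> i * ev y (pd j (u i)))"
    proof -
      have "\<rho> i y * ev y (pd j (u i)) = lam C u y * (ev y (pd j (u i)) * ?g i y) - \<mu> y * (\<alpha> i * ev y (pd j (u i)))" for i
        unfolding \<rho>_def by (simp add: algebra_simps)
      then show ?thesis by (simp only: sum_subtractf sum_distrib_left)
    qed
    then show ?thesis unfolding D[OF that] lam_eq[OF rel_u that] by simp
  qed
  \<comment> \<open>By Euler's identity \<open>u\<close> times its degree k is a combination of its
    derivatives, and k is invertible.\<close>
  have \<rho>u: "(\<Sum>i\<in>C. \<rho> i y * ev y (u i)) = 0" if "y \<in> H" for y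
  proof -
    have "of_nat k * ev y (u i) = (\<Sum>j\<in>A. y j * ev y (pd j (u i)))" if "i \<in> C" for i
      using arg_cong[OF euler[OF hom_u[OF that]], of "ev y"] by (simp add: meval_simps hom_of_nat)
    then have "of_nat k * (\<Sum>i\<in>C. \<rho> i y * ev y (u i)) = (\<Sum>i\<in>C. \<Sum>j\<in>A. y j * (\<rho> i y * ev y (pd j (u i))))"
      by (simp add: sum_distrib_left mult.left_commute[of "of_nat k"]) (simp add: sum_distrib_left mult_ac)
    also have "\<dots> = (\<Sum>j\<in>A. \<Sum>i\<in>C. y j * (\<rho> i y * ev y (pd j (u i))))" by (rule sum.swap)
    also have "\<dots> = (\<Sum>j\<in>A. y j * (\<Sum>i\<in>C. \<rho> i y * ev y (pd j (u i))))" by (simp add: sum_distrib_left)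
    also have "\<dots> = 0" using \<rho>M[OF that] by simp
    finally show ?thesis using k by (simp add: of_nat_K_0)
  qed
  have lin_g: "linpoly (?g i)" for i by (rule linpoly_meval[OF rhom_ident linpoly_ev])
  have lin_\<mu>: "linpoly \<mu>"
  proof -
    have "linpoly (\<lambda>y. inverse (\<alpha> b0) * (\<Sum>i\<in>C. ev y (pd b0 (u i)) * ?g i y))"
      by (intro linpoly_mult linpoly_sum linpoly_const linpoly_ev lin_g)
    then show ?thesis by (simp add: \<mu>_def[abs_def] field_simps)
  qed
  have lin_\<rho>: "linpoly (\<rho> i)" for i
  proof -
    have "linpoly (\<lambda>y. lam C u y * ?g i y + \<mu> y * (- \<alpha> i))"
      by (intro linpoly_add linpoly_mult linpoly_const linpoly_lam lin_g lin_\<mu>)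
    then show ?thesis by (simp add: \<rho>_def[abs_def])
  qed
  have \<rho>0: "\<rho> c y = 0" if c: "c \<in> C" and y: "y \<in> H" for c y
  proof -
    obtain x z where "z \<in> Pol A \<and> \<not> Z z \<and> (\<forall>t\<in>S. x t \<in> Pol A) \<and>
      (\<forall>y\<in>H. (\<Sum>t\<in>S. ev y (x t) * (lam C u y * \<alpha> t)) + ev y z * \<alpha> c = 0)"
      using lam_surj[OF c] by (elim exE)
    then have xz: "z \<in> Pol A" "\<not> Z z" "\<And>t. t \<in> S \<Longrightarrow> x t \<in> Pol A"
      "\<And>y. y \<in> H \<Longrightarrow> (\<Sum>t\<in>S. ev y (x t) * (lam C u y * \<alpha> t)) + ev y z * \<alpha> c = 0"
      by simp_all
    \<comment> \<open>A combination of derivatives of \<open>u\<close> and of the unit vector at c.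
      By \<open>lam_surj\<close> it is a relation, hence proportional to \<open>u\<close> and
      orthogonal to \<rho>. Since \<rho> is orthogonal to the derivatives as well, z times its entry
      at c is zero.\<close>
    define v where "v i = (\<Sum>t\<in>S. x t * pd t (u i)) + (if i = c then z else 0)" for i
    have sv: "(\<Sum>i\<in>C. f i * ev y (v i)) = (\<Sum>t\<in>S. ev y (x t) * (\<Sum>i\<in>C. f i * ev y (pd t (u i)))) + f c * ev y z" for f y
    proof -
      have "(\<Sum>i\<in>C. f i * ev y (v i)) = (\<Sum>i\<in>C. \<Sum>t\<in>S. ev y (x t) * (f i * ev y (pd t (u i)))) + (\<Sum>i\<in>C. if i = c then f c * ev y z else 0)"
        unfolding sum.distrib[symmetric] v_def
        by (intro sum.cong refl) (auto simp: meval_simps distrib_left sum_distrib_left mult_ac)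
      also have "(\<Sum>i\<in>C. \<Sum>t\<in>S. ev y (x t) * (f i * ev y (pd t (u i)))) = (\<Sum>t\<in>S. \<Sum>i\<in>C. ev y (x t) * (f i * ev y (pd t (u i))))"
        by (rule sum.swap)
      finally show ?thesis using finC c by (simp add: sum_distrib_left)
    qed
    have "rel \<alpha> C v" unfolding rel_def
    proof (intro conjI ballI)
      show "v i \<in> Pol A" if "i \<in> C" for i
        unfolding v_def using that xz uP by (intro Pol_add Pol_sum Pol_mult pd_Pol) auto
      fix y assume y: "y \<in> H"
      have "(\<Sum>t\<in>S. ev y (x t) * (\<Sum>i\<in>C. \<alpha> i * ev y (pd t (u i)))) = (\<Sum>t\<in>S. ev y (x t) * (lam C u y * \<alpha> t))"
        using SA by (intro sum.cong refl) (simp add: lam_eq[OF rel_u y] subset_iff)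
      then show "(\<Sum>i\<in>C. \<alpha> i * ev y (v i)) = 0" unfolding sv using xz(4)[OF y] by (simp add: mult.commute)
    qed
    then have prp: "ev y (u i0) * ev y (v i) = ev y (v i0) * ev y (u i)" if "i \<in> C" "y \<in> H" for i y
      using proportional[OF _ that(1)] that(2) by (simp add: Z_def meval_simps)
    show ?thesis
    proof (rule dom_cancel[OF lin_\<rho> not_Z_mult[OF u_i0 xz(2)] _ y])
      fix y assume y: "y \<in> H"
      have "(\<Sum>t\<in>S. ev y (x t) * (\<Sum>i\<in>C. \<rho> i y * ev y (pd t (u i)))) = 0"
        using \<rho>M[OF y] SA by (intro sum.neutral) (auto simp: subset_iff)
      then have "ev y (u i0 * z) * \<rho> c y = ev y (u i0) * (\<Sum>i\<in>C. \<rho> i y * ev y (v i))"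
        unfolding sv by (simp add: meval_mult mult_ac)
      also have "\<dots> = (\<Sum>i\<in>C. \<rho> i y * (ev y (u i0) * ev y (v i)))" by (simp add: sum_distrib_left mult_ac)
      also have "\<dots> = ev y (v i0) * (\<Sum>i\<in>C. \<rho> i y * ev y (u i))"
        using prp[OF _ y] by (simp add: sum_distrib_left mult_ac)
      finally show "ev y (u i0 * z) * \<rho> c y = 0" using \<rho>u[OF y] by simp
    qed
  qed
  have pdb0: "pd b0 G = 0"
  proof (rule poly_mapping_eqI)
    fix n :: "'x \<Rightarrow>\<^sub>0 nat"
    have "b0 \<in> mkeys (n + sg b0 1)" unfolding keys_add_nat by simp
    then have "n + sg b0 1 \<notin> mkeys G" using G unfolding Pol_def by blast
    then show "look (pd b0 G) n = look 0 n" by (simp add: lookup_pd in_keys_iff)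
  qed
  have "\<mu> y = 0" if "y \<in> H" for y
    using \<rho>0[OF bC(1) that] b0(2) by (simp add: \<rho>_def pdb0)
  then have "lam C u y * ?g c y = 0" if "y \<in> H" for y
    using \<rho>0[OF c that] that by (simp add: \<rho>_def)
  then have "\<forall>y\<in>H. ?g c y = 0" using dom[OF linpoly_lam lin_g, of C u c] lam_u by blast
  then show ?thesis using y by blast
qed

text \<open>Descent on the degree. The derivatives of G vanish at the point and have smaller degree,
  so they are zero. All exponents of G are then multiples of p and, \<open>'k\<close> being perfect,
  G is the p-th power of a polynomial of smaller degree that still vanishes at the point.\<close>

lemma generic_K:
  assumes "G \<in> Pol (C - {b0})" "\<And>y. y \<in> H \<Longrightarrow> meval ident (pt y) G = (0::'k)" "\<And>m. m \<in> mkeys G \<Longrightarrow> wt C m \<le> n"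
  shows "G = 0"
  using assms
proof (induction n arbitrary: G rule: less_induct)
  case (less n G)
  have kC: "mkeys m \<subseteq> C - {b0}" if "m \<in> mkeys G" for m
    using that less.prems(1) unfolding Pol_def by blast
  show ?case
  proof (cases "n = 0")
    case True
    have "m = 0" if "m \<in> mkeys G" for m
    proof (rule poly_mapping_eqI)
      fix x show "look m x = look 0 x"
        using less.prems(3)[OF that] True finC kC[OF that] by (cases "x \<in> C") (auto simp: wt_def in_keys_iff)
    qed
    then have G: "G = mconst (look G 0)"
      by (intro poly_mapping_eqI) (metis in_keys_iff lookup_single_eq lookup_single_not_eq mconst_def)
    have "meval ident (pt (\<lambda>_. 0)) (mconst (look G 0)) = 0"
      using less.prems(2)[OF zero_H] unfolding G[symmetric] .
    then have "look G 0 = 0" by (simp add: ident_def)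
    then show ?thesis using G by (simp add: mconst_def)
  next
    case False
    have pd0: "pd c G = 0" if c: "c \<in> C" for c
    proof (rule less.IH[of "n - 1"])
      show "n - 1 < n" using False by simp
      show "pd c G \<in> Pol (C - {b0})" using less.prems(1) by (rule pd_Pol)
      show "meval ident (pt y) (pd c G) = 0" if "y \<in> H" for y
        using deriv_zero[OF less.prems(1,2) c that] by blast
      fix m assume "m \<in> mkeys (pd c G)"
      then have "wt C (m + sg c 1) \<le> n" by (rule less.prems(3)[OF keys_pd])
      moreover have "wt C (sg c 1) = 1" using c finC by (simp add: wt_def lookup_single when_def)
      ultimately show "wt C m \<le> n - 1" by (simp add: wt_add)
    qed
    have pdvd: "p dvd look m x" if m: "m \<in> mkeys G" for m x
    proof (cases "x \<in> C \<and> look m x \<noteq> 0")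
      case True
      then have e: "m - sg x 1 + sg x 1 = m" by (intro single_add_minus) auto
      have l: "look (m - sg x 1) x + 1 = look m x" using True by (simp add: lookup_minus)
      have "look (pd x G) (m - sg x 1) = of_nat (look m x) * look G m"
        unfolding lookup_pd e l ..
      then have "(of_nat (look m x) :: 'k) = 0 \<or> look G m = 0" using pd0[of x] True by simp
      moreover have "look G m \<noteq> 0" by (rule m[unfolded in_keys_iff])
      ultimately show ?thesis by (simp only: of_nat_K_0) blast
    next
      case False
      then have "look m x = 0" using kC[OF m] by (auto simp: in_keys_iff)
      then show ?thesis by simp
    qed
    obtain rt :: "'k \<Rightarrow> 'k" where rt: "\<And>x. rt x ^ p = x" using perfect by metis
    define dv where "dv m = Poly_Mapping.map (\<lambda>n. n div p) m" for m :: "'x \<Rightarrow>\<^sub>0 nat"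
    have ldv: "look (dv m) x = look m x div p" for m x by (simp add: dv_def map.rep_eq when_def)
    have kdv: "mkeys (dv m) \<subseteq> mkeys m" for m
    proof
      fix x assume "x \<in> mkeys (dv m)"
      then have "look m x div p \<noteq> 0" unfolding in_keys_iff ldv .
      then have "look m x \<noteq> 0" by (cases "look m x = 0") auto
      then show "x \<in> mkeys m" by (simp only: in_keys_iff not_False_eq_True)
    qed
    define G' where "G' = (\<Sum>m\<in>mkeys G. sg (dv m) (rt (look G m)))"
    have mev_dv: "mev y (dv m) ^ p = mev y m" if "m \<in> mkeys G" for y :: "'x \<Rightarrow> 'k" and m
    proof -
      have "mev y (dv m) ^ p = (\<Prod>x\<in>mkeys m. (y x ^ look (dv m) x) ^ p)"
        by (simp only: mev_superset[OF finite_keys kdv] prod_power_distrib)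
      also have "\<dots> = mev y m" unfolding mev_def
        by (intro prod.cong refl) (simp add: power_mult[symmetric] ldv dvd_div_mult_self[OF pdvd[OF that]])
      finally show ?thesis .
    qed
    have ev': "meval ident y G' ^ p = meval ident y G" for y
      unfolding G'_def ik.meval_sum frob_sum ik.meval_single power_mult_distrib
      by (simp add: ident_def rt mev_dv meval_def)
    have "G' = 0"
    proof (rule less.IH[of "n div p"])
      show "n div p < n" using False p_gt_1 by simp
      show "G' \<in> Pol (C - {b0})" unfolding G'_def
      proof (intro Pol_sum Pol_single)
        fix m assume "m \<in> mkeys G" then show "mkeys (dv m) \<subseteq> C - {b0}" using kdv[of m] kC[of m] by blast
      qed
      show "meval ident (pt y) G' = 0" if "y \<in> H" for y
        using ev'[of "pt y"] less.prems(2)[OF that] p_gt_0 by (metis power_eq_0_iff)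
      fix m assume "m \<in> mkeys G'"
      then have "m \<in> (\<Union>m\<in>mkeys G. mkeys (sg (dv m) (rt (look G m))))"
        unfolding G'_def by (rule subsetD[OF Poly_Mapping.keys_sum])
      then obtain m' where m': "m' \<in> mkeys G" "m \<in> mkeys (sg (dv m') (rt (look G m')))" by (rule UN_E)
      then have mm: "m = dv m'" by (auto split: if_splits)
      have "p * wt C m = wt C m'" unfolding wt_def mm sum_distrib_left ldv
        by (intro sum.cong refl dvd_mult_div_cancel pdvd m')
      then show "wt C m \<le> n div p" using less.prems(3)[OF m'(1)] p_gt_0
        by (metis div_le_mono nonzero_mult_div_cancel_left not_gr0)
    qed
    then have "meval ident y G = 0" for y using ev'[of y] p_gt_0 by (simp add: power_0_left)
    then show ?thesis using finC by (intro mpoly_eq_0I[OF infK _ less.prems(1)]) auto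
  qed
qed

text \<open>The relation \<open>u\<close> is a generic point of the linear section.\<close>
lemma generic:
  assumes c: "c \<in> Pol C" and z: "Z (msubst u c)" shows "Cq.Z c"
proof -
  obtain G where GP: "G \<in> Pol (C - {b0})" and evG: "\<And>w. meval ident w G = ev (Cq.lift_pt w) c"
    using Cq.eliminate_b0[OF c] by blast
  obtain n where n: "\<forall>m\<in>mkeys G. wt C m < n" using wcomp_bound[of G C] by blast
  have "G = 0"
  proof (rule generic_K[OF GP])
    fix y assume y: "y \<in> H"
    have "meval ident (pt y) G = ev (pt y) c" unfolding evG Cq.lift_pt_id[OF pt_H[OF y]] ..
    also have "\<dots> = 0" using z y by (simp add: Z_def meval_subst)
    finally show "meval ident (pt y) G = 0" .
  next
    show "wt C m \<le> n" if "m \<in> mkeys G" for m using n that by auto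
  qed
  then have "ev (Cq.lift_pt w) c = 0" for w using evG[of w] by (simp only: ik.meval_0)
  then show ?thesis unfolding Cq.Z_def using Cq.lift_pt_id by metis
qed

text \<open>Substituting the point \<open>u\<close> turns a relation over the function field of the
  section into one over that of the whole form, and by \<open>generic\<close> no non-zero
  coefficient is lost.\<close>

lemma Cq_ind: "\<not> Cq.dep \<alpha> S"
proof
  assume "Cq.dep \<alpha> S"
  then obtain c i where c: "Cq.rel \<alpha> S c" "i \<in> S" "\<not> Cq.Z (c i)" by (auto simp: Cq.dep_def)
  have "rel \<alpha> S (\<lambda>i. msubst u (c i))" unfolding rel_def
  proof (intro conjI ballI)
    show "msubst u (c i) \<in> Pol A" if "i \<in> S" for i
      using c(1) that by (intro msubst_Pol[of _ C] uP) (auto simp: Cq.rel_def)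
    show "(\<Sum>i\<in>S. \<alpha> i * ev y (msubst u (c i))) = 0" if "y \<in> H" for y
      using Cq.relD[OF c(1) pt_H[OF that]] by (simp add: meval_subst)
  qed
  then have "Z (msubst u (c i))" using rel_indep[OF _ ind] c(2) by blast
  then have "Cq.Z (c i)" using c by (intro generic) (auto simp: Cq.rel_def)
  then show False using c(3) by blast
qed

text \<open>By \<open>rank\<close> each further coefficient depends on \<open>S\<close> over the
  whole function field, hence over that of the section by \<open>dep_restrict\<close>; by
  \<open>Cq_ind\<close> its own coefficient there is non-zero. These relations invert the map
  \<open>u\<close>, so they are given one common denominator and one degree.\<close>

lemma section_spans:
  "\<exists>h b d. homog C d h \<and> \<not> Cq.Z h \<and> (\<forall>j\<in>A - C. \<forall>s\<in>S. homog C d (b j s)) \<and>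
    (\<forall>j\<in>A - C. \<forall>w\<in>Cq.H. ev w h * \<alpha> j + (\<Sum>s\<in>S. \<alpha> s * ev w (b j s)) = 0)"
proof -
  define Q where "Q j c k \<longleftrightarrow> Cq.rel \<alpha> (insert j S) c \<and> (\<forall>i\<in>insert j S. homog C k (c i)) \<and> \<not> Cq.Z (c j)" for j c k
  have "\<exists>c k. Q j c k" if j: "j \<in> A - C" for j
  proof -
    have jS: "j \<notin> S" using j CS by auto
    have "dep \<alpha> (insert j S)"
      using rank[of "insert j S"] SA j jS finS by (metis DiffD1 card_insert_disjoint insert_subset lessI not_le)
    then have "Cq.dep \<alpha> (insert j S)" by (intro dep_restrict[OF _ _ CA bC]) (simp_all only: finS finite_insert)
    then obtain c k where c: "Cq.rel \<alpha> (insert j S) c" "\<And>i. i \<in> insert j S \<Longrightarrow> homog C k (c i)" "\<exists>i\<in>insert j S. \<not> Cq.Z (c i)"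
      using Cq.dep_homog[of \<alpha> "insert j S"] finS by auto
    have "\<not> Cq.Z (c j)"
    proof
      assume z: "Cq.Z (c j)"
      then have "Cq.rel \<alpha> (insert j S - {j}) c" using c(1) finS by (intro Cq.rel_remove) auto
      then have "Cq.rel \<alpha> S c" using jS by simp
      then show False using c(3) z Cq.rel_indep[OF _ Cq_ind] by blast
    qed
    then show ?thesis using c unfolding Q_def by blast
  qed
  then obtain c where "\<And>j. j \<in> A - C \<Longrightarrow> \<exists>k. Q j (c j) k" by metis
  then obtain kk where Q: "\<And>j. j \<in> A - C \<Longrightarrow> Q j (c j) (kk j)" by metis
  define h where "h = (\<Prod>j\<in>A - C. c j j)"
  define E where "E j = (\<Prod>i\<in>A - C - {j}. c i i)" for j
  define d where "d = (\<Sum>j\<in>A - C. kk j)"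
  have fin: "finite (A - C)" using finA by simp
  have hE: "h = c j j * E j" if "j \<in> A - C" for j
    unfolding h_def E_def using that fin by (simp add: prod.remove)
  show ?thesis
  proof (intro exI[of _ h] exI[of _ "\<lambda>j s. E j * c j s"] exI[of _ d] conjI ballI)
    show "homog C d h" unfolding h_def d_def using Q by (intro homog_prod) (auto simp: Q_def)
    show "\<not> Cq.Z h" unfolding h_def using Q by (intro Cq.not_Z_prod) (auto simp: Q_def)
    show "homog C d (E j * c j s)" if j: "j \<in> A - C" and s: "s \<in> S" for j s
    proof -
      have "homog C (\<Sum>i\<in>A - C - {j}. kk i) (E j)"
        unfolding E_def using Q by (intro homog_prod) (auto simp: Q_def)
      moreover have "homog C (kk j) (c j s)" using Q[OF j] s by (auto simp: Q_def)
      ultimately have "homog C ((\<Sum>i\<in>A - C - {j}. kk i) + kk j) (E j * c j s)" by (rule homog_mult)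
      moreover have "(\<Sum>i\<in>A - C - {j}. kk i) + kk j = d"
        unfolding d_def using j fin by (simp add: sum.remove)
      ultimately show ?thesis by simp
    qed
    fix j w assume j: "j \<in> A - C" and w: "w \<in> Cq.H"
    have jS: "j \<notin> S" using j CS by auto
    have "Cq.rel \<alpha> (insert j S) (c j)" using Q[OF j] by (simp add: Q_def)
    from Cq.relD[OF this w] have "\<alpha> j * ev w (c j j) + (\<Sum>s\<in>S. \<alpha> s * ev w (c j s)) = 0"
      using jS finS by simp
    then have "ev w (E j) * (\<alpha> j * ev w (c j j) + (\<Sum>s\<in>S. \<alpha> s * ev w (c j s))) = 0" by simp
    then show "ev w h * \<alpha> j + (\<Sum>s\<in>S. \<alpha> s * ev w (E j * c j s)) = 0"
      by (simp add: hE[OF j] meval_mult distrib_left sum_distrib_left mult_ac)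
  qed
qed

end

section \<open>The birational maps in coordinates\<close>

definition hom_el :: "'x set set \<Rightarrow> ('x, 'f::field) mpoly \<Rightarrow> bool" where
  "hom_el Bs q \<longleftrightarrow> (\<exists>e. q \<in> mhomog Bs e)"

lemma hom_elI: "q \<in> mhomog Bs e \<Longrightarrow> hom_el Bs q" by (auto simp: hom_el_def)
lemma hom_el_mult: "hom_el Bs q \<Longrightarrow> hom_el Bs r \<Longrightarrow> hom_el Bs (q * r)"
  unfolding hom_el_def using mhomog_mult by blast
lemma hom_el_power: "hom_el Bs q \<Longrightarrow> hom_el Bs (q ^ n)"
  unfolding hom_el_def using mhomog_power by blast
lemma hom_el_1: "hom_el Bs 1" by (rule hom_elI[OF mhomog_1])
lemma hom_el_Pol: "hom_el Bs q \<Longrightarrow> q \<in> Pol (\<Union>Bs)"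
  unfolding hom_el_def using mhomog_Pol by blast

lemma (in rhom) homog_scale:
  assumes "finite A" "homog A k q" shows "meval \<iota> (\<lambda>i. t * y i) q = t ^ k * meval \<iota> y q"
proof -
  have q: "wcomp A k q = q"
    using assms(2) by (intro poly_mapping_eqI) (auto simp: lookup_wcomp homog_def in_keys_iff)
  have "meval \<iota> (\<lambda>i. t * y i) q = meval \<iota> (\<lambda>x. if x \<in> A then t * y x else y x) q"
    using homog_Pol[OF assms(2)] by (rule meval_cong) simp
  then show ?thesis using meval_scale_wcomp[OF assms(1), of t y k q] unfolding q by simp
qed

context gsect
begin

definition "AP = Inl ` C \<union> Inr ` {..card (A - C)}"
text \<open>The second block consists of free homogeneous coordinates. Zero coefficients there keep
  the equation of the section while making the facts of \<open>qform\<close> available for the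
  product.\<close>

definition "\<alpha>P = case_sum \<alpha> (\<lambda>_::nat. 0)"

lemma AP_Union: "AP = \<Union>{Inl ` C, Inr ` {..card (A - C)}}" by (auto simp: AP_def)

sublocale Pq: qform \<iota> p AP \<alpha>P "case_sum a (\<lambda>_. 0)" "Inl b0" "Inl b1"
proof
  show "finite AP" using finC by (simp add: AP_def)
  show "\<alpha>P i ^ p = \<iota> (case i of Inl x \<Rightarrow> a x | Inr _ \<Rightarrow> 0)" if "i \<in> AP" for i
    using that CA p_gt_0 by (auto simp: AP_def \<alpha>P_def \<alpha>_p subset_iff power_0_left split: sum.split)
qed (use bC b0 b1 in \<open>auto simp: AP_def \<alpha>P_def\<close>)

lemma Pq_H: "w \<in> Pq.H \<longleftrightarrow> (\<lambda>i. w (Inl i)) \<in> Cq.H"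
proof -
  have "(\<Sum>i\<in>AP. \<alpha>P i * w i) = (\<Sum>i\<in>Inl ` C. \<alpha>P i * w i)"
    using finC by (intro sum.mono_neutral_right) (auto simp: AP_def \<alpha>P_def)
  also have "\<dots> = (\<Sum>i\<in>C. \<alpha> i * w (Inl i))" by (simp add: sum.reindex \<alpha>P_def)
  finally show ?thesis by (simp add: Pq.H_def Cq.H_def)
qed

abbreviation "inl q \<equiv> msubst (\<lambda>i. mvar (Inl i)) q"

lemma ev_inl: "ev w (inl q) = ev (\<lambda>i. w (Inl i)) q"
  by (simp add: meval_subst)

lemma not_Z_inl: assumes "\<not> Cq.Z q" shows "\<not> Pq.Z (inl q)"
proof -
  obtain \<omega> where "\<omega> \<in> Cq.H" "ev \<omega> q \<noteq> 0" using assms by (auto simp: Cq.Z_def)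
  then show ?thesis unfolding Pq.Z_def
    by (auto simp: ev_inl Pq_H intro!: bexI[of _ "case_sum \<omega> (\<lambda>_. 0)"])
qed

text \<open>Restricted to the first block of coordinates, a dependence becomes one over the function
  field of the section, where \<open>S\<close> is independent.\<close>

lemma Pq_ind: "\<not> Pq.dep \<alpha> S"
proof
  assume d: "Pq.dep \<alpha> S"
  interpret R: qform \<iota> p "Inl ` C" \<alpha>P "case_sum a (\<lambda>_. 0)" "Inl b0" "Inl b1"
    by (rule Pq.qform_sub) (use bC in \<open>auto simp: AP_def\<close>)
  have RH: "w \<in> R.H \<longleftrightarrow> (\<lambda>i. w (Inl i)) \<in> Cq.H" for w
  proof -
    have "(\<Sum>i\<in>Inl ` C. \<alpha>P i * w i) = (\<Sum>i\<in>C. \<alpha> i * w (Inl i))"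
      by (simp add: sum.reindex \<alpha>P_def)
    then show ?thesis by (simp only: R.H_def Cq.H_def mem_Collect_eq)
  qed
  have "R.dep \<alpha> S"
    by (rule Pq.dep_restrict[OF finS d]) (use bC in \<open>auto simp: AP_def\<close>)
  then obtain c i where c: "R.rel \<alpha> S c" "i \<in> S" "\<not> R.Z (c i)" by (auto simp: R.dep_def)
  define c' where "c' i = msubst (case_sum mvar (\<lambda>_. 0)) (c i)" for i
  have ev_c': "ev \<omega> (c' i) = ev (case_sum \<omega> (\<lambda>_. 0)) (c i)" for \<omega> i
  proof -
    have "(\<lambda>x. ev \<omega> (case_sum mvar (\<lambda>_. 0) x)) = (case_sum \<omega> (\<lambda>_. 0) :: 'x + nat \<Rightarrow> 'k)"
      by (rule ext) (auto split: sum.split)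
    then show ?thesis unfolding c'_def meval_subst by (simp only:)
  qed
  have "Cq.rel \<alpha> S c'" unfolding Cq.rel_def
  proof (intro conjI ballI)
    show "c' i \<in> Pol C" if "i \<in> S" for i
      unfolding c'_def using c(1) that by (intro msubst_Pol[of _ "Inl ` C"]) (auto simp: R.rel_def)
    show "(\<Sum>i\<in>S. \<alpha> i * ev y (c' i)) = 0" if "y \<in> Cq.H" for y
      unfolding ev_c' by (rule R.relD[OF c(1)]) (simp add: RH that)
  qed
  moreover have "\<not> Cq.Z (c' i)"
  proof -
    obtain w where w: "w \<in> R.H" "ev w (c i) \<noteq> 0" using c(3) by (auto simp: R.Z_def)
    have "ev (\<lambda>i. w (Inl i)) (c' i) = ev w (c i)" unfolding ev_c'
      using c(1,2) by (intro meval_cong[of _ "Inl ` C"]) (auto simp: R.rel_def)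
    moreover have "(\<lambda>i. w (Inl i)) \<in> Cq.H" using w(1) unfolding RH .
    ultimately show ?thesis using w(2) unfolding Cq.Z_def by metis
  qed
  ultimately show False using Cq_ind c(2) unfolding Cq.dep_def by blast
qed

text \<open>Write w and t for the two blocks. \<tau> scales the point w of the section by t 0 and
  adds, with factors t (n + 1), the vectors of \<open>H\<close> provided by
  \<open>section_spans\<close>; \<sigma> has w = u(y). One composite is scalar because relations on
  \<open>C\<close> are proportional to \<open>u\<close>, the other because relations on
  \<open>S\<close> vanish.\<close>

theorem birational_maps:
  defines "Bs' \<equiv> {Inl ` C, Inr ` {..card (A - C)}}"
  shows "\<exists>\<sigma> \<tau> d d' a b a' b'.
    (\<forall>i\<in>A. \<tau> i \<in> mhomog Bs' d) \<and> (\<forall>B\<in>Bs'. \<forall>x\<in>B. \<sigma> x \<in> mhomog {A} (d' B)) \<and>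
    (\<forall>y\<in>H. (\<lambda>x. ev y (\<sigma> x)) \<in> Pq.H) \<and> (\<forall>w\<in>Pq.H. (\<lambda>i. ev w (\<tau> i)) \<in> H) \<and>
    hom_el {A} a \<and> hom_el {A} b \<and> \<not> Z a \<and> \<not> Z b \<and>
    (\<forall>i\<in>A. Z (a * msubst \<sigma> (\<tau> i) - b * mvar i)) \<and>
    (\<forall>B\<in>Bs'. hom_el Bs' (a' B) \<and> hom_el Bs' (b' B) \<and> \<not> Pq.Z (a' B) \<and> \<not> Pq.Z (b' B) \<and>
       (\<forall>x\<in>B. Pq.Z (a' B * msubst \<tau> (\<sigma> x) - b' B * mvar x)))"
proof -
  obtain h b d where hbd: "homog C d h \<and> \<not> Cq.Z h \<and> (\<forall>j\<in>A - C. \<forall>s\<in>S. homog C d (b j s)) \<and>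
    (\<forall>j\<in>A - C. \<forall>w\<in>Cq.H. ev w h * \<alpha> j + (\<Sum>s\<in>S. \<alpha> s * ev w (b j s)) = 0)"
    using section_spans by (elim exE)
  then have h: "homog C d h" "\<not> Cq.Z h" by simp_all
  have b: "homog C d (b j s)" if "j \<in> A - C" "s \<in> S" for j s
    using hbd that by blast
  have hb: "ev w h * \<alpha> j + (\<Sum>s\<in>S. \<alpha> s * ev w (b j s)) = 0" if "j \<in> A - C" "w \<in> Cq.H" for j w
    using hbd that by blast
  define r where "r = card (A - C)"
  obtain jj where jj: "bij_betw jj {..<r} (A - C)"
    using ex_bij_betw_nat_finite[of "A - C"] finA unfolding r_def atLeast0LessThan by auto
  define idx where "idx = the_inv_into {..<r} jj"
  have idx: "jj (idx j) = j" "idx j < r" if "j \<in> A - C" for j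
    using that jj unfolding idx_def bij_betw_def
    by (auto intro: f_the_inv_into_f dest: the_inv_into_into[where B = "{..<r}"])
  have jjA: "jj n \<in> A - C" "idx (jj n) = n" if "n < r" for n
    using that jj unfolding idx_def bij_betw_def by (auto intro: the_inv_into_f_f)
  \<comment> \<open>The factor \<open>b0\<close> gives \<open>h1\<close> the degree of h times a
    coordinate, so that all entries of \<tau> have the same bidegree.\<close>
  define h1 where "h1 = mvar b0 * h"
  define b1' where "b1' j s = mvar b0 * b j s" for j s
  have h1: "homog C (Suc d) h1" "\<not> Cq.Z h1"
    unfolding h1_def using homog_mult[OF homog_var[OF finC bC(1)] h(1)] Cq.not_Z_mult[OF Cq.not_Z_b0 h(2)] by simp_all
  have b1: "homog C (Suc d) (b1' j s)" if "j \<in> A - C" "s \<in> S" for j s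
    unfolding b1'_def using homog_mult[OF homog_var[OF finC bC(1)] b[OF that]] by simp
  have hb1: "ev w h1 * \<alpha> j + (\<Sum>s\<in>S. \<alpha> s * ev w (b1' j s)) = 0" if "j \<in> A - C" "w \<in> Cq.H" for j w
  proof -
    have "ev w h1 * \<alpha> j + (\<Sum>s\<in>S. \<alpha> s * ev w (b1' j s)) = w b0 * (ev w h * \<alpha> j + (\<Sum>s\<in>S. \<alpha> s * ev w (b j s)))"
      by (simp add: h1_def b1'_def meval_mult distrib_left sum_distrib_left mult_ac)
    then show ?thesis using hb[OF that] by simp
  qed
  define \<tau> where "\<tau> i = (if i \<in> C then mvar (Inr 0) * inl h * mvar (Inl i) +
      (if i \<in> S then \<Sum>n<r. mvar (Inr (Suc n)) * inl (b1' (jj n) i) else 0)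
      else mvar (Inr (Suc (idx i))) * inl h1)" for i
  define hu where "hu = msubst u h"
  define hu1 where "hu1 = msubst u h1"
  \<comment> \<open>The second block solves \<tau> = c y for t at w = u(y): outside \<open>C\<close>
    this reads t (n + 1) * hu1 = c * y, and at \<open>i0\<close> it reads t 0 * hu * u i0 = c * y
    i0. The choice c = hu * u i0 * hu1 clears the denominators.\<close>
  define \<sigma> where "\<sigma> = case_sum u (case_nat (hu1 * mvar i0) (\<lambda>n. hu * u i0 * mvar (jj n)))"
  have i0C: "i0 \<in> C" and SC: "S \<subseteq> C" using CS(1) by auto
  have \<tau>C: "ev w (\<tau> i) = w (Inr 0) * ev (\<lambda>i. w (Inl i)) h * w (Inl i) +
      (if i \<in> S then \<Sum>n<r. w (Inr (Suc n)) * ev (\<lambda>i. w (Inl i)) (b1' (jj n) i) else 0)"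
    if "i \<in> C" for w i
    using that by (auto simp: \<tau>_def meval_simps ev_inl)
  have \<tau>i0: "ev w (\<tau> i0) = w (Inr 0) * ev (\<lambda>i. w (Inl i)) h * w (Inl i0)" for w
    using \<tau>C[OF i0C] CS(2) by simp
  have \<tau>J: "ev w (\<tau> (jj n)) = w (Inr (Suc n)) * ev (\<lambda>i. w (Inl i)) h1" if "n < r" for w n
    using jjA[OF that] by (simp add: \<tau>_def meval_simps ev_inl)
  have reJ: "(\<Sum>j\<in>A - C. F j) = (\<Sum>n<r. F (jj n))" for F :: "'x \<Rightarrow> 'k"
    using sum.reindex_bij_betw[OF jj, of F] by simp
  have splitA: "(\<Sum>i\<in>A. F i) = (\<Sum>i\<in>C. F i) + (\<Sum>n<r. F (jj n))" for F :: "'x \<Rightarrow> 'k"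
    unfolding reJ[symmetric] using sum.subset_diff[OF CA finA, of F] by (simp add: add.commute)
  have \<tau>H: "(\<lambda>i. ev w (\<tau> i)) \<in> H" if "w \<in> Pq.H" for w
  proof -
    let ?w = "\<lambda>i. w (Inl i)"
    have W: "?w \<in> Cq.H" using that by (simp add: Pq_H)
    have "(\<Sum>i\<in>C. \<alpha> i * ev w (\<tau> i)) = (\<Sum>i\<in>C. w (Inr 0) * ev ?w h * (\<alpha> i * w (Inl i))) +
        (\<Sum>i\<in>C. if i \<in> S then \<alpha> i * (\<Sum>n<r. w (Inr (Suc n)) * ev ?w (b1' (jj n) i)) else 0)"
      unfolding sum.distrib[symmetric] by (intro sum.cong refl) (simp add: \<tau>C distrib_left mult_ac)
    also have "(\<Sum>i\<in>C. w (Inr 0) * ev ?w h * (\<alpha> i * w (Inl i))) = w (Inr 0) * ev ?w h * (\<Sum>i\<in>C. \<alpha> i * w (Inl i))"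
      by (simp only: sum_distrib_left)
    also have "(\<Sum>i\<in>C. \<alpha> i * w (Inl i)) = 0" using W by (simp add: Cq.H_def)
    also have "(\<Sum>i\<in>C. if i \<in> S then \<alpha> i * (\<Sum>n<r. w (Inr (Suc n)) * ev ?w (b1' (jj n) i)) else 0) =
        (\<Sum>i\<in>S. \<Sum>n<r. w (Inr (Suc n)) * (\<alpha> i * ev ?w (b1' (jj n) i)))"
      using SC finC by (intro sum.mono_neutral_cong_right) (auto simp: sum_distrib_left mult_ac)
    also have "\<dots> = (\<Sum>n<r. \<Sum>i\<in>S. w (Inr (Suc n)) * (\<alpha> i * ev ?w (b1' (jj n) i)))" by (rule sum.swap)
    finally have "(\<Sum>i\<in>A. \<alpha> i * ev w (\<tau> i)) =
        (\<Sum>n<r. w (Inr (Suc n)) * (ev ?w h1 * \<alpha> (jj n) + (\<Sum>i\<in>S. \<alpha> i * ev ?w (b1' (jj n) i))))"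
      unfolding splitA by (simp add: \<tau>J sum_distrib_left distrib_left sum.distrib mult_ac add.commute)
    also have "\<dots> = 0" using hb1[OF jjA(1) W] by simp
    finally show ?thesis by (simp add: H_def)
  qed
  have \<sigma>H: "(\<lambda>x. ev y (\<sigma> x)) \<in> Pq.H" if "y \<in> H" for y
    unfolding Pq_H using pt_H[OF that] by (simp add: \<sigma>_def)
  have hP: "h \<in> Pol C" "h1 \<in> Pol C" using h(1) h1(1) homog_Pol by blast+
  have nhu: "\<not> Z hu" "\<not> Z hu1" unfolding hu_def hu1_def using generic[OF hP(1)] generic[OF hP(2)] h(2) h1(2) by blast+
  define c where "c = hu * u i0 * hu1"
  have nc: "\<not> Z c" unfolding c_def by (intro not_Z_mult nhu u_i0)
  have ev_hu: "ev y hu = ev (pt y) h" "ev y hu1 = ev (pt y) h1" for y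
    by (simp_all add: hu_def hu1_def meval_subst)
  have \<sigma>0: "ev y (\<sigma> (Inr 0)) = ev (pt y) h1 * y i0" for y by (simp add: \<sigma>_def meval_simps ev_hu)
  have \<sigma>S: "ev y (\<sigma> (Inr (Suc n))) = ev (pt y) h * ev y (u i0) * y (jj n)" for y n
    by (simp add: \<sigma>_def meval_simps ev_hu)
  have comp1: "ev (\<lambda>x. ev y (\<sigma> x)) (\<tau> i) = ev y c * y i" if y: "y \<in> H" and i: "i \<in> A" for y i
  proof (cases "i \<in> C")
    case False
    then obtain n where n: "n < r" "i = jj n" using idx[of i] i by auto
    have "(\<lambda>i. ev y (\<sigma> (Inl i))) = pt y" by (simp add: \<sigma>_def)
    then show ?thesis unfolding n(2) \<tau>J[OF n(1)] \<sigma>S by (simp add: c_def meval_simps ev_hu)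
  next
    case True
    \<comment> \<open>Up to the factor \<open>hu * u i0\<close> this is the second summand of \<tau>
      at the image of y. Subtracting it from \<open>hu1 * mvar i\<close> leaves a relation on
      \<open>C\<close>, hence a multiple of \<open>u\<close>.\<close>
    define T where "T i = (if i \<in> S then \<Sum>n<r. mvar (jj n) * msubst u (b1' (jj n) i) else 0)" for i
    define v where "v i = hu1 * mvar i - T i" for i
    have TP: "T i \<in> Pol A" if "i \<in> C" for i
    proof -
      have "msubst u (b1' (jj n) i) \<in> Pol A" if "n < r" "i \<in> S" for n
        using b1[OF jjA(1)[OF that(1)] that(2)] uP by (intro msubst_Pol[of _ C]) (auto dest: homog_Pol)
      then show ?thesis unfolding T_def using jjA by (auto intro!: Pol_sum Pol_mult)
    qed
    have evT: "ev y (T i) = (if i \<in> S then \<Sum>n<r. y (jj n) * ev (pt y) (b1' (jj n) i) else 0)" for y i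
      by (simp add: T_def meval_simps meval_subst)
    have relv: "rel \<alpha> C v" unfolding rel_def
    proof (intro conjI ballI)
      show "v i \<in> Pol A" if "i \<in> C" for i
        unfolding v_def hu1_def using that CA TP uP hP by (intro Pol_diff Pol_mult msubst_Pol[of _ C]) auto
      fix y assume y: "y \<in> H"
      have "(\<Sum>i\<in>C. \<alpha> i * ev y (T i)) = (\<Sum>i\<in>S. \<Sum>n<r. y (jj n) * (\<alpha> i * ev (pt y) (b1' (jj n) i)))"
        using SC finC by (intro sum.mono_neutral_cong_right) (auto simp: evT sum_distrib_left mult_ac)
      also have "\<dots> = (\<Sum>n<r. \<Sum>i\<in>S. y (jj n) * (\<alpha> i * ev (pt y) (b1' (jj n) i)))" by (rule sum.swap)
      also have "\<dots> = (\<Sum>n<r. y (jj n) * (- (ev (pt y) h1 * \<alpha> (jj n))))"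
      proof (intro sum.cong refl)
        fix n assume "n \<in> {..<r}"
        then have "(\<Sum>i\<in>S. \<alpha> i * ev (pt y) (b1' (jj n) i)) = - (ev (pt y) h1 * \<alpha> (jj n))"
          using hb1[OF jjA(1) pt_H[OF y], of n] by (simp add: eq_neg_iff_add_eq_0 add.commute)
        then show "(\<Sum>i\<in>S. y (jj n) * (\<alpha> i * ev (pt y) (b1' (jj n) i))) = y (jj n) * (- (ev (pt y) h1 * \<alpha> (jj n)))"
          by (simp only: sum_distrib_left[symmetric])
      qed
      also have "\<dots> = - (ev (pt y) h1 * (\<Sum>n<r. \<alpha> (jj n) * y (jj n)))"
        by (simp add: sum_distrib_left sum_negf mult_ac)
      finally have sT: "(\<Sum>i\<in>C. \<alpha> i * ev y (T i)) = - (ev (pt y) h1 * (\<Sum>n<r. \<alpha> (jj n) * y (jj n)))" .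
      have "(\<Sum>i\<in>C. \<alpha> i * ev y (v i)) = ev (pt y) h1 * (\<Sum>i\<in>C. \<alpha> i * y i) - (\<Sum>i\<in>C. \<alpha> i * ev y (T i))"
        by (simp add: v_def meval_simps ev_hu right_diff_distrib sum_subtractf sum_distrib_left sum_distrib_right mult_ac)
      also have "\<dots> = ev (pt y) h1 * (\<Sum>i\<in>C. \<alpha> i * y i) + ev (pt y) h1 * (\<Sum>n<r. \<alpha> (jj n) * y (jj n))"
        unfolding sT by simp
      also have "\<dots> = ev (pt y) h1 * (\<Sum>i\<in>A. \<alpha> i * y i)" unfolding splitA by (simp add: distrib_left)
      finally show "(\<Sum>i\<in>C. \<alpha> i * ev y (v i)) = 0" using y by (simp add: H_def)
    qed
    have vi0: "ev y (v i0) = ev (pt y) h1 * y i0" using CS(2) by (simp add: v_def T_def meval_simps ev_hu)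
    have "ev y (u i0) * ev y (v i) = ev y (v i0) * ev y (u i)"
      using proportional[OF relv True] y by (simp add: Z_def meval_simps)
    then have pr: "ev y (u i0) * (ev (pt y) h1 * y i - ev y (T i)) = ev (pt y) h1 * y i0 * ev y (u i)"
      unfolding vi0 by (simp add: v_def meval_simps ev_hu)
    have "(\<lambda>i. ev y (\<sigma> (Inl i))) = pt y" "ev y (\<sigma> (Inl i)) = ev y (u i)" by (simp_all add: \<sigma>_def)
    then have "ev (\<lambda>x. ev y (\<sigma> x)) (\<tau> i) = ev (pt y) h * (ev (pt y) h1 * y i0 * ev y (u i)) +
        ev (pt y) h * ev y (u i0) * ev y (T i)"
      unfolding \<tau>C[OF True] \<sigma>0 \<sigma>S evT by (simp add: sum_distrib_left mult_ac)
    then show ?thesis unfolding pr[symmetric] by (simp add: c_def meval_simps ev_hu algebra_simps)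
  qed
  \<comment> \<open>Bidegrees: x on the first block, y on the second.\<close>
  define E where "E x y = (\<lambda>B :: ('x + nat) set. if B = Inl ` C then x else y)" for x y :: nat
  have ne: "Inr ` {..r} \<noteq> (Inl ` C :: ('x + nat) set)" using i0C by auto
  have Bs': "Bs' = {Inl ` C, Inr ` {..r}}" by (simp add: Bs'_def r_def)
  have disj: "disjoint Bs'" unfolding Bs' disjoint_def by auto
  have vl: "mvar (Inl i) \<in> mhomog Bs' (E 1 0)" if "i \<in> C" for i
    unfolding E_def using that finC disj by (intro mvar_mhomog) (auto simp: Bs')
  have vr: "mvar (Inr n) \<in> mhomog Bs' (E 0 1)" if "n \<le> r" for n
  proof -
    have "mvar (Inr n) \<in> mhomog Bs' (\<lambda>A. if A = Inr ` {..r} then 1 else 0)"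
      using that disj by (intro mvar_mhomog) (auto simp: Bs')
    moreover have "mhomog Bs' (\<lambda>A. if A = Inr ` {..r} then 1 else 0) = mhomog Bs' (E 0 1)"
      using ne by (intro mhomog_cong) (auto simp: Bs' E_def)
    ultimately show ?thesis by blast
  qed
  have vi: "inl q \<in> mhomog Bs' (E e 0)" if "homog C e q" for q e
  proof -
    have "inl q \<in> mhomog Bs' (\<lambda>B. \<Sum>A\<in>{C}. e * E 1 0 B)"
      using that finC vl by (intro msubst_mhomog[where e' = "\<lambda>_. e" and d = "\<lambda>_. E 1 0"])
        (auto simp: homog_mhomog disjoint_def)
    moreover have "(\<lambda>B. E e 0 B) = (\<lambda>B. if B = Inl ` C then e else 0)" by (simp add: E_def)
    ultimately show ?thesis unfolding E_def by (elim back_subst[of "\<lambda>e. _ \<in> mhomog Bs' e"]) (auto simp: fun_eq_iff)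
  qed
  have mE: "f * g \<in> mhomog Bs' (E (x + x') (y + y'))" if "f \<in> mhomog Bs' (E x y)" "g \<in> mhomog Bs' (E x' y')" for f g x x' y y'
  proof -
    have "(\<lambda>A. E x y A + E x' y' A) = E (x + x') (y + y')" by (auto simp: E_def)
    then show ?thesis using mhomog_mult[OF that] by simp
  qed
  have t_hom: "\<tau> i \<in> mhomog Bs' (E (Suc d) 1)" if "i \<in> A" for i
  proof (cases "i \<in> C")
    case True
    have "mvar (Inr 0) * inl h * mvar (Inl i) \<in> mhomog Bs' (E (Suc d) 1)"
      using mE[OF mE[OF vr[of 0] vi[OF h(1)]] vl[OF True]] by simp
    moreover have "mvar (Inr (Suc n)) * inl (b1' (jj n) i) \<in> mhomog Bs' (E (Suc d) 1)" if "n < r" "i \<in> S" for n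
      using mE[OF vr[of "Suc n"] vi[OF b1[OF jjA(1)[OF that(1)] that(2)]]] that by simp
    ultimately show ?thesis using True unfolding \<tau>_def by (auto intro!: mhomog_add mhomog_sum)
  next
    case False
    then have "idx i < r" using idx that by blast
    then show ?thesis using False mE[OF vr[of "Suc (idx i)"] vi[OF h1(1)]] by (simp add: \<tau>_def)
  qed
  have u_hom: "homog A (e * k) (msubst u q)" if "homog C e q" for e q
  proof -
    have "msubst u q \<in> mhomog {A} (\<lambda>B. \<Sum>A\<in>{C}. e * k)"
      using that finC hom_u by (intro msubst_mhomog[where e' = "\<lambda>_. e" and d = "\<lambda>_ _. k"])
        (auto simp: homog_mhomog disjoint_def)
    then show ?thesis by (simp add: homog_mhomog)
  qed
  define d' where "d' B = (if B = Inl ` C then (\<lambda>_::'x set. k) else (\<lambda>_. Suc d * k + 1))" for B :: "('x + nat) set"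
  have s_hom: "\<sigma> x \<in> mhomog {A} (d' B)" if "B \<in> Bs'" "x \<in> B" for B x
  proof (cases "B = Inl ` C")
    case True
    then show ?thesis using that hom_u by (auto simp: d'_def \<sigma>_def homog_mhomog)
  next
    case False
    then obtain n where n: "x = Inr n" "n \<le> r" "B = Inr ` {..r}" using \<open>B \<in> Bs'\<close> \<open>x \<in> B\<close> unfolding Bs' by blast
    have "homog A (Suc d * k + 1) (\<sigma> (Inr n))"
    proof (cases n)
      case 0
      then show ?thesis using homog_mult[OF u_hom[OF h1(1)] homog_var[OF finA i0A]] by (simp add: \<sigma>_def hu1_def)
    next
      case (Suc n')
      then have "jj n' \<in> A" using jjA[of n'] n(2) by auto
      then have "homog A (d * k + k + 1) (hu * u i0 * mvar (jj n'))"
        unfolding hu_def by (intro homog_mult u_hom h(1) hom_u i0C homog_var finA)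
      then show ?thesis using Suc by (simp add: \<sigma>_def add.commute)
    qed
    then show ?thesis using False n(1) by (simp add: d'_def homog_mhomog)
  qed
  define ui where "ui = msubst \<tau> (u i0)"
  have z_ui: "ev w ui = ev (\<lambda>i. ev w (\<tau> i)) (u i0)" for w by (simp add: ui_def meval_subst)
  have \<tau>P: "\<tau> i \<in> Pol AP" if "i \<in> A" for i
    using mhomog_Pol[OF t_hom[OF that]] by (simp add: Bs'_def AP_Union)
  \<comment> \<open>Pulled back along \<sigma>, \<open>ui\<close> becomes
    \<open>c ^ k * u i0\<close>, which does not vanish on \<open>H\<close>.\<close>
  have n_ui: "\<not> Pq.Z ui"
  proof
    assume z: "Pq.Z ui"
    have "ev y (c ^ k * u i0) = 0" if y: "y \<in> H" for y
    proof -
      have "0 = ev (\<lambda>x. ev y (\<sigma> x)) ui" using z \<sigma>H[OF y] by (simp add: Pq.Z_def)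
      also have "\<dots> = ev (\<lambda>i. ev y c * y i) (u i0)"
        unfolding z_ui by (rule meval_cong[OF uP[OF i0C]]) (rule comp1[OF y])
      also have "\<dots> = ev y (c ^ k * u i0)" by (simp add: homog_scale[OF finA hom_u[OF i0C]] meval_simps)
      finally show ?thesis by simp
    qed
    then have "Z (c ^ k * u i0)" by (simp add: Z_def)
    then show False using not_Z_mult[OF not_Z_power[OF nc] u_i0] by blast
  qed
  have "\<not> Cq.Z (mvar i0)"
  proof
    assume "Cq.Z (mvar i0)"
    then have "Z (u i0)" using pt_H by (auto simp: Cq.Z_def Z_def)
    then show False using u_i0 by blast
  qed
  from not_Z_inl[OF this] have n_w: "\<not> Pq.Z (mvar (Inl i0))" by simp
  have prp: "w (Inl i0) * ev (\<lambda>i. ev w (\<tau> i)) (u i) = ev w ui * w (Inl i)" if w: "w \<in> Pq.H" and i: "i \<in> C" for w i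
  proof -
    \<comment> \<open>These differences satisfy the linear relation on \<open>C\<close> and vanish
      at \<open>i0\<close>. So they form a relation on \<open>S\<close>, which is independent over
      the function field of the product.\<close>
    define D where "D i = mvar (Inl i0) * msubst \<tau> (u i) - ui * mvar (Inl i)" for i
    have evD: "ev w (D i) = w (Inl i0) * ev (\<lambda>i. ev w (\<tau> i)) (u i) - ev w ui * w (Inl i)" for w i
      by (simp add: D_def meval_simps meval_subst)
    have evDi0: "ev w (D i0) = 0" for w unfolding evD z_ui by simp
    have "Pq.rel \<alpha> S D" unfolding Pq.rel_def
    proof (intro conjI ballI)
      show "D i \<in> Pol AP" if "i \<in> S" for i
        unfolding D_def ui_def using that SC i0C uP \<tau>P
        by (intro Pol_diff Pol_mult msubst_Pol[of _ A] Pol_var) (auto simp: AP_def)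
      fix w assume w: "w \<in> Pq.H"
      have "(\<Sum>i\<in>S. \<alpha> i * ev w (D i)) = (\<Sum>i\<in>C. \<alpha> i * ev w (D i))"
        unfolding CS(1) using finS CS(2) by (simp add: evDi0)
      also have "\<dots> = w (Inl i0) * (\<Sum>i\<in>C. \<alpha> i * ev (\<lambda>i. ev w (\<tau> i)) (u i)) - ev w ui * (\<Sum>i\<in>C. \<alpha> i * w (Inl i))"
        by (simp add: evD right_diff_distrib sum_subtractf sum_distrib_left mult_ac)
      also have "\<dots> = 0" using relD[OF rel_u \<tau>H[OF w]] w by (simp add: Pq_H Cq.H_def)
      finally show "(\<Sum>i\<in>S. \<alpha> i * ev w (D i)) = 0" .
    qed
    then have "Pq.Z (D i)" if "i \<in> S" for i using Pq.rel_indep[OF _ Pq_ind] that by blast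
    then have "i \<in> S \<Longrightarrow> ev w (D i) = 0" using w unfolding Pq.Z_def by blast
    moreover have "i = i0 \<or> i \<in> S" using i unfolding CS(1) by blast
    ultimately have "ev w (D i) = 0" using evDi0[of w] by blast
    then show ?thesis by (simp add: evD)
  qed
  have scale: "w (Inl i0) ^ e * ev (pt (\<lambda>i. ev w (\<tau> i))) q = ev w ui ^ e * ev (\<lambda>i. w (Inl i)) q"
    if "w \<in> Pq.H" "homog C e q" for w e q
  proof -
    have "w (Inl i0) ^ e * ev (pt (\<lambda>i. ev w (\<tau> i))) q = ev (\<lambda>i. w (Inl i0) * pt (\<lambda>i. ev w (\<tau> i)) i) q"
      by (simp add: homog_scale[OF finC that(2)])
    also have "\<dots> = ev (\<lambda>i. ev w ui * w (Inl i)) q"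
      by (rule meval_cong[OF homog_Pol[OF that(2)]]) (rule prp[OF that(1)])
    also have "\<dots> = ev w ui ^ e * ev (\<lambda>i. w (Inl i)) q" by (simp add: homog_scale[OF finC that(2)])
    finally show ?thesis .
  qed
  \<comment> \<open>The exponent \<open>Suc d\<close> is the degree of \<open>h1\<close>, whose
    value at the image has to be rescaled by \<open>scale\<close>.\<close>
  define a' where "a' B = (if B = Inl ` C then mvar (Inl i0) else mvar (Inl i0) ^ Suc d :: ('x + nat, 'f) mpoly)" for B :: "('x + nat) set"
  define b' where "b' B = (if B = Inl ` C then ui else ui ^ Suc d * inl h1 * inl h * mvar (Inl i0))" for B :: "('x + nat) set"
  have he: "hom_el Bs' (mvar (Inl i0))" "hom_el Bs' ui" "hom_el Bs' (inl h)" "hom_el Bs' (inl h1)"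
  proof -
    show "hom_el Bs' ui" unfolding ui_def
    proof (rule hom_elI, rule msubst_mhomog[where Bs' = "{A}" and e' = "\<lambda>_. k" and d = "\<lambda>_. E (Suc d) 1"])
      show "u i0 \<in> mhomog {A} (\<lambda>_. k)" using hom_u[OF i0C] by (simp add: homog_mhomog)
    qed (use finA t_hom in \<open>auto simp: disjoint_def\<close>)
  qed (rule hom_elI[OF vl[OF i0C]] hom_elI[OF vi[OF h(1)]] hom_elI[OF vi[OF h1(1)]])+
  have blk: "Pq.Z (a' B * msubst \<tau> (\<sigma> x) - b' B * mvar x)" if B: "B \<in> Bs'" "x \<in> B" for B x
    unfolding Pq.Z_def
  proof
    fix w assume w: "w \<in> Pq.H"
    let ?z = "\<lambda>i. ev w (\<tau> i)"
    have e: "ev w (msubst \<tau> (\<sigma> x)) = ev ?z (\<sigma> x)" by (simp add: meval_subst)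
    show "ev w (a' B * msubst \<tau> (\<sigma> x) - b' B * mvar x) = 0"
    proof (cases "B = Inl ` C")
      case True
      then obtain i where i: "i \<in> C" "x = Inl i" using B by auto
      have "ev ?z (\<sigma> x) = ev ?z (u i)" by (simp add: i \<sigma>_def)
      then show ?thesis using prp[OF w i(1)] True by (simp add: meval_simps meval_subst a'_def b'_def i(2) \<sigma>_def)
    next
      case False
      then obtain n where n: "x = Inr n" "n \<le> r" using B by (auto simp: Bs')
      have "w (Inl i0) ^ Suc d * ev ?z (\<sigma> (Inr n)) =
          ev w ui ^ Suc d * ev (\<lambda>i. w (Inl i)) h1 * ev (\<lambda>i. w (Inl i)) h * w (Inl i0) * w (Inr n)"
      proof (cases n)
        case 0
        have "w (Inl i0) ^ Suc d * ev ?z (\<sigma> (Inr 0)) = (w (Inl i0) ^ Suc d * ev (pt ?z) h1) * ?z i0"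
          unfolding \<sigma>0 by (simp add: mult_ac)
        then show ?thesis unfolding scale[OF w h1(1)] \<tau>i0 0 by (simp add: mult_ac)
      next
        case (Suc n')
        then have n': "n' < r" using n(2) by simp
        have "w (Inl i0) ^ Suc d * ev ?z (\<sigma> (Inr (Suc n'))) =
            w (Inl i0) * (w (Inl i0) ^ d * ev (pt ?z) h) * ev ?z (u i0) * ?z (jj n')"
          unfolding \<sigma>S by (simp add: mult_ac)
        then show ?thesis unfolding scale[OF w h(1)] \<tau>J[OF n'] Suc z_ui by (simp add: mult_ac)
      qed
      then show ?thesis using False by (simp add: meval_simps e[unfolded n(1)] a'_def b'_def n(1) ev_inl)
    qed
  qed
  show ?thesis
  proof (rule exI[of _ \<sigma>], rule exI[of _ \<tau>], rule exI[of _ "E (Suc d) 1"], rule exI[of _ d'],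
      rule exI[of _ 1], rule exI[of _ c], rule exI[of _ a'], rule exI[of _ b'], intro conjI ballI)
    have cPol: "c \<in> Pol A" unfolding c_def hu_def hu1_def
      using hP uP i0C by (intro Pol_mult msubst_Pol[of _ C]) auto
    have "homog A (d * k + k + Suc d * k) c" unfolding c_def hu_def hu1_def
      by (intro homog_mult u_hom h(1) h1(1) hom_u i0C)
    then show "hom_el {A} c" by (auto simp: homog_mhomog intro: hom_elI)
    show "hom_el {A} 1" by (rule hom_el_1)
    show "Z (1 * msubst \<sigma> (\<tau> i) - c * mvar i)" if "i \<in> A" for i
      using comp1[OF _ that] by (simp add: Z_def meval_simps meval_subst)
    show "hom_el Bs' (a' B)" "hom_el Bs' (b' B)" for B
      unfolding a'_def b'_def by (auto intro!: hom_el_mult hom_el_power he simp del: power_Suc)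
    show "\<not> Pq.Z (a' B)" "\<not> Pq.Z (b' B)" for B
      unfolding a'_def b'_def using n_w n_ui not_Z_inl[OF h(2)] not_Z_inl[OF h1(2)]
      by (auto dest!: Pq.Z_prime simp del: power_Suc simp: Pq.not_Z_power)
  qed (use t_hom s_hom \<sigma>H \<tau>H nc blk in auto)
qed

end

section \<open>Homogeneous primes\<close>

lemma mpoly_ring_simps [simp]:
  "x \<otimes>\<^bsub>mpoly_ring V\<^esub> y = x * y" "x \<oplus>\<^bsub>mpoly_ring V\<^esub> y = x + y"
  "\<one>\<^bsub>mpoly_ring V\<^esub> = 1" "\<zero>\<^bsub>mpoly_ring V\<^esub> = 0"
  by (simp_all add: mpoly_ring_def)

lemma cring_mpoly_ring: "cring (mpoly_ring V)"
proof (rule cringI)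
  show "abelian_group (mpoly_ring V)"
  proof (rule abelian_groupI)
    fix x assume "x \<in> carrier (mpoly_ring V)"
    then show "\<exists>y\<in>carrier (mpoly_ring V). y \<oplus>\<^bsub>mpoly_ring V\<^esub> x = \<zero>\<^bsub>mpoly_ring V\<^esub>"
      by (intro bexI[of _ "- x"]) (auto intro: Pol_uminus)
  qed (auto intro: Pol_add simp: add_ac)
  show "Group.comm_monoid (mpoly_ring V)"
    by (rule comm_monoidI) (auto intro: Pol_mult simp: mult_ac)
qed (auto simp: distrib_right)

text \<open>Ideals as plain sets of polynomials, so that the arguments below use the type class
  operations instead of those of \<open>mpoly_ring\<close>.\<close>

definition isideal :: "'x set \<Rightarrow> ('x, 'f::field) mpoly set \<Rightarrow> bool" where
  "isideal V Q \<longleftrightarrow> Q \<subseteq> Pol V \<and> 0 \<in> Q \<and> (\<forall>q\<in>Q. \<forall>r\<in>Q. q + r \<in> Q) \<and> (\<forall>q\<in>Q. \<forall>r\<in>Pol V. r * q \<in> Q)"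

definition isprime :: "'x set \<Rightarrow> ('x, 'f::field) mpoly set \<Rightarrow> bool" where
  "isprime V Q \<longleftrightarrow> isideal V Q \<and> 1 \<notin> Q \<and> (\<forall>q\<in>Pol V. \<forall>r\<in>Pol V. q * r \<in> Q \<longrightarrow> q \<in> Q \<or> r \<in> Q)"

lemma a_inv_mpoly_ring: "x \<in> Pol V \<Longrightarrow> \<ominus>\<^bsub>mpoly_ring V\<^esub> x = - x"
proof -
  interpret cring "mpoly_ring V" by (rule cring_mpoly_ring)
  assume "x \<in> Pol V"
  then show ?thesis by (intro sum_zero_eq_neg[symmetric, of "- x" x, simplified]) (auto intro: Pol_uminus)
qed

lemma isideal_uminus: "isideal V Q \<Longrightarrow> q \<in> Q \<Longrightarrow> - q \<in> Q"
  using Pol_uminus[OF Pol_1, of V] unfolding isideal_def by (metis mult_minus1)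

lemma ideal_iff: "ideal Q (mpoly_ring V) \<longleftrightarrow> isideal V Q"
proof
  assume Q: "ideal Q (mpoly_ring V)"
  interpret ideal Q "mpoly_ring V" by fact
  show "isideal V Q" unfolding isideal_def
    using a_subset subgroup.m_closed[OF a_subgroup] I_l_closed
      additive_subgroup.zero_closed[OF is_additive_subgroup] by (intro conjI ballI) simp_all
next
  assume Q: "isideal V Q"
  interpret cring "mpoly_ring V" by (rule cring_mpoly_ring)
  show "ideal Q (mpoly_ring V)"
  proof (rule idealI)
    show "subgroup Q (add_monoid (mpoly_ring V))"
    proof (rule group.subgroupI[OF a_group])
      fix x assume x: "x \<in> Q"
      then have "inv\<^bsub>add_monoid (mpoly_ring V)\<^esub> x = - x"
        using Q a_inv_mpoly_ring[of x V] unfolding isideal_def a_inv_def by blast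
      then show "inv\<^bsub>add_monoid (mpoly_ring V)\<^esub> x \<in> Q" using isideal_uminus[OF Q x] by simp
    qed (use Q in \<open>auto simp: isideal_def\<close>)
  qed (use Q ring_axioms in \<open>auto simp: isideal_def mult.commute\<close>)
qed

lemma primeideal_iff: "primeideal Q (mpoly_ring V) \<longleftrightarrow> isprime V Q"
proof
  assume "primeideal Q (mpoly_ring V)"
  then interpret primeideal Q "mpoly_ring V" .
  have "1 \<notin> Q" using one_imp_carrier I_notcarr by auto
  then show "isprime V Q"
    unfolding isprime_def using ideal_iff[of Q V] is_ideal I_prime by auto
next
  assume Q: "isprime V Q"
  show "primeideal Q (mpoly_ring V)"
  proof (rule primeidealI)
    show "carrier (mpoly_ring V) \<noteq> Q" using Q by (auto simp: isprime_def)
  qed (use Q cring_mpoly_ring in \<open>auto simp: ideal_iff isprime_def\<close>)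
qed

lemma isideal_sum: "isideal V Q \<Longrightarrow> (\<And>i. i \<in> S \<Longrightarrow> f i \<in> Q) \<Longrightarrow> sum f S \<in> Q"
  by (induction S rule: infinite_finite_induct) (auto simp: isideal_def)

lemma isideal_diff: "isideal V Q \<Longrightarrow> q \<in> Q \<Longrightarrow> r \<in> Q \<Longrightarrow> q - r \<in> Q"
  using isideal_uminus[of V Q r] unfolding isideal_def by (metis diff_conv_add_uminus)

lemma isprime_mult: "isprime V Q \<Longrightarrow> q \<in> Pol V \<Longrightarrow> r \<in> Pol V \<Longrightarrow> q * r \<in> Q \<longleftrightarrow> q \<in> Q \<or> r \<in> Q"
  unfolding isprime_def isideal_def by (metis mult.commute)

lemma not_1_isprime: "isprime V Q \<Longrightarrow> 1 \<notin> Q" by (simp add: isprime_def)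

lemma isprime_power: "isprime V Q \<Longrightarrow> q \<in> Pol V \<Longrightarrow> q \<notin> Q \<Longrightarrow> q ^ n \<notin> Q"
  by (induction n) (simp_all add: isprime_mult[of V Q] Pol_power not_1_isprime)

lemma isprime_prod:
  assumes "isprime V Q" "\<And>i. i \<in> S \<Longrightarrow> f i \<in> Pol V" "\<And>i. i \<in> S \<Longrightarrow> f i \<notin> Q"
  shows "prod f S \<notin> Q"
  using assms(2,3)
  by (induction S rule: infinite_finite_induct)
    (simp_all add: isprime_mult[OF assms(1)] Pol_prod not_1_isprime[OF assms(1)])

text \<open>For an ideal \<open>Q\<close> this is the largest ideal inside it that is graded by the
  degree in the block \<open>B\<close>.\<close>

definition core :: "'x set \<Rightarrow> 'x set \<Rightarrow> ('x, 'f::field) mpoly set \<Rightarrow> ('x, 'f) mpoly set" where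
  "core V B Q = {q \<in> Pol V. \<forall>k. wcomp B k q \<in> Q}"

definition wt_homog :: "'x set \<Rightarrow> ('x, 'f::field) mpoly set \<Rightarrow> bool" where
  "wt_homog B Q \<longleftrightarrow> (\<forall>q\<in>Q. \<forall>k. wcomp B k q \<in> Q)"

lemma wcomp_wcomp: "wcomp B k (wcomp B' l q) = wcomp B' l (wcomp B k q)"
  by (rule poly_mapping_eqI) (simp add: lookup_wcomp)
lemma wcomp_same: "wcomp B k (wcomp B l q) = (if k = l then wcomp B k q else 0)"
  by (rule poly_mapping_eqI) (auto simp: lookup_wcomp)

lemma core_subset: assumes "isideal V Q" shows "core V B Q \<subseteq> Q"
proof
  fix q assume q: "q \<in> core V B Q"
  obtain N where "\<forall>m\<in>mkeys q. wt B m < N" using wcomp_bound[of q B] by blast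
  then have "q = (\<Sum>k<N. wcomp B k q)" by (intro wcomp_expand) auto
  moreover have "(\<Sum>k<N. wcomp B k q) \<in> Q" using q by (intro isideal_sum[OF assms]) (auto simp: core_def)
  ultimately show "q \<in> Q" by simp
qed

lemma isideal_core: assumes "isideal V Q" shows "isideal V (core V B Q)"
  unfolding isideal_def
proof (intro conjI ballI)
  show "q + r \<in> core V B Q" if "q \<in> core V B Q" "r \<in> core V B Q" for q r
    using that assms by (auto simp: core_def isideal_def wcomp_add intro: Pol_add)
  show "r * q \<in> core V B Q" if "q \<in> core V B Q" "r \<in> Pol V" for q r
  proof -
    have "wcomp B i r * wcomp B (k - i) q \<in> Q" for k i
      using that assms wcomp_Pol[of r V B i] by (auto simp: core_def isideal_def)
    then have "wcomp B k (r * q) \<in> Q" for k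
      unfolding wcomp_mult by (intro isideal_sum[OF assms])
    then show ?thesis using that by (auto simp: core_def intro: Pol_mult)
  qed
qed (use assms in \<open>auto simp: core_def isideal_def\<close>)

text \<open>The lowest components of two polynomials outside the core have a product outside the prime.\<close>
lemma isprime_core: assumes "isprime V Q" shows "isprime V (core V B Q)"
  unfolding isprime_def
proof (intro conjI ballI impI)
  have I: "isideal V Q" using assms by (simp add: isprime_def)
  show "isideal V (core V B Q)" by (rule isideal_core[OF I])
  show "1 \<notin> core V B Q" using core_subset[OF I] assms by (auto simp: isprime_def)
  fix q r assume q: "q \<in> Pol V" and r: "r \<in> Pol V" and qr: "q * r \<in> core V B Q"
  show "q \<in> core V B Q \<or> r \<in> core V B Q"
  proof (rule ccontr)
    assume "\<not> ?thesis"
    then have ex: "\<exists>k. wcomp B k q \<notin> Q" "\<exists>k. wcomp B k r \<notin> Q" using q r by (auto simp: core_def)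
    define k where "k = (LEAST k. wcomp B k q \<notin> Q)"
    define l where "l = (LEAST k. wcomp B k r \<notin> Q)"
    have k: "wcomp B k q \<notin> Q" "\<And>i. i < k \<Longrightarrow> wcomp B i q \<in> Q"
      unfolding k_def using LeastI_ex[OF ex(1)] not_less_Least by blast+
    have l: "wcomp B l r \<notin> Q" "\<And>i. i < l \<Longrightarrow> wcomp B i r \<in> Q"
      unfolding l_def using LeastI_ex[OF ex(2)] not_less_Least by blast+
    have P: "wcomp B i q \<in> Pol V" "wcomp B i r \<in> Pol V" for i using q r wcomp_Pol by blast+
    have s: "(\<Sum>i\<in>{..k + l} - {k}. wcomp B i q * wcomp B (k + l - i) r) \<in> Q"
    proof (rule isideal_sum[OF I])
      fix i assume "i \<in> {..k + l} - {k}"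
      then have "i < k \<or> k + l - i < l" by auto
      then show "wcomp B i q * wcomp B (k + l - i) r \<in> Q"
        using k(2) l(2) P isprime_mult[OF assms] by blast
    qed
    have e: "wcomp B (k + l) (q * r) = wcomp B k q * wcomp B l r +
        (\<Sum>i\<in>{..k + l} - {k}. wcomp B i q * wcomp B (k + l - i) r)"
      unfolding wcomp_mult by (subst sum.remove[of _ k]) auto
    have "wcomp B (k + l) (q * r) \<in> Q" using qr by (simp add: core_def)
    then have "wcomp B k q * wcomp B l r \<in> Q" using isideal_diff[OF I _ s] unfolding e by fastforce
    then show False using k(1) l(1) P isprime_mult[OF assms] by blast
  qed
qed

lemma wt_homog_core: "wt_homog B (core V B Q)" if "isideal V Q"
  unfolding wt_homog_def core_def using that by (auto simp: wcomp_same wcomp_Pol isideal_def)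
lemma wt_homog_core': "wt_homog B' Q \<Longrightarrow> wt_homog B' (core V B Q)"
  unfolding wt_homog_def core_def by (auto simp: wcomp_wcomp[of B] wcomp_Pol)

lemma wcomp_mhomog:
  assumes "q \<in> mhomog Bs e" "B \<in> Bs" shows "wcomp B k q = (if k = e B then q else 0)"
  using assms by (intro poly_mapping_eqI) (auto simp: lookup_wcomp mhomog_iff in_keys_iff)

lemma core_mhomog:
  assumes "q \<in> mhomog Bs e" "B \<in> Bs" "isideal (\<Union>Bs) Q" shows "q \<in> core (\<Union>Bs) B Q \<longleftrightarrow> q \<in> Q"
  using assms by (auto simp: core_def wcomp_mhomog[OF assms(1,2)] mhomog_iff isideal_def)

text \<open>The preimage of a multihomogeneous prime under a substitution of forms need not be
  multihomogeneous, because different multidegrees may be sent to the same one. Taking the core for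
  each block repairs this without changing membership of multihomogeneous elements.\<close>

definition hcore :: "'x set set \<Rightarrow> ('x, 'f::field) mpoly set \<Rightarrow> ('x, 'f) mpoly set" where
  "hcore Bs Q = foldr (core (\<Union>Bs)) (SOME xs. set xs = Bs) Q"

lemma hcore:
  assumes "finite Bs" "isprime (\<Union>Bs) Q"
  shows "isprime (\<Union>Bs) (hcore Bs Q)" "\<And>B. B \<in> Bs \<Longrightarrow> wt_homog B (hcore Bs Q)"
    "\<And>q e. q \<in> mhomog Bs e \<Longrightarrow> q \<in> hcore Bs Q \<longleftrightarrow> q \<in> Q"
proof -
  have *: "isprime (\<Union>Bs) (foldr (core (\<Union>Bs)) xs Q) \<and> (\<forall>B\<in>set xs. wt_homog B (foldr (core (\<Union>Bs)) xs Q)) \<and>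
      (\<forall>e. \<forall>q\<in>mhomog Bs e. q \<in> foldr (core (\<Union>Bs)) xs Q \<longleftrightarrow> q \<in> Q)" if "set xs \<subseteq> Bs" for xs
    using that
  proof (induction xs)
    case (Cons B xs)
    then have I: "isideal (\<Union>Bs) (foldr (core (\<Union>Bs)) xs Q)" by (auto simp: isprime_def)
    from Cons show ?case
      by (auto intro: isprime_core wt_homog_core[OF I] wt_homog_core' simp: core_mhomog[OF _ _ I])
  qed (use assms(2) in auto)
  have "set (SOME xs. set xs = Bs) = Bs" using finite_list[OF assms(1)] by (rule someI_ex)
  with *[of "SOME xs. set xs = Bs"]
  show "isprime (\<Union>Bs) (hcore Bs Q)" "\<And>B. B \<in> Bs \<Longrightarrow> wt_homog B (hcore Bs Q)"
    "\<And>q e. q \<in> mhomog Bs e \<Longrightarrow> q \<in> hcore Bs Q \<longleftrightarrow> q \<in> Q"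
    unfolding hcore_def by blast+
qed

text \<open>Splitting an element into components, one block at a time, stays inside the ideal and
  ends with multihomogeneous pieces. In the induction, \<open>F\<close> contains the blocks that are
  still to be split.\<close>

lemma wt_homog_generated:
  assumes "finite Bs" "isideal (\<Union>Bs) Q" "\<And>B. B \<in> Bs \<Longrightarrow> wt_homog B Q"
  shows "Q = genideal (mpoly_ring (\<Union>Bs)) (Q \<inter> (\<Union>e. mhomog Bs e))"
proof
  let ?I = "genideal (mpoly_ring (\<Union>Bs)) (Q \<inter> (\<Union>e. mhomog Bs e))"
  interpret cring "mpoly_ring (\<Union>Bs)" by (rule cring_mpoly_ring)
  have QP: "Q \<subseteq> Pol (\<Union>Bs)" using assms(2) by (simp add: isideal_def)
  show "?I \<subseteq> Q" using assms(2) by (intro genideal_minimal) (auto simp: ideal_iff)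
  have I: "isideal (\<Union>Bs) ?I" unfolding ideal_iff[symmetric] using QP by (intro genideal_ideal) auto
  have sub: "Q \<inter> (\<Union>e. mhomog Bs e) \<subseteq> ?I" using QP by (intro genideal_self) auto
  have "finite F \<Longrightarrow> F \<subseteq> Bs \<Longrightarrow> q \<in> Q \<Longrightarrow> (\<forall>B\<in>Bs - F. \<exists>k. \<forall>m\<in>mkeys q. wt B m = k) \<Longrightarrow> q \<in> ?I" for F q
  proof (induction F arbitrary: q rule: finite_induct)
    case (empty q)
    then obtain e where "\<forall>B\<in>Bs. \<forall>m\<in>mkeys q. wt B m = e B" by (metis Diff_empty)
    then have "q \<in> mhomog Bs e" using empty QP by (auto simp: mhomog_iff)
    then show ?case using sub empty by blast
  next
    case (insert B F q)
    obtain N where "\<forall>m\<in>mkeys q. wt B m < N" using wcomp_bound[of q B] by blast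
    then have q: "q = (\<Sum>k<N. wcomp B k q)" by (intro wcomp_expand) auto
    have "wcomp B k q \<in> ?I" for k
    proof (rule insert.IH)
      show "F \<subseteq> Bs" using insert.prems by blast
      show "wcomp B k q \<in> Q" using insert.prems assms(3)[of B] by (auto simp: wt_homog_def)
      show "\<forall>B'\<in>Bs - F. \<exists>l. \<forall>m\<in>mkeys (wcomp B k q). wt B' m = l"
      proof
        fix B' assume B': "B' \<in> Bs - F"
        have ks: "m \<in> mkeys (wcomp B k q) \<Longrightarrow> m \<in> mkeys q \<and> wt B m = k" for m
          by (auto simp: in_keys_iff lookup_wcomp split: if_splits)
        show "\<exists>l. \<forall>m\<in>mkeys (wcomp B k q). wt B' m = l"
        proof (cases "B' = B")
          case True then show ?thesis using ks by blast
        next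
          case False
          then obtain l where "\<forall>m\<in>mkeys q. wt B' m = l" using insert.prems(3) B' by blast
          then show ?thesis using ks by blast
        qed
      qed
    qed
    then have "(\<Sum>k<N. wcomp B k q) \<in> ?I" by (intro isideal_sum[OF I])
    then show ?case using q by simp
  qed
  from this[OF assms(1) order_refl] show "Q \<subseteq> ?I" by auto
qed

section \<open>Local rings of a multiprojective hypersurface\<close>

text \<open>This abstracts from the hyperplane: \<open>Z\<close> is a prime membership test that
  agrees with divisibility by f on the coordinate ring. \<open>generic_block\<close> makes the ideal
  of f a point, since it contains all variables of no block.\<close>

locale mphyp =
  fixes Bs :: "'x set set" and f :: "('x, 'f::field) mpoly" and Z :: "('x, 'f) mpoly \<Rightarrow> bool"
  assumes finBs: "finite Bs" and fin_block: "\<And>B. B \<in> Bs \<Longrightarrow> finite B" and disj: "disjoint Bs"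
    and Z_f: "\<And>q. q \<in> Pol (\<Union>Bs) \<Longrightarrow> Z q \<longleftrightarrow> (\<exists>g\<in>Pol (\<Union>Bs). q = g * f)"
    and f_hom: "hom_el Bs f"
    and Z_add: "\<And>q r. Z q \<Longrightarrow> Z r \<Longrightarrow> Z (q + r)" and Z_mult: "\<And>q r. Z q \<Longrightarrow> Z (r * q)"
    and Z_prime: "\<And>q r. Z (q * r) \<Longrightarrow> Z q \<or> Z r" and not_Z_1: "\<not> Z 1"
    and generic_block: "\<And>B. B \<in> Bs \<Longrightarrow> \<exists>x\<in>B. \<not> Z (mvar x)"
begin

abbreviation "R \<equiv> Pol (\<Union>Bs)"
abbreviation "pts \<equiv> mproj_points Bs f"

lemma f_R: "f \<in> R" using f_hom by (rule hom_el_Pol)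
lemma Z_mult': "Z q \<Longrightarrow> Z (q * r)" using Z_mult[of q r] by (simp add: mult.commute)
lemma Z_uminus: "Z q \<Longrightarrow> Z (- q)" using Z_mult[of q "- 1"] by simp
lemma Z_diff: "Z q \<Longrightarrow> Z r \<Longrightarrow> Z (q - r)" using Z_add[of q "- r"] Z_uminus[of r] by simp
lemma Z_0: "Z 0" using Z_f[of 0] by (auto intro: bexI[of _ 0])
lemma Z_sum: "(\<And>i. i \<in> S \<Longrightarrow> Z (g i)) \<Longrightarrow> Z (sum g S)"
  by (induction S rule: infinite_finite_induct) (auto intro: Z_add Z_0)
lemma not_Z_power: "\<not> Z q \<Longrightarrow> \<not> Z (q ^ n)"
  by (induction n) (auto simp: not_Z_1 dest: Z_prime)
lemma not_Z_prod: "(\<And>i. i \<in> S \<Longrightarrow> \<not> Z (g i)) \<Longrightarrow> \<not> Z (prod g S)"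
  by (induction S rule: infinite_finite_induct) (auto simp: not_Z_1 dest: Z_prime)

lemma cgenideal_iff: "q \<in> cgenideal (mpoly_ring (\<Union>Bs)) f \<longleftrightarrow> q \<in> R \<and> Z q"
  using Z_f[of q] f_R by (auto simp: cgenideal_def intro: Pol_mult)

text \<open>Covers points and the generic ideal alike, so that stalks and the function field are
  treated by the same lemmas.\<close>

definition okP :: "('x, 'f) mpoly set \<Rightarrow> bool" where
  "okP P \<longleftrightarrow> isprime (\<Union>Bs) P \<and> (\<forall>q\<in>R. Z q \<longrightarrow> q \<in> P)"

lemma okP_point: assumes "P \<in> pts" shows "okP P"
proof -
  have P: "isprime (\<Union>Bs) P" "f \<in> P" using assms by (auto simp: mproj_points_def primeideal_iff)
  then show ?thesis unfolding okP_def isprime_def isideal_def using Z_f by auto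
qed

lemma okP_generic: "okP (cgenideal (mpoly_ring (\<Union>Bs)) f)"
  unfolding okP_def isprime_def isideal_def
  using Z_0 Z_add Z_mult Z_prime not_Z_1 by (auto simp: cgenideal_iff intro: Pol_add Pol_mult)

definition fr :: "('x, 'f) mpoly set \<Rightarrow> ('x, 'f) mpoly \<Rightarrow> ('x, 'f) mpoly \<Rightarrow> bool" where
  "fr P a b \<longleftrightarrow> (\<exists>e. a \<in> mhomog Bs e \<and> b \<in> mhomog Bs e) \<and> b \<notin> P"

lemma fr_R: "fr P a b \<Longrightarrow> a \<in> R \<and> b \<in> R" by (auto simp: fr_def mhomog_iff)

text \<open>The auxiliary factor t in \<open>mfrac\<close> lies outside a prime that contains the
  ideal of f. As that ideal is itself prime, t can be cancelled.\<close>

lemma mem_mfrac: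
  assumes "okP P" "fr P a b"
  shows "(c, d) \<in> mfrac Bs f P a b \<longleftrightarrow> fr P c d \<and> Z (a * d - c * b)"
proof
  assume "(c, d) \<in> mfrac Bs f P a b"
  then have cd: "fr P c d" and t: "\<exists>t\<in>(\<Union>e. mhomog Bs e) - P. t * (a * d - c * b) \<in> cgenideal (mpoly_ring (\<Union>Bs)) f"
    by (auto simp: mfrac_def fr_def)
  from t obtain t where "t \<in> R" "t \<notin> P" "Z (t * (a * d - c * b))" by (auto simp: cgenideal_iff mhomog_iff)
  moreover then have "\<not> Z t" using assms(1) by (auto simp: okP_def)
  ultimately show "fr P c d \<and> Z (a * d - c * b)" using cd Z_prime by blast
next
  assume *: "fr P c d \<and> Z (a * d - c * b)"
  have "1 \<notin> P" using assms(1) by (simp add: okP_def isprime_def)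
  then have "1 \<in> (\<Union>e. mhomog Bs e) - P" using mhomog_1 by blast
  moreover have "1 * (a * d - c * b) \<in> cgenideal (mpoly_ring (\<Union>Bs)) f"
    using * fr_R[of P c d] fr_R[OF assms(2)] by (auto simp: cgenideal_iff intro!: Pol_diff Pol_mult)
  ultimately show "(c, d) \<in> mfrac Bs f P a b" using * unfolding mfrac_def fr_def by blast
qed

lemma mfrac_self: "okP P \<Longrightarrow> fr P a b \<Longrightarrow> (a, b) \<in> mfrac Bs f P a b"
  using mem_mfrac Z_0 by simp

lemma mfrac_eq:
  assumes P: "okP P" and ab: "fr P a b" and cd: "fr P c d"
  shows "mfrac Bs f P a b = mfrac Bs f P c d \<longleftrightarrow> Z (a * d - c * b)"
proof
  assume "mfrac Bs f P a b = mfrac Bs f P c d"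
  then have "(c, d) \<in> mfrac Bs f P a b" using mfrac_self[OF P cd] by simp
  then show "Z (a * d - c * b)" using mem_mfrac[OF P ab] by blast
next
  assume z: "Z (a * d - c * b)"
  have nz: "\<not> Z b" "\<not> Z d" using P ab cd fr_R[OF ab] fr_R[OF cd] by (auto simp: okP_def fr_def)
  have "Z (a * v - u * b) \<longleftrightarrow> Z (c * v - u * d)" for u v
  proof
    assume *: "Z (a * v - u * b)"
    have "b * (c * v - u * d) = d * (a * v - u * b) - v * (a * d - c * b)" by (simp add: algebra_simps)
    then have "Z (b * (c * v - u * d))" using Z_diff[OF Z_mult[OF *, of d] Z_mult[OF z, of v]] by simp
    then show "Z (c * v - u * d)" using Z_prime nz by blast
  next
    assume *: "Z (c * v - u * d)"
    have "d * (a * v - u * b) = b * (c * v - u * d) + v * (a * d - c * b)" by (simp add: algebra_simps)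
    then have "Z (d * (a * v - u * b))" using Z_add[OF Z_mult[OF *, of b] Z_mult[OF z, of v]] by simp
    then show "Z (a * v - u * b)" using Z_prime nz by blast
  qed
  then show "mfrac Bs f P a b = mfrac Bs f P c d"
    using mem_mfrac[OF P ab] mem_mfrac[OF P cd] by auto
qed

lemma carrier_stalk: "carrier (mproj_stalk Bs f P) = {mfrac Bs f P a b | a b. fr P a b}"
  by (auto simp: mproj_stalk_def fr_def)

lemma fr_mult: assumes P: "okP P" and ab: "fr P a b" and cd: "fr P c d" shows "fr P (a * c) (b * d)"
proof -
  obtain e where e: "a \<in> mhomog Bs e" "b \<in> mhomog Bs e" using ab[unfolded fr_def] by blast
  obtain e' where e': "c \<in> mhomog Bs e'" "d \<in> mhomog Bs e'" using cd[unfolded fr_def] by blast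
  have "isprime (\<Union>Bs) P" using P by (simp add: okP_def)
  then have "b * d \<notin> P"
    using ab cd isprime_mult[OF _ mhomog_Pol[OF e(2)] mhomog_Pol[OF e'(2)], of P] by (simp add: fr_def)
  then show ?thesis unfolding fr_def using mhomog_mult[OF e(1) e'(1)] mhomog_mult[OF e(2) e'(2)] by blast
qed

lemma fr_add: assumes P: "okP P" and ab: "fr P a b" and cd: "fr P c d" shows "fr P (a * d + c * b) (b * d)"
proof -
  obtain e0 where e0: "a \<in> mhomog Bs e0" "b \<in> mhomog Bs e0" using ab[unfolded fr_def] by blast
  obtain e' where e': "c \<in> mhomog Bs e'" "d \<in> mhomog Bs e'" using cd[unfolded fr_def] by blast
  note e = e0 e'
  have "c * b \<in> mhomog Bs (\<lambda>A. e0 A + e' A)" using mhomog_mult[OF e(2,3)] by (simp add: mult.commute)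
  then have "a * d + c * b \<in> mhomog Bs (\<lambda>A. e0 A + e' A)" using mhomog_mult[OF e(1,4)] by (intro mhomog_add)
  moreover have "b * d \<notin> P" using fr_mult[OF P ab cd] by (simp add: fr_def)
  ultimately show ?thesis using mhomog_mult[OF e(2,4)] by (auto simp: fr_def)
qed

lemma fr_same: "a \<in> mhomog Bs e \<Longrightarrow> b \<in> mhomog Bs e \<Longrightarrow> b \<notin> P \<Longrightarrow> fr P a b" by (auto simp: fr_def)

lemma fr_const: "okP P \<Longrightarrow> fr P (mconst c) 1"
  by (rule fr_same[OF mhomog_const]) (auto simp: okP_def isprime_def)

text \<open>The stalk operations are unions over representatives. They are well defined as soon as
  the summand is constant on the class, which is not empty.\<close>

lemma UN_mfrac:
  assumes "okP P" "fr P a b" "\<And>c d. fr P c d \<Longrightarrow> Z (a * d - c * b) \<Longrightarrow> F c d = w"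
  shows "(\<Union>(c, d)\<in>mfrac Bs f P a b. F c d) = w"
proof -
  have "F c d = w" if "(c, d) \<in> mfrac Bs f P a b" for c d
    using that assms(3)[of c d] unfolding mem_mfrac[OF assms(1,2)] by simp
  then show ?thesis using mfrac_self[OF assms(1,2)] by fastforce
qed

lemma stalk_mult:
  assumes P: "okP P" and ab: "fr P a b" and cd: "fr P c d"
  shows "mfrac Bs f P a b \<otimes>\<^bsub>mproj_stalk Bs f P\<^esub> mfrac Bs f P c d = mfrac Bs f P (a * c) (b * d)"
  unfolding mproj_stalk_def monoid.simps
proof (rule UN_mfrac[OF P ab], rule UN_mfrac[OF P cd])
  fix a1 b1 c1 d1 assume 1: "fr P a1 b1" "Z (a * b1 - a1 * b)" and 2: "fr P c1 d1" "Z (c * d1 - c1 * d)"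
  have "a1 * c1 * (b * d) - a * c * (b1 * d1) = - (c1 * d) * (a * b1 - a1 * b) - (a * b1) * (c * d1 - c1 * d)"
    by (simp add: algebra_simps)
  then have "Z (a1 * c1 * (b * d) - a * c * (b1 * d1))"
    using Z_diff[OF Z_mult[OF 1(2), of "- (c1 * d)"] Z_mult[OF 2(2), of "a * b1"]] by simp
  then show "mfrac Bs f P (a1 * c1) (b1 * d1) = mfrac Bs f P (a * c) (b * d)"
    using mfrac_eq[OF P fr_mult[OF P 1(1) 2(1)] fr_mult[OF P ab cd]] by blast
qed

lemma stalk_add:
  assumes P: "okP P" and ab: "fr P a b" and cd: "fr P c d"
  shows "mfrac Bs f P a b \<oplus>\<^bsub>mproj_stalk Bs f P\<^esub> mfrac Bs f P c d = mfrac Bs f P (a * d + c * b) (b * d)"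
  unfolding mproj_stalk_def ring.simps
proof (rule UN_mfrac[OF P ab], rule UN_mfrac[OF P cd])
  fix a1 b1 c1 d1 assume 1: "fr P a1 b1" "Z (a * b1 - a1 * b)" and 2: "fr P c1 d1" "Z (c * d1 - c1 * d)"
  have "(a1 * d1 + c1 * b1) * (b * d) - (a * d + c * b) * (b1 * d1) =
      - (d1 * d) * (a * b1 - a1 * b) - (b1 * b) * (c * d1 - c1 * d)"
    by (simp add: algebra_simps)
  then have "Z ((a1 * d1 + c1 * b1) * (b * d) - (a * d + c * b) * (b1 * d1))"
    using Z_diff[OF Z_mult[OF 1(2), of "- (d1 * d)"] Z_mult[OF 2(2), of "b1 * b"]] by simp
  then show "mfrac Bs f P (a1 * d1 + c1 * b1) (b1 * d1) = mfrac Bs f P (a * d + c * b) (b * d)"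
    using mfrac_eq[OF P fr_add[OF P 1(1) 2(1)] fr_add[OF P ab cd]] by blast
qed

lemma stalk_one: "\<one>\<^bsub>mproj_stalk Bs f P\<^esub> = mfrac Bs f P 1 1"
  and stalk_zero: "\<zero>\<^bsub>mproj_stalk Bs f P\<^esub> = mfrac Bs f P 0 1"
  by (simp_all add: mproj_stalk_def)

end

section \<open>A criterion for birationality\<close>

context mphyp
begin

definition D :: "('x, 'f) mpoly \<Rightarrow> ('x, 'f) mpoly set set" where
  "D q = {P \<in> pts. q \<notin> P}"

lemma openin_D: "hom_el Bs q \<Longrightarrow> openin (mproj_zariski Bs f) (D q)"
  unfolding mproj_zariski_def D_def hom_el_def by (rule topology_generated_by_Basis) blast

lemma point_prime: "P \<in> pts \<Longrightarrow> isprime (\<Union>Bs) P"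
  by (simp add: mproj_points_def primeideal_iff)

lemma point_Z: "P \<in> pts \<Longrightarrow> q \<in> R \<Longrightarrow> Z q \<Longrightarrow> q \<in> P"
  using okP_point by (simp add: okP_def)

lemma topspace_zariski [simp]: "topspace (mproj_zariski Bs f) = pts"
proof -
  have "\<And>P. P \<in> pts \<Longrightarrow> 1 \<notin> P" using point_prime by (simp add: isprime_def)
  then have "{P \<in> pts. 1 \<notin> P} = pts" by blast
  moreover have "1 \<in> (\<Union>e. mhomog Bs e)" using mhomog_1 by blast
  ultimately show ?thesis unfolding mproj_zariski_def topology_generated_by_topspace by blast
qed

text \<open>Points are prime, so a product of multihomogeneous polynomials cuts out the intersection
  of two basic open sets.\<close>

lemma zariski_basis:
  assumes "openin (mproj_zariski Bs f) T" "P \<in> T"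
  shows "\<exists>q. hom_el Bs q \<and> P \<in> D q \<and> D q \<subseteq> T"
proof -
  let ?S = "{{P \<in> pts. q \<notin> P} | q. q \<in> (\<Union>e. mhomog Bs e)}"
  have "generate_topology_on ?S T"
    using assms(1) unfolding mproj_zariski_def openin_topology_generated_by_iff .
  then show ?thesis using assms(2)
  proof (induction arbitrary: P)
    case (Int a b)
    then obtain q r where q: "hom_el Bs q" "P \<in> D q" "D q \<subseteq> a" and r: "hom_el Bs r" "P \<in> D r" "D r \<subseteq> b"
      by (meson IntD1 IntD2)
    have "D (q * r) = D q \<inter> D r"
      using isprime_mult[OF point_prime hom_el_Pol[OF q(1)] hom_el_Pol[OF r(1)]] by (auto simp: D_def)
    then show ?case using q r hom_el_mult[OF q(1) r(1)] by (intro exI[of _ "q * r"]) auto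
  next
    case (UN K)
    then obtain k where k: "k \<in> K" "P \<in> k" by blast
    obtain q where "hom_el Bs q" "P \<in> D q" "D q \<subseteq> k" using UN.IH[OF k] by blast
    then show ?case using k(1) by blast
  next
    case (Basis s)
    then obtain q where "s = D q" "hom_el Bs q" unfolding D_def hom_el_def by blast
    then show ?case using Basis.prems by blast
  qed simp
qed

lemma generic_point: "cgenideal (mpoly_ring (\<Union>Bs)) f \<in> pts"
proof -
  let ?P = "cgenideal (mpoly_ring (\<Union>Bs)) f"
  interpret cring "mpoly_ring (\<Union>Bs)" by (rule cring_mpoly_ring)
  have P: "isprime (\<Union>Bs) ?P" using okP_generic by (simp add: okP_def)
  have fP: "f \<in> ?P" using f_R by (intro cgenideal_self) simp
  have PR: "?P \<subseteq> R" using P by (simp add: isprime_def isideal_def)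
  have "ideal ?P (mpoly_ring (\<Union>Bs))" using P by (simp add: isprime_def ideal_iff)
  then have 1: "genideal (mpoly_ring (\<Union>Bs)) (?P \<inter> (\<Union>e. mhomog Bs e)) \<subseteq> ?P"
    by (rule genideal_minimal) blast
  have I: "ideal (genideal (mpoly_ring (\<Union>Bs)) (?P \<inter> (\<Union>e. mhomog Bs e))) (mpoly_ring (\<Union>Bs))"
    using PR by (intro genideal_ideal) auto
  have "f \<in> ?P \<inter> (\<Union>e. mhomog Bs e)" using fP f_hom unfolding hom_el_def by blast
  moreover have "?P \<inter> (\<Union>e. mhomog Bs e) \<subseteq> genideal (mpoly_ring (\<Union>Bs)) (?P \<inter> (\<Union>e. mhomog Bs e))"
    using PR by (intro genideal_self) auto
  ultimately have "f \<in> genideal (mpoly_ring (\<Union>Bs)) (?P \<inter> (\<Union>e. mhomog Bs e))" by blast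
  then have 2: "?P \<subseteq> genideal (mpoly_ring (\<Union>Bs)) (?P \<inter> (\<Union>e. mhomog Bs e))"
    by (rule cgenideal_minimal[OF I])
  have 3: "\<forall>A\<in>Bs. \<exists>x\<in>A. mvar x \<notin> ?P" using generic_block by (auto simp: cgenideal_iff)
  show ?thesis unfolding mproj_points_def primeideal_iff using P fP 3 subset_antisym[OF 2 1] by blast
qed

text \<open>The generic point lies in every non-empty basic open set.\<close>

lemma dense_D:
  assumes "hom_el Bs q" "\<not> Z q"
  shows "mproj_zariski Bs f closure_of (D q) = topspace (mproj_zariski Bs f)"
proof -
  let ?g = "cgenideal (mpoly_ring (\<Union>Bs)) f"
  have "P \<in> mproj_zariski Bs f closure_of (D q)" if P: "P \<in> pts" for P
    unfolding in_closure_of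
  proof (intro conjI allI impI)
    show "P \<in> topspace (mproj_zariski Bs f)" using P by simp
    fix T assume T: "P \<in> T \<and> openin (mproj_zariski Bs f) T"
    then obtain r where r: "hom_el Bs r" "P \<in> D r" "D r \<subseteq> T" using zariski_basis by blast
    have "\<not> Z r" using r(2) point_Z[OF P hom_el_Pol[OF r(1)]] by (auto simp: D_def)
    then have "?g \<in> D r" "?g \<in> D q" using generic_point assms(2) by (auto simp: D_def cgenideal_iff)
    then show "\<exists>y. y \<in> D q \<and> y \<in> T" using r(3) by blast
  qed
  then show ?thesis using closure_of_subset_topspace[of "mproj_zariski Bs f" "D q"] by auto
qed

lemma Z_prod_diff:
  assumes "\<And>i. i \<in> S \<Longrightarrow> Z (g i - h i)" shows "Z (prod g S - prod h S)"
  using assms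
proof (induction S rule: infinite_finite_induct)
  case (insert x S)
  have "prod g (insert x S) - prod h (insert x S) = prod g S * (g x - h x) + h x * (prod g S - prod h S)"
    using insert.hyps by (simp add: algebra_simps)
  moreover have "Z (prod g S * (g x - h x))" "Z (h x * (prod g S - prod h S))"
    using insert by (auto intro: Z_mult)
  ultimately show ?case using Z_add by simp
qed (simp_all add: Z_0)

lemma Z_power_diff: "Z (g - h) \<Longrightarrow> Z (g ^ n - h ^ n)"
  using Z_prod_diff[of "{..<n}" "\<lambda>_. g" "\<lambda>_. h"] by simp

text \<open>In a monomial each variable of the block \<open>A\<close> brings in one factor
  \<open>a A\<close> or \<open>b A\<close>. By multihomogeneity there are \<open>e A\<close> such
  factors in every monomial of q, so they can be taken out of the sum.\<close>

lemma Z_rescale: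
  assumes ab: "\<And>A x. A \<in> Bs \<Longrightarrow> x \<in> A \<Longrightarrow> Z (a A * \<rho> x - b A * mvar x)" and q: "q \<in> mhomog Bs e"
  shows "Z ((\<Prod>A\<in>Bs. a A ^ e A) * msubst \<rho> q - (\<Prod>A\<in>Bs. b A ^ e A) * q)"
proof -
  have fin: "finite (\<Union>Bs)" using finBs fin_block by auto
  have mono: "Z ((\<Prod>A\<in>Bs. a A ^ e A) * mev \<rho> m - (\<Prod>A\<in>Bs. b A ^ e A) * mev mvar m)" if "m \<in> mkeys q" for m
  proof -
    have km: "mkeys m \<subseteq> \<Union>Bs" "\<And>A. A \<in> Bs \<Longrightarrow> e A = (\<Sum>x\<in>A. look m x)"
      using q that by (auto simp: mhomog_def mpoly_ring_def)
    have split: "(\<Prod>A\<in>Bs. c A ^ e A) * mev y m = (\<Prod>A\<in>Bs. \<Prod>x\<in>A. (c A * y x) ^ look m x)" for c :: "'x set \<Rightarrow> ('x, 'f) mpoly" and y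
    proof -
      have "mev y m = (\<Prod>A\<in>Bs. \<Prod>x\<in>A. y x ^ look m x)"
        unfolding mev_superset[OF fin km(1)] using finBs fin_block disj
        by (subst prod.Union_disjoint) (auto simp: disjoint_def)
      moreover have "(\<Prod>A\<in>Bs. c A ^ e A) = (\<Prod>A\<in>Bs. \<Prod>x\<in>A. c A ^ look m x)"
        by (intro prod.cong refl) (simp add: km(2) power_sum)
      ultimately show ?thesis by (simp add: prod.distrib power_mult_distrib)
    qed
    show ?thesis unfolding split by (intro Z_prod_diff Z_power_diff ab)
  qed
  have e: "h * msubst y q = (\<Sum>m\<in>mkeys q. mconst (look q m) * (h * mev y m))" for h and y :: "'x \<Rightarrow> ('x, 'f) mpoly"
    unfolding meval_def sum_distrib_left by (simp only: mult.left_commute)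
  have "Z ((\<Prod>A\<in>Bs. a A ^ e A) * msubst \<rho> q - (\<Prod>A\<in>Bs. b A ^ e A) * msubst mvar q)"
    unfolding e sum_subtractf[symmetric] right_diff_distrib[symmetric] by (intro Z_sum Z_mult mono)
  then show ?thesis by (simp only: msubst_mvar)
qed

end

text \<open>Outside its zero set all rescaling factors are invertible, and so is one variable of
  each block; the latter keeps the image of a point away from the irrelevant ideals.\<close>

definition dprod :: "'x set set \<Rightarrow> (('x, 'f::field) mpoly \<Rightarrow> bool) \<Rightarrow> ('x set \<Rightarrow> ('x, 'f) mpoly) \<Rightarrow>
    ('x set \<Rightarrow> ('x, 'f) mpoly) \<Rightarrow> ('x, 'f) mpoly" where
  "dprod Bs Z a b = (\<Prod>A\<in>Bs. a A * b A * mvar (SOME x. x \<in> A \<and> \<not> Z (mvar x)))"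

text \<open>Rational maps in both directions, given by forms and compatible with the equations,
  whose composites are the identity up to one factor b / a for each block.\<close>

locale birmap = X: mphyp Bs f Z + Y: mphyp Bs' f' Z'
  for Bs :: "'x set set" and f :: "('x, 'f::field) mpoly" and Z
    and Bs' :: "'y set set" and f' :: "('y, 'f) mpoly" and Z' +
  fixes \<sigma> :: "'y \<Rightarrow> ('x, 'f) mpoly" and \<tau> :: "'x \<Rightarrow> ('y, 'f) mpoly"
    and d :: "'y set \<Rightarrow> 'x set \<Rightarrow> nat" and d' :: "'x set \<Rightarrow> 'y set \<Rightarrow> nat"
    and a b :: "'x set \<Rightarrow> ('x, 'f) mpoly" and a' b' :: "'y set \<Rightarrow> ('y, 'f) mpoly"
  assumes \<sigma>_hom: "\<And>B y. B \<in> Bs' \<Longrightarrow> y \<in> B \<Longrightarrow> \<sigma> y \<in> mhomog Bs (d B)"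
    and \<tau>_hom: "\<And>A x. A \<in> Bs \<Longrightarrow> x \<in> A \<Longrightarrow> \<tau> x \<in> mhomog Bs' (d' A)"
    and \<sigma>_Z: "\<And>q. Z' q \<Longrightarrow> Z (msubst \<sigma> q)" and \<tau>_Z: "\<And>q. Z q \<Longrightarrow> Z' (msubst \<tau> q)"
    and ab_hom: "\<And>A. A \<in> Bs \<Longrightarrow> hom_el Bs (a A) \<and> hom_el Bs (b A) \<and> \<not> Z (a A) \<and> \<not> Z (b A)"
    and ab: "\<And>A x. A \<in> Bs \<Longrightarrow> x \<in> A \<Longrightarrow> Z (a A * msubst \<sigma> (\<tau> x) - b A * mvar x)"
    and ab'_hom: "\<And>B. B \<in> Bs' \<Longrightarrow> hom_el Bs' (a' B) \<and> hom_el Bs' (b' B) \<and> \<not> Z' (a' B) \<and> \<not> Z' (b' B)"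
    and ab': "\<And>B y. B \<in> Bs' \<Longrightarrow> y \<in> B \<Longrightarrow> Z' (a' B * msubst \<tau> (\<sigma> y) - b' B * mvar y)"
begin

lemma sym: "birmap Bs' f' Z' Bs f Z \<tau> \<sigma> d' d a' b' a b"
  by unfold_locales (fact \<sigma>_hom \<tau>_hom \<sigma>_Z \<tau>_Z ab_hom ab ab'_hom ab')+

abbreviation "\<theta> \<equiv> msubst \<sigma>"
abbreviation "\<eta> \<equiv> msubst \<tau>"
abbreviation "\<delta> \<equiv> dprod Bs Z a b"
abbreviation "\<delta>' \<equiv> dprod Bs' Z' a' b'"
definition "alp e = (\<Prod>A\<in>Bs. a A ^ e A)"
definition "bet e = (\<Prod>A\<in>Bs. b A ^ e A)"

lemma \<theta>_hom: "q \<in> mhomog Bs' e \<Longrightarrow> \<theta> q \<in> mhomog Bs (\<lambda>B. \<Sum>A\<in>Bs'. e A * d A B)"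
  by (rule msubst_mhomog[OF _ Y.finBs Y.fin_block Y.disj \<sigma>_hom])

lemma \<theta>_hom_el: "hom_el Bs' q \<Longrightarrow> hom_el Bs (\<theta> q)"
  unfolding hom_el_def using \<theta>_hom by blast

lemma \<theta>_Pol: "q \<in> Y.R \<Longrightarrow> \<theta> q \<in> X.R"
  using \<sigma>_hom by (intro msubst_Pol) (auto dest: mhomog_Pol)

lemma comp_rescale: "q \<in> mhomog Bs e \<Longrightarrow> Z (alp e * \<theta> (\<eta> q) - bet e * q)"
  unfolding alp_def bet_def mc.meval_subst using ab by (intro X.Z_rescale) auto

lemma not_Z_alp: "\<not> Z (alp e)" "\<not> Z (bet e)"
  unfolding alp_def bet_def using ab_hom by (auto intro!: X.not_Z_prod X.not_Z_power)

lemma ab_R: "A \<in> Bs \<Longrightarrow> a A \<in> X.R" "A \<in> Bs \<Longrightarrow> b A \<in> X.R"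
  using ab_hom by (blast intro: hom_el_Pol)+

lemma alp_R: "alp e \<in> X.R" "bet e \<in> X.R"
  unfolding alp_def bet_def by (auto intro!: Pol_prod Pol_power ab_R)

lemma some_var:
  assumes "A \<in> Bs"
  shows "(SOME x. x \<in> A \<and> \<not> Z (mvar x)) \<in> A \<and> \<not> Z (mvar (SOME x. x \<in> A \<and> \<not> Z (mvar x)))"
proof (rule someI_ex)
  obtain x where "x \<in> A" "\<not> Z (mvar x)" by (rule bexE[OF X.generic_block[OF assms]])
  then show "\<exists>x. x \<in> A \<and> \<not> Z (mvar x)" by (intro exI conjI)
qed

lemma \<delta>_hom: "hom_el Bs \<delta>"
proof -
  have "finite S \<Longrightarrow> S \<subseteq> Bs \<Longrightarrow> hom_el Bs (\<Prod>A\<in>S. a A * b A * mvar (SOME x. x \<in> A \<and> \<not> Z (mvar x)))" for S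
  proof (induction S rule: finite_induct)
    case (insert A S)
    have "hom_el Bs (mvar (SOME x. x \<in> A \<and> \<not> Z (mvar x)))"
    proof (rule hom_elI[OF mvar_mhomog[OF X.fin_block _ _ X.disj]])
      show "A \<in> Bs" "A \<in> Bs" using insert.prems by auto
      then show "(SOME x. x \<in> A \<and> \<not> Z (mvar x)) \<in> A" using some_var[of A] by blast
    qed
    then show ?case unfolding prod.insert[OF insert.hyps]
      using insert ab_hom[of A] by (intro hom_el_mult) auto
  qed (simp add: hom_el_1)
  from this[OF X.finBs order_refl] show ?thesis by (simp add: dprod_def)
qed

lemma not_Z_\<delta>: "\<not> Z \<delta>"
  unfolding dprod_def
proof (rule X.not_Z_prod)
  fix A assume "A \<in> Bs"
  then show "\<not> Z (a A * b A * mvar (SOME x. x \<in> A \<and> \<not> Z (mvar x)))"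
    using ab_hom[of A] some_var[of A] X.Z_prime by blast
qed

text \<open>Applying the other substitution to a vanishing \<open>\<theta> q\<close> would make a
  multiple of q by a non-zero factor vanish, by \<open>comp_rescale\<close> with the sides
  exchanged.\<close>

lemma \<theta>_not_Z: assumes "hom_el Bs' q" "\<not> Z' q" shows "\<not> Z (\<theta> q)"
proof
  interpret S: birmap Bs' f' Z' Bs f Z \<tau> \<sigma> d' d a' b' a b by (rule sym)
  assume "Z (\<theta> q)"
  then have 1: "Z' (S.alp e * \<eta> (\<theta> q))" for e by (intro Y.Z_mult \<tau>_Z)
  obtain e where e: "q \<in> mhomog Bs' e" using assms(1) by (auto simp: hom_el_def)
  have "Z' (S.alp e * \<eta> (\<theta> q) - (S.alp e * \<eta> (\<theta> q) - S.bet e * q))"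
    by (rule Y.Z_diff[OF 1 S.comp_rescale[OF e]])
  then have "Z' (S.bet e * q)" by simp
  then show False using S.not_Z_alp assms(2) Y.Z_prime by blast
qed

text \<open>Both the point and its image have to avoid the exceptional locus;
  \<open>\<theta> \<delta>'\<close> pulls back the condition at the image. This symmetry lets
  \<open>g\<close> map \<open>U\<close> onto the corresponding set on the other side.\<close>

definition "U = {P \<in> X.pts. \<delta> \<notin> P \<and> \<theta> \<delta>' \<notin> P}"
definition "g P = hcore Bs' {q \<in> Y.R. \<theta> q \<in> P}"

lemma U_pt: "P \<in> U \<Longrightarrow> P \<in> X.pts" by (simp add: U_def)
lemma U_ok: "P \<in> U \<Longrightarrow> X.okP P" using X.okP_point by (simp add: U_def)

end

text \<open>The context is reopened several times: \<open>S\<close> is the statement with the two sides exchanged, and it sees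
  only the facts that were proved before its interpretation.\<close>

context birmap
begin

interpretation S: birmap Bs' f' Z' Bs f Z \<tau> \<sigma> d' d a' b' a b by (rule sym)

lemma U_D: "U = X.D (\<delta> * \<theta> \<delta>')"
proof -
  have "\<delta> * \<theta> \<delta>' \<in> P \<longleftrightarrow> \<delta> \<in> P \<or> \<theta> \<delta>' \<in> P" if "P \<in> X.pts" for P
    by (rule isprime_mult[OF X.point_prime[OF that] hom_el_Pol[OF \<delta>_hom] hom_el_Pol[OF \<theta>_hom_el[OF S.\<delta>_hom]]])
  then show ?thesis unfolding U_def X.D_def by blast
qed

lemma \<delta>\<delta>_hom: "hom_el Bs (\<delta> * \<theta> \<delta>')"
  by (rule hom_el_mult[OF \<delta>_hom \<theta>_hom_el[OF S.\<delta>_hom]])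

lemma U_open: "openin (mproj_zariski Bs f) U"
  by (subst U_D, rule X.openin_D[OF \<delta>\<delta>_hom])

lemma U_dense: "mproj_zariski Bs f closure_of U = topspace (mproj_zariski Bs f)"
  unfolding U_D
proof (rule X.dense_D[OF \<delta>\<delta>_hom], rule notI)
  assume "Z (\<delta> * \<theta> \<delta>')"
  from X.Z_prime[OF this] show False using not_Z_\<delta> \<theta>_not_Z[OF S.\<delta>_hom S.not_Z_\<delta>] by (elim disjE) simp_all
qed

lemma not_mem_factor:
  assumes "P \<in> X.pts" "(\<Prod>i\<in>S. h i) \<notin> P" "\<And>i. i \<in> S \<Longrightarrow> h i \<in> X.R" "finite S" "i \<in> S"
  shows "h i \<notin> P"
proof
  have P: "isprime (\<Union>Bs) P" by (rule X.point_prime[OF assms(1)])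
  assume "h i \<in> P"
  moreover have "(\<Prod>i\<in>S - {i}. h i) \<in> X.R" using assms(3) by (intro Pol_prod) auto
  ultimately have "h i * (\<Prod>i\<in>S - {i}. h i) \<in> P" using isprime_mult[OF P] assms(3,5) by blast
  then show False using assms(2) prod.remove[OF assms(4,5), of h] by simp
qed

lemma \<delta>_factors:
  assumes P: "P \<in> X.pts" "\<delta> \<notin> P" and A: "A \<in> Bs"
  shows "a A \<notin> P \<and> b A \<notin> P"
proof -
  have R: "a B \<in> X.R" "b B \<in> X.R" "mvar (SOME x. x \<in> B \<and> \<not> Z (mvar x)) \<in> X.R" if "B \<in> Bs" for B
    using some_var[OF that] that by (auto intro!: ab_R Pol_var)
  have "a A * b A * mvar (SOME x. x \<in> A \<and> \<not> Z (mvar x)) \<notin> P"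
    using P(2) unfolding dprod_def
    by (rule not_mem_factor[OF P(1) _ _ X.finBs A]) (intro Pol_mult R)
  then show ?thesis
    unfolding isprime_mult[OF X.point_prime[OF P(1)] Pol_mult[OF R(1)[OF A] R(2)[OF A]] R(3)[OF A]]
      isprime_mult[OF X.point_prime[OF P(1)] R(1)[OF A] R(2)[OF A]] by simp
qed

lemma alp_notin:
  assumes "P \<in> X.pts" "\<delta> \<notin> P" shows "alp e \<notin> P \<and> bet e \<notin> P"
  unfolding alp_def bet_def using \<delta>_factors[OF assms] X.point_prime[OF assms(1)]
  by (intro conjI isprime_prod[of "\<Union>Bs"] isprime_power[of "\<Union>Bs"] Pol_power ab_R) auto

text \<open>At a point of \<open>U\<close> the factors \<open>alp e\<close> and \<open>bet e\<close>
  lie outside the prime, so \<open>comp_rescale\<close> transfers membership from one side to the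
  other.\<close>

lemma comp_mem:
  assumes P: "P \<in> U" and q: "q \<in> mhomog Bs e" shows "\<theta> (\<eta> q) \<in> P \<longleftrightarrow> q \<in> P"
proof -
  have pr: "isprime (\<Union>Bs) P" and Pp: "P \<in> X.pts" and n: "alp e \<notin> P" "bet e \<notin> P"
    using P X.point_prime alp_notin by (auto simp: U_def)
  have R: "\<theta> (\<eta> q) \<in> X.R" "q \<in> X.R" using q S.\<theta>_hom[OF q] mhomog_Pol by (auto intro: \<theta>_Pol)
  have I: "isideal (\<Union>Bs) P" using pr by (simp add: isprime_def)
  have "alp e * \<theta> (\<eta> q) - bet e * q \<in> X.R" using R alp_R by (intro Pol_diff Pol_mult)
  then have z: "alp e * \<theta> (\<eta> q) - bet e * q \<in> P" using X.point_Z[OF Pp _ comp_rescale[OF q]] by blast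
  have "alp e * \<theta> (\<eta> q) \<in> P \<longleftrightarrow> bet e * q \<in> P"
  proof
    assume "alp e * \<theta> (\<eta> q) \<in> P" from isideal_diff[OF I this z] show "bet e * q \<in> P" by simp
  next
    assume "bet e * q \<in> P"
    then have "(alp e * \<theta> (\<eta> q) - bet e * q) + bet e * q \<in> P" using I z unfolding isideal_def by blast
    then show "alp e * \<theta> (\<eta> q) \<in> P" by simp
  qed
  then show ?thesis using isprime_mult[OF pr alp_R(1) R(1)] isprime_mult[OF pr alp_R(2) R(2)] n by blast
qed

lemma g_props:
  assumes P: "P \<in> U"
  shows "isprime (\<Union>Bs') (g P)" "B \<in> Bs' \<Longrightarrow> wt_homog B (g P)"
    "q \<in> mhomog Bs' e \<Longrightarrow> q \<in> g P \<longleftrightarrow> \<theta> q \<in> P"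
proof -
  have pr: "isprime (\<Union>Bs) P" using P X.point_prime by (simp add: U_def)
  then have I: "isideal (\<Union>Bs) P" by (simp add: isprime_def)
  have "isprime (\<Union>Bs') {q \<in> Y.R. \<theta> q \<in> P}"
    unfolding isprime_def isideal_def
  proof (intro conjI ballI impI)
    show "1 \<notin> {q \<in> Y.R. \<theta> q \<in> P}" using pr by (simp add: isprime_def)
    show "q + r \<in> {q \<in> Y.R. \<theta> q \<in> P}" if "q \<in> {q \<in> Y.R. \<theta> q \<in> P}" "r \<in> {q \<in> Y.R. \<theta> q \<in> P}" for q r
      using that I by (simp add: isideal_def mc.meval_simps Pol_add)
    show "r * q \<in> {q \<in> Y.R. \<theta> q \<in> P}" if "q \<in> {q \<in> Y.R. \<theta> q \<in> P}" "r \<in> Y.R" for q r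
      using that I \<theta>_Pol[of r] by (simp add: isideal_def mc.meval_simps Pol_mult)
    fix q r assume "q \<in> Y.R" "r \<in> Y.R" "q * r \<in> {q \<in> Y.R. \<theta> q \<in> P}"
    then show "q \<in> {q \<in> Y.R. \<theta> q \<in> P} \<or> r \<in> {q \<in> Y.R. \<theta> q \<in> P}"
      using isprime_mult[OF pr \<theta>_Pol \<theta>_Pol, of q r] by (simp add: mc.meval_simps)
  next
    show "0 \<in> {q \<in> Y.R. \<theta> q \<in> P}" using I by (simp add: isideal_def)
  qed blast
  note h = hcore[OF Y.finBs this]
  show "isprime (\<Union>Bs') (g P)" "B \<in> Bs' \<Longrightarrow> wt_homog B (g P)" unfolding g_def by (rule h(1), rule h(2))
  show "q \<in> g P \<longleftrightarrow> \<theta> q \<in> P" if "q \<in> mhomog Bs' e" 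
    unfolding g_def h(3)[OF that] using mhomog_Pol[OF that] by simp
qed

lemma g_hom_el: "P \<in> U \<Longrightarrow> hom_el Bs' q \<Longrightarrow> q \<in> g P \<longleftrightarrow> \<theta> q \<in> P"
  unfolding hom_el_def using g_props(3) by blast

text \<open>The image avoids \<open>\<eta> \<delta>\<close> because P avoids \<delta>, by
  \<open>comp_mem\<close>. The variables among the factors of \<delta>' show that it contains no
  whole block.\<close>

lemma g_V: assumes P: "P \<in> U" shows "g P \<in> S.U"
proof -
  note pr = g_props(1)[OF P]
  have Pp: "P \<in> X.pts" and n: "\<delta> \<notin> P" "\<theta> \<delta>' \<notin> P" using P by (auto simp: U_def)
  have \<delta>': "\<delta>' \<notin> g P" using g_hom_el[OF P S.\<delta>_hom] n by simp
  obtain e where e: "\<delta> \<in> mhomog Bs e" using \<delta>_hom by (auto simp: hom_el_def)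
  have \<eta>\<delta>: "\<eta> \<delta> \<notin> g P"
    using g_hom_el[OF P S.\<theta>_hom_el[OF \<delta>_hom]] comp_mem[OF P e] n by simp
  have "mvar (SOME y. y \<in> B \<and> \<not> Z' (mvar y)) \<notin> g P" if B: "B \<in> Bs'" for B
  proof
    let ?y = "SOME y. y \<in> B \<and> \<not> Z' (mvar y)"
    assume y: "mvar ?y \<in> g P"
    have I: "isideal (\<Union>Bs') (g P)" using pr by (simp add: isprime_def)
    have R: "a' C * b' C * mvar (SOME y. y \<in> C \<and> \<not> Z' (mvar y)) \<in> Y.R" if "C \<in> Bs'" for C
      using S.some_var[OF that] that by (intro Pol_mult) (auto intro!: S.ab_R Pol_var)
    have "\<delta>' = (a' B * b' B * (\<Prod>A\<in>Bs' - {B}. a' A * b' A * mvar (SOME x. x \<in> A \<and> \<not> Z' (mvar x)))) * mvar ?y"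
      unfolding dprod_def prod.remove[OF Y.finBs B] by (simp only: mult_ac)
    moreover have "a' B * b' B * (\<Prod>A\<in>Bs' - {B}. a' A * b' A * mvar (SOME x. x \<in> A \<and> \<not> Z' (mvar x))) \<in> Y.R"
    proof (rule Pol_mult[OF Pol_mult[OF S.ab_R(1)[OF B] S.ab_R(2)[OF B]]], rule Pol_prod)
      show "a' A * b' A * mvar (SOME x. x \<in> A \<and> \<not> Z' (mvar x)) \<in> Y.R" if "A \<in> Bs' - {B}" for A
        using R[of A] that by simp
    qed
    ultimately have "\<delta>' \<in> g P" using I y by (simp add: isideal_def)
    then show False using \<delta>' by simp
  qed
  then have "\<forall>B\<in>Bs'. \<exists>y\<in>B. mvar y \<notin> g P" using S.some_var by blast
  moreover have "f' \<in> g P"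
  proof -
    have "Z' f'" using Y.Z_f[OF Y.f_R] by (intro iffD2[OF Y.Z_f[OF Y.f_R]] bexI[of _ 1]) auto
    then have "\<theta> f' \<in> P" using X.point_Z[OF Pp \<theta>_Pol[OF Y.f_R] \<sigma>_Z] by blast
    then show ?thesis using g_hom_el[OF P Y.f_hom] by simp
  qed
  moreover have "g P = genideal (mpoly_ring (\<Union>Bs')) (g P \<inter> (\<Union>e. mhomog Bs' e))"
    using pr g_props(2)[OF P] by (intro wt_homog_generated[OF Y.finBs]) (auto simp: isprime_def)
  ultimately have "g P \<in> Y.pts" unfolding mproj_points_def primeideal_iff using pr by blast
  then show ?thesis using \<delta>' \<eta>\<delta> by (simp add: S.U_def)
qed

end

context birmap
begin

interpretation S: birmap Bs' f' Z' Bs f Z \<tau> \<sigma> d' d a' b' a b by (rule sym)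

text \<open>Points are generated by their multihomogeneous elements, for which
  \<open>comp_mem\<close> decides membership.\<close>

lemma g_inverse: assumes P: "P \<in> U" shows "S.g (g P) = P"
proof -
  have "S.g (g P) \<in> U" using S.g_V[OF g_V[OF P]] .
  then have 1: "S.g (g P) = genideal (mpoly_ring (\<Union>Bs)) (S.g (g P) \<inter> (\<Union>e. mhomog Bs e))"
    by (simp add: U_def mproj_points_def)
  have 2: "P = genideal (mpoly_ring (\<Union>Bs)) (P \<inter> (\<Union>e. mhomog Bs e))"
    using P by (simp add: U_def mproj_points_def)
  have "q \<in> S.g (g P) \<longleftrightarrow> q \<in> P" if "q \<in> mhomog Bs e" for q e
    using S.g_props(3)[OF g_V[OF P] that] g_props(3)[OF P S.\<theta>_hom[OF that]] comp_mem[OF P that] by simp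
  then have "S.g (g P) \<inter> (\<Union>e. mhomog Bs e) = P \<inter> (\<Union>e. mhomog Bs e)" by blast
  then show ?thesis using 1 2 by metis
qed

lemma preimage_open:
  assumes "openin (mproj_zariski Bs' f') W" shows "openin (mproj_zariski Bs f) {P \<in> U. g P \<in> W}"
proof (subst openin_subopen, intro ballI)
  fix P assume P: "P \<in> {P \<in> U. g P \<in> W}"
  then obtain q where q: "hom_el Bs' q" "g P \<in> Y.D q" "Y.D q \<subseteq> W" using Y.zariski_basis[OF assms] by blast
  have "openin (mproj_zariski Bs f) (U \<inter> X.D (\<theta> q))"
    by (rule openin_Int[OF U_open X.openin_D[OF \<theta>_hom_el[OF q(1)]]])
  moreover have "P \<in> U \<inter> X.D (\<theta> q)"
    using P q(2) g_hom_el[OF _ q(1), of P] U_pt by (auto simp: X.D_def Y.D_def)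
  moreover have "U \<inter> X.D (\<theta> q) \<subseteq> {P \<in> U. g P \<in> W}"
  proof
    fix Q assume Q: "Q \<in> U \<inter> X.D (\<theta> q)"
    then have "g Q \<in> Y.D q" using g_hom_el[OF _ q(1), of Q] S.U_pt[OF g_V] by (auto simp: X.D_def Y.D_def)
    then show "Q \<in> {P \<in> U. g P \<in> W}" using Q q(3) by blast
  qed
  ultimately show "\<exists>T. openin (mproj_zariski Bs f) T \<and> P \<in> T \<and> T \<subseteq> {P \<in> U. g P \<in> W}" by blast
qed

lemma topspace_U: "topspace (subtopology (mproj_zariski Bs f) U) = U"
  using U_pt by (auto simp: topspace_subtopology)

lemma g_continuous:
  "continuous_map (subtopology (mproj_zariski Bs f) U) (subtopology (mproj_zariski Bs' f') S.U) g"
  unfolding continuous_map_in_subtopology unfolding continuous_map_def topspace_U Y.topspace_zariski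
proof (intro conjI allI impI)
  show "g \<in> U \<rightarrow> S.U" using g_V by blast
  then show "g \<in> U \<rightarrow> Y.pts" using S.U_pt by blast
  fix W assume "openin (mproj_zariski Bs' f') W"
  then show "openin (subtopology (mproj_zariski Bs f) U) {P \<in> U. g P \<in> W}"
    unfolding openin_open_subtopology[OF U_open] using preimage_open by blast
qed

end

section \<open>The homeomorphism and the pullback of fractions and sections\<close>

context birmap
begin

interpretation S: birmap Bs' f' Z' Bs f Z \<tau> \<sigma> d' d a' b' a b by (rule sym)

lemma g_homeo:
  "homeomorphic_map (subtopology (mproj_zariski Bs f) U) (subtopology (mproj_zariski Bs' f') S.U) g"
  unfolding homeomorphic_map_maps homeomorphic_maps_def topspace_U S.topspace_U
  using g_continuous S.g_continuous g_inverse S.g_inverse by blast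

text \<open>Pullback of a fraction, encoded as a union over representatives like the operations of
  the stalk.\<close>

definition "tr P x = (\<Union>(u, v)\<in>x. mfrac Bs f P (\<theta> u) (\<theta> v))"

lemma fr_\<theta>: assumes "P \<in> U" "Y.fr (g P) u v" shows "X.fr P (\<theta> u) (\<theta> v)"
proof -
  obtain e where e: "u \<in> mhomog Bs' e" "v \<in> mhomog Bs' e" "v \<notin> g P" using assms(2) by (auto simp: Y.fr_def)
  then have "\<theta> v \<notin> P" using g_props(3)[OF assms(1) e(2)] by simp
  then show ?thesis using X.fr_same[OF \<theta>_hom[OF e(1)] \<theta>_hom[OF e(2)]] by blast
qed

lemma gP_ok: "P \<in> U \<Longrightarrow> Y.okP (g P)" by (rule S.U_ok[OF g_V])

lemma tr_mfrac:
  assumes P: "P \<in> U" and uv: "Y.fr (g P) u v"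
  shows "tr P (mfrac Bs' f' (g P) u v) = mfrac Bs f P (\<theta> u) (\<theta> v)"
  unfolding tr_def
proof (rule Y.UN_mfrac[OF gP_ok[OF P] uv])
  fix c e assume ce: "Y.fr (g P) c e" "Z' (u * e - c * v)"
  have "u * e - c * v = - (c * v - u * e)" by simp
  then have "Z' (c * v - u * e)" using Y.Z_uminus[OF ce(2)] by simp
  from \<sigma>_Z[OF this] have "Z (\<theta> c * \<theta> v - \<theta> u * \<theta> e)" by (simp add: mc.meval_simps)
  then show "mfrac Bs f P (\<theta> c) (\<theta> e) = mfrac Bs f P (\<theta> u) (\<theta> v)"
    using X.mfrac_eq[OF U_ok[OF P] fr_\<theta>[OF P ce(1)] fr_\<theta>[OF P uv]] by blast
qed

lemma tr_carrier:
  assumes "P \<in> U" "x \<in> carrier (mproj_stalk Bs' f' (g P))" shows "tr P x \<in> carrier (mproj_stalk Bs f P)"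
  using assms tr_mfrac[OF assms(1)] fr_\<theta>[OF assms(1)] unfolding X.carrier_stalk Y.carrier_stalk by blast

lemma tr_ring:
  assumes P: "P \<in> U" and x: "x \<in> carrier (mproj_stalk Bs' f' (g P))" and y: "y \<in> carrier (mproj_stalk Bs' f' (g P))"
  shows "tr P (x \<otimes>\<^bsub>mproj_stalk Bs' f' (g P)\<^esub> y) = tr P x \<otimes>\<^bsub>mproj_stalk Bs f P\<^esub> tr P y"
    "tr P (x \<oplus>\<^bsub>mproj_stalk Bs' f' (g P)\<^esub> y) = tr P x \<oplus>\<^bsub>mproj_stalk Bs f P\<^esub> tr P y"
proof -
  obtain u v where u: "Y.fr (g P) u v" "x = mfrac Bs' f' (g P) u v" using x unfolding Y.carrier_stalk by blast
  obtain c e where c: "Y.fr (g P) c e" "y = mfrac Bs' f' (g P) c e" using y unfolding Y.carrier_stalk by blast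
  note ok = gP_ok[OF P] U_ok[OF P]
  show "tr P (x \<otimes>\<^bsub>mproj_stalk Bs' f' (g P)\<^esub> y) = tr P x \<otimes>\<^bsub>mproj_stalk Bs f P\<^esub> tr P y"
    unfolding u(2) c(2) Y.stalk_mult[OF ok(1) u(1) c(1)] tr_mfrac[OF P u(1)] tr_mfrac[OF P c(1)]
      tr_mfrac[OF P Y.fr_mult[OF ok(1) u(1) c(1)]] X.stalk_mult[OF ok(2) fr_\<theta>[OF P u(1)] fr_\<theta>[OF P c(1)]]
    by (simp add: mc.meval_simps)
  show "tr P (x \<oplus>\<^bsub>mproj_stalk Bs' f' (g P)\<^esub> y) = tr P x \<oplus>\<^bsub>mproj_stalk Bs f P\<^esub> tr P y"
    unfolding u(2) c(2) Y.stalk_add[OF ok(1) u(1) c(1)] tr_mfrac[OF P u(1)] tr_mfrac[OF P c(1)]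
      tr_mfrac[OF P Y.fr_add[OF ok(1) u(1) c(1)]] X.stalk_add[OF ok(2) fr_\<theta>[OF P u(1)] fr_\<theta>[OF P c(1)]]
    by (simp add: mc.meval_simps)
qed

lemma tr_const:
  assumes P: "P \<in> U" shows "tr P (mfrac Bs' f' (g P) (mconst c) 1) = mfrac Bs f P (mconst c) 1"
  using tr_mfrac[OF P Y.fr_const[OF gP_ok[OF P]]] by simp

lemma tr_one: "P \<in> U \<Longrightarrow> tr P (mfrac Bs' f' (g P) 1 1) = mfrac Bs f P 1 1"
  using tr_mfrac[of P 1 1] Y.fr_same[OF mhomog_1 mhomog_1, of "g P"] gP_ok[of P]
  by (simp add: Y.okP_def isprime_def)

definition "hh W s = (\<lambda>P\<in>{P \<in> U. g P \<in> W}. tr P (s (g P)))"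

lemma hh_carrier:
  assumes W: "openin (mproj_zariski Bs' f') W" and s: "s \<in> carrier (mproj_sections Bs' f' W)"
  shows "hh W s \<in> carrier (mproj_sections Bs f {P \<in> U. g P \<in> W})"
proof -
  have s1: "s Q \<in> carrier (mproj_stalk Bs' f' Q)" if "Q \<in> W" for Q
    using s that by (auto simp: mproj_sections_def)
  have s2: "\<exists>V u v e. openin (mproj_zariski Bs' f') V \<and> Q \<in> V \<and> V \<subseteq> W \<and> u \<in> mhomog Bs' e \<and> v \<in> mhomog Bs' e \<and>
      (\<forall>Q\<in>V. v \<notin> Q \<and> s Q = mfrac Bs' f' Q u v)" if "Q \<in> W" for Q
    using s that by (auto simp: mproj_sections_def)
  have "\<exists>V u v e. openin (mproj_zariski Bs f) V \<and> P \<in> V \<and> V \<subseteq> {P \<in> U. g P \<in> W} \<and>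
      u \<in> mhomog Bs e \<and> v \<in> mhomog Bs e \<and> (\<forall>Q\<in>V. v \<notin> Q \<and> hh W s Q = mfrac Bs f Q u v)"
    if P: "P \<in> U" "g P \<in> W" for P
  proof -
    obtain V u v e where V: "openin (mproj_zariski Bs' f') V" "g P \<in> V" "V \<subseteq> W"
      "u \<in> mhomog Bs' e" "v \<in> mhomog Bs' e" "\<forall>Q\<in>V. v \<notin> Q \<and> s Q = mfrac Bs' f' Q u v"
      using s2[OF P(2)] by blast
    have "v' \<notin> Q \<and> hh W s Q = mfrac Bs f Q (\<theta> u) v'" if Q: "Q \<in> {P \<in> U. g P \<in> V}" and v': "v' = \<theta> v" for Q v'
    proof -
      have Q1: "Q \<in> U" "g Q \<in> V" "g Q \<in> W" using Q V(3) by auto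
      have fr: "Y.fr (g Q) u v" using Y.fr_same[OF V(4,5)] V(6) Q1(2) by blast
      have "s (g Q) = mfrac Bs' f' (g Q) u v" using V(6) Q1(2) by blast
      then have "hh W s Q = mfrac Bs f Q (\<theta> u) (\<theta> v)" using tr_mfrac[OF Q1(1) fr] Q1 by (simp add: hh_def)
      then show ?thesis using fr_\<theta>[OF Q1(1) fr] v' by (simp add: X.fr_def)
    qed
    moreover have "{P \<in> U. g P \<in> V} \<subseteq> {P \<in> U. g P \<in> W}" using V(3) by blast
    moreover have "P \<in> {P \<in> U. g P \<in> V}" using P(1) V(2) by blast
    ultimately show ?thesis using preimage_open[OF V(1)] \<theta>_hom[OF V(4)] \<theta>_hom[OF V(5)] by blast
  qed
  moreover have "hh W s \<in> (\<Pi>\<^sub>E P\<in>{P \<in> U. g P \<in> W}. carrier (mproj_stalk Bs f P))"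
    unfolding hh_def using tr_carrier s1 by (intro restrict_PiE_iff[THEN iffD2]) blast
  ultimately show ?thesis unfolding mproj_sections_def partial_object.simps by blast
qed

end

context birmap
begin

interpretation S: birmap Bs' f' Z' Bs f Z \<tau> \<sigma> d' d a' b' a b by (rule sym)

text \<open>Numerator and denominator have the same multidegree, so the double substitution rescales
  both by the same factors, which cancel in the fraction.\<close>

lemma tr_inverse:
  assumes Q: "Q \<in> S.U" and x: "x \<in> carrier (mproj_stalk Bs' f' Q)"
  shows "S.tr Q (tr (S.g Q) x) = x"
proof -
  have P: "S.g Q \<in> U" "g (S.g Q) = Q" using S.g_V[OF Q] S.g_inverse[OF Q] by auto
  obtain u v where u: "Y.fr Q u v" "x = mfrac Bs' f' Q u v" using x unfolding Y.carrier_stalk by blast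
  obtain e where e: "u \<in> mhomog Bs' e" "v \<in> mhomog Bs' e" using u(1) by (auto simp: Y.fr_def)
  have f1: "X.fr (S.g Q) (\<theta> u) (\<theta> v)" using fr_\<theta>[OF P(1)] u(1) P(2) by simp
  have f2: "Y.fr Q (\<eta> (\<theta> u)) (\<eta> (\<theta> v))" by (rule S.fr_\<theta>[OF Q f1])
  have t: "S.tr Q (tr (S.g Q) x) = mfrac Bs' f' Q (\<eta> (\<theta> u)) (\<eta> (\<theta> v))"
    using tr_mfrac[OF P(1), of u v] u P(2) S.tr_mfrac[OF Q f1] by simp
  have "S.alp e * (\<eta> (\<theta> u) * v - u * \<eta> (\<theta> v)) =
      v * (S.alp e * \<eta> (\<theta> u) - S.bet e * u) - u * (S.alp e * \<eta> (\<theta> v) - S.bet e * v)"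
    by (simp add: algebra_simps)
  moreover have "Z' \<dots>" by (intro Y.Z_diff Y.Z_mult S.comp_rescale e)
  ultimately have "Z' (\<eta> (\<theta> u) * v - u * \<eta> (\<theta> v))" using Y.Z_prime S.not_Z_alp by metis
  then show ?thesis using t Y.mfrac_eq[OF S.U_ok[OF Q] f2 u(1)] u(2) by simp
qed

lemma hh_inverse:
  assumes W: "W \<subseteq> S.U" and s: "s \<in> carrier (mproj_sections Bs' f' W)"
  shows "S.hh {P \<in> U. g P \<in> W} (hh W s) = s"
proof
  fix Q
  have sE: "s \<in> (\<Pi>\<^sub>E P\<in>W. carrier (mproj_stalk Bs' f' P))" using s by (simp add: mproj_sections_def)
  show "S.hh {P \<in> U. g P \<in> W} (hh W s) Q = s Q"
  proof (cases "Q \<in> W")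
    case True
    then have Q: "Q \<in> S.U" using W by blast
    have P: "S.g Q \<in> U" "g (S.g Q) = Q" using S.g_V[OF Q] S.g_inverse[OF Q] by auto
    have "s Q \<in> carrier (mproj_stalk Bs' f' Q)" using sE True by blast
    then show ?thesis using tr_inverse[OF Q] P Q True by (simp add: S.hh_def hh_def)
  next
    case False
    then have "s Q = undefined" using sE by (simp add: PiE_def extensional_def)
    then show ?thesis using False S.g_inverse by (auto simp: S.hh_def)
  qed
qed

end

context birmap
begin

interpretation S: birmap Bs' f' Z' Bs f Z \<tau> \<sigma> d' d a' b' a b by (rule sym)

lemma preimage_inverse: "W \<subseteq> S.U \<Longrightarrow> {Q \<in> S.U. S.g Q \<in> {P \<in> U. g P \<in> W}} = W"
  using S.g_V S.g_inverse by (auto simp: subset_iff)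

lemma hh_iso:
  assumes W: "openin (mproj_zariski Bs' f') W" "W \<subseteq> S.U"
  shows "hh W \<in> ring_iso (mproj_sections Bs' f' W) (mproj_sections Bs f {P \<in> U. g P \<in> W})"
proof -
  let ?R = "mproj_sections Bs' f' W" and ?W = "{P \<in> U. g P \<in> W}"
  have car: "s (g P) \<in> carrier (mproj_stalk Bs' f' (g P))" if "s \<in> carrier ?R" "P \<in> ?W" for s P
    using that by (auto simp: mproj_sections_def)
  have W': "openin (mproj_zariski Bs f) ?W" "?W \<subseteq> U" using preimage_open[OF W(1)] by auto
  have "bij_betw (hh W) (carrier ?R) (carrier (mproj_sections Bs f ?W))"
  proof (rule bij_betw_byWitness[where f' = "S.hh ?W"])
    show "\<forall>s\<in>carrier ?R. S.hh ?W (hh W s) = s" using hh_inverse[OF W(2)] by blast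
    show "\<forall>t\<in>carrier (mproj_sections Bs f ?W). hh W (S.hh ?W t) = t"
      using S.hh_inverse[OF W'(2)] unfolding preimage_inverse[OF W(2)] by blast
    show "hh W ` carrier ?R \<subseteq> carrier (mproj_sections Bs f ?W)" using hh_carrier[OF W(1)] by blast
    show "S.hh ?W ` carrier (mproj_sections Bs f ?W) \<subseteq> carrier ?R"
      using S.hh_carrier[OF W'(1)] unfolding preimage_inverse[OF W(2)] by blast
  qed
  moreover have "hh W \<in> ring_hom ?R (mproj_sections Bs f ?W)"
  proof (rule ring_hom_memI)
    show "hh W s \<in> carrier (mproj_sections Bs f ?W)" if "s \<in> carrier ?R" for s by (rule hh_carrier[OF W(1) that])
    fix s t assume s: "s \<in> carrier ?R" and t: "t \<in> carrier ?R"
    show "hh W (s \<otimes>\<^bsub>?R\<^esub> t) = hh W s \<otimes>\<^bsub>mproj_sections Bs f ?W\<^esub> hh W t"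
      unfolding hh_def mproj_sections_def monoid.simps
      using tr_ring(1)[OF _ car[OF s] car[OF t]] by (intro restrict_ext) simp
    show "hh W (s \<oplus>\<^bsub>?R\<^esub> t) = hh W s \<oplus>\<^bsub>mproj_sections Bs f ?W\<^esub> hh W t"
      unfolding hh_def mproj_sections_def ring.simps
      using tr_ring(2)[OF _ car[OF s] car[OF t]] by (intro restrict_ext) simp
  next
    show "hh W \<one>\<^bsub>?R\<^esub> = \<one>\<^bsub>mproj_sections Bs f ?W\<^esub>"
      unfolding hh_def mproj_sections_def monoid.simps X.stalk_one Y.stalk_one
      using tr_one by (intro restrict_ext) simp
  qed
  ultimately show ?thesis by (simp add: ring_iso_def)
qed

theorem birational: "birational_over (mproj_hypersurface Bs f) (mproj_hypersurface Bs' f')"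
proof -
  let ?X = "mproj_hypersurface Bs f" and ?Y = "mproj_hypersurface Bs' f'"
  have z: "zar ?X = mproj_zariski Bs f" "zar ?Y = mproj_zariski Bs' f'" by (simp_all add: mproj_hypersurface_def)
  have o: "zar (open_sub ?X U) = subtopology (mproj_zariski Bs f) U"
    "zar (open_sub ?Y S.U) = subtopology (mproj_zariski Bs' f') S.U"
    "sec (open_sub ?X U) = mproj_sections Bs f" "sec (open_sub ?Y S.U) = mproj_sections Bs' f'"
    "res (open_sub ?X U) = (\<lambda>U V s. restrict s V)" "res (open_sub ?Y S.U) = (\<lambda>U V s. restrict s V)"
    "scal (open_sub ?X U) = (\<lambda>U c. \<lambda>P\<in>U. mfrac Bs f P (mconst c) 1)"
    "scal (open_sub ?Y S.U) = (\<lambda>U c. \<lambda>P\<in>U. mfrac Bs' f' P (mconst c) 1)"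
    by (simp_all add: mproj_hypersurface_def open_sub_def)
  have "iso_over (open_sub ?X U) (open_sub ?Y S.U)"
    unfolding iso_over_def o Let_def topspace_U openin_open_subtopology[OF S.U_open]
  proof (rule exI[of _ g], rule exI[of _ hh], intro conjI allI impI ballI)
    show "homeomorphic_map (subtopology (mproj_zariski Bs f) U) (subtopology (mproj_zariski Bs' f') S.U) g"
      by (rule g_homeo)
    fix V assume V: "openin (mproj_zariski Bs' f') V \<and> V \<subseteq> S.U"
    then show "hh V \<in> ring_iso (mproj_sections Bs' f' V) (mproj_sections Bs f {x \<in> U. g x \<in> V})"
      using hh_iso by blast
    show "hh V (\<lambda>P\<in>V. mfrac Bs' f' P (mconst c) 1) = (\<lambda>P\<in>{x \<in> U. g x \<in> V}. mfrac Bs f P (mconst c) 1)" for c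
      unfolding hh_def using tr_const by (intro restrict_ext) simp
    fix W s assume "(openin (mproj_zariski Bs' f') W \<and> W \<subseteq> S.U) \<and> W \<subseteq> V"
    then have W: "W \<subseteq> V" by blast
    show "hh W (restrict s W) = restrict (hh V s) {x \<in> U. g x \<in> W}"
      unfolding hh_def using W by (auto simp: fun_eq_iff restrict_def)
  qed
  then show ?thesis unfolding birational_over_def z using U_open U_dense S.U_open S.U_dense by blast
qed

end

section \<open>The first defect index as a codimension\<close>

context field
begin

lemma ext_space_simps [simp]:
  "carrier (ext_space R B) = B \<rightarrow>\<^sub>E carrier R" "\<zero>\<^bsub>ext_space R B\<^esub> = (\<lambda>b\<in>B. \<zero>)"
  "u \<oplus>\<^bsub>ext_space R B\<^esub> w = (\<lambda>b\<in>B. u b \<oplus> w b)" "c \<odot>\<^bsub>ext_space R B\<^esub> u = (\<lambda>b\<in>B. c \<otimes> u b)"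
  by (simp_all add: ext_space_def)

lemma ext_eqI: "u \<in> B \<rightarrow>\<^sub>E M \<Longrightarrow> w \<in> B \<rightarrow>\<^sub>E N \<Longrightarrow> (\<And>b. b \<in> B \<Longrightarrow> u b = w b) \<Longrightarrow> u = w"
  by (rule extensionalityI[of u B]) (auto simp: PiE_def)

lemma ext_space_abelian: "abelian_group (ext_space R B)"
proof (rule abelian_groupI)
  fix x y z assume x: "x \<in> carrier (ext_space R B)" and y: "y \<in> carrier (ext_space R B)"
  then have xy: "x b \<in> carrier R" "y b \<in> carrier R" if "b \<in> B" for b using that by (auto simp: PiE_iff)
  show "x \<oplus>\<^bsub>ext_space R B\<^esub> y \<in> carrier (ext_space R B)" using xy by auto
  show "x \<oplus>\<^bsub>ext_space R B\<^esub> y = y \<oplus>\<^bsub>ext_space R B\<^esub> x" using xy by (auto simp: a_comm intro!: restrict_ext)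
  show "x \<oplus>\<^bsub>ext_space R B\<^esub> y \<oplus>\<^bsub>ext_space R B\<^esub> z = x \<oplus>\<^bsub>ext_space R B\<^esub> (y \<oplus>\<^bsub>ext_space R B\<^esub> z)"
    if z: "z \<in> carrier (ext_space R B)"
    using xy z by (auto simp: PiE_iff a_assoc intro!: restrict_ext)
next
  fix x assume x: "x \<in> carrier (ext_space R B)"
  then have xb: "x b \<in> carrier R" if "b \<in> B" for b using that by (auto simp: PiE_iff)
  have xE: "x \<in> B \<rightarrow>\<^sub>E carrier R" using x by simp
  show "\<zero>\<^bsub>ext_space R B\<^esub> \<oplus>\<^bsub>ext_space R B\<^esub> x = x"
    using xb by (intro ext_eqI[OF _ xE, of _ "carrier R"]) auto
  show "\<exists>y\<in>carrier (ext_space R B). y \<oplus>\<^bsub>ext_space R B\<^esub> x = \<zero>\<^bsub>ext_space R B\<^esub>"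
    using xb by (intro bexI[of _ "\<lambda>b\<in>B. \<ominus> x b"]) (auto intro!: restrict_ext simp: l_neg)
qed auto

lemma ext_space_vs: "vectorspace R (ext_space R B)"
proof -
  have "Module.module R (ext_space R B)"
  proof (rule moduleI)
    show "cring R" by (rule cring_axioms)
    show "abelian_group (ext_space R B)" by (rule ext_space_abelian)
    fix a b x y assume a: "a \<in> carrier R" and x: "x \<in> carrier (ext_space R B)"
    then have xb: "x b \<in> carrier R" if "b \<in> B" for b using that by (auto simp: PiE_iff)
    show "a \<odot>\<^bsub>ext_space R B\<^esub> x \<in> carrier (ext_space R B)" using a xb by auto
    show "(a \<oplus> b) \<odot>\<^bsub>ext_space R B\<^esub> x = a \<odot>\<^bsub>ext_space R B\<^esub> x \<oplus>\<^bsub>ext_space R B\<^esub> b \<odot>\<^bsub>ext_space R B\<^esub> x"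
      if "b \<in> carrier R" using a xb that by (auto simp: l_distr intro!: restrict_ext)
    show "(a \<otimes> b) \<odot>\<^bsub>ext_space R B\<^esub> x = a \<odot>\<^bsub>ext_space R B\<^esub> (b \<odot>\<^bsub>ext_space R B\<^esub> x)"
      if "b \<in> carrier R" using a xb that by (auto simp: m_assoc intro!: restrict_ext)
    show "a \<odot>\<^bsub>ext_space R B\<^esub> (x \<oplus>\<^bsub>ext_space R B\<^esub> y) = a \<odot>\<^bsub>ext_space R B\<^esub> x \<oplus>\<^bsub>ext_space R B\<^esub> a \<odot>\<^bsub>ext_space R B\<^esub> y"
      if "y \<in> carrier (ext_space R B)" using a xb that by (auto simp: r_distr PiE_iff intro!: restrict_ext)
  next
    fix x assume x: "x \<in> carrier (ext_space R B)"
    then have xb: "x b \<in> carrier R" if "b \<in> B" for b using that by (auto simp: PiE_iff)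
    have xE: "x \<in> B \<rightarrow>\<^sub>E carrier R" using x by simp
    show "\<one> \<odot>\<^bsub>ext_space R B\<^esub> x = x" using xb by (intro ext_eqI[OF _ xE, of _ "carrier R"]) auto
  qed
  then show ?thesis unfolding vectorspace_def using field_axioms by blast
qed

lemma ext_finsum:
  assumes "finite I" "\<And>i. i \<in> I \<Longrightarrow> h i \<in> carrier (ext_space R B)" "b \<in> B"
  shows "(finsum (ext_space R B) h I) b = (\<Oplus>i\<in>I. h i b)"
proof -
  interpret E: abelian_group "ext_space R B" by (rule ext_space_abelian)
  show ?thesis using assms(1,2)
  proof (induction I rule: finite_induct)
    case empty then show ?case using assms(3) by simp
  next
    case (insert i I)
    have 1: "h \<in> I \<rightarrow> carrier (ext_space R B)" "h i \<in> carrier (ext_space R B)" using insert.prems by auto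
    have 2: "(\<lambda>i. h i b) \<in> I \<rightarrow> carrier R" "h i b \<in> carrier R" using insert.prems assms(3) by (auto simp: PiE_iff)
    have "finsum (ext_space R B) h (insert i I) = h i \<oplus>\<^bsub>ext_space R B\<^esub> finsum (ext_space R B) h I"
      by (rule E.finsum_insert[OF insert.hyps 1])
    moreover have "(\<Oplus>i\<in>insert i I. h i b) = h i b \<oplus> (\<Oplus>i\<in>I. h i b)"
      by (rule finsum_insert[OF insert.hyps 2])
    ultimately show ?case using insert.IH insert.prems assms(3) by simp
  qed
qed

lemma finsum_delta:
  assumes "finite B" "i \<in> B" "g i \<in> carrier R" "\<And>b. b \<in> B \<Longrightarrow> b \<noteq> i \<Longrightarrow> g b = \<zero>"
  shows "(\<Oplus>b\<in>B. g b) = g i"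
proof -
  have "(\<Oplus>b\<in>B. g b) = g i \<oplus> (\<Oplus>b\<in>B - {i}. g b)"
    using finsum_insert[of "B - {i}" i g] assms by (auto simp: insert_absorb)
  also have "(\<Oplus>b\<in>B - {i}. g b) = (\<Oplus>b\<in>B - {i}. \<zero>)"
    by (rule finsum_cong') (use assms(4) in auto)
  also have "(\<Oplus>b\<in>B - {i}. \<zero>) = \<zero>" by (rule finsum_zero)
  finally show ?thesis using assms(3) by simp
qed

lemma ext_space_dim:
  assumes B: "finite B"
  shows "vectorspace.fin_dim R (ext_space R B)" "vectorspace.dim R (ext_space R B) = card B"
proof -
  interpret E: vectorspace R "ext_space R B" by (rule ext_space_vs)
  define e where "e b = (\<lambda>c\<in>B. if c = b then \<one> else \<zero>)" for b
  have inj: "inj_on e B"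
  proof (rule inj_onI)
    fix b c assume "b \<in> B" "c \<in> B" "e b = e c"
    then have "e b b = e c b" by simp
    then show "b = c" using \<open>b \<in> B\<close> by (simp add: e_def split: if_splits)
  qed
  have eC: "e b \<in> carrier (ext_space R B)" for b unfolding e_def by auto
  then have eS: "e ` B \<subseteq> carrier (ext_space R B)" by blast
  have lc: "E.lincomb a (e ` B) c = a (e c)" if a: "a \<in> e ` B \<rightarrow> carrier R" and c: "c \<in> B" for a c
  proof -
    have m: "a v \<odot>\<^bsub>ext_space R B\<^esub> v \<in> carrier (ext_space R B)" if "v \<in> e ` B" for v
    proof (rule E.smult_closed)
      show "a v \<in> carrier R" using a that by blast
      show "v \<in> carrier (ext_space R B)" using that eS by blast
    qed
    have ac: "a (e c) \<in> carrier R" using a c by blast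
    have "E.lincomb a (e ` B) c = (\<Oplus>v\<in>e ` B. (a v \<odot>\<^bsub>ext_space R B\<^esub> v) c)"
      unfolding E.lincomb_def by (rule ext_finsum[OF finite_imageI[OF B] m c])
    also have "\<dots> = (a (e c) \<odot>\<^bsub>ext_space R B\<^esub> e c) c"
    proof (rule finsum_delta)
      show "finite (e ` B)" "e c \<in> e ` B" using B c by auto
      show "(a (e c) \<odot>\<^bsub>ext_space R B\<^esub> e c) c \<in> carrier R" using ac c by (simp add: e_def)
      show "(a v \<odot>\<^bsub>ext_space R B\<^esub> v) c = \<zero>" if v: "v \<in> e ` B" "v \<noteq> e c" for v
      proof -
        obtain b where b: "b \<in> B" "v = e b" using v(1) by blast
        have "a v \<in> carrier R" using a v(1) by blast
        moreover have "b \<noteq> c" using v(2) b(2) by blast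
        ultimately show ?thesis using c b(2) by (simp add: e_def)
      qed
    qed
    also have "\<dots> = a (e c)" using ac c by (simp add: e_def)
    finally show ?thesis .
  qed
  have "E.basis (e ` B)"
    unfolding E.basis_def
  proof (intro conjI)
    show "E.lin_indpt (e ` B)"
    proof (rule E.finite_lin_indpt2)
      fix a assume a: "a \<in> e ` B \<rightarrow> carrier R" and z: "E.lincomb a (e ` B) = \<zero>\<^bsub>ext_space R B\<^esub>"
      show "\<forall>v\<in>e ` B. a v = \<zero>"
      proof
        fix v assume "v \<in> e ` B"
        then obtain c where c: "c \<in> B" "v = e c" by blast
        show "a v = \<zero>" using lc[OF a c(1)] c unfolding z by simp
      qed
    qed (use B eS in auto)
    show "E.span (e ` B) = carrier (ext_space R B)"
    proof
      show "E.span (e ` B) \<subseteq> carrier (ext_space R B)" by (rule E.span_is_subset2[OF eS])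
      show "carrier (ext_space R B) \<subseteq> E.span (e ` B)"
      proof
        fix u assume u: "u \<in> carrier (ext_space R B)"
        define a where "a v = u (the_inv_into B e v)" for v
        have a: "a (e c) = u c" if "c \<in> B" for c unfolding a_def using the_inv_into_f_f[OF inj that] by simp
        have aC: "a \<in> e ` B \<rightarrow> carrier R" using a u by (auto simp: PiE_iff)
        have "E.lincomb a (e ` B) \<in> carrier (ext_space R B)" by (rule E.lincomb_closed[OF eS aC])
        then have "E.lincomb a (e ` B) = u"
          using u lc[OF aC] a by (intro ext_eqI[of _ B "carrier R" _ "carrier R"]) auto
        then show "u \<in> E.span (e ` B)"
          unfolding E.finite_span[OF finite_imageI[OF B] eS] using aC by blast
      qed
    qed
  qed (rule eS)
  then show "E.dim = card B" "E.fin_dim"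
    using E.dim_basis[OF finite_imageI[OF B]] card_image[OF inj] B
    unfolding E.fin_dim_def E.basis_def by auto
qed

text \<open>The square block of \<open>N\<close> on \<open>S\<close> is the identity, so the map to
  the coordinate space of \<open>S\<close> is onto. Rank-nullity then counts the kernel.\<close>

lemma ext_space_kernel_dim:
  assumes B: "finite B" and S: "S \<subseteq> B"
    and N: "\<And>s b. s \<in> S \<Longrightarrow> b \<in> B \<Longrightarrow> N s b \<in> carrier R"
    and N1: "\<And>s. s \<in> S \<Longrightarrow> N s s = \<one>" and N0: "\<And>s t. s \<in> S \<Longrightarrow> t \<in> S \<Longrightarrow> t \<noteq> s \<Longrightarrow> N s t = \<zero>"
  shows "vectorspace.dim R (ext_space R B\<lparr>carrier :=
      {u \<in> carrier (ext_space R B). \<forall>s\<in>S. (\<Oplus>b\<in>B. N s b \<otimes> u b) = \<zero>}\<rparr>) + card S = card B"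
proof -
  define T where "T u = (\<lambda>s\<in>S. \<Oplus>b\<in>B. N s b \<otimes> u b)" for u
  have fS: "finite S" using S B finite_subset by blast
  have uN: "(\<lambda>b. N s b \<otimes> u b) \<in> B \<rightarrow> carrier R" if "u \<in> B \<rightarrow>\<^sub>E carrier R" "s \<in> S" for u s
    using that N by (auto simp: PiE_iff)
  have TC: "T u \<in> S \<rightarrow>\<^sub>E carrier R" if "u \<in> B \<rightarrow>\<^sub>E carrier R" for u
    unfolding T_def using finsum_closed[OF uN[OF that]] by auto
  have hom: "T \<in> module_hom R (ext_space R B) (ext_space R S)"
    unfolding module_hom_def mem_Collect_eq
  proof (intro conjI allI impI ballI)
    show "T \<in> carrier (ext_space R B) \<rightarrow> carrier (ext_space R S)" using TC by simp
    fix u w assume uw: "u \<in> carrier (ext_space R B) \<and> w \<in> carrier (ext_space R B)"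
    then have u: "u \<in> carrier (ext_space R B)" and w: "w \<in> carrier (ext_space R B)" by blast+
    have *: "(\<Oplus>b\<in>B. N s b \<otimes> (\<lambda>b\<in>B. u b \<oplus> w b) b) = (\<Oplus>b\<in>B. N s b \<otimes> u b) \<oplus> (\<Oplus>b\<in>B. N s b \<otimes> w b)" if s: "s \<in> S" for s
    proof -
      have uw: "u \<in> B \<rightarrow>\<^sub>E carrier R" "w \<in> B \<rightarrow>\<^sub>E carrier R" using u w by auto
      have "(\<Oplus>b\<in>B. N s b \<otimes> (\<lambda>b\<in>B. u b \<oplus> w b) b) = (\<Oplus>b\<in>B. N s b \<otimes> u b \<oplus> N s b \<otimes> w b)"
      proof (rule finsum_cong')
        show "(\<lambda>b. N s b \<otimes> u b \<oplus> N s b \<otimes> w b) \<in> B \<rightarrow> carrier R" using uN[OF uw(1) s] uN[OF uw(2) s] by blast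
        show "N s b \<otimes> (\<lambda>b\<in>B. u b \<oplus> w b) b = N s b \<otimes> u b \<oplus> N s b \<otimes> w b" if "b \<in> B" for b
          using that N[OF s that] uw by (simp add: r_distr PiE_iff)
      qed simp
      then show ?thesis using finsum_addf[OF uN[OF uw(1) s] uN[OF uw(2) s]] by simp
    qed
    show "T (u \<oplus>\<^bsub>ext_space R B\<^esub> w) = T u \<oplus>\<^bsub>ext_space R S\<^esub> T w"
      unfolding T_def ext_space_simps by (intro restrict_ext) (simp only: * restrict_apply' )
  next
    fix r u assume "r \<in> carrier R \<and> u \<in> carrier (ext_space R B)"
    then have r: "r \<in> carrier R" and u: "u \<in> carrier (ext_space R B)" by blast+
    have *: "(\<Oplus>b\<in>B. N s b \<otimes> (\<lambda>b\<in>B. r \<otimes> u b) b) = r \<otimes> (\<Oplus>b\<in>B. N s b \<otimes> u b)" if s: "s \<in> S" for s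
    proof -
      have uw: "u \<in> B \<rightarrow>\<^sub>E carrier R" using u by auto
      have "(\<Oplus>b\<in>B. N s b \<otimes> (\<lambda>b\<in>B. r \<otimes> u b) b) = (\<Oplus>b\<in>B. r \<otimes> (N s b \<otimes> u b))"
      proof (rule finsum_cong')
        show "(\<lambda>b. r \<otimes> (N s b \<otimes> u b)) \<in> B \<rightarrow> carrier R" using uN[OF uw s] r by blast
        show "N s b \<otimes> (\<lambda>b\<in>B. r \<otimes> u b) b = r \<otimes> (N s b \<otimes> u b)" if "b \<in> B" for b
          using that N[OF s that] uw r by (simp add: m_lcomm PiE_iff)
      qed simp
      then show ?thesis using finsum_rdistr[OF B r uN[OF uw s]] by simp
    qed
    show "T (r \<odot>\<^bsub>ext_space R B\<^esub> u) = r \<odot>\<^bsub>ext_space R S\<^esub> T u"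
      unfolding T_def ext_space_simps by (intro restrict_ext) (simp only: * restrict_apply')
  qed
  have "mod_hom R (ext_space R B) (ext_space R S) T"
    using ext_space_vs[of B] ext_space_vs[of S] hom
    unfolding mod_hom_def mod_hom_axioms_def vectorspace_def by blast
  then have "linear_map R (ext_space R B) (ext_space R S) T"
    unfolding linear_map_def using ext_space_vs by blast
  then interpret T: linear_map R "ext_space R B" "ext_space R S" T .
  have im: "T.imT = carrier (ext_space R S)"
  proof
    show "T.imT \<subseteq> carrier (ext_space R S)" unfolding T.im_def using TC by auto
    show "carrier (ext_space R S) \<subseteq> T.imT"
    proof
      fix t assume t: "t \<in> carrier (ext_space R S)"
      \<comment> \<open>Extension by zero is a preimage of t, because \<open>N\<close> is the
        identity on \<open>S\<close>.\<close>
      define u where "u = (\<lambda>b\<in>B. if b \<in> S then t b else \<zero>)"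
      have tS: "t s \<in> carrier R" if "s \<in> S" for s using t that by (auto simp: PiE_iff)
      have uC: "u \<in> B \<rightarrow>\<^sub>E carrier R" unfolding u_def using tS by auto
      have "(\<Oplus>b\<in>B. N s b \<otimes> u b) = t s" if s: "s \<in> S" for s
      proof -
        have sB: "s \<in> B" using s S by blast
        have "(\<Oplus>b\<in>B. N s b \<otimes> u b) = N s s \<otimes> u s"
        proof (rule finsum_delta[OF B sB])
          show "N s s \<otimes> u s \<in> carrier R" using uN[OF uC s] sB by blast
          show "N s b \<otimes> u b = \<zero>" if "b \<in> B" "b \<noteq> s" for b
            using that N[OF s that(1)] N0[OF s _ that(2)] tS by (cases "b \<in> S") (simp_all add: u_def)
        qed
        then show ?thesis using N1[OF s] tS[OF s] sB s by (simp add: u_def)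
      qed
      then have "T u = t"
        using TC[OF uC] t by (intro ext_eqI[of _ S "carrier R" _ "carrier R"]) (auto simp: T_def)
      then show "t \<in> T.imT" unfolding T.im_def using uC by auto
    qed
  qed
  have ker: "T.kerT = {u \<in> carrier (ext_space R B). \<forall>s\<in>S. (\<Oplus>b\<in>B. N s b \<otimes> u b) = \<zero>}"
    unfolding T.ker_def T_def by (auto simp: fun_eq_iff restrict_def)
  have eqS: "ext_space R S\<lparr>carrier := carrier (ext_space R S)\<rparr> = ext_space R S" by simp
  have "card S + vectorspace.dim R (ext_space R B\<lparr>carrier := T.kerT\<rparr>) = card B"
    using T.rank_nullity[OF ext_space_dim(1)[OF B]]
    unfolding im eqS ext_space_dim(2)[OF B] ext_space_dim(2)[OF fS] .
  then show ?thesis unfolding ker by linarith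
qed

end

section \<open>The function field as the field of degree-zero fractions at the generic point\<close>

context mphyp
begin

definition "G = cgenideal (mpoly_ring (\<Union>Bs)) f"
definition "qt u v = mfrac Bs f G u v"
abbreviation "L \<equiv> function_field Bs f"

text \<open>Unlike \<open>fr\<close> it names the common multidegree, which is needed to keep sums
  over one denominator homogeneous.\<close>

definition FF :: "('x set \<Rightarrow> nat) \<Rightarrow> ('x, 'f) mpoly \<Rightarrow> ('x, 'f) mpoly \<Rightarrow> bool" where
  "FF e u v \<longleftrightarrow> u \<in> mhomog Bs e \<and> v \<in> mhomog Bs e \<and> \<not> Z v"

lemma FF_fr: "FF e u v \<Longrightarrow> fr G u v"
  unfolding FF_def G_def using fr_same[of u e v] cgenideal_iff by blast

lemma okG: "okP G" unfolding G_def by (rule okP_generic)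

lemma qt_eq: "FF e u v \<Longrightarrow> FF e' w x \<Longrightarrow> qt u v = qt w x \<longleftrightarrow> Z (u * x - w * v)"
  unfolding qt_def by (rule mfrac_eq[OF okG FF_fr FF_fr])

lemma FF_mult: "FF e u v \<Longrightarrow> FF e' w x \<Longrightarrow> FF (\<lambda>A. e A + e' A) (u * w) (v * x)"
  unfolding FF_def using mhomog_mult Z_prime by blast

lemma FF_add: assumes "FF e u v" "FF e' w x" shows "FF (\<lambda>A. e A + e' A) (u * x + w * v) (v * x)"
proof -
  have "w * v \<in> mhomog Bs (\<lambda>A. e A + e' A)"
    using assms mhomog_mult[of v Bs e w e'] by (simp add: FF_def mult.commute)
  then show ?thesis using assms mhomog_mult Z_prime mhomog_add unfolding FF_def by blast
qed

lemma qt_mult: "FF e u v \<Longrightarrow> FF e' w x \<Longrightarrow> qt u v \<otimes>\<^bsub>L\<^esub> qt w x = qt (u * w) (v * x)"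
  unfolding qt_def function_field_def G_def[symmetric] by (rule stalk_mult[OF okG FF_fr FF_fr])

lemma qt_add: "FF e u v \<Longrightarrow> FF e' w x \<Longrightarrow> qt u v \<oplus>\<^bsub>L\<^esub> qt w x = qt (u * x + w * v) (v * x)"
  unfolding qt_def function_field_def G_def[symmetric] by (rule stalk_add[OF okG FF_fr FF_fr])

lemma qt_one: "\<one>\<^bsub>L\<^esub> = qt 1 1" and qt_zero: "\<zero>\<^bsub>L\<^esub> = qt 0 1"
  unfolding qt_def function_field_def G_def[symmetric] by (rule stalk_one, rule stalk_zero)

lemma FF_1: "FF (\<lambda>_. 0) 1 1" and FF_0: "FF (\<lambda>_. 0) 0 1" and FF_const: "FF (\<lambda>_. 0) (mconst c) 1"
  using not_Z_1 by (simp_all add: FF_def)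

lemma qt_carrier: "FF e u v \<Longrightarrow> qt u v \<in> carrier L"
  unfolding function_field_def G_def[symmetric] carrier_stalk qt_def using FF_fr by blast

lemma qt_cases: assumes "x \<in> carrier L" obtains e u v where "FF e u v" "x = qt u v"
proof -
  obtain u v where uv: "fr G u v" "x = qt u v"
    using assms unfolding function_field_def G_def[symmetric] carrier_stalk qt_def by blast
  obtain e where "u \<in> mhomog Bs e" "v \<in> mhomog Bs e" "v \<notin> G" using uv(1) by (auto simp: fr_def)
  moreover then have "\<not> Z v" using mhomog_Pol unfolding G_def cgenideal_iff by blast
  ultimately show ?thesis using that[of e u v] uv(2) by (simp add: FF_def)
qed

lemma qt_eq_zero: "FF e u v \<Longrightarrow> qt u v = \<zero>\<^bsub>L\<^esub> \<longleftrightarrow> Z u"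
  unfolding qt_zero using qt_eq[OF _ FF_0] by simp

lemma function_field_field: "field L"
proof -
  have cr: "cring L"
  proof (rule cringI)
    show "abelian_group L"
    proof (rule abelian_groupI)
      fix x y z assume x: "x \<in> carrier L" and y: "y \<in> carrier L"
      obtain e u v where u: "FF e u v" "x = qt u v" by (rule qt_cases[OF x])
      obtain e' u' v' where u': "FF e' u' v'" "y = qt u' v'" by (rule qt_cases[OF y])
      show "x \<oplus>\<^bsub>L\<^esub> y \<in> carrier L" unfolding u(2) u'(2) qt_add[OF u(1) u'(1)] by (rule qt_carrier[OF FF_add[OF u(1) u'(1)]])
      show "x \<oplus>\<^bsub>L\<^esub> y = y \<oplus>\<^bsub>L\<^esub> x" unfolding u(2) u'(2) qt_add[OF u(1) u'(1)] qt_add[OF u'(1) u(1)]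
        by (simp add: mult.commute add.commute)
      show "x \<oplus>\<^bsub>L\<^esub> y \<oplus>\<^bsub>L\<^esub> z = x \<oplus>\<^bsub>L\<^esub> (y \<oplus>\<^bsub>L\<^esub> z)" if z: "z \<in> carrier L"
      proof -
        obtain e2 u2 v2 where u2: "FF e2 u2 v2" "z = qt u2 v2" by (rule qt_cases[OF z])
        show ?thesis
          unfolding u(2) u'(2) u2(2) qt_add[OF u(1) u'(1)] qt_add[OF u'(1) u2(1)]
            qt_add[OF FF_add[OF u(1) u'(1)] u2(1)] qt_add[OF u(1) FF_add[OF u'(1) u2(1)]]
          by (simp add: algebra_simps)
      qed
    next
      show "\<zero>\<^bsub>L\<^esub> \<in> carrier L" unfolding qt_zero by (rule qt_carrier[OF FF_0])
      fix x assume x: "x \<in> carrier L"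
      obtain e u v where u: "FF e u v" "x = qt u v" by (rule qt_cases[OF x])
      show "\<zero>\<^bsub>L\<^esub> \<oplus>\<^bsub>L\<^esub> x = x" unfolding qt_zero u(2) qt_add[OF FF_0 u(1)] by simp
      have n: "FF e (- u) v" using u(1) mhomog_uminus by (auto simp: FF_def)
      have "qt (- u) v \<oplus>\<^bsub>L\<^esub> x = \<zero>\<^bsub>L\<^esub>"
        unfolding u(2) qt_add[OF n u(1)] qt_eq_zero[OF FF_add[OF n u(1)]] by (simp add: Z_0)
      then show "\<exists>y\<in>carrier L. y \<oplus>\<^bsub>L\<^esub> x = \<zero>\<^bsub>L\<^esub>" using qt_carrier[OF n] by blast
    qed
    show "Group.comm_monoid L"
    proof (rule comm_monoidI)
      fix x y z assume x: "x \<in> carrier L" and y: "y \<in> carrier L"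
      obtain e u v where u: "FF e u v" "x = qt u v" by (rule qt_cases[OF x])
      obtain e' u' v' where u': "FF e' u' v'" "y = qt u' v'" by (rule qt_cases[OF y])
      show "x \<otimes>\<^bsub>L\<^esub> y \<in> carrier L" unfolding u(2) u'(2) qt_mult[OF u(1) u'(1)] by (rule qt_carrier[OF FF_mult[OF u(1) u'(1)]])
      show "x \<otimes>\<^bsub>L\<^esub> y = y \<otimes>\<^bsub>L\<^esub> x" unfolding u(2) u'(2) qt_mult[OF u(1) u'(1)] qt_mult[OF u'(1) u(1)]
        by (simp add: mult.commute)
      show "x \<otimes>\<^bsub>L\<^esub> y \<otimes>\<^bsub>L\<^esub> z = x \<otimes>\<^bsub>L\<^esub> (y \<otimes>\<^bsub>L\<^esub> z)" if z: "z \<in> carrier L"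
      proof -
        obtain e2 u2 v2 where u2: "FF e2 u2 v2" "z = qt u2 v2" by (rule qt_cases[OF z])
        show ?thesis
          unfolding u(2) u'(2) u2(2) qt_mult[OF u(1) u'(1)] qt_mult[OF u'(1) u2(1)]
            qt_mult[OF FF_mult[OF u(1) u'(1)] u2(1)] qt_mult[OF u(1) FF_mult[OF u'(1) u2(1)]]
          by (simp add: mult.assoc)
      qed
    next
      show "\<one>\<^bsub>L\<^esub> \<in> carrier L" unfolding qt_one by (rule qt_carrier[OF FF_1])
      fix x assume x: "x \<in> carrier L"
      obtain e u v where u: "FF e u v" "x = qt u v" by (rule qt_cases[OF x])
      show "\<one>\<^bsub>L\<^esub> \<otimes>\<^bsub>L\<^esub> x = x" unfolding qt_one u(2) qt_mult[OF FF_1 u(1)] by simp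
    qed
    fix x y z assume x: "x \<in> carrier L" and y: "y \<in> carrier L" and z: "z \<in> carrier L"
    obtain e u v where u: "FF e u v" "x = qt u v" by (rule qt_cases[OF x])
    obtain e' u' v' where u': "FF e' u' v'" "y = qt u' v'" by (rule qt_cases[OF y])
    obtain e2 u2 v2 where u2: "FF e2 u2 v2" "z = qt u2 v2" by (rule qt_cases[OF z])
    have F: "FF (\<lambda>A. e A + e' A + e2 A) ((u * v' + u' * v) * u2) (v * v' * v2)"
      by (rule FF_mult[OF FF_add[OF u(1) u'(1)] u2(1)])
    have F': "FF (\<lambda>A. e A + e2 A + (e' A + e2 A)) (u * u2 * (v' * v2) + u' * u2 * (v * v2)) (v * v2 * (v' * v2))"
      by (rule FF_add[OF FF_mult[OF u(1) u2(1)] FF_mult[OF u'(1) u2(1)]])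
    have "(u * v' + u' * v) * u2 * (v * v2 * (v' * v2)) - (u * u2 * (v' * v2) + u' * u2 * (v * v2)) * (v * v' * v2) = 0"
      by (simp add: algebra_simps)
    then have "qt ((u * v' + u' * v) * u2) (v * v' * v2) = qt (u * u2 * (v' * v2) + u' * u2 * (v * v2)) (v * v2 * (v' * v2))"
      unfolding qt_eq[OF F F'] using Z_0 by simp
    then show "(x \<oplus>\<^bsub>L\<^esub> y) \<otimes>\<^bsub>L\<^esub> z = x \<otimes>\<^bsub>L\<^esub> z \<oplus>\<^bsub>L\<^esub> y \<otimes>\<^bsub>L\<^esub> z"
      unfolding u(2) u'(2) u2(2) qt_add[OF u(1) u'(1)] qt_mult[OF u(1) u2(1)] qt_mult[OF u'(1) u2(1)]
        qt_mult[OF FF_add[OF u(1) u'(1)] u2(1)] qt_add[OF FF_mult[OF u(1) u2(1)] FF_mult[OF u'(1) u2(1)]] .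
  qed
  then interpret L: cring L .
  show ?thesis
  proof (rule L.cring_fieldI2)
    show "\<zero>\<^bsub>L\<^esub> \<noteq> \<one>\<^bsub>L\<^esub>" using qt_eq_zero[OF FF_1] not_Z_1 unfolding qt_one by metis
    fix x assume x: "x \<in> carrier L" "x \<noteq> \<zero>\<^bsub>L\<^esub>"
    obtain e u v where u: "FF e u v" "x = qt u v" by (rule qt_cases[OF x(1)])
    have "\<not> Z u" using x(2) u qt_eq_zero by blast
    then have i: "FF e v u" using u(1) by (auto simp: FF_def)
    have "x \<otimes>\<^bsub>L\<^esub> qt v u = \<one>\<^bsub>L\<^esub>"
      unfolding u(2) qt_mult[OF u(1) i] qt_one qt_eq[OF FF_mult[OF u(1) i] FF_1] by (simp add: Z_0 mult.commute)
    then show "\<exists>b\<in>carrier L. x \<otimes>\<^bsub>L\<^esub> b = \<one>\<^bsub>L\<^esub>" using qt_carrier[OF i] by blast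
  qed
qed

interpretation L: field L by (rule function_field_field)

lemma qt_add_same:
  assumes "FF e u v" "FF e w v" shows "qt u v \<oplus>\<^bsub>L\<^esub> qt w v = qt (u + w) v"
proof -
  have F: "FF e (u + w) v" using assms mhomog_add by (auto simp: FF_def)
  have "(u * v + w * v) * v - (u + w) * (v * v) = 0" by (simp add: algebra_simps)
  then show ?thesis unfolding qt_add[OF assms] qt_eq[OF FF_add[OF assms] F] using Z_0 by simp
qed

lemma qt_sum:
  assumes "finite I" "FF e 0 v" "\<And>i. i \<in> I \<Longrightarrow> FF e (w i) v"
  shows "(\<Oplus>\<^bsub>L\<^esub>i\<in>I. qt (w i) v) = qt (\<Sum>i\<in>I. w i) v"
  using assms(1,3)
proof (induction I rule: finite_induct)
  case empty
  show ?case using qt_eq_zero[OF assms(2)] Z_0 by simp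
next
  case (insert i I)
  have F: "FF e (\<Sum>i\<in>I. w i) v" using assms(2) insert.prems mhomog_sum[of I w Bs e] by (auto simp: FF_def)
  have "(\<Oplus>\<^bsub>L\<^esub>j\<in>insert i I. qt (w j) v) = qt (w i) v \<oplus>\<^bsub>L\<^esub> (\<Oplus>\<^bsub>L\<^esub>j\<in>I. qt (w j) v)"
    using insert.prems qt_carrier by (intro L.finsum_insert[OF insert.hyps]) blast+
  also have "\<dots> = qt (w i + (\<Sum>i\<in>I. w i)) v"
    using insert.IH insert.prems qt_add_same[OF _ F, of "w i"] by simp
  finally show ?case using insert.hyps by simp
qed

lemma qt_pow:
  assumes "FF e u v" shows "FF (\<lambda>A. n * e A) (u ^ n) (v ^ n) \<and> qt u v [^]\<^bsub>L\<^esub> n = qt (u ^ n) (v ^ n)"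
proof (induction n)
  case 0 then show ?case using FF_1 by (simp add: qt_one)
next
  case (Suc n)
  have "qt u v [^]\<^bsub>L\<^esub> Suc n = qt (u ^ n) (v ^ n) \<otimes>\<^bsub>L\<^esub> qt u v" using Suc by simp
  also have "\<dots> = qt (u ^ n * u) (v ^ n * v)" using qt_mult[OF conjunct1[OF Suc] assms] .
  finally show ?case using FF_mult[OF assms conjunct1[OF Suc]] by (simp add: mult.commute)
qed

lemma common_denominator:
  assumes "finite I" "\<forall>i\<in>I. x i \<in> carrier L"
  shows "\<exists>e v w. FF e 0 v \<and> (\<forall>i\<in>I. FF e (w i) v \<and> x i = qt (w i) v)"
  using assms
proof (induction I rule: finite_induct)
  case empty then show ?case using FF_0 by blast
next
  case (insert i I)
  then obtain e v w where w: "FF e 0 v" "\<forall>i\<in>I. FF e (w i) v \<and> x i = qt (w i) v" by blast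
  obtain e' u' v' where u': "FF e' u' v'" "x i = qt u' v'" using qt_cases[of "x i"] insert.prems by blast
  have 0: "FF (\<lambda>A. e A + e' A) 0 (v * v')" using FF_mult[OF w(1) u'(1)] by simp
  have n: "FF e v v" and n': "FF e' v' v'" using w(1) u'(1) by (auto simp: FF_def)
  have "FF (\<lambda>A. e A + e' A) (v * u') (v * v') \<and> x i = qt (v * u') (v * v')"
    using FF_mult[OF n u'(1)] qt_eq[OF u'(1) FF_mult[OF n u'(1)]] u'(2) Z_0 by (simp add: mult_ac)
  moreover have "FF (\<lambda>A. e A + e' A) (w j * v') (v * v') \<and> x j = qt (w j * v') (v * v')" if "j \<in> I" for j
  proof -
    have j: "FF e (w j) v" "x j = qt (w j) v" using w(2) that by auto
    show ?thesis using FF_mult[OF j(1) n'] qt_eq[OF j(1) FF_mult[OF j(1) n']] j(2) Z_0 by (simp add: mult_ac)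
  qed
  ultimately have "\<forall>j\<in>insert i I. FF (\<lambda>A. e A + e' A) (if j = i then v * u' else w j * v') (v * v') \<and>
      x j = qt (if j = i then v * u' else w j * v') (v * v')"
    using insert.hyps by auto
  then show ?case using 0 by (intro exI conjI)
qed

end

section \<open>The defect index over the function field in terms of the rank\<close>

context qform
begin

lemma fm_homog: "homog A p fm"
  unfolding fm_def homog_mhomog
proof (rule mhomog_sum)
  fix i assume i: "i \<in> A"
  have "mvar i \<in> mhomog {A} (\<lambda>_. 1)" using homog_var[OF finA i] by (simp add: homog_mhomog)
  from mhomog_mult[OF mhomog_const mhomog_power[OF this]]
  show "mconst (a i) * mvar i ^ p \<in> mhomog {A} (\<lambda>_. p)" by simp
qed

lemma mphyp_self: "mphyp {A} fm Z"
proof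
  show "hom_el {A} fm" using fm_homog unfolding homog_mhomog by (rule hom_elI)
  show "\<exists>x\<in>B. \<not> Z (mvar x)" if "B \<in> {A}" for B using that b0(1) not_Z_b0 by blast
qed (use finA Z_iff Z_add Z_mult Z_prime not_Z_1 in \<open>auto simp: disjoint_def\<close>)

text \<open>The fractions \<open>n j s / h\<close> express all roots through the basis
  \<open>S\<close>. Homogeneity of one degree makes them elements of the function field, and the
  identity block on \<open>S\<close> is the form of matrix required by
  \<open>ext_space_kernel_dim\<close>.\<close>

lemma homog_spans:
  assumes S: "S \<subseteq> A" "\<not> dep \<alpha> S" and sp: "\<forall>i\<in>A. spans \<alpha> S (\<alpha> i)"
  shows "\<exists>h n d. homog A d h \<and> \<not> Z h \<and> (\<forall>j\<in>A. \<forall>s\<in>S. homog A d (n j s)) \<and>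
    (\<forall>j\<in>A. \<forall>y\<in>H. ev y h * \<alpha> j = (\<Sum>s\<in>S. \<alpha> s * ev y (n j s))) \<and>
    (\<forall>j\<in>S. \<forall>s\<in>S. n j s = (if j = s then h else 0))"
proof -
  have finS: "finite S" using S(1) finA finite_subset by blast
  define Q where "Q j c k \<longleftrightarrow> rel \<alpha> (insert j S) c \<and> (\<forall>i\<in>insert j S. homog A k (c i)) \<and> \<not> Z (c j)" for j c k
  have "\<exists>c k. Q j c k" if j: "j \<in> A - S" for j
  proof -
    have jS: "j \<notin> S" using j by auto
    obtain d e where de: "d \<in> Pol A" "\<not> Z d" "\<forall>s\<in>S. e s \<in> Pol A" "\<forall>y\<in>H. ev y d * \<alpha> j = (\<Sum>s\<in>S. \<alpha> s * ev y (e s))"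
      using bspec[OF sp, of j] j unfolding spans_def by auto
    have "(\<Sum>s\<in>S. \<alpha> s * ev y ((e(j := - d)) s)) = (\<Sum>s\<in>S. \<alpha> s * ev y (e s))" for y
      using jS by (intro sum.cong refl) auto
    then have "rel \<alpha> (insert j S) (e(j := - d))"
      unfolding rel_def using de finS jS by (auto simp: meval_simps Pol_uminus mult.commute)
    moreover have "\<not> Z ((e(j := - d)) j)" using de(2) Z_uminus[of "- d"] by auto
    ultimately have "dep \<alpha> (insert j S)" unfolding dep_def by blast
    then obtain c k where c: "rel \<alpha> (insert j S) c" "\<And>i. i \<in> insert j S \<Longrightarrow> homog A k (c i)" "\<exists>i\<in>insert j S. \<not> Z (c i)"
      using dep_homog[of \<alpha> "insert j S"] finS by auto
    have "\<not> Z (c j)"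
    proof
      assume z: "Z (c j)"
      then have "rel \<alpha> (insert j S - {j}) c" using c(1) finS by (intro rel_remove) auto
      then have "rel \<alpha> S c" using jS by simp
      then show False using c(3) z rel_indep[OF _ S(2)] by blast
    qed
    then show ?thesis using c unfolding Q_def by blast
  qed
  then obtain c where "\<And>j. j \<in> A - S \<Longrightarrow> \<exists>k. Q j (c j) k" by metis
  then obtain kk where Q: "\<And>j. j \<in> A - S \<Longrightarrow> Q j (c j) (kk j)" by metis
  define h where "h = (\<Prod>j\<in>A - S. c j j)"
  define E where "E j = (\<Prod>i\<in>A - S - {j}. c i i)" for j
  define d where "d = (\<Sum>j\<in>A - S. kk j)"
  \<comment> \<open>Outside \<open>S\<close> the entries come from a relation solved for \<alpha> j,
    whence the sign.\<close>
  define n where "n j s = (if j \<in> S then if j = s then h else 0 else - (E j * c j s))" for j s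
  have fin: "finite (A - S)" using finA by simp
  have hE: "h = c j j * E j" if "j \<in> A - S" for j
    unfolding h_def E_def using that fin by (simp add: prod.remove)
  have hh: "homog A d h" unfolding h_def d_def using Q by (intro homog_prod) (auto simp: Q_def)
  have Eh: "homog A d (E j * c j s)" if j: "j \<in> A - S" and s: "s \<in> S" for j s
  proof -
    have "homog A (\<Sum>i\<in>A - S - {j}. kk i) (E j)"
      unfolding E_def using Q by (intro homog_prod) (auto simp: Q_def)
    moreover have "homog A (kk j) (c j s)" using Q[OF j] s by (auto simp: Q_def)
    ultimately have "homog A ((\<Sum>i\<in>A - S - {j}. kk i) + kk j) (E j * c j s)" by (rule homog_mult)
    moreover have "(\<Sum>i\<in>A - S - {j}. kk i) + kk j = d"
      unfolding d_def using j fin by (simp add: sum.remove)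
    ultimately show ?thesis by simp
  qed
  show ?thesis
  proof (intro exI[of _ h] exI[of _ n] exI[of _ d] conjI ballI)
    show "homog A d h" by (rule hh)
    show "\<not> Z h" unfolding h_def using Q by (intro not_Z_prod) (auto simp: Q_def)
    show "homog A d (n j s)" if "j \<in> A" "s \<in> S" for j s
      using hh Eh[of j s] that unfolding n_def homog_mhomog by (auto intro: mhomog_uminus)
    show "n j s = (if j = s then h else 0)" if "j \<in> S" "s \<in> S" for j s using that by (simp add: n_def)
    fix j y assume j: "j \<in> A" and y: "y \<in> H"
    show "ev y h * \<alpha> j = (\<Sum>s\<in>S. \<alpha> s * ev y (n j s))"
    proof (cases "j \<in> S")
      case True
      have "(\<Sum>s\<in>S. \<alpha> s * ev y (n j s)) = (\<Sum>s\<in>S. if j = s then \<alpha> s * ev y h else 0)"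
        using True by (intro sum.cong refl) (simp add: n_def)
      then show ?thesis using True finS by simp
    next
      case False
      then have j': "j \<in> A - S" using j by blast
      have "rel \<alpha> (insert j S) (c j)" using Q[OF j'] by (simp add: Q_def)
      from relD[OF this y] have "\<alpha> j * ev y (c j j) + (\<Sum>s\<in>S. \<alpha> s * ev y (c j s)) = 0"
        using False finS by simp
      then have e: "\<alpha> j * ev y (c j j) = - (\<Sum>s\<in>S. \<alpha> s * ev y (c j s))" by (rule eq_neg_iff_add_eq_0[THEN iffD2])
      have "ev y h * \<alpha> j = ev y (E j) * (\<alpha> j * ev y (c j j))" by (simp add: hE[OF j'] meval_mult mult_ac)
      also have "\<dots> = (\<Sum>s\<in>S. \<alpha> s * ev y (n j s))"
        unfolding e using False by (simp add: n_def meval_simps sum_distrib_left sum_negf mult_ac)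
      finally show ?thesis .
    qed
  qed
qed

text \<open>Over the function field, the isotropic vectors form the kernel of the linear map that expresses
  \<open>\<Sum>b. \<alpha> b * u b\<close> in terms of a maximal independent set \<open>S\<close> of coefficients.\<close>
theorem i1_card:
  assumes S: "S \<subseteq> A" "\<not> dep \<alpha> S" and sp: "\<forall>i\<in>A. spans \<alpha> S (\<alpha> i)"
  shows "i1 p a A + card S = card A"
proof -
  interpret M: mphyp "{A}" fm Z by (rule mphyp_self)
  interpret L: field M.L by (rule M.function_field_field)
  have finS: "finite S" using S(1) finA finite_subset by blast
  obtain h n d where hn: "homog A d h \<and> \<not> Z h \<and> (\<forall>j\<in>A. \<forall>s\<in>S. homog A d (n j s)) \<and>
      (\<forall>j\<in>A. \<forall>y\<in>H. ev y h * \<alpha> j = (\<Sum>s\<in>S. \<alpha> s * ev y (n j s))) \<and>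
      (\<forall>j\<in>S. \<forall>s\<in>S. n j s = (if j = s then h else 0))"
    using homog_spans[OF S sp] by (elim exE)
  then have h: "h \<in> mhomog {A} (\<lambda>_. d)" "\<not> Z h" by (simp_all add: homog_mhomog)
  have n: "M.FF (\<lambda>_. d) (n j s) h" if "j \<in> A" "s \<in> S" for j s
    using hn that h unfolding M.FF_def homog_mhomog by blast
  have hnE: "ev y h * \<alpha> j = (\<Sum>s\<in>S. \<alpha> s * ev y (n j s))" if "j \<in> A" "y \<in> H" for j y using hn that by blast
  have nS: "n j s = (if j = s then h else 0)" if "j \<in> S" "s \<in> S" for j s using hn that by blast
  define N where "N s b = M.qt (n b s) h" for s b
  have "(\<forall>s\<in>S. (\<Oplus>\<^bsub>M.L\<^esub>b\<in>A. N s b \<otimes>\<^bsub>M.L\<^esub> u b) = \<zero>\<^bsub>M.L\<^esub>) \<longleftrightarrow>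
      ext_form p M.L (function_field_scal {A} fm) A a u = \<zero>\<^bsub>M.L\<^esub>"
    if u: "u \<in> A \<rightarrow>\<^sub>E carrier M.L" for u
  proof -
    have uc: "\<forall>b\<in>A. u b \<in> carrier M.L" using u by blast
    obtain e v w where w: "M.FF e 0 v" "\<forall>b\<in>A. M.FF e (w b) v \<and> u b = M.qt (w b) v"
      using M.common_denominator[OF finA uc] by blast
    have wF: "M.FF e (w b) v" "u b = M.qt (w b) v" if "b \<in> A" for b using w(2) that by auto
    have wP: "w b \<in> Pol A" if "b \<in> A" for b using wF(1)[OF that] mhomog_Pol unfolding M.FF_def by fastforce
    have hv0: "M.FF (\<lambda>B. d + e B) 0 (h * v)" using M.FF_mult[OF _ w(1), of "\<lambda>_. d" 0 h] h by (simp add: M.FF_def)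
    have t1: "(\<Oplus>\<^bsub>M.L\<^esub>b\<in>A. N s b \<otimes>\<^bsub>M.L\<^esub> u b) = \<zero>\<^bsub>M.L\<^esub> \<longleftrightarrow> Z (\<Sum>b\<in>A. n b s * w b)" if s: "s \<in> S" for s
    proof -
      have F: "M.FF (\<lambda>B. d + e B) (n b s * w b) (h * v)" if "b \<in> A" for b
        by (rule M.FF_mult[OF n[OF that s] wF(1)[OF that]])
      have F': "M.FF (\<lambda>B. d + e B) (\<Sum>b\<in>A. n b s * w b) (h * v)"
        using hv0 F mhomog_sum[of A "\<lambda>b. n b s * w b"] by (simp add: M.FF_def)
      have "(\<Oplus>\<^bsub>M.L\<^esub>b\<in>A. N s b \<otimes>\<^bsub>M.L\<^esub> u b) = (\<Oplus>\<^bsub>M.L\<^esub>b\<in>A. M.qt (n b s * w b) (h * v))"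
      proof (rule L.finsum_cong')
        show "(\<lambda>b. M.qt (n b s * w b) (h * v)) \<in> A \<rightarrow> carrier M.L" using M.qt_carrier[OF F] by blast
        show "N s b \<otimes>\<^bsub>M.L\<^esub> u b = M.qt (n b s * w b) (h * v)" if "b \<in> A" for b
          unfolding N_def wF(2)[OF that] by (rule M.qt_mult[OF n[OF that s] wF(1)[OF that]])
      qed simp
      also have "\<dots> = M.qt (\<Sum>b\<in>A. n b s * w b) (h * v)" by (rule M.qt_sum[OF finA hv0 F])
      finally show ?thesis using M.qt_eq_zero[OF F'] by simp
    qed
    have t2: "ext_form p M.L (function_field_scal {A} fm) A a u = \<zero>\<^bsub>M.L\<^esub> \<longleftrightarrow> Z (\<Sum>b\<in>A. mconst (a b) * w b ^ p)"
    proof -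
      have pw: "M.FF (\<lambda>B. p * e B) (w b ^ p) (v ^ p)" "u b [^]\<^bsub>M.L\<^esub> p = M.qt (w b ^ p) (v ^ p)" if "b \<in> A" for b
        using M.qt_pow[OF wF(1)[OF that], of p] wF(2)[OF that] by auto
      have F: "M.FF (\<lambda>B. p * e B) (mconst (a b) * w b ^ p) (v ^ p)" if "b \<in> A" for b
        using M.FF_mult[OF M.FF_const pw(1)[OF that]] by simp
      have v0: "M.FF (\<lambda>B. p * e B) 0 (v ^ p)"
        using w(1) mhomog_power[of v "{A}" e p] M.not_Z_power by (simp add: M.FF_def)
      have F': "M.FF (\<lambda>B. p * e B) (\<Sum>b\<in>A. mconst (a b) * w b ^ p) (v ^ p)"
        using v0 F mhomog_sum[of A "\<lambda>b. mconst (a b) * w b ^ p"] by (simp add: M.FF_def)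
      have "ext_form p M.L (function_field_scal {A} fm) A a u = (\<Oplus>\<^bsub>M.L\<^esub>b\<in>A. M.qt (mconst (a b) * w b ^ p) (v ^ p))"
        unfolding ext_form_def
      proof (rule L.finsum_cong')
        show "(\<lambda>b. M.qt (mconst (a b) * w b ^ p) (v ^ p)) \<in> A \<rightarrow> carrier M.L" using M.qt_carrier[OF F] by blast
        show "function_field_scal {A} fm (a b) \<otimes>\<^bsub>M.L\<^esub> u b [^]\<^bsub>M.L\<^esub> p = M.qt (mconst (a b) * w b ^ p) (v ^ p)" if "b \<in> A" for b
        proof -
          have "function_field_scal {A} fm (a b) = M.qt (mconst (a b)) 1"
            unfolding function_field_scal_def M.qt_def M.G_def ..
          then show ?thesis using M.qt_mult[OF M.FF_const pw(1)[OF that], of "a b"] pw(2)[OF that] by simp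
        qed
      qed simp
      also have "\<dots> = M.qt (\<Sum>b\<in>A. mconst (a b) * w b ^ p) (v ^ p)" by (rule M.qt_sum[OF finA v0 F])
      finally show ?thesis using M.qt_eq_zero[OF F'] by simp
    qed
    have pe: "ev y (\<Sum>b\<in>A. mconst (a b) * w b ^ p) = (\<Sum>b\<in>A. \<alpha> b * ev y (w b)) ^ p" for y
      by (simp add: meval_simps frob_sum power_mult_distrib \<alpha>_p)
    \<comment> \<open>By \<open>pe\<close> the form is the p-th power of a linear combination of
      roots. Up to the factor h, that combination has on \<open>S\<close> the values of the linear
      map with matrix \<open>N\<close> as coefficients; since \<open>S\<close> is independent, both
      vanish together.\<close>
    have ex: "ev y h * (\<Sum>b\<in>A. \<alpha> b * ev y (w b)) = (\<Sum>s\<in>S. \<alpha> s * ev y (\<Sum>b\<in>A. n b s * w b))" if y: "y \<in> H" for y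
    proof -
      have "ev y h * (\<Sum>b\<in>A. \<alpha> b * ev y (w b)) = (\<Sum>b\<in>A. (ev y h * \<alpha> b) * ev y (w b))"
        by (simp add: sum_distrib_left mult.assoc)
      also have "\<dots> = (\<Sum>b\<in>A. (\<Sum>s\<in>S. \<alpha> s * ev y (n b s)) * ev y (w b))"
        by (intro sum.cong refl) (simp add: hnE y)
      also have "\<dots> = (\<Sum>b\<in>A. \<Sum>s\<in>S. \<alpha> s * (ev y (n b s) * ev y (w b)))"
        by (simp add: sum_distrib_right mult.assoc)
      also have "\<dots> = (\<Sum>s\<in>S. \<Sum>b\<in>A. \<alpha> s * (ev y (n b s) * ev y (w b)))" by (rule sum.swap)
      finally show ?thesis by (simp add: meval_simps sum_distrib_left)
    qed
    have "(\<forall>s\<in>S. Z (\<Sum>b\<in>A. n b s * w b)) \<longleftrightarrow> Z (\<Sum>b\<in>A. mconst (a b) * w b ^ p)"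
    proof
      assume z: "\<forall>s\<in>S. Z (\<Sum>b\<in>A. n b s * w b)"
      have "Z (h * (\<Sum>b\<in>A. mconst (a b) * w b ^ p))" unfolding Z_def
      proof
        fix y assume y: "y \<in> H"
        have "(\<Sum>s\<in>S. \<alpha> s * ev y (\<Sum>b\<in>A. n b s * w b)) = 0"
          using z y by (intro sum.neutral ballI) (simp add: Z_def)
        then have "ev y h * (\<Sum>b\<in>A. \<alpha> b * ev y (w b)) = 0" using ex[OF y] by simp
        then show "ev y (h * (\<Sum>b\<in>A. mconst (a b) * w b ^ p)) = 0"
          unfolding meval_mult pe using p_gt_0 by auto
      qed
      then show "Z (\<Sum>b\<in>A. mconst (a b) * w b ^ p)" using h(2) Z_prime by blast
    next
      assume z: "Z (\<Sum>b\<in>A. mconst (a b) * w b ^ p)"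
      have nP: "n b s \<in> Pol A" if "b \<in> A" "s \<in> S" for b s
        using n[OF that] mhomog_Pol unfolding M.FF_def by fastforce
      have "rel \<alpha> S (\<lambda>s. \<Sum>b\<in>A. n b s * w b)"
        unfolding rel_def
      proof (intro conjI ballI)
        show "(\<Sum>b\<in>A. n b s * w b) \<in> Pol A" if "s \<in> S" for s using nP wP that by (intro Pol_sum Pol_mult)
        fix y assume y: "y \<in> H"
        have "(\<Sum>b\<in>A. \<alpha> b * ev y (w b)) = 0" using z y pe[of y] by (simp add: Z_def)
        then show "(\<Sum>s\<in>S. \<alpha> s * ev y (\<Sum>b\<in>A. n b s * w b)) = 0" using ex[OF y] by simp
      qed
      then show "\<forall>s\<in>S. Z (\<Sum>b\<in>A. n b s * w b)" using rel_indep[OF _ S(2)] by blast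
    qed
    then show ?thesis unfolding t2 using t1 by blast
  qed
  then have ker: "{u \<in> carrier (ext_space M.L A). ext_form p M.L (function_field_scal {A} fm) A a u = \<zero>\<^bsub>M.L\<^esub>} =
      {u \<in> carrier (ext_space M.L A). \<forall>s\<in>S. (\<Oplus>\<^bsub>M.L\<^esub>b\<in>A. N s b \<otimes>\<^bsub>M.L\<^esub> u b) = \<zero>\<^bsub>M.L\<^esub>}"
    by (auto simp: ext_space_def)
  have fmq: "ql_poly p a A (\<lambda>b. b) = fm" by (simp add: ql_poly_def fm_def)
  have h1: "M.FF (\<lambda>_. d) h h" "M.FF (\<lambda>_. d) 0 h" using h by (simp_all add: M.FF_def)
  show ?thesis unfolding i1_def fmq Let_def defect_index_def ker
  proof (rule L.ext_space_kernel_dim[OF finA S(1)])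
    show "N s b \<in> carrier M.L" if "s \<in> S" "b \<in> A" for s b unfolding N_def by (rule M.qt_carrier[OF n[OF that(2,1)]])
    show "N s s = \<one>\<^bsub>M.L\<^esub>" if "s \<in> S" for s
      using that nS M.qt_eq[OF h1(1) M.FF_1] Z_0 by (simp add: N_def M.qt_one)
    show "N s t = \<zero>\<^bsub>M.L\<^esub>" if "s \<in> S" "t \<in> S" "t \<noteq> s" for s t
      using that nS M.qt_eq_zero[OF h1(2)] Z_0 by (simp add: N_def)
  qed
qed

end

section \<open>The main theorem\<close>

lemma (in qform) max_indep_ex:
  assumes "finite C" "\<not> dep \<gamma> {}"
  shows "\<exists>S. S \<subseteq> C \<and> \<not> dep \<gamma> S \<and> (\<forall>i\<in>C. spans \<gamma> S (\<gamma> i))"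
proof (rule max_indep[OF assms(1) empty_subsetI assms(2)])
  fix S assume a: "S \<subseteq> C" "\<not> dep \<gamma> S" "\<And>i. i \<in> C \<Longrightarrow> spans \<gamma> S (\<gamma> i)"
  show ?thesis by (intro exI[of _ S] conjI ballI a)
qed

lemma (in aform) good_relation_ex:
  assumes "C \<subseteq> A" "dep \<alpha> C"
  shows "\<exists>u k. rel \<alpha> C u \<and> (\<forall>i\<in>C. homog A k (u i)) \<and> (\<exists>y\<in>H. lam C u y \<noteq> 0) \<and> \<not> p dvd k"
proof (rule good_relation[OF assms])
  fix u k assume a: "rel \<alpha> C u" "\<And>i. i \<in> C \<Longrightarrow> homog A k (u i)" "\<exists>y\<in>H. lam C u y \<noteq> 0" "\<not> p dvd k"
  show ?thesis by (intro exI[of _ u] exI[of _ k] conjI ballI a)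
qed

context gsect
begin

text \<open>The equation of the product is that of \<open>Pq\<close>, whose additional summands have
  coefficient zero.\<close>

lemma mphyp_product: "mphyp {Inl ` C, Inr ` {..card (A - C)}} (ql_poly p a C Inl) Pq.Z"
proof -
  let ?Bs = "{Inl ` C, Inr ` {..card (A - C)}} :: ('x + nat) set set"
  have fm: "ql_poly p a C Inl = Pq.fm"
  proof -
    have "Pq.fm = (\<Sum>i\<in>Inl ` C. mconst (case_sum a (\<lambda>_. 0) i) * mvar i ^ p)"
      unfolding Pq.fm_def using Pq.finA by (intro sum.mono_neutral_right) (auto simp: AP_def mconst_def)
    also have "\<dots> = ql_poly p a C Inl" unfolding ql_poly_def by (simp add: sum.reindex)
    finally show ?thesis ..
  qed
  have dis: "disjoint ?Bs" by (auto simp: disjoint_def)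
  have hom: "hom_el ?Bs Pq.fm" unfolding fm[symmetric] ql_poly_def
  proof (rule hom_elI, rule mhomog_sum)
    fix i assume "i \<in> C"
    then have "mvar (Inl i) \<in> mhomog ?Bs (\<lambda>B. if B = Inl ` C then 1 else 0)"
      using finC dis by (intro mvar_mhomog) auto
    from mhomog_mult[OF mhomog_const mhomog_power[OF this]]
    show "mconst (a i) * mvar (Inl i) ^ p \<in> mhomog ?Bs (\<lambda>B. 0 + p * (if B = Inl ` C then 1 else 0))" .
  qed
  have "\<not> Pq.Z (mvar (Inr 0))"
  proof
    assume z: "Pq.Z (mvar (Inr 0))"
    have "case_sum (\<lambda>_. 0) (\<lambda>_. 1) \<in> Pq.H" unfolding Pq_H by (simp add: Cq.H_def)
    then show False using z unfolding Pq.Z_def by fastforce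
  qed
  then have gb: "\<exists>x\<in>B. \<not> Pq.Z (mvar x)" if "B \<in> ?Bs" for B
    using that bC(1) Pq.not_Z_b0 by blast
  show ?thesis unfolding fm
  proof
    show "finite ?Bs" "disjoint ?Bs" "hom_el ?Bs Pq.fm" using dis hom by simp_all
    show "finite B" if "B \<in> ?Bs" for B using that finC by auto
    show "Pq.Z q \<longleftrightarrow> (\<exists>g\<in>Pol (\<Union>?Bs). q = g * Pq.fm)" if "q \<in> Pol (\<Union>?Bs)" for q
      using Pq.Z_iff[of q] that unfolding AP_Union .
    show "\<exists>x\<in>B. \<not> Pq.Z (mvar x)" if "B \<in> ?Bs" for B by (rule gb[OF that])
    show "Pq.Z (q + r)" if "Pq.Z q" "Pq.Z r" for q r by (rule Pq.Z_add[OF that])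
    show "Pq.Z (r * q)" if "Pq.Z q" for q r by (rule Pq.Z_mult[OF that])
    show "Pq.Z q \<or> Pq.Z r" if "Pq.Z (q * r)" for q r using Pq.Z_prime[OF that] .
    show "\<not> Pq.Z 1" by (rule Pq.not_Z_1)
  qed
qed

end

text \<open>On a finite field the p-th power map, being injective, would be surjective.\<close>

lemma infinite_nonperfect:
  assumes "prime p" "CHAR('f::field) = p" "\<not> surj (\<lambda>x::'f. x ^ p)"
  shows "infinite (UNIV :: 'f set)"
proof
  assume fin: "finite (UNIV :: 'f set)"
  have p0: "p > 0" using assms(1) by (rule prime_gt_0_nat)
  have "inj (\<lambda>x::'f. x ^ p)"
  proof (rule injI)
    fix x y :: 'f assume *: "x ^ p = y ^ p"
    have "(x - y + y) ^ p = (x - y) ^ p + y ^ p"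
      by (rule freshmans_dream) (use assms in auto)
    then have "(x - y) ^ p = 0" using * by simp
    then show "x = y" using p0 by simp
  qed
  then show False using finite_UNIV_inj_surj[OF fin] assms(3) by blast
qed

lemma two_elements:
  assumes "card A \<ge> 2" obtains x y where "x \<in> A" "y \<in> A" "x \<noteq> y"
proof -
  have "finite A" using assms by (intro card_ge_0_finite) linarith
  then have "\<not> (\<forall>x\<in>A. \<forall>y\<in>A. x = y)" using card_le_Suc0_iff_eq[of A] assms by linarith
  then show ?thesis using that by blast
qed

section \<open>The p-th root of an anisotropic form and changes of basis\<close>

locale ql_space = finite_dimensional_vector_space smul B
  for smul :: "'f::field \<Rightarrow> 'v::ab_group_add \<Rightarrow> 'v" and B :: "'v set" +
  fixes p :: nat and \<phi> :: "'v \<Rightarrow> 'f"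
  assumes prime: "prime p" and char: "CHAR('f) = p" and nonperfect: "\<not> surj (\<lambda>x::'f. x ^ p)"
    and form: "quasilinear_form p smul \<phi>" and aniso: "anisotropic \<phi>"
begin

lemma finB: "finite B" and indB: "independent B" and spanB: "span B = UNIV"
  using finite_Basis independent_Basis span_Basis .

sublocale K: frob "to_ac :: 'f \<Rightarrow> 'f alg_closure" p
proof
  show "infinite (UNIV :: 'f set)" by (rule infinite_nonperfect[OF prime char nonperfect])
  show "\<exists>y. y ^ p = x" for x :: "'f alg_closure"
    using nth_root_exists[of p x] prime_gt_0_nat[OF prime] by blast
qed (use prime char in \<open>auto simp: to_ac_add to_ac_mult\<close>)

text \<open>As the p-th power map of the closure is additive and injective, this root of the form is
  linear over the base field; anisotropy makes it an embedding of the whole space.\<close>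

definition \<alpha> :: "'v \<Rightarrow> 'f alg_closure" where "\<alpha> v = (SOME y. y ^ p = to_ac (\<phi> v))"

lemma \<alpha>_p: "\<alpha> v ^ p = to_ac (\<phi> v)"
  unfolding \<alpha>_def by (rule someI_ex[OF K.perfect])

lemma \<alpha>_add: "\<alpha> (v + w) = \<alpha> v + \<alpha> w"
proof (rule K.frob_inj)
  have "\<phi> (v + w) = \<phi> v + \<phi> w" using form by (simp add: quasilinear_form_def)
  then show "\<alpha> (v + w) ^ p = (\<alpha> v + \<alpha> w) ^ p" by (simp add: K.frob_add \<alpha>_p K.hom_add)
qed

lemma \<alpha>_scale: "\<alpha> (smul c v) = to_ac c * \<alpha> v"
proof (rule K.frob_inj)
  have "\<phi> (smul c v) = c ^ p * \<phi> v" using form by (simp add: quasilinear_form_def)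
  then show "\<alpha> (smul c v) ^ p = (to_ac c * \<alpha> v) ^ p" by (simp add: \<alpha>_p power_mult_distrib K.hom_mult K.hom_power)
qed

lemma \<alpha>_0: "\<alpha> 0 = 0" using \<alpha>_scale[of 0 0] by simp

lemma \<alpha>_sum: "\<alpha> (sum g I) = (\<Sum>i\<in>I. \<alpha> (g i))"
  by (induction I rule: infinite_finite_induct) (simp_all add: \<alpha>_0 \<alpha>_add)

lemma \<alpha>_eq_0: "\<alpha> v = 0 \<Longrightarrow> v = 0"
proof -
  assume "\<alpha> v = 0"
  then have "to_ac (\<phi> v) = 0" using \<alpha>_p[of v] K.p_gt_0 by (simp add: power_0_left)
  then show "v = 0" using aniso by (simp add: anisotropic_def)
qed

text \<open>The injective linear map \<alpha> carries independence of vectors over to their roots.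
  The irrational ratio required by \<open>qform\<close> is the independence of \<open>b0\<close> and
  \<open>b1\<close>.\<close>

lemma aform_indep:
  assumes A: "independent A" and b: "b0 \<in> A" "b1 \<in> A" "b0 \<noteq> b1"
  shows "aform to_ac p A \<alpha> \<phi> b0 b1"
proof
  show "finite A" by (rule finiteI_independent[OF A])
  then have fin: "finite A" .
  show "\<alpha> i ^ p = to_ac (\<phi> i)" for i by (rule \<alpha>_p)
  show "b0 \<in> A" "b1 \<in> A" by (rule b)+
  show "\<alpha> b0 \<noteq> 0"
  proof
    assume "\<alpha> b0 = 0"
    then have "b0 = 0" by (rule \<alpha>_eq_0)
    then show False using A b(1) dependent_zero by blast
  qed
  have ind: "f i = 0" if "(\<Sum>i\<in>A. to_ac (f i) * \<alpha> i) = 0" "i \<in> A" for f i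
  proof -
    have "\<alpha> (\<Sum>i\<in>A. smul (f i) i) = 0" using that(1) by (simp add: \<alpha>_sum \<alpha>_scale)
    then have "(\<Sum>i\<in>A. smul (f i) i) = 0" by (rule \<alpha>_eq_0)
    then show ?thesis by (rule independentD[OF A fin order_refl _ that(2)])
  qed
  show "\<alpha> b1 \<noteq> to_ac c * \<alpha> b0" for c
  proof
    assume e: "\<alpha> b1 = to_ac c * \<alpha> b0"
    let ?f = "\<lambda>i. if i = b1 then 1 else if i = b0 then - c else 0"
    have "(\<Sum>i\<in>A. to_ac (?f i) * \<alpha> i) = (\<Sum>i\<in>{b0, b1}. to_ac (?f i) * \<alpha> i)"
      using b fin by (intro sum.mono_neutral_right) auto
    also have "\<dots> = 0" using b(3) e by (simp add: K.hom_uminus)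
    finally show False using ind[of ?f b1] b(2) by simp
  qed
  show "f i = 0" if "(\<Sum>i\<in>A. to_ac (f i) * \<alpha> i) = 0" "i \<in> A" for f i by (rule ind[OF that])
qed

definition isbasis :: "'v set \<Rightarrow> bool" where "isbasis X1 \<longleftrightarrow> independent X1 \<and> span X1 = UNIV"

text \<open>The change of coordinates: \<open>lin X1 Y1 b\<close> is the coordinate of \<open>b \<in> X1\<close> in terms of those of \<open>Y1\<close>.\<close>
definition lin :: "'v set \<Rightarrow> 'v set \<Rightarrow> 'v \<Rightarrow> ('v, 'f) mpoly" where
  "lin X1 Y1 b = (\<Sum>y\<in>Y1. mconst (representation X1 y b) * mvar y)"

abbreviation "ev \<equiv> meval (to_ac :: 'f \<Rightarrow> 'f alg_closure)"
abbreviation "HH X1 \<equiv> qform.H X1 \<alpha>"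

lemma isbasis_fin: "isbasis X1 \<Longrightarrow> finite X1"
  unfolding isbasis_def using finiteI_independent by blast

lemma ev_lin: "ev w (lin X1 Y1 b) = (\<Sum>y\<in>Y1. to_ac (representation X1 y b) * w y)"
  by (simp add: lin_def K.meval_simps)

lemma rep_sum: "isbasis X1 \<Longrightarrow> (\<Sum>b\<in>X1. smul (representation X1 v b) b) = v"
  unfolding isbasis_def by (intro sum_representation_eq) (auto simp: finiteI_independent)

lemma lin_sum:
  assumes X1: "isbasis X1"
  shows "(\<Sum>b\<in>X1. \<alpha> b * ev w (lin X1 Y1 b)) = (\<Sum>y\<in>Y1. \<alpha> y * w y)"
proof -
  have "(\<Sum>b\<in>X1. \<alpha> b * ev w (lin X1 Y1 b)) = (\<Sum>b\<in>X1. \<Sum>y\<in>Y1. \<alpha> (smul (representation X1 y b) b) * w y)"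
    by (simp add: ev_lin sum_distrib_left \<alpha>_scale mult_ac)
  also have "\<dots> = (\<Sum>y\<in>Y1. \<Sum>b\<in>X1. \<alpha> (smul (representation X1 y b) b) * w y)" by (rule sum.swap)
  also have "\<dots> = (\<Sum>y\<in>Y1. \<alpha> (\<Sum>b\<in>X1. smul (representation X1 y b) b) * w y)"
    by (simp add: \<alpha>_sum sum_distrib_right)
  finally show ?thesis by (simp add: rep_sum[OF X1])
qed

lemma lin_lin:
  assumes X1: "isbasis X1" and Y1: "isbasis Y1" and b: "b \<in> X1"
  shows "ev (\<lambda>y. ev w (lin Y1 X1 y)) (lin X1 Y1 b) = w b"
proof -
  have i: "independent X1" and s: "span X1 = UNIV" using X1 by (auto simp: isbasis_def)
  have "ev (\<lambda>y. ev w (lin Y1 X1 y)) (lin X1 Y1 b) =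
      (\<Sum>y\<in>Y1. \<Sum>c\<in>X1. to_ac (representation X1 y b * representation Y1 c y) * w c)"
    by (simp add: ev_lin sum_distrib_left K.hom_mult mult_ac)
  also have "\<dots> = (\<Sum>c\<in>X1. \<Sum>y\<in>Y1. to_ac (representation X1 y b * representation Y1 c y) * w c)" by (rule sum.swap)
  also have "\<dots> = (\<Sum>c\<in>X1. to_ac (\<Sum>y\<in>Y1. representation X1 y b * representation Y1 c y) * w c)"
    by (simp add: K.hom_sum sum_distrib_right)
  also have "\<dots> = (\<Sum>c\<in>X1. to_ac (if c = b then 1 else 0) * w c)"
  proof (intro sum.cong refl)
    fix c assume c: "c \<in> X1"
    have "representation X1 c b = representation X1 (\<Sum>y\<in>Y1. smul (representation Y1 c y) y) b"
      by (simp add: rep_sum[OF Y1])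
    also have "\<dots> = (\<Sum>y\<in>Y1. representation X1 (smul (representation Y1 c y) y) b)"
      by (subst representation_sum[OF i]) (simp_all add: s)
    also have "\<dots> = (\<Sum>y\<in>Y1. representation X1 y b * representation Y1 c y)"
      by (intro sum.cong refl) (simp add: representation_scale[OF i] s mult.commute)
    finally have "(\<Sum>y\<in>Y1. representation X1 y b * representation Y1 c y) = (if c = b then 1 else 0)"
      using representation_basis[OF i c] by (auto split: if_splits)
    then show "to_ac (\<Sum>y\<in>Y1. representation X1 y b * representation Y1 c y) * w c = to_ac (if c = b then 1 else 0) * w c" by simp
  qed
  also have "\<dots> = (\<Sum>c\<in>X1. if c = b then w c else 0)" by (intro sum.cong refl) simp
  finally show ?thesis using isbasis_fin[OF X1] b by simp
qed

lemma lin_Pol: "lin X1 Y1 b \<in> Pol Y1"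
  unfolding lin_def by (intro Pol_sum Pol_mult Pol_const Pol_var)

lemma lin_homog: "finite Y1 \<Longrightarrow> lin X1 Y1 b \<in> mhomog {Y1} (\<lambda>_. 1)"
  unfolding lin_def
proof (rule mhomog_sum)
  fix y assume "finite Y1" "y \<in> Y1"
  then have "mvar y \<in> mhomog {Y1} (\<lambda>_. 1)" using homog_var[of Y1 y] by (simp add: homog_mhomog)
  from mhomog_mult[OF mhomog_const this]
  show "mconst (representation X1 y b) * mvar y \<in> mhomog {Y1} (\<lambda>_. 1)" by simp
qed

end

text \<open>The index \<open>i1\<close> is formed with one basis, while the section becomes a
  coordinate section only in a basis that extends \<open>C\<close>. Ranks and maps have to be
  carried from one to the other.\<close>

locale two_bases = ql_space smul B p \<phi> for smul :: "'f::field \<Rightarrow> 'v::ab_group_add \<Rightarrow> 'v" and B p \<phi> +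
  fixes X1 Y1 :: "'v set" and x0 x1 y0 y1 :: 'v
  assumes X1: "isbasis X1" and Y1: "isbasis Y1"
    and x: "x0 \<in> X1" "x1 \<in> X1" "x0 \<noteq> x1" and y: "y0 \<in> Y1" "y1 \<in> Y1" "y0 \<noteq> y1"
begin

sublocale X: aform to_ac p X1 \<alpha> \<phi> x0 x1
  by (rule aform_indep) (use X1 x in \<open>auto simp: isbasis_def\<close>)
sublocale Y: aform to_ac p Y1 \<alpha> \<phi> y0 y1
  by (rule aform_indep) (use Y1 y in \<open>auto simp: isbasis_def\<close>)

lemma swap: "two_bases smul B p \<phi> Y1 X1 y0 y1 x0 x1"
  by unfold_locales (rule X1 Y1 x y)+

abbreviation "toX w \<equiv> \<lambda>b. ev w (lin X1 Y1 b)"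
abbreviation "toY w \<equiv> \<lambda>b. ev w (lin Y1 X1 b)"
abbreviation "sub q \<equiv> msubst (lin X1 Y1) q"

lemma toX_H: "w \<in> Y.H \<Longrightarrow> toX w \<in> X.H"
  unfolding X.H_def Y.H_def mem_Collect_eq lin_sum[OF X1] .

lemma toY_H: "w \<in> X.H \<Longrightarrow> toY w \<in> Y.H"
  unfolding X.H_def Y.H_def mem_Collect_eq lin_sum[OF Y1] .

lemma ev_sub: "ev w (sub q) = ev (toX w) q" by (rule K.meval_subst)

lemma ev_back: "q \<in> Pol X1 \<Longrightarrow> ev (toX (toY w)) q = ev w q"
  by (erule K.meval_cong) (rule lin_lin[OF X1 Y1])

lemma sub_Z: assumes "q \<in> Pol X1" "Y.Z (sub q)" shows "X.Z q"
  unfolding X.Z_def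
proof
  fix w assume "w \<in> X.H"
  then have "ev (toY w) (sub q) = 0" using assms(2) toY_H unfolding Y.Z_def by blast
  then show "ev w q = 0" unfolding ev_sub ev_back[OF assms(1)] .
qed

lemma sub_Pol: "q \<in> Pol X1 \<Longrightarrow> sub q \<in> Pol Y1"
  by (erule msubst_Pol) (rule lin_Pol)

lemma sub_mhomog: assumes "q \<in> mhomog {X1} e" shows "sub q \<in> mhomog {Y1} (\<lambda>_. e X1)"
proof -
  have "sub q \<in> mhomog {Y1} (\<lambda>B. \<Sum>A\<in>{X1}. e A * (\<lambda>_ _. 1) A B)"
    using X.finA lin_homog[OF Y.finA] by (intro msubst_mhomog[OF assms]) (auto simp: disjoint_def)
  then show ?thesis by simp
qed

text \<open>The tautological relation with coefficients \<open>mvar\<close> has \<lambda> = 1, so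
  \<open>rank_bound\<close> applies to the full index set \<open>Y1\<close>. A spanning family for
  the coordinates of \<open>X1\<close> still spans after the linear substitution.\<close>

lemma rank_le:
  assumes S: "S \<subseteq> X1" "\<not> X.dep \<alpha> S" "\<And>i. i \<in> X1 \<Longrightarrow> X.spans \<alpha> S (\<alpha> i)"
    and T: "T \<subseteq> Y1" "\<not> Y.dep \<alpha> T"
  shows "card T \<le> card S"
proof (rule Y.rank_bound[OF order_refl _ _ _ _ T])
  have finS: "finite S" using S(1) X.finA finite_subset by blast
  then show "finite S" .
  show "Y.rel \<alpha> Y1 mvar" unfolding Y.rel_def by (auto simp: Y.H_def)
  have "(\<Sum>i\<in>Y1. \<alpha> i * ev w (pd y0 (mvar i))) = (\<Sum>i\<in>Y1. if i = y0 then \<alpha> i else 0)" for w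
    by (intro sum.cong refl) (simp add: pd_var)
  then have "Y.lam Y1 mvar w = 1" for w unfolding Y.lam_def using Y.finA Y.b0 by simp
  moreover have "(\<lambda>_. 0) \<in> Y.H" by (simp add: Y.H_def)
  ultimately show "\<exists>y\<in>Y.H. Y.lam Y1 mvar y \<noteq> 0" by (intro bexI[of _ "\<lambda>_. 0"]) simp_all
  have S3: "\<forall>i\<in>X1. X.spans \<alpha> S (\<alpha> i)" using S(3) by blast
  obtain h n d where hn: "homog X1 d h \<and> \<not> X.Z h \<and> (\<forall>j\<in>X1. \<forall>s\<in>S. homog X1 d (n j s)) \<and>
    (\<forall>j\<in>X1. \<forall>y\<in>X.H. ev y h * \<alpha> j = (\<Sum>s\<in>S. \<alpha> s * ev y (n j s))) \<and>
    (\<forall>j\<in>S. \<forall>s\<in>S. n j s = (if j = s then h else 0))"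
    using X.homog_spans[OF S(1,2) S3] by (elim exE)
  have hP: "h \<in> Pol X1" "\<not> X.Z h" using hn homog_Pol by blast+
  have nP: "n j s \<in> Pol X1" if "j \<in> X1" "s \<in> S" for j s using hn homog_Pol that by blast
  have hnE: "ev y h * \<alpha> j = (\<Sum>s\<in>S. \<alpha> s * ev y (n j s))" if "j \<in> X1" "y \<in> X.H" for j y using hn that by blast
  fix i assume "i \<in> Y1"
  show "Y.spans \<alpha> S (\<alpha> i)" unfolding Y.spans_def
  proof (intro exI[of _ "sub h"] exI[of _ "\<lambda>s. sub (\<Sum>b\<in>X1. mconst (representation X1 i b) * n b s)"] conjI ballI)
    show "sub h \<in> Pol Y1" by (rule sub_Pol[OF hP(1)])
    show "\<not> Y.Z (sub h)" using sub_Z[OF hP(1)] hP(2) by blast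
    show "sub (\<Sum>b\<in>X1. mconst (representation X1 i b) * n b s) \<in> Pol Y1" if "s \<in> S" for s
      using nP that by (intro sub_Pol Pol_sum Pol_mult Pol_const)
    fix w assume "w \<in> Y.H"
    then have w: "toX w \<in> X.H" by (rule toX_H)
    have "\<alpha> i = \<alpha> (\<Sum>b\<in>X1. smul (representation X1 i b) b)" by (simp add: rep_sum[OF X1])
    also have "\<dots> = (\<Sum>b\<in>X1. to_ac (representation X1 i b) * \<alpha> b)" by (simp add: \<alpha>_sum \<alpha>_scale)
    finally have "ev (toX w) h * \<alpha> i = (\<Sum>b\<in>X1. to_ac (representation X1 i b) * (ev (toX w) h * \<alpha> b))"
      by (simp add: sum_distrib_left mult_ac)
    also have "\<dots> = (\<Sum>b\<in>X1. to_ac (representation X1 i b) * (\<Sum>s\<in>S. \<alpha> s * ev (toX w) (n b s)))"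
      by (intro sum.cong refl) (simp add: hnE w)
    also have "\<dots> = (\<Sum>b\<in>X1. \<Sum>s\<in>S. \<alpha> s * (to_ac (representation X1 i b) * ev (toX w) (n b s)))"
      by (simp add: sum_distrib_left mult_ac)
    also have "\<dots> = (\<Sum>s\<in>S. \<Sum>b\<in>X1. \<alpha> s * (to_ac (representation X1 i b) * ev (toX w) (n b s)))" by (rule sum.swap)
    also have "\<dots> = (\<Sum>s\<in>S. \<alpha> s * ev (toX w) (\<Sum>b\<in>X1. mconst (representation X1 i b) * n b s))"
      by (simp add: K.meval_simps sum_distrib_left)
    finally show "ev w (sub h) * \<alpha> i = (\<Sum>s\<in>S. \<alpha> s * ev w (sub (\<Sum>b\<in>X1. mconst (representation X1 i b) * n b s)))"
      unfolding ev_sub .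
  qed
qed

end

section \<open>Reduction of an arbitrary subspace to a coordinate section\<close>

context ql_space
begin

text \<open>The tautological relation keeps the rank below \<open>card B\<close>, so
  \<open>i1\<close> is positive and \<open>i1 - 1\<close> is a true difference. A positive rank will
  leave at least two coordinates for the section.\<close>

lemma i1_rank:
  assumes b: "b0 \<in> B" "b1 \<in> B" "b0 \<noteq> b1"
  shows "\<exists>S0. S0 \<subseteq> B \<and> \<not> qform.dep to_ac B \<alpha> \<alpha> S0 \<and> (\<forall>i\<in>B. qform.spans to_ac B \<alpha> \<alpha> S0 (\<alpha> i)) \<and>
    i1 p \<phi> B + card S0 = card B \<and> 0 < card S0 \<and> card S0 < card B"
proof -
  interpret Q: aform to_ac p B \<alpha> \<phi> b0 b1 by (rule aform_indep[OF indB b])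
  have de: "\<not> Q.dep \<alpha> {}" by (simp add: Q.dep_def)
  obtain S0 where S0: "S0 \<subseteq> B" "\<not> Q.dep \<alpha> S0" and S0': "\<forall>i\<in>B. Q.spans \<alpha> S0 (\<alpha> i)"
    using Q.max_indep_ex[OF finB de] by (elim exE conjE)
  have fS0: "finite S0" using S0(1) finB finite_subset by blast
  have "S0 \<noteq> {}"
  proof
    assume "S0 = {}"
    then obtain d where "\<not> Q.Z d" "\<forall>y\<in>Q.H. ev y d * \<alpha> b0 = 0"
      using bspec[OF S0' b(1)] unfolding Q.spans_def by auto
    then show False using Q.b0(2) unfolding Q.Z_def by simp
  qed
  moreover have "S0 \<noteq> B"
  proof
    assume "S0 = B"
    moreover have "Q.rel \<alpha> B mvar" unfolding Q.rel_def by (auto simp: Q.H_def)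
    ultimately show False using S0(2) Q.not_Z_b0 b(1) unfolding Q.dep_def by blast
  qed
  then have "card S0 < card B" using S0(1) finB by (intro psubset_card_mono) auto
  ultimately have pos: "0 < card S0" "card S0 < card B" using fS0 by (auto simp: card_gt_0_iff)
  show ?thesis by (intro exI[of _ S0] conjI S0(1,2) S0' Q.i1_card[OF S0(1,2) S0'] pos)
qed

theorem main:
  assumes dim: "dim (UNIV :: 'v set) \<ge> 2" and codim: "dim U + (i1 p \<phi> B - 1) = dim (UNIV :: 'v set)"
    and C: "C \<subseteq> U" "independent C" "span C = U"
  shows "birational_over (ql_hypersurface p \<phi> B) (ql_hypersurface_times_proj p \<phi> C (i1 p \<phi> B - 1))"
proof -
  have cB: "card B \<ge> 2" using dim by simp
  then obtain c0 c1 where c: "c0 \<in> B" "c1 \<in> B" "c0 \<noteq> c1" by (rule two_elements)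
  obtain S0 where S0r: "S0 \<subseteq> B \<and> \<not> qform.dep to_ac B \<alpha> \<alpha> S0 \<and> (\<forall>i\<in>B. qform.spans to_ac B \<alpha> \<alpha> S0 (\<alpha> i)) \<and>
    i1 p \<phi> B + card S0 = card B \<and> 0 < card S0 \<and> card S0 < card B"
    using i1_rank[OF c] by (elim exE)
  then have i1: "i1 p \<phi> B + card S0 = card B" "0 < card S0" "card S0 < card B" by blast+
  have S0: "S0 \<subseteq> B" "\<not> qform.dep to_ac B \<alpha> \<alpha> S0" using S0r by blast+
  have S03: "qform.spans to_ac B \<alpha> \<alpha> S0 (\<alpha> i)" if "i \<in> B" for i using S0r that by blast
  have "dim U = card C" using C(2,3) dim_span_eq_card_independent by metis
  then have cC: "card C + (i1 p \<phi> B - 1) = card B" using codim by simp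
  \<comment> \<open>The section has one coordinate more than the rank: this is what the codimension
    \<open>i1 - 1\<close> amounts to.\<close>
  then have cC': "card C = Suc (card S0)" using i1 by linarith
  \<comment> \<open>Extending \<open>C\<close> to a basis turns the section into a coordinate
    section.\<close>
  define B' where "B' = extend_basis C"
  have B': "isbasis B'" "C \<subseteq> B'"
    unfolding B'_def isbasis_def using C(2) by (simp_all add: independent_extend_basis extend_basis_superset)
  have fB': "finite B'" by (rule isbasis_fin[OF B'(1)])
  have fC: "finite C" using B'(2) fB' finite_subset by blast
  have cB': "card B' = card B"
    using B'(1) dim_eq_card[of B' UNIV] unfolding isbasis_def by (simp add: dim_UNIV)
  have "card C \<ge> 2" using cC' i1 by linarith
  then obtain b0 b1 where b: "b0 \<in> C" "b1 \<in> C" "b0 \<noteq> b1" by (rule two_elements)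
  have bB: "b0 \<in> B'" "b1 \<in> B'" using b B'(2) by auto
  have Bb: "isbasis B" unfolding isbasis_def using indB spanB by simp
  interpret E: two_bases smul B p \<phi> B B' c0 c1 b0 b1
    by unfold_locales (fact Bb B' c bB b)+
  interpret E': two_bases smul B p \<phi> B' B b0 b1 c0 c1 by (rule E.swap)
  have rank0: "card T \<le> card S0" if "T \<subseteq> B'" "\<not> E.Y.dep \<alpha> T" for T
    by (rule E.rank_le[OF S0 S03 that])
  have dC: "E.Y.dep \<alpha> C" using rank0[OF B'(2)] cC' by fastforce
  obtain u k where u: "E.Y.rel \<alpha> C u" "\<forall>i\<in>C. homog B' k (u i)" "\<exists>y\<in>E.Y.H. E.Y.lam C u y \<noteq> 0" "\<not> p dvd k"
    using E.Y.good_relation_ex[OF B'(2) dC] by (elim exE conjE)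
  have de: "\<not> E.Y.dep \<alpha> {}" by (simp add: E.Y.dep_def)
  obtain S where S: "S \<subseteq> C" "\<not> E.Y.dep \<alpha> S" and S': "\<forall>i\<in>C. E.Y.spans \<alpha> S (\<alpha> i)"
    using E.Y.max_indep_ex[OF fC de] by (elim exE conjE)
  obtain S1 where S1: "S1 \<subseteq> B'" "\<not> E.Y.dep \<alpha> S1" and S1': "\<forall>i\<in>B'. E.Y.spans \<alpha> S1 (\<alpha> i)"
    using E.Y.max_indep_ex[OF fB' de] by (elim exE conjE)
  have fS: "finite S" using S(1) fC finite_subset by blast
  \<comment> \<open>The relation \<open>u\<close> on \<open>C\<close> has non-zero \<lambda>, so the
    roots in \<open>C\<close> already have the full rank. Together with the comparison of the two
    bases this fixes \<open>card S\<close>.\<close>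
  have rank: "card T \<le> card S" if "T \<subseteq> B'" "\<not> E.Y.dep \<alpha> T" for T
    by (rule E.Y.rank_bound[OF B'(2) u(1,3) fS bspec[OF S'] that])
  have "card S0 \<le> card S1" by (rule E'.rank_le[OF S1 bspec[OF S1'] S0(1,2)])
  moreover have "card S1 \<le> card S" by (rule rank[OF S1(1,2)])
  moreover have "S \<subseteq> B'" using S(1) B'(2) by blast
  then have "card S \<le> card S0" using rank0 S(2) by blast
  ultimately have cS: "card C = Suc (card S)" using cC' by simp
  then have "card (C - S) = 1" using card_Diff_subset[OF fS S(1)] by simp
  then obtain i0 where "C - S = {i0}" by (rule card_1_singletonE)
  then have i0: "C = insert i0 S" "i0 \<notin> S" using S(1) by blast+
  interpret GS: gsect to_ac p B' \<alpha> \<phi> b0 b1 C S i0 u k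
  proof
    show "C \<subseteq> B'" by (rule B'(2))
    show "b0 \<in> C" "b1 \<in> C" by (rule b)+
    show "C = insert i0 S" "i0 \<notin> S" by (rule i0)+
    show "\<not> E.Y.dep \<alpha> S" by (rule S(2))
    show "E.Y.rel \<alpha> C u" by (rule u(1))
    show "homog B' k (u i)" if "i \<in> C" for i by (rule bspec[OF u(2) that])
    show "\<exists>y\<in>E.Y.H. E.Y.lam C u y \<noteq> 0" by (rule u(3))
    show "\<not> p dvd k" by (rule u(4))
    show "card T \<le> card S" if "T \<subseteq> B'" "\<not> E.Y.dep \<alpha> T" for T by (rule rank[OF that])
  qed
  define r where "r = i1 p \<phi> B - 1"
  have r: "card (B' - C) = r" using card_Diff_subset[OF fC B'(2)] cC cB' by (simp add: r_def)
  define Bs' where "Bs' = {Inl ` C, Inr ` {..r} :: ('v + nat) set}"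
  have Bs': "{Inl ` C, Inr ` {..card (B' - C)}} = Bs'" by (simp add: Bs'_def r)
  obtain \<sigma> \<tau> d d' a1 b1' a' b' where mp:
    "(\<forall>i\<in>B'. \<tau> i \<in> mhomog Bs' d) \<and> (\<forall>B\<in>Bs'. \<forall>x\<in>B. \<sigma> x \<in> mhomog {B'} (d' B)) \<and>
    (\<forall>y\<in>E.Y.H. (\<lambda>x. ev y (\<sigma> x)) \<in> GS.Pq.H) \<and> (\<forall>w\<in>GS.Pq.H. (\<lambda>i. ev w (\<tau> i)) \<in> E.Y.H) \<and>
    hom_el {B'} a1 \<and> hom_el {B'} b1' \<and> \<not> E.Y.Z a1 \<and> \<not> E.Y.Z b1' \<and>
    (\<forall>i\<in>B'. E.Y.Z (a1 * msubst \<sigma> (\<tau> i) - b1' * mvar i)) \<and>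
    (\<forall>B\<in>Bs'. hom_el Bs' (a' B) \<and> hom_el Bs' (b' B) \<and> \<not> GS.Pq.Z (a' B) \<and> \<not> GS.Pq.Z (b' B) \<and>
       (\<forall>x\<in>B. GS.Pq.Z (a' B * msubst \<tau> (\<sigma> x) - b' B * mvar x)))"
    using GS.birational_maps unfolding Bs' by (elim exE)
  have \<tau>h: "\<tau> i \<in> mhomog Bs' d" if "i \<in> B'" for i using mp that by blast
  have \<sigma>h: "\<sigma> x \<in> mhomog {B'} (d' B2)" if "B2 \<in> Bs'" "x \<in> B2" for B2 x using mp that by blast
  have \<sigma>H: "(\<lambda>x. ev y (\<sigma> x)) \<in> GS.Pq.H" if "y \<in> E.Y.H" for y using mp that by blast
  have \<tau>H: "(\<lambda>i. ev w (\<tau> i)) \<in> E.Y.H" if "w \<in> GS.Pq.H" for w using mp that by blast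
  have a1: "hom_el {B'} a1" "hom_el {B'} b1'" "\<not> E.Y.Z a1" "\<not> E.Y.Z b1'" using mp by blast+
  have comp: "E.Y.Z (a1 * msubst \<sigma> (\<tau> i) - b1' * mvar i)" if "i \<in> B'" for i using mp that by blast
  have a': "hom_el Bs' (a' B2) \<and> hom_el Bs' (b' B2) \<and> \<not> GS.Pq.Z (a' B2) \<and> \<not> GS.Pq.Z (b' B2)" if "B2 \<in> Bs'" for B2
    using mp that by blast
  have comp': "GS.Pq.Z (a' B2 * msubst \<tau> (\<sigma> x) - b' B2 * mvar x)" if "B2 \<in> Bs'" "x \<in> B2" for B2 x using mp that by blast
  \<comment> \<open>The maps between the section and the hypersurface in the basis \<open>B'\<close>
    are composed with the change of coordinates to \<open>B\<close>.\<close>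
  define \<sigma>1 where "\<sigma>1 x = E'.sub (\<sigma> x)" for x
  define \<tau>1 where "\<tau>1 x = msubst \<tau> (lin B B' x)" for x
  have ev_\<sigma>1: "ev y (\<sigma>1 x) = ev (E.toY y) (\<sigma> x)" for y x unfolding \<sigma>1_def by (rule E'.ev_sub)
  have ev_\<tau>1: "ev w (\<tau>1 x) = ev (\<lambda>i. ev w (\<tau> i)) (lin B B' x)" for w x unfolding \<tau>1_def by (rule K.meval_subst)
  have hs: "hom_el {B} (E'.sub q) \<and> \<not> E.X.Z (E'.sub q)" if "hom_el {B'} q" "\<not> E.Y.Z q" for q
    using that E'.sub_mhomog E'.sub_Z hom_el_Pol[OF that(1)] unfolding hom_el_def by auto
  have mX: "mphyp {B} E.X.fm E.X.Z" by (rule E.X.mphyp_self)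
  have fX: "ql_poly p \<phi> B (\<lambda>b. b) = E.X.fm" by (simp add: ql_poly_def E.X.fm_def)
  have mY: "mphyp Bs' (ql_poly p \<phi> C Inl) GS.Pq.Z" using GS.mphyp_product unfolding Bs' .
  have "birmap {B} E.X.fm E.X.Z Bs' (ql_poly p \<phi> C Inl) GS.Pq.Z \<sigma>1 \<tau>1 (\<lambda>B2 _. d' B2 B') (\<lambda>_. d)
      (\<lambda>_. E'.sub a1) (\<lambda>_. E'.sub b1') a' b'"
    unfolding birmap_def birmap_axioms_def
  proof (intro conjI allI impI mX mY)
    show "\<sigma>1 y \<in> mhomog {B} (\<lambda>_. d' B2 B')" if "B2 \<in> Bs'" "y \<in> B2" for B2 y
      unfolding \<sigma>1_def by (rule E'.sub_mhomog[OF \<sigma>h[OF that]])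
    show "\<tau>1 x \<in> mhomog Bs' d" for A x
    proof -
      have "mconst (representation B y x) * \<tau> y \<in> mhomog Bs' d" if "y \<in> B'" for y
        using mhomog_mult[OF mhomog_const \<tau>h[OF that]] by simp
      then show ?thesis unfolding \<tau>1_def lin_def mc.meval_simps mc.meval_const mc.meval_var by (rule mhomog_sum)
    qed
    show "E.X.Z (msubst \<sigma>1 q)" if "GS.Pq.Z q" for q unfolding E.X.Z_def
    proof
      fix y assume "y \<in> E.X.H"
      then have "(\<lambda>x. ev y (\<sigma>1 x)) \<in> GS.Pq.H" unfolding ev_\<sigma>1 by (intro \<sigma>H E.toY_H)
      then show "ev y (msubst \<sigma>1 q) = 0" using that unfolding K.meval_subst GS.Pq.Z_def by blast
    qed
    show "GS.Pq.Z (msubst \<tau>1 q)" if "E.X.Z q" for q unfolding GS.Pq.Z_def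
    proof
      fix w assume "w \<in> GS.Pq.H"
      then have "(\<lambda>x. ev w (\<tau>1 x)) \<in> E.X.H" unfolding ev_\<tau>1 by (intro E.toX_H \<tau>H)
      then show "ev w (msubst \<tau>1 q) = 0" using that unfolding K.meval_subst E.X.Z_def by blast
    qed
    show "hom_el {B} (E'.sub a1)" "hom_el {B} (E'.sub b1')" "\<not> E.X.Z (E'.sub a1)" "\<not> E.X.Z (E'.sub b1')"
      using hs[OF a1(1,3)] hs[OF a1(2,4)] by blast+
    show "hom_el Bs' (a' B2)" "hom_el Bs' (b' B2)" "\<not> GS.Pq.Z (a' B2)" "\<not> GS.Pq.Z (b' B2)" if "B2 \<in> Bs'" for B2
      using a'[OF that] by blast+
    show "E.X.Z (E'.sub a1 * msubst \<sigma>1 (\<tau>1 x) - E'.sub b1' * mvar x)" if "A \<in> {B}" "x \<in> A" for A x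
      unfolding E.X.Z_def
    proof
      fix y assume y: "y \<in> E.X.H"
      let ?y = "E.toY y"
      have x: "x \<in> B" using that by simp
      have yH: "?y \<in> E.Y.H" by (rule E.toY_H[OF y])
      have c1: "ev ?y a1 * ev (\<lambda>z. ev ?y (\<sigma> z)) (\<tau> i) = ev ?y b1' * ?y i" if "i \<in> B'" for i
        using comp[OF that] yH unfolding E.Y.Z_def by (simp add: K.meval_simps K.meval_subst)
      have "ev y (msubst \<sigma>1 (\<tau>1 x)) = (\<Sum>i\<in>B'. to_ac (representation B i x) * ev (\<lambda>z. ev ?y (\<sigma> z)) (\<tau> i))"
        unfolding K.meval_subst[of y \<sigma>1] ev_\<sigma>1 ev_\<tau>1 ev_lin ..
      then have "ev ?y a1 * ev y (msubst \<sigma>1 (\<tau>1 x)) =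
          (\<Sum>i\<in>B'. to_ac (representation B i x) * (ev ?y a1 * ev (\<lambda>z. ev ?y (\<sigma> z)) (\<tau> i)))"
        by (simp add: sum_distrib_left mult_ac)
      also have "\<dots> = (\<Sum>i\<in>B'. to_ac (representation B i x) * (ev ?y b1' * ?y i))"
        by (intro sum.cong refl) (simp only: c1)
      also have "\<dots> = ev ?y b1' * ev ?y (lin B B' x)"
        unfolding ev_lin[of ?y] by (simp add: sum_distrib_left mult_ac)
      also have "ev ?y (lin B B' x) = y x" by (rule lin_lin[OF Bb B'(1) x])
      finally show "ev y (E'.sub a1 * msubst \<sigma>1 (\<tau>1 x) - E'.sub b1' * mvar x) = 0"
        unfolding K.meval_diff K.meval_mult E'.ev_sub K.meval_var by simp
    qed
    show "GS.Pq.Z (a' B2 * msubst \<tau>1 (\<sigma>1 x) - b' B2 * mvar x)" if "B2 \<in> Bs'" "x \<in> B2" for B2 x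
      unfolding GS.Pq.Z_def
    proof
      fix w assume w: "w \<in> GS.Pq.H"
      have sP: "\<sigma> x \<in> Pol B'" using mhomog_Pol[OF \<sigma>h[OF that]] by simp
      have "ev w (msubst \<tau>1 (\<sigma>1 x)) = ev w (msubst \<tau> (\<sigma> x))"
        unfolding K.meval_subst ev_\<sigma>1 ev_\<tau>1 by (rule E'.ev_back[OF sP])
      then show "ev w (a' B2 * msubst \<tau>1 (\<sigma>1 x) - b' B2 * mvar x) = 0"
        using comp'[OF that] w unfolding GS.Pq.Z_def K.meval_diff K.meval_mult by simp
    qed
  qed
  then have "birational_over (mproj_hypersurface {B} E.X.fm) (mproj_hypersurface Bs' (ql_poly p \<phi> C Inl))"
    by (rule birmap.birational)
  then show ?thesis unfolding fX Bs'_def r_def by simp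
qed

end

theorem theorem7p6:
  fixes p :: nat
    and smul :: "'f::field \<Rightarrow> 'v::ab_group_add \<Rightarrow> 'v"
    and B U C :: "'v set"
    and \<phi> :: "'v \<Rightarrow> 'f"
  assumes "prime p" and "CHAR('f) = p" and nonperfect: "\<not> surj (\<lambda>x::'f. x ^ p)"
    and V: "finite_dimensional_vector_space smul B"
    and form: "quasilinear_form p smul \<phi>" and "anisotropic \<phi>"
    and dim: "vector_space.dim smul (UNIV :: 'v set) \<ge> 2"
    and U: "Modules.module.subspace smul U"
    and codim: "vector_space.dim smul U + (i1 p \<phi> B - 1) = vector_space.dim smul (UNIV :: 'v set)"
    and C: "C \<subseteq> U" "\<not> Modules.module.dependent smul C" "Modules.module.span smul C = U"
  shows "birational_over (ql_hypersurface p \<phi> B)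
           (ql_hypersurface_times_proj p \<phi> C (i1 p \<phi> B - 1))"
proof -
  interpret V: finite_dimensional_vector_space smul B by (rule V)
  interpret Q: ql_space smul B p \<phi>
    by unfold_locales (fact assms)+
  show ?thesis by (rule Q.main[OF dim codim C])
qed

end
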